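(* Let $n\ge 2$ and fix an integer $c\ge 2$. Let $\mathcal{E}$ be a 1-type uniform Steiner vector bundle on $\mathbb{P}^n$ of rank $r$, with no trivial summands (i.e. $\mathcal{O}_{\mathbb{P}^n}$ is not a direct summand of $\mathcal{E}$), defined by an exact sequence $$0 \rightarrow \mathcal{E} \rightarrow \mathcal{O}_{\mathbb{P}^n}^{r+c} \rightarrow \mathcal{O}_{\mathbb{P}^n}(1)^c \rightarrow 0.$$ Then $c+2(n-1)\leq r \leq cn$. Moreover, these bounds are sharp, and for every integer $r\in[c+2(n-1),cn]$ there exists a 1-type uniform Steiner vector bundle $\mathcal{E}$ on $\mathbb{P}^n$ with $c_1(\mathcal{E})=-c$ and $\operatorname{rk}(\mathcal{E})=r$.
   Context: The base field $\mathbb{K}$ is algebraically closed of characteristic $0$. A vector bundle $\mathcal{E}$ on $\mathbb{P}^n$ is a Steiner bundle if it is the kernel in a short exact sequence $0\to\mathcal{E}\to\mathcal{O}_{\mathbb{P}^n}^{x}\to\mathcal{O}_{\mathbb{P}^n}(1)^{c}\to 0$; then $c_1(\mathcal{E})=-c$ and $\operatorname{rk}\mathcal{E}=x-c$. A rank $r$ vector bundle $\mathcal{E}$ on $\mathbb{P}^n$ is uniform if its splitting type (the integers $a_1\le\dots\le a_r$ with $\mathcal{E}|_L\cong\bigoplus_{i=1}^r\mathcal{O}_L(a_i)$) is the same for every line $L\subset\mathbb{P}^n$. For an integer $k\ge1$, a uniform Steiner bundle is called $k$-type uniform if for every line $L$ one has $\mathcal{E}|_L\cong\bigoplus_{i=0}^{k}\mathcal{O}_L(-i)^{a_i}$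 with $a_i\ge 0$ independent of $L$ and $a_k>0$. *)

theory Defs
  imports "HOL-Computational_Algebra.Polynomial" "HOL-Library.FuncSet"
begin

text \<open>
  Everything is over a ground field \<open>'k\<close>, which is algebraically closed of characteristic 0 in
  the theorem. The coordinate space of dimension \<open>m\<close> is the set of sequences vanishing from index \<open>m\<close> on.
  A point of projective \<open>n\<close>-space is a punctured line through the origin, that is, the set of all
  its homogeneous coordinate vectors.
\<close>

type_synonym 'k vect = "nat \<Rightarrow> 'k"
type_synonym 'k point = "'k vect set"

definition coord_space :: "nat \<Rightarrow> 'k::field vect set" where
  "coord_space m = {v. \<forall>i\<ge>m. v i = 0}"

definition point_of :: "'k::field vect \<Rightarrow> 'k point" where
  "point_of v = {(\<lambda>i. t * v i) | t. t \<noteq> 0}"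

definition proj_space :: "nat \<Rightarrow> 'k::field point set" where
  "proj_space n = point_of ` (coord_space (Suc n) - {\<lambda>_. 0})"

definition is_line :: "nat \<Rightarrow> 'k::field point set \<Rightarrow> bool" where
  "is_line n L \<longleftrightarrow>
     (\<exists>u\<in>coord_space (Suc n). \<exists>w\<in>coord_space (Suc n).
        (\<forall>a b. (\<forall>i. a * u i + b * w i = 0) \<longrightarrow> a = 0 \<and> b = 0) \<and>
        L = {point_of (\<lambda>i. a * u i + b * w i) | a b. a \<noteq> 0 \<or> b \<noteq> 0})"

text \<open>
  \<open>form n d f\<close>: \<open>f\<close> is a homogeneous polynomial of degree \<open>d\<close> in the variables with indices
  \<open>0, \<dots>, n\<close>. Polynomials are identified with polynomial functions, which is harmless over an
  infinite field. The zero polynomial is a form of every degree.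
\<close>

inductive form :: "nat \<Rightarrow> nat \<Rightarrow> ('k::field vect \<Rightarrow> 'k) \<Rightarrow> bool" for n where
  const: "form n 0 (\<lambda>_. a)"
| var: "i \<le> n \<Longrightarrow> form n 1 (\<lambda>v. v i)"
| add: "form n d f \<Longrightarrow> form n d g \<Longrightarrow> form n d (\<lambda>v. f v + g v)"
| mult: "form n d f \<Longrightarrow> form n e g \<Longrightarrow> form n (d + e) (\<lambda>v. f v * g v)"

text \<open>
  Below, \<open>X\<close> is a closed subvariety of projective \<open>n\<close>-space (only the whole space and lines are
  used). \<open>zopen n X U\<close>: \<open>U\<close> is open in the Zariski topology of \<open>X\<close>.
\<close>

definition zopen :: "nat \<Rightarrow> 'k::field point set \<Rightarrow> 'k point set \<Rightarrow> bool" where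
  "zopen n X U \<longleftrightarrow>
     (\<exists>F. (\<forall>f\<in>F. \<exists>d. form n d f) \<and> U = {p\<in>X. \<exists>f\<in>F. \<exists>v\<in>p. f v \<noteq> 0})"

text \<open>
  A regular section over \<open>U\<close> of the \<open>d\<close>-th twist of the structure sheaf is a function on the
  cone over \<open>U\<close> that is locally a quotient of forms with difference of degrees \<open>d\<close>;
  \<open>s p v\<close> is its value at the representative \<open>v\<close> of \<open>p\<close>.
\<close>

definition twisted_regular ::
  "nat \<Rightarrow> 'k::field point set \<Rightarrow> int \<Rightarrow> 'k point set \<Rightarrow> ('k point \<Rightarrow> 'k vect \<Rightarrow> 'k) \<Rightarrow> bool" where
  "twisted_regular n X d U s \<longleftrightarrow>
     (\<forall>p\<in>U. \<exists>V g h a b. zopen n X V \<and> p \<in> V \<and> V \<subseteq> U \<and>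
        form n a g \<and> form n b h \<and> int a - int b = d \<and>
        (\<forall>q\<in>V. \<forall>v\<in>q. h v \<noteq> 0 \<and> s q v = g v / h v))"

definition regular_fun ::
  "nat \<Rightarrow> 'k::field point set \<Rightarrow> 'k point set \<Rightarrow> ('k point \<Rightarrow> 'k) \<Rightarrow> bool" where
  "regular_fun n X U f \<longleftrightarrow> twisted_regular n X 0 U (\<lambda>p v. f p)"

text \<open>
  A vector bundle is given by its fibres and by its sheaf of regular sections. The fibres are
  linear subspaces of the space of functions \<open>'a \<Rightarrow> 'k\<close>, for some index type \<open>'a\<close> (every vector
  space embeds into such a space), and nothing is assumed about how they vary inside that
  space. Only the values of a section at the points of its domain are relevant.
\<close>

record ('k, 'a) vbundle =
  fibre :: "'k point \<Rightarrow> ('a \<Rightarrow> 'k) set"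
  sections :: "'k point set \<Rightarrow> ('k point \<Rightarrow> 'a \<Rightarrow> 'k) set"

text \<open>
  \<open>e 0, \<dots>, e (r - 1)\<close> is a frame over the open set \<open>U\<close>: a basis of every fibre, and, over
  every open subset of \<open>U\<close>, a basis of the sections over the ring of regular functions.
\<close>

definition local_frame ::
  "nat \<Rightarrow> 'k::field point set \<Rightarrow> ('k, 'a) vbundle \<Rightarrow> nat \<Rightarrow> 'k point set
     \<Rightarrow> (nat \<Rightarrow> 'k point \<Rightarrow> 'a \<Rightarrow> 'k) \<Rightarrow> bool" where
  "local_frame n X E r U e \<longleftrightarrow>
     (\<forall>q\<in>U. fibre E q = {(\<lambda>x. \<Sum>i<r. a i * e i q x) | a. True} \<and>
            (\<forall>a. (\<forall>x. (\<Sum>i<r. a i * e i q x) = 0) \<longrightarrow> (\<forall>i<r. a i = 0))) \<and>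
     (\<forall>W s. zopen n X W \<and> W \<subseteq> U \<longrightarrow>
        (s \<in> sections E W \<longleftrightarrow>
           (\<exists>f. (\<forall>i<r. regular_fun n X W (f i)) \<and>
                (\<forall>q\<in>W. s q = (\<lambda>x. \<Sum>i<r. f i q * e i q x)))))"

definition vector_bundle ::
  "nat \<Rightarrow> 'k::field point set \<Rightarrow> nat \<Rightarrow> ('k, 'a) vbundle \<Rightarrow> bool" where
  "vector_bundle n X r E \<longleftrightarrow>
     (\<forall>U V s. zopen n X U \<and> zopen n X V \<and> V \<subseteq> U \<and> s \<in> sections E U \<longrightarrow> s \<in> sections E V) \<and>
     (\<forall>U s. zopen n X U \<and> (\<forall>p\<in>U. \<exists>V. zopen n X V \<and> p \<in> V \<and> V \<subseteq> U \<and> s \<in> sections E V)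
        \<longrightarrow> s \<in> sections E U) \<and>
     (\<forall>p\<in>X. \<exists>U e. zopen n X U \<and> p \<in> U \<and> local_frame n X E r U e)"

text \<open>The line bundles \<open>\<O>\<^sub>X(d)\<close>: the fibre at \<open>p\<close> consists of the functions on the punctured
  line \<open>p\<close> that are homogeneous of degree \<open>d\<close>, extended by zero.\<close>

definition twist_bundle ::
  "nat \<Rightarrow> 'k::field point set \<Rightarrow> int \<Rightarrow> ('k, 'k vect) vbundle" where
  "twist_bundle n X d =
     \<lparr> fibre = (\<lambda>p. {g. (\<forall>v\<in>p. \<forall>t. t \<noteq> 0 \<longrightarrow> g (\<lambda>i. t * v i) = t powi d * g v) \<and>
                         (\<forall>v. v \<notin> p \<longrightarrow> g v = 0)}),
       sections = (\<lambda>U. {s. (\<forall>p\<in>U. \<forall>v. v \<notin> p \<longrightarrow> s p v = 0) \<and> twisted_regular n X d U s}) \<rparr>"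

definition direct_sum :: "nat \<Rightarrow> (nat \<Rightarrow> ('k::field, 'a) vbundle) \<Rightarrow> ('k, nat \<times> 'a) vbundle" where
  "direct_sum m F =
     \<lparr> fibre = (\<lambda>p. {g. (\<forall>i<m. (\<lambda>x. g (i, x)) \<in> fibre (F i) p) \<and>
                         (\<forall>i\<ge>m. \<forall>x. g (i, x) = 0)}),
       sections = (\<lambda>U. {s. (\<forall>i<m. (\<lambda>p x. s p (i, x)) \<in> sections (F i) U) \<and>
                            (\<forall>p\<in>U. \<forall>i\<ge>m. \<forall>x. s p (i, x) = 0)}) \<rparr>"

abbreviation power_bundle :: "nat \<Rightarrow> ('k::field, 'a) vbundle \<Rightarrow> ('k, nat \<times> 'a) vbundle" where
  "power_bundle m F \<equiv> direct_sum m (\<lambda>_. F)"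

definition binary_sum ::
  "('k::field, 'a) vbundle \<Rightarrow> ('k, 'b) vbundle \<Rightarrow> ('k, 'a + 'b) vbundle" where
  "binary_sum E F =
     \<lparr> fibre = (\<lambda>p. {g. (\<lambda>x. g (Inl x)) \<in> fibre E p \<and> (\<lambda>y. g (Inr y)) \<in> fibre F p}),
       sections = (\<lambda>U. {s. (\<lambda>p x. s p (Inl x)) \<in> sections E U \<and>
                            (\<lambda>p y. s p (Inr y)) \<in> sections F U}) \<rparr>"

text \<open>
  The restriction (pull-back) of a bundle on \<open>X\<close> to a closed subvariety \<open>Y\<close> of \<open>X\<close>: its sections
  are locally combinations of sections on \<open>X\<close> with regular functions on \<open>Y\<close> as coefficients.
\<close>

definition restrict_bundle ::
  "nat \<Rightarrow> 'k::field point set \<Rightarrow> 'k point set \<Rightarrow> ('k, 'a) vbundle \<Rightarrow> ('k, 'a) vbundle" where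
  "restrict_bundle n X Y E =
     \<lparr> fibre = fibre E,
       sections = (\<lambda>W. {s. \<forall>p\<in>W. \<exists>U V m e f.
          zopen n X U \<and> zopen n Y V \<and> p \<in> V \<and> V \<subseteq> U \<and> V \<subseteq> W \<and>
          (\<forall>j<m. e j \<in> sections E U) \<and> (\<forall>j<m. regular_fun n Y V (f j)) \<and>
          (\<forall>q\<in>V. s q = (\<lambda>x. \<Sum>j<(m::nat). f j q * e j q x))}) \<rparr>"

definition bundle_hom ::
  "nat \<Rightarrow> 'k::field point set \<Rightarrow> ('k, 'a) vbundle \<Rightarrow> ('k, 'b) vbundle
     \<Rightarrow> ('k point \<Rightarrow> ('a \<Rightarrow> 'k) \<Rightarrow> ('b \<Rightarrow> 'k)) \<Rightarrow> bool" where
  "bundle_hom n X E F \<phi> \<longleftrightarrow>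
     (\<forall>p\<in>X. \<forall>u\<in>fibre E p. \<phi> p u \<in> fibre F p) \<and>
     (\<forall>p\<in>X. \<forall>u\<in>fibre E p. \<forall>w\<in>fibre E p. \<forall>a b.
        \<phi> p (\<lambda>x. a * u x + b * w x) = (\<lambda>y. a * \<phi> p u y + b * \<phi> p w y)) \<and>
     (\<forall>U s. zopen n X U \<and> s \<in> sections E U \<longrightarrow> (\<lambda>p. \<phi> p (s p)) \<in> sections F U)"

definition bundle_iso ::
  "nat \<Rightarrow> 'k::field point set \<Rightarrow> ('k, 'a) vbundle \<Rightarrow> ('k, 'b) vbundle \<Rightarrow> bool" where
  "bundle_iso n X E F \<longleftrightarrow>
     (\<exists>\<phi> \<psi>. bundle_hom n X E F \<phi> \<and> bundle_hom n X F E \<psi> \<and>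
        (\<forall>p\<in>X. (\<forall>u\<in>fibre E p. \<psi> p (\<phi> p u) = u) \<and> (\<forall>w\<in>fibre F p. \<phi> p (\<psi> p w) = w)))"

text \<open>
  Exactness of \<open>0 \<rightarrow> E \<rightarrow> F \<rightarrow> G \<rightarrow> 0\<close> as a sequence of sheaves of sections: \<open>E\<close> maps
  isomorphically onto the kernel sheaf of \<open>\<pi>\<close>, and sections of \<open>G\<close> lift locally.
\<close>

definition short_exact ::
  "nat \<Rightarrow> 'k::field point set \<Rightarrow> ('k, 'a) vbundle \<Rightarrow> ('k, 'b) vbundle \<Rightarrow> ('k, 'c) vbundle
     \<Rightarrow> ('k point \<Rightarrow> ('a \<Rightarrow> 'k) \<Rightarrow> ('b \<Rightarrow> 'k)) \<Rightarrow> ('k point \<Rightarrow> ('b \<Rightarrow> 'k) \<Rightarrow> ('c \<Rightarrow> 'k)) \<Rightarrow> bool" where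
  "short_exact n X E F G \<iota> \<pi> \<longleftrightarrow>
     bundle_hom n X E F \<iota> \<and> bundle_hom n X F G \<pi> \<and>
     (\<forall>U s. zopen n X U \<and> s \<in> sections E U \<and> (\<forall>p\<in>U. \<iota> p (s p) = (\<lambda>_. 0))
        \<longrightarrow> (\<forall>p\<in>U. s p = (\<lambda>_. 0))) \<and>
     (\<forall>U t. zopen n X U \<and> t \<in> sections F U \<longrightarrow>
        ((\<forall>p\<in>U. \<pi> p (t p) = (\<lambda>_. 0)) \<longleftrightarrow> (\<exists>s\<in>sections E U. \<forall>p\<in>U. \<iota> p (s p) = t p))) \<and>
     (\<forall>U w. zopen n X U \<and> w \<in> sections G U \<longrightarrow>
        (\<forall>p\<in>U. \<exists>V t. zopen n X V \<and> p \<in> V \<and> V \<subseteq> U \<and> t \<in> sections F V \<and>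
                      (\<forall>q\<in>V. \<pi> q (t q) = w q)))"

definition steiner_bundle :: "nat \<Rightarrow> nat \<Rightarrow> nat \<Rightarrow> ('k::field, 'a) vbundle \<Rightarrow> bool" where
  "steiner_bundle n r c E \<longleftrightarrow>
     vector_bundle n (proj_space n) r E \<and>
     (\<exists>\<iota> \<pi>. short_exact n (proj_space n) E
        (power_bundle (r + c) (twist_bundle n (proj_space n) 0))
        (power_bundle c (twist_bundle n (proj_space n) 1)) \<iota> \<pi>)"

definition splitting_type ::
  "nat \<Rightarrow> 'k::field point set \<Rightarrow> nat \<Rightarrow> ('k, 'a) vbundle \<Rightarrow> (nat \<Rightarrow> int) \<Rightarrow> bool" where
  "splitting_type n L r E b \<longleftrightarrow>
     (\<forall>i j. i \<le> j \<and> j < r \<longrightarrow> b i \<le> b j) \<and>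
     bundle_iso n L (restrict_bundle n (proj_space n) L E) (direct_sum r (\<lambda>i. twist_bundle n L (b i)))"

definition uniform_bundle :: "nat \<Rightarrow> nat \<Rightarrow> ('k::field, 'a) vbundle \<Rightarrow> bool" where
  "uniform_bundle n r E \<longleftrightarrow>
     vector_bundle n (proj_space n) r E \<and> (\<exists>b. \<forall>L. is_line n L \<longrightarrow> splitting_type n L r E b)"

definition k_type_uniform_steiner ::
  "nat \<Rightarrow> nat \<Rightarrow> nat \<Rightarrow> nat \<Rightarrow> ('k::field, 'a) vbundle \<Rightarrow> bool" where
  "k_type_uniform_steiner k n r c E \<longleftrightarrow>
     1 \<le> k \<and> steiner_bundle n r c E \<and> uniform_bundle n r E \<and>
     (\<exists>a :: nat \<Rightarrow> nat. a k > 0 \<and>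
        (\<forall>L. is_line n L \<longrightarrow>
           bundle_iso n L (restrict_bundle n (proj_space n) L E)
             (direct_sum (Suc k) (\<lambda>i. power_bundle (a i) (twist_bundle n L (- int i))))))"

text \<open>The index type of a complement of the trivial line bundle can be taken to be that of \<open>E\<close>,
  since the complement is isomorphic to a subbundle of \<open>E\<close>.\<close>

definition has_trivial_summand :: "nat \<Rightarrow> ('k::field, 'a) vbundle \<Rightarrow> bool" where
  "has_trivial_summand n E \<longleftrightarrow>
     (\<exists>s (F :: ('k, 'a) vbundle). vector_bundle n (proj_space n) s F \<and>
        bundle_iso n (proj_space n) E (binary_sum (twist_bundle n (proj_space n) 0) F))"

text \<open>
  The first Chern class of a rank \<open>r\<close> bundle \<open>E\<close> on projective space is the integer \<open>d\<close> with
  \<open>\<Lambda>\<^sup>r E \<cong> \<O>(d)\<close>. Such an isomorphism is the same as a regular family \<open>\<omega>\<close> of nonzero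
  alternating \<open>r\<close>-linear maps from the fibres of \<open>E\<close> to those of \<open>\<O>(d)\<close>.
\<close>

definition first_chern_class_is ::
  "nat \<Rightarrow> nat \<Rightarrow> ('k::field, 'a) vbundle \<Rightarrow> int \<Rightarrow> bool" where
  "first_chern_class_is n r E d \<longleftrightarrow>
     (\<exists>\<omega> :: 'k point \<Rightarrow> (nat \<Rightarrow> 'a \<Rightarrow> 'k) \<Rightarrow> ('k vect \<Rightarrow> 'k).
        (\<forall>p\<in>proj_space n.
           (\<forall>u\<in>{..<r} \<rightarrow>\<^sub>E fibre E p. \<omega> p u \<in> fibre (twist_bundle n (proj_space n) d) p) \<and>
           (\<forall>u\<in>{..<r} \<rightarrow>\<^sub>E fibre E p. \<forall>i<r. \<forall>x\<in>fibre E p. \<forall>y\<in>fibre E p. \<forall>a b.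
              \<omega> p (u(i := (\<lambda>z. a * x z + b * y z))) =
                (\<lambda>v. a * \<omega> p (u(i := x)) v + b * \<omega> p (u(i := y)) v)) \<and>
           (\<forall>u\<in>{..<r} \<rightarrow>\<^sub>E fibre E p. \<forall>i j. i < j \<and> j < r \<and> u i = u j \<longrightarrow> \<omega> p u = (\<lambda>_. 0)) \<and>
           (\<exists>u\<in>{..<r} \<rightarrow>\<^sub>E fibre E p. \<omega> p u \<noteq> (\<lambda>_. 0))) \<and>
        (\<forall>U s. zopen n (proj_space n) U \<and> (\<forall>i<r. s i \<in> sections E U) \<longrightarrow>
           (\<lambda>p. \<omega> p (\<lambda>i\<in>{..<r}. s i p)) \<in> sections (twist_bundle n (proj_space n) d) U))"

end

theory Submission
  imports Defs "Jordan_Normal_Form.Determinant" "HOL-Library.Function_Algebras"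
begin

text \<open>
  On global sections the map \<open>\<O>\<^sup>N \<rightarrow> \<O>(1)\<^sup>c\<close>, \<open>N = r + c\<close>, is a matrix \<open>A v\<close> of linear forms with \<open>c\<close>
  rows and \<open>N\<close> columns. Its kernel is 1-type uniform if and only if, for independent \<open>u\<close> and
  \<open>w\<close>, the \<open>2c\<close> rows of \<open>A u\<close> and \<open>A w\<close> are independent: on the line through \<open>u\<close> and \<open>w\<close>, vectors
  of \<open>ker (A w)\<close> lift to linear sections of the kernel, and this turns a relation
  \<open>g (A u) + h (A w) = 0\<close> into an infinite chain of relations, which is impossible.

  A column of \<open>A\<close> is a linear form on \<open>(n + 1) \<times> c\<close> matrices, and the condition says that the \<open>N\<close> forms
  have no common zero \<open>u g\<^sup>t + w h\<^sup>t\<close> other than \<open>0\<close>. The matrices of rank at most \<open>2\<close> form a cone of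
  dimension \<open>2 (n + 1) + 2 c - 4\<close>, whence \<open>N \<ge> 2 c + 2 (n - 1)\<close>. If \<open>N > (n + 1) c\<close>, some constant
  vector lies in the kernel of every \<open>A v\<close> and spans a trivial summand. Conversely, read \<open>u, w, g, h\<close> as
  polynomials in one variable. The coefficients of \<open>u g + w h\<close> and \<open>u' g + w' h\<close> have no common
  nonzero zero because the Wronskian of \<open>u\<close> and \<open>w\<close> does not vanish; they span \<open>2 c + 2 (n - 1)\<close> forms,
  and further forms can be added up to \<open>(n + 1) c\<close>.
\<close>

subsection \<open>Linear algebra\<close>

text \<open>The lower bound needs a nonzero common zero of few linear forms on a cone. It is found
  as a linear functional on the degree one part of the coordinate ring: a maximal space of linear
  forms whose ideal fills no graded piece is a hyperplane, and the coordinates modulo it give the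
  point. Only cubic relations have to be carried over, since they say that the 3 x 3 minors vanish.
  Algebraic closedness enters through an eigenvalue, characteristic 0 through the Wronskian and
  through grids of natural numbers on which polynomials are determined. The other obstacle is that a
  bundle is a mere family of fibres with a sheaf, and exactness concerns sections. The matrix
  \<open>A v\<close> has to be extracted: the images of constant sections are global sections of
  O(1), and these are linear because they are so on every line, where a section is a polynomial in
  each of two charts. The converse is explicit: the \<open>2c\<close> rows over a line are completed
  to coordinates on the constant vectors, in which the kernel visibly splits, and the first Chern
  class comes from determinants of lifted bases.\<close>

definition indep_rows :: "nat \<Rightarrow> nat \<Rightarrow> (nat \<Rightarrow> nat \<Rightarrow> 'k::field) \<Rightarrow> bool" where
  "indep_rows m N B \<longleftrightarrow> (\<forall>g. (\<forall>l<N. (\<Sum>k<m. g k * B k l) = 0) \<longrightarrow> (\<forall>k<m. g k = 0))"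

lemma indep_rowsD:
  "indep_rows m N B \<Longrightarrow> (\<And>l. l < N \<Longrightarrow> (\<Sum>k<m. g k * B k l) = 0) \<Longrightarrow> k < m \<Longrightarrow> g k = 0"
  unfolding indep_rows_def by blast

text \<open>Induction on the number of rows: a row independent of the previous ones cannot vanish on
  their common kernel, so some vector \<open>z\<close> of that kernel detects it, and the old right
  inverse is corrected by multiples of \<open>z\<close>.\<close>

lemma indep_rows_right_inverse:
  fixes B :: "nat \<Rightarrow> nat \<Rightarrow> 'k::field"
  assumes "indep_rows m N B"
  shows "\<exists>Y. \<forall>k<m. \<forall>j<m. (\<Sum>l<N. B k l * Y l j) = (if k = j then 1 else 0)"
  using assms
proof (induction m)
  case 0
  then show ?case by simp
next
  case (Suc m)
  have "indep_rows m N B"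
    unfolding indep_rows_def
  proof (intro allI impI)
    fix g k assume g: "\<forall>l<N. (\<Sum>k<m. g k * B k l) = 0" and k: "k < m"
    have "(g(m := 0)) k = 0"
      by (rule indep_rowsD[OF Suc.prems]) (use g k in auto)
    then show "g k = 0" using k by simp
  qed
  from Suc.IH[OF this] obtain Y where
    Y: "\<And>k j. k < m \<Longrightarrow> j < m \<Longrightarrow> (\<Sum>l<N. B k l * Y l j) = (if k = j then 1 else 0)" by blast
  have "\<exists>z. (\<forall>k<m. (\<Sum>l<N. B k l * z l) = 0) \<and> (\<Sum>l<N. B m l * z l) \<noteq> 0"
  proof (rule ccontr)
    assume "\<nexists>z. (\<forall>k<m. (\<Sum>l<N. B k l * z l) = 0) \<and> (\<Sum>l<N. B m l * z l) \<noteq> 0"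
    then have z0: "\<And>z. (\<forall>k<m. (\<Sum>l<N. B k l * z l) = 0) \<Longrightarrow> (\<Sum>l<N. B m l * z l) = 0" by blast
    define h where "h j = (\<Sum>l<N. B m l * Y l j)" for j
    have *: "B m l0 = (\<Sum>j<m. h j * B j l0)" if l0: "l0 < N" for l0
    proof -
      \<comment> \<open>The unit vector at \<open>l0\<close> minus its \<open>Y\<close>-part lies in
        the common kernel of the first \<open>m\<close> rows; row \<open>m\<close> vanishes on it,
        which writes entry \<open>l0\<close> of row \<open>m\<close> as a combination with
        coefficients \<open>h\<close>.\<close>
      define z where "z l = (if l = l0 then 1 else 0) - (\<Sum>j<m. Y l j * B j l0)" for l
      have e: "(\<Sum>l<N. B k l * z l) = B k l0 - (\<Sum>j<m. (\<Sum>l<N. B k l * Y l j) * B j l0)" for k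
      proof -
        have "(\<Sum>l<N. B k l * z l) = (\<Sum>l<N. (if l = l0 then B k l else 0)) - (\<Sum>l<N. B k l * (\<Sum>j<m. Y l j * B j l0))"
          unfolding z_def right_diff_distrib sum_subtractf by (simp add: if_distrib cong: if_cong)
        also have "(\<Sum>l<N. B k l * (\<Sum>j<m. Y l j * B j l0)) = (\<Sum>j<m. (\<Sum>l<N. B k l * Y l j) * B j l0)"
          by (simp add: sum_distrib_left sum_distrib_right mult.assoc, subst sum.swap, simp)
        finally show ?thesis using l0 by (simp add: sum.delta)
      qed
      have "(\<Sum>l<N. B k l * z l) = 0" if "k < m" for k
      proof -
        have "(\<Sum>j<m. (\<Sum>l<N. B k l * Y l j) * B j l0) = (\<Sum>j<m. if k = j then B j l0 else 0)"
          by (rule sum.cong) (use Y[OF that] in auto)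
        then show ?thesis using e that by (simp add: sum.delta')
      qed
      then have "(\<Sum>l<N. B m l * z l) = 0" using z0 by blast
      then show ?thesis using e[of m] h_def by simp
    qed
    have "(\<Sum>k<Suc m. (if k = m then - 1 else h k) * B k l) = 0" if "l < N" for l
      using *[OF that] by simp
    from indep_rowsD[OF Suc.prems this, of m] have "(-1 :: 'k) = 0" by simp
    then show False by simp
  qed
  then obtain z where z: "\<And>k. k < m \<Longrightarrow> (\<Sum>l<N. B k l * z l) = 0" and "(\<Sum>l<N. B m l * z l) \<noteq> 0" by blast
  define q where "q = (\<Sum>l<N. B m l * z l)"
  define h where "h j = (\<Sum>l<N. B m l * Y l j)" for j
  have q: "q \<noteq> 0" using \<open>(\<Sum>l<N. B m l * z l) \<noteq> 0\<close> q_def by simp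
  define Y' where "Y' l j = (if j = m then z l / q else Y l j - h j * (z l / q))" for l j
  have Y'm: "(\<Sum>l<N. B k l * Y' l m) = (\<Sum>l<N. B k l * z l) / q" for k
    unfolding Y'_def by (simp add: sum_divide_distrib)
  have Y'j: "(\<Sum>l<N. B k l * Y' l j) = (\<Sum>l<N. B k l * Y l j) - h j * ((\<Sum>l<N. B k l * z l) / q)" if "j < m" for k j
    using that unfolding Y'_def
    by (simp add: sum_subtractf algebra_simps sum_divide_distrib sum_distrib_left)
  have "\<forall>k<Suc m. \<forall>j<Suc m. (\<Sum>l<N. B k l * Y' l j) = (if k = j then 1 else 0)"
  proof (intro allI impI)
    fix k j assume "k < Suc m" "j < Suc m"
    then consider "k = m" "j = m" | "k < m" "j = m" | "k = m" "j < m" | "k < m" "j < m" by linarith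
    then show "(\<Sum>l<N. B k l * Y' l j) = (if k = j then 1 else 0)"
    proof cases
      case 1 then show ?thesis using Y'm q q_def by simp
    next
      case 2 then show ?thesis using Y'm z by simp
    next
      case 3 then show ?thesis using Y'j[of j m] q by (simp add: q_def[symmetric] h_def[symmetric])
    next
      case 4 then show ?thesis using Y'j[of j k] z Y by simp
    qed
  qed
  then show ?case by blast
qed

lemma right_inverse_imp_indep_rows:
  fixes B :: "nat \<Rightarrow> nat \<Rightarrow> 'k::field"
  assumes Y: "\<And>k j. k < m \<Longrightarrow> j < m \<Longrightarrow> (\<Sum>l<N. B k l * Y l j) = (if k = j then 1 else 0)"
  shows "indep_rows m N B"
  unfolding indep_rows_def
proof (intro allI impI)
  fix g j assume g: "\<forall>l<N. (\<Sum>k<m. g k * B k l) = 0" and j: "j < m"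
  have "g j = (\<Sum>k<m. g k * (\<Sum>l<N. B k l * Y l j))"
    using j by (subst sum.cong[OF refl, where h="\<lambda>k. if k = j then g k else 0"]) (auto simp: Y sum.delta)
  also have "\<dots> = (\<Sum>l<N. (\<Sum>k<m. g k * B k l) * Y l j)"
    by (simp add: sum_distrib_left sum_distrib_right mult.assoc, subst sum.swap, simp)
  also have "\<dots> = 0" using g by simp
  finally show "g j = 0" .
qed

text \<open>The system is padded with zero equations to a square one, whose determinant vanishes
  because its transpose annihilates the unit vector at the first padded equation.\<close>

lemma more_unknowns_than_equations:
  fixes B :: "nat \<Rightarrow> nat \<Rightarrow> 'k::field"
  assumes "N < m"
  shows "\<exists>g. (\<exists>k<m. g k \<noteq> 0) \<and> (\<forall>l<N. (\<Sum>k<m. g k * B k l) = 0)"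
proof -
  define A where "A = mat m m (\<lambda>(l,k). if l < N then B k l else 0)"
  have A: "A \<in> carrier_mat m m" by (simp add: A_def)
  have "det (transpose_mat A) = 0"
  proof (subst det_0_iff_vec_prod_zero_field)
    show "transpose_mat A \<in> carrier_mat m m" using A by simp
    show "\<exists>v. v \<in> carrier_vec m \<and> v \<noteq> 0\<^sub>v m \<and> transpose_mat A *\<^sub>v v = 0\<^sub>v m"
      by (rule exI[of _ "unit_vec m N"]) (use assms in \<open>auto simp: A_def intro!: eq_vecI\<close>)
  qed
  then have "det A = 0" using det_transpose[OF A] by simp
  then obtain v where v: "v \<in> carrier_vec m" "v \<noteq> 0\<^sub>v m" "A *\<^sub>v v = 0\<^sub>v m"
    using det_0_iff_vec_prod_zero_field[OF A] by blast
  have "\<exists>k<m. v $ k \<noteq> 0" using v(1,2) by (metis carrier_vecD eq_vecI index_zero_vec(1) index_zero_vec(2))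
  moreover have "(\<Sum>k<m. v $ k * B k l) = 0" if l: "l < N" for l
  proof -
    have "0 = (A *\<^sub>v v) $ l" using v(3) l assms by simp
    also have "\<dots> = (\<Sum>k<m. B k l * v $ k)"
      using l assms v(1) by (simp add: A_def scalar_prod_def atLeast0LessThan)
    finally show ?thesis by (simp add: mult.commute)
  qed
  ultimately show ?thesis by (intro exI[of _ "\<lambda>k. v $ k"]) auto
qed

lemma indep_rows_le:
  fixes B :: "nat \<Rightarrow> nat \<Rightarrow> 'k::field"
  assumes "indep_rows m N B" shows "m \<le> N"
proof (rule ccontr)
  assume "\<not> m \<le> N"
  then obtain g where "\<exists>k<m. g k \<noteq> 0" "\<forall>l<N. (\<Sum>k<m. g k * B k l) = 0"
    using more_unknowns_than_equations[of N m B] by auto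
  then show False using assms unfolding indep_rows_def by blast
qed

text \<open>Steinitz exchange in contrapositive form: if every unit vector were a combination of the
  \<open>m\<close> rows, the coefficient vectors, \<open>N > m\<close> of them in dimension
  \<open>m\<close>, would be dependent, and then so would be the unit vectors.\<close>

lemma indep_rows_extend:
  fixes B :: "nat \<Rightarrow> nat \<Rightarrow> 'k::field"
  assumes B: "indep_rows m N B" and "m < N"
  shows "\<exists>l0<N. indep_rows (Suc m) N (B(m := (\<lambda>l. if l = l0 then 1 else 0)))"
proof (rule ccontr)
  assume neg: "\<not> ?thesis"
  have "\<exists>c. \<forall>l<N. (if l = l0 then 1 else 0) = (\<Sum>k<m. c k * B k l)" if l0: "l0 < N" for l0
  proof -
    from neg l0 obtain g where
      g: "\<And>l. l < N \<Longrightarrow> (\<Sum>k<Suc m. g k * (B(m := (\<lambda>l. if l = l0 then 1 else 0))) k l) = 0"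
      and gn: "\<exists>k<Suc m. g k \<noteq> 0"
      unfolding indep_rows_def by blast
    have g': "(\<Sum>k<m. g k * B k l) + g m * (if l = l0 then 1 else 0) = 0" if "l < N" for l
      using g[OF that] by simp
    have gm: "g m \<noteq> 0"
    proof
      assume "g m = 0"
      then have "\<forall>l<N. (\<Sum>k<m. g k * B k l) = 0" using g' by simp
      then have "\<forall>k<m. g k = 0" using B unfolding indep_rows_def by blast
      then show False using gn \<open>g m = 0\<close> less_Suc_eq by auto
    qed
    show ?thesis
    proof (intro exI[of _ "\<lambda>k. - g k / g m"] allI impI)
      fix l assume "l < N"
      have "(\<Sum>k<m. - g k / g m * B k l) = - (\<Sum>k<m. g k * B k l) / g m"
        by (simp add: sum_negf sum_divide_distrib)
      moreover have "- (\<Sum>k<m. g k * B k l) = g m * (if l = l0 then 1 else 0)"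
        using g'[OF \<open>l < N\<close>] by (simp add: eq_neg_iff_add_eq_0 add.commute neg_eq_iff_add_eq_0)
      ultimately show "(if l = l0 then 1 else 0) = (\<Sum>k<m. - g k / g m * B k l)"
        using gm by simp
    qed
  qed
  then obtain c where c: "\<And>l0 l. l0 < N \<Longrightarrow> l < N \<Longrightarrow> (if l = l0 then 1 else 0) = (\<Sum>k<m. c l0 k * B k l)"
    by metis
  obtain g where g: "\<exists>k<N. g k \<noteq> 0" "\<And>l. l < m \<Longrightarrow> (\<Sum>k<N. g k * c k l) = 0"
    using more_unknowns_than_equations[OF \<open>m < N\<close>] by metis
  have "g l = 0" if "l < N" for l
  proof -
    have "g l = (\<Sum>l0<N. g l0 * (if l = l0 then 1 else 0))" using that by (simp add: sum.delta' if_distrib cong: if_cong)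
    also have "\<dots> = (\<Sum>l0<N. g l0 * (\<Sum>k<m. c l0 k * B k l))"
      by (rule sum.cong) (use c that in auto)
    also have "\<dots> = (\<Sum>k<m. (\<Sum>l0<N. g l0 * c l0 k) * B k l)"
      by (simp add: sum_distrib_left sum_distrib_right mult.assoc, subst sum.swap, simp)
    also have "\<dots> = 0" using g(2) by simp
    finally show ?thesis .
  qed
  then show False using g(1) by blast
qed

lemma indep_rows_extend_many:
  fixes B :: "nat \<Rightarrow> nat \<Rightarrow> 'k::field"
  assumes "indep_rows m N B" "m + d \<le> N"
  shows "\<exists>G. indep_rows (m + d) N G \<and> (\<forall>k<m. G k = B k)"
  using assms(2)
proof (induction d)
  case 0
  then show ?case using assms(1) by auto
next
  case (Suc d)
  then obtain G where G: "indep_rows (m + d) N G" "\<forall>k<m. G k = B k" by auto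
  from indep_rows_extend[OF G(1)] Suc.prems obtain l0 where
    "indep_rows (Suc (m + d)) N (G(m + d := (\<lambda>l. if l = l0 then 1 else 0)))" by auto
  then have "indep_rows (m + Suc d) N (G(m + d := (\<lambda>l. if l = l0 then 1 else 0)))" by simp
  moreover have "\<forall>k<m. (G(m + d := (\<lambda>l. if l = l0 then 1 else 0))) k = B k" using G(2) by simp
  ultimately show ?case by blast
qed

lemma right_inverse_imp_left_inverse:
  fixes G :: "nat \<Rightarrow> nat \<Rightarrow> 'k::field"
  assumes "\<And>k j. k < N \<Longrightarrow> j < N \<Longrightarrow> (\<Sum>l<N. G k l * Y l j) = (if k = j then 1 else 0)"
    and "k < N" "j < N"
  shows "(\<Sum>l<N. Y k l * G l j) = (if k = j then 1 else 0)"
proof -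
  let ?G = "mat N N (\<lambda>(i,j). G i j)" and ?Y = "mat N N (\<lambda>(i,j). Y i j)"
  have "?G * ?Y = 1\<^sub>m N"
  proof (rule eq_matI)
    fix i j assume "i < dim_row (1\<^sub>m N :: 'k mat)" "j < dim_col (1\<^sub>m N :: 'k mat)"
    then have ij: "i < N" "j < N" by auto
    then have "(?G * ?Y) $$ (i, j) = (\<Sum>l = 0..<N. G i l * Y l j)"
      by (simp add: scalar_prod_def)
    then show "(?G * ?Y) $$ (i, j) = 1\<^sub>m N $$ (i, j)"
      using assms(1)[OF ij] ij by (simp only: atLeast0LessThan index_one_mat)
  qed auto
  then have "?Y * ?G = 1\<^sub>m N" by (rule mat_mult_left_right_inverse[rotated 2]) auto
  then have "(?Y * ?G) $$ (k, j) = 1\<^sub>m N $$ (k, j)" by simp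
  moreover have "(?Y * ?G) $$ (k, j) = (\<Sum>l = 0..<N. Y k l * G l j)"
    using assms(2,3) by (simp add: scalar_prod_def)
  ultimately show ?thesis using assms(2,3) by (simp only: atLeast0LessThan index_one_mat)
qed

text \<open>Coordinates adapted to given rows: the rows become the first \<open>m\<close> coordinate
  functions, and the columns of \<open>Y\<close> are the dual basis. Local frames, splittings on
  lines and nonvanishing determinants are all read off from such a pair.\<close>

lemma indep_rows_completion:
  fixes B :: "nat \<Rightarrow> nat \<Rightarrow> 'k::field"
  assumes "indep_rows m N B"
  shows "\<exists>G Y. (\<forall>k<m. G k = B k) \<and>
    (\<forall>k<N. \<forall>j<N. (\<Sum>l<N. G k l * Y l j) = (if k = j then 1 else 0)) \<and>
    (\<forall>k<N. \<forall>j<N. (\<Sum>l<N. Y k l * G l j) = (if k = j then 1 else 0))"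
proof -
  obtain G where G: "indep_rows N N G" "\<And>k. k < m \<Longrightarrow> G k = B k"
    using indep_rows_extend_many[OF assms, of "N - m"] indep_rows_le[OF assms] by auto
  obtain Y where Y: "\<And>k j. k < N \<Longrightarrow> j < N \<Longrightarrow> (\<Sum>l<N. G k l * Y l j) = (if k = j then 1 else 0)"
    using indep_rows_right_inverse[OF G(1)] by blast
  show ?thesis
    by (intro exI[of _ G] exI[of _ Y] conjI allI impI G(2) Y right_inverse_imp_left_inverse[OF Y])
qed

text \<open>A Krylov argument. Take a nonzero polynomial \<open>p\<close> of least degree with
  \<open>\<Sum> coeff p k * v k = 0\<close> and a root \<open>\<mu>\<close> of it; the cofactor
  \<open>q\<close> of \<open>[:- \<mu>, 1:]\<close> gives a nonzero combination by minimality, and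
  the shift multiplies it by \<open>\<mu>\<close>. No linear map carrying \<open>v k\<close> to
  \<open>v (Suc k)\<close> is assumed, so the lemma also applies to sequences of successively chosen
  vectors.\<close>

lemma shift_eigenvector:
  fixes v :: "nat \<Rightarrow> nat \<Rightarrow> 'k::alg_closed_field"
  assumes v0: "\<exists>i<h. v 0 i \<noteq> 0"
  obtains a and M :: nat and \<mu> where "(\<exists>i<h. (\<Sum>k<M. a k * v k i) \<noteq> 0) \<and>
    (\<forall>i<h. (\<Sum>k<M. a k * v (Suc k) i) = \<mu> * (\<Sum>k<M. a k * v k i))"
proof -
  define rel where "rel p \<longleftrightarrow> (\<forall>i<h. (\<Sum>k\<le>degree p. coeff p k * v k i) = 0)" for p
  have "\<exists>p. p \<noteq> 0 \<and> rel p"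
  proof -
    obtain g where g: "\<exists>k<Suc h. g k \<noteq> 0" "\<And>i. i < h \<Longrightarrow> (\<Sum>k<Suc h. g k * v k i) = 0"
      using more_unknowns_than_equations[of h "Suc h" v] by auto
    define p where "p = (\<Sum>k<Suc h. monom (g k) k)"
    have c: "coeff p k = (if k < Suc h then g k else 0)" for k
      unfolding p_def coeff_sum by (simp add: coeff_monom sum.delta' del: sum.lessThan_Suc)
    have "p \<noteq> 0" using g(1) c by (metis coeff_0)
    moreover have "rel p"
      unfolding rel_def
    proof (intro allI impI)
      fix i assume i: "i < h"
      have "degree p \<le> h" by (rule degree_le) (simp add: c)
      then have "(\<Sum>k\<le>degree p. coeff p k * v k i) = (\<Sum>k<Suc h. coeff p k * v k i)"
        by (intro sum.mono_neutral_left) (auto simp: coeff_eq_0)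
      also have "\<dots> = (\<Sum>k<Suc h. g k * v k i)" by (rule sum.cong) (auto simp: c)
      finally show "(\<Sum>k\<le>degree p. coeff p k * v k i) = 0" using g(2)[OF i] by simp
    qed
    ultimately show ?thesis by blast
  qed
  then obtain p where p: "p \<noteq> 0" "rel p" and
    pmin: "\<And>q. q \<noteq> 0 \<and> rel q \<Longrightarrow> degree p \<le> degree q"
    using ex_has_least_nat[of "\<lambda>p. p \<noteq> 0 \<and> rel p" _ degree] by metis
  \<comment> \<open>A nonzero constant relation would say \<open>v 0 = 0\<close>.\<close>
  have "degree p > 0"
  proof (rule ccontr)
    assume "\<not> degree p > 0"
    then have d: "degree p = 0" by simp
    then have "coeff p 0 \<noteq> 0" using p(1) leading_coeff_0_iff by metis
    then show False using p(2) v0 d unfolding rel_def by auto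
  qed
  then obtain \<mu> where "poly p \<mu> = 0" using alg_closed_imp_poly_has_root by blast
  then obtain q where q: "p = [:- \<mu>, 1:] * q" using poly_eq_0_iff_dvd by blast
  have q0: "q \<noteq> 0" using p(1) q by auto
  have dq: "degree p = Suc (degree q)" using q0 unfolding q by (subst degree_mult_eq) auto
  have pq: "p = pCons 0 q - Polynomial.smult \<mu> q" unfolding q by simp
  have "\<not> rel q" using pmin[of q] q0 dq by auto
  then have 1: "\<exists>i<h. (\<Sum>k<Suc (degree q). coeff q k * v k i) \<noteq> 0"
    unfolding rel_def lessThan_Suc_atMost by blast
  have 2: "(\<Sum>k<Suc (degree q). coeff q k * v (Suc k) i) = \<mu> * (\<Sum>k<Suc (degree q). coeff q k * v k i)"
    if i: "i < h" for i
  proof -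
    have "0 = (\<Sum>k\<le>Suc (degree q). coeff p k * v k i)" using p(2) i dq unfolding rel_def by simp
    also have "\<dots> = (\<Sum>k\<le>Suc (degree q). coeff (pCons 0 q) k * v k i) - \<mu> * (\<Sum>k\<le>Suc (degree q). coeff q k * v k i)"
      unfolding pq by (simp only: coeff_diff coeff_smult left_diff_distrib sum_subtractf sum_distrib_left mult.assoc)
    also have "(\<Sum>k\<le>Suc (degree q). coeff (pCons 0 q) k * v k i) = (\<Sum>k<Suc (degree q). coeff q k * v (Suc k) i)"
      unfolding lessThan_Suc_atMost by (subst sum.atMost_Suc_shift) simp
    also have "(\<Sum>k\<le>Suc (degree q). coeff q k * v k i) = (\<Sum>k<Suc (degree q). coeff q k * v k i)"
      unfolding lessThan_Suc_atMost by (subst sum.atMost_Suc) (simp add: coeff_eq_0)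
    finally show ?thesis by simp
  qed
  show thesis by (rule that[of "coeff q" "Suc (degree q)" \<mu>]) (use 1 2 in blast)
qed

text \<open>Here \<open>v\<close> is the orbit of a nonzero vector under right multiplication by
  \<open>m\<close>, so the shift is the matrix itself. The eigenvector is a row vector because the
  rows of \<open>m\<close> will hold coefficients of relations between generators.\<close>

lemma eigenvector_exists:
  fixes m :: "nat \<Rightarrow> nat \<Rightarrow> 'k::alg_closed_field"
  assumes "h > 0"
  shows "\<exists>z \<mu>. (\<exists>i<h. z i \<noteq> 0) \<and> (\<forall>j<h. (\<Sum>i<h. z i * m i j) = \<mu> * z j)"
proof -
  define v where "v = rec_nat (\<lambda>i. 1::'k) (\<lambda>_ w j. \<Sum>i<h. w i * m i j)"
  have v: "v 0 = (\<lambda>_. 1)" "v (Suc k) = (\<lambda>j. \<Sum>i<h. v k i * m i j)" for k by (simp_all add: v_def)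
  have nz: "\<exists>i<h. v 0 i \<noteq> 0" using assms v(1) by auto
  obtain a M \<mu> where a: "(\<exists>i<h. (\<Sum>k<M. a k * v k i) \<noteq> 0) \<and>
    (\<forall>i<h. (\<Sum>k<M. a k * v (Suc k) i) = \<mu> * (\<Sum>k<M. a k * v k i))"
    by (rule shift_eigenvector[of h v, OF nz])
  have "(\<Sum>i<h. (\<Sum>k<M. a k * v k i) * m i j) = \<mu> * (\<Sum>k<M. a k * v k j)" if "j < h" for j
  proof -
    have "(\<Sum>i<h. (\<Sum>k<M. a k * v k i) * m i j) = (\<Sum>k<M. a k * (\<Sum>i<h. v k i * m i j))"
      by (simp add: sum_distrib_left sum_distrib_right mult.assoc, subst sum.swap, simp)
    then show ?thesis using a that by (simp add: v(2))
  qed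
  then show ?thesis using a by (intro exI[of _ "\<lambda>i. \<Sum>k<M. a k * v k i"] exI[of _ \<mu>]) auto
qed

section \<open>Vector spaces of scalar functions\<close>

lemma sum_fun_apply: "(\<Sum>i\<in>A. f i) x = (\<Sum>i\<in>A. f i x :: 'k::field)"
  by (induction A rule: infinite_finite_induct) auto

text \<open>A named scalar multiplication, so that functions form an instance of the general vector
  space theory while products of functions remain pointwise.\<close>

definition scf :: "'k::field \<Rightarrow> ('x \<Rightarrow> 'k) \<Rightarrow> 'x \<Rightarrow> 'k" where
  "scf a f = (\<lambda>x. a * f x)"

lemma scf_apply [simp]: "scf a f x = a * f x"
  by (simp add: scf_def)

global_interpretation fs: vector_space "scf :: 'k::field \<Rightarrow> ('x \<Rightarrow> 'k) \<Rightarrow> 'x \<Rightarrow> 'k"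
  by unfold_locales (auto simp: algebra_simps fun_eq_iff plus_fun_def)

lemma scf_mult: "scf a f * g = scf a (f * g)" "f * scf a g = scf a (f * g)" for f g :: "'x \<Rightarrow> 'k::field"
  by (auto simp: fun_eq_iff times_fun_def)

lemma subspace_mult_preimage: "fs.subspace S \<Longrightarrow> fs.subspace {f. g * f \<in> S}" for g :: "'x \<Rightarrow> 'k::field"
  unfolding fs.subspace_def by (simp add: distrib_left scf_mult)

lemma mult_span_in:
  fixes g :: "'x \<Rightarrow> 'k::field"
  assumes "fs.subspace S" "\<And>a. a \<in> A \<Longrightarrow> g * a \<in> S" "f \<in> fs.span A"
  shows "g * f \<in> S"
  using fs.span_minimal[OF _ subspace_mult_preimage[OF assms(1), of g], of A] assms(2,3) by blast

text \<open>Makes it possible to check on a spanning set that multiplication by \<open>x\<close> is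
  onto modulo \<open>S\<close>.\<close>

lemma subspace_mod: "fs.subspace S \<Longrightarrow> fs.subspace W \<Longrightarrow> fs.subspace {f. \<exists>g\<in>W. f - x * g \<in> S}"
  for x :: "'x \<Rightarrow> 'k::field"
  unfolding fs.subspace_def
proof (intro conjI ballI allI, goal_cases)
  case 1
  then show ?case by (auto intro!: bexI[of _ 0])
next
  case (2 f g)
  then obtain f' g' where "f' \<in> W" "f - x * f' \<in> S" "g' \<in> W" "g - x * g' \<in> S" by auto
  moreover have "f + g - x * (f' + g') = (f - x * f') + (g - x * g')" by (simp add: algebra_simps)
  ultimately have "f + g - x * (f' + g') \<in> S" "f' + g' \<in> W" using 2 by metis+
  then show ?case by blast
next
  case (3 a f)
  then obtain f' where "f' \<in> W" "f - x * f' \<in> S" by auto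
  moreover have "scf a f - x * scf a f' = scf a (f - x * f')" by (auto simp: fun_eq_iff algebra_simps)
  ultimately have "scf a f - x * scf a f' \<in> S" "scf a f' \<in> W" using 3 by metis+
  then show ?case by blast
qed

subsection \<open>Common zeros of linear forms on a cone\<close>

text \<open>
  This replaces the projective dimension theorem. The functions \<open>X q\<close> are the homogeneous coordinates
  of the points of a cone in terms of parameters, \<open>R t\<close> is the part of degree \<open>t\<close> of its coordinate
  ring, and \<open>J L t\<close> that of the ideal generated by a set \<open>L\<close> of linear forms. \<open>good L\<close> says that this
  ideal contains no power of the irrelevant ideal.
\<close>

locale coord_functions =
  fixes I :: "'q set" and X :: "'q \<Rightarrow> 'x \<Rightarrow> 'k::alg_closed_field"
  assumes finI: "finite I"
begin

primrec R :: "nat \<Rightarrow> ('x \<Rightarrow> 'k) set" where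
  "R 0 = fs.span {1}"
| "R (Suc t) = fs.span {X q * f | q f. q \<in> I \<and> f \<in> R t}"

fun J :: "('x \<Rightarrow> 'k) set \<Rightarrow> nat \<Rightarrow> ('x \<Rightarrow> 'k) set" where
  "J L 0 = {0}"
| "J L (Suc t) = fs.span {l * f | l f. l \<in> L \<and> f \<in> R t}"

definition good :: "('x \<Rightarrow> 'k) set \<Rightarrow> bool" where
  "good L \<longleftrightarrow> (\<forall>t. J L t \<noteq> R t)"

lemma subspace_R: "fs.subspace (R t)"
  by (cases t) auto

lemma subspace_J: "fs.subspace (J L t)"
  by (cases t) simp_all

lemma R_SucI: "q \<in> I \<Longrightarrow> f \<in> R t \<Longrightarrow> X q * f \<in> R (Suc t)"
  unfolding R.simps by (rule fs.span_base) blast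

lemma J_SucI: "l \<in> L \<Longrightarrow> f \<in> R t \<Longrightarrow> l * f \<in> J L (Suc t)"
  unfolding J.simps by (rule fs.span_base) blast

lemma one_in_R0: "1 \<in> R 0"
  by (auto intro!: fs.span_base)

lemma X_in_R1: "q \<in> I \<Longrightarrow> X q \<in> R 1"
  using R_SucI[OF _ one_in_R0] by simp

lemma R1_mult:
  assumes "l \<in> R 1" "f \<in> R t" shows "l * f \<in> R (Suc t)"
proof -
  have "f * l \<in> R (Suc t)"
  proof (rule mult_span_in[OF subspace_R])
    show "l \<in> fs.span {X q * f | q f. q \<in> I \<and> f \<in> R 0}" using assms(1) by (simp del: R.simps(1))
  next
    fix a assume "a \<in> {X q * f | q f. q \<in> I \<and> f \<in> R 0}"
    then obtain q g where a: "a = X q * g" "q \<in> I" "g \<in> fs.span {1}" by auto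
    have "f * g \<in> R t"
      by (rule mult_span_in[OF subspace_R _ a(3)]) (use assms(2) in auto)
    then have "X q * (f * g) \<in> R (Suc t)" using a(2) by (rule R_SucI[rotated])
    then show "f * a \<in> R (Suc t)" unfolding a(1) by (simp add: mult.left_commute del: R.simps)
  qed
  then show ?thesis by (simp add: mult.commute)
qed

lemma J_subset_R: "L \<subseteq> R 1 \<Longrightarrow> J L t \<subseteq> R t"
proof (cases t)
  case 0
  then show ?thesis using fs.subspace_0[OF subspace_R] by (simp del: R.simps)
next
  case (Suc t')
  assume "L \<subseteq> R 1"
  then show ?thesis unfolding Suc J.simps
    by (intro fs.span_minimal[OF _ subspace_R]) (use R1_mult in blast)
qed

lemma J_mono: "L \<subseteq> L' \<Longrightarrow> J L t \<subseteq> J L' t"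
proof (cases t)
  case (Suc t')
  assume "L \<subseteq> L'"
  then show ?thesis unfolding Suc J.simps by (intro fs.span_mono) blast
qed simp

lemma R1_mult_J:
  assumes "x \<in> R 1" "f \<in> J L t" shows "x * f \<in> J L (Suc t)"
proof (cases t)
  case 0
  then show ?thesis using assms(2) fs.subspace_0[OF subspace_J] by (simp del: J.simps(2))
next
  case (Suc t')
  show ?thesis
  proof (rule mult_span_in[OF subspace_J])
    show "f \<in> fs.span {l * f | l f. l \<in> L \<and> f \<in> R t'}" using assms(2) Suc by simp
  next
    fix a assume "a \<in> {l * f | l f. l \<in> L \<and> f \<in> R t'}"
    then obtain l g where a: "a = l * g" "l \<in> L" "g \<in> R t'" by auto
    have "l * (x * g) \<in> J L (Suc t)"
      using a R1_mult[OF assms(1) a(3)] Suc by (intro J_SucI) (auto simp del: R.simps)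
    then show "x * a \<in> J L (Suc t)" unfolding a(1) by (simp add: mult.left_commute del: J.simps)
  qed
qed

lemma J_span: "J (fs.span L) t = J L t"
proof (cases t)
  case (Suc t')
  have "J (fs.span L) (Suc t') \<subseteq> J L (Suc t')"
    unfolding J.simps(2)[of "fs.span L"]
  proof (intro fs.span_minimal[OF _ subspace_J] subsetI)
    fix a assume "a \<in> {l * f | l f. l \<in> fs.span L \<and> f \<in> R t'}"
    then obtain l f where a: "a = l * f" "l \<in> fs.span L" "f \<in> R t'" by auto
    have "f * l \<in> J L (Suc t')"
      by (rule mult_span_in[OF subspace_J _ a(2)]) (use J_SucI[OF _ a(3)] in \<open>simp add: mult.commute del: J.simps\<close>)
    then show "a \<in> J L (Suc t')" unfolding a(1) by (simp add: mult.commute del: J.simps)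
  qed
  then show ?thesis using J_mono[OF fs.span_superset[of L], of t] Suc by blast
qed simp

text \<open>The ring is generated in degree one: \<open>R (Suc t)\<close> consists of combinations
  of coordinates times elements of \<open>R t\<close>, so one full graded piece of the ideal makes
  all later ones full.\<close>

lemma J_eq_R_mono:
  assumes "L \<subseteq> R 1" "J L t = R t" "t \<le> t'" shows "J L t' = R t'"
  using assms(3)
proof (induction t' rule: dec_induct)
  case base
  then show ?case by (rule assms(2))
next
  case (step t')
  have "R (Suc t') \<subseteq> J L (Suc t')"
    unfolding R.simps(2)
  proof (intro fs.span_minimal[OF _ subspace_J] subsetI)
    fix a assume "a \<in> {X q * f | q f. q \<in> I \<and> f \<in> R t'}"
    then show "a \<in> J L (Suc t')" using R1_mult_J[OF X_in_R1] step.IH by (auto simp del: J.simps R.simps)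
  qed
  then show ?case using J_subset_R[OF assms(1), of "Suc t'"] by blast
qed

lemma R_finite_span: "\<exists>F. finite F \<and> F \<subseteq> R t \<and> R t \<subseteq> fs.span F"
proof (induction t)
  case 0
  show ?case by (intro exI[of _ "{1}"] conjI) (use one_in_R0 in blast, use one_in_R0 in blast, unfold R.simps, rule subset_refl)
next
  case (Suc t)
  then obtain F where F: "finite F" "F \<subseteq> R t" "R t \<subseteq> fs.span F" by blast
  let ?F = "(\<lambda>(q,f). X q * f) ` (I \<times> F)"
  have "R (Suc t) \<subseteq> fs.span ?F"
    unfolding R.simps(2)
  proof (intro fs.span_minimal[OF _ fs.subspace_span] subsetI)
    fix a assume "a \<in> {X q * f | q f. q \<in> I \<and> f \<in> R t}"
    then obtain q f where a: "a = X q * f" "q \<in> I" "f \<in> fs.span F" using F by blast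
    show "a \<in> fs.span ?F" unfolding a(1)
      by (rule mult_span_in[OF fs.subspace_span _ a(3)]) (use a(2) in \<open>auto intro!: fs.span_base\<close>)
  qed
  moreover have "?F \<subseteq> R (Suc t)" using R_SucI F(2) by (auto simp del: R.simps)
  moreover have "finite ?F" using F(1) finI by simp
  ultimately show ?case by blast
qed

text \<open>A finite family spanning the quotient \<open>R t / J L t\<close>. Only spanning is asked
  for; minimality of the number of members will do the work of a basis.\<close>

definition gen :: "('x \<Rightarrow> 'k) set \<Rightarrow> nat \<Rightarrow> 'i set \<Rightarrow> ('i \<Rightarrow> 'x \<Rightarrow> 'k) \<Rightarrow> bool" where
  "gen L t S c \<longleftrightarrow> finite S \<and> (\<forall>i\<in>S. c i \<in> R t) \<and> (\<forall>f\<in>R t. \<exists>a. f - (\<Sum>i\<in>S. scf (a i) (c i)) \<in> J L t)"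

text \<open>Multiplication by \<open>x\<close> maps degree \<open>t\<close> onto degree
  \<open>t + 1\<close> in the quotient of the coordinate ring by the ideal of
  \<open>L\<close>.\<close>

definition surj_at :: "('x \<Rightarrow> 'k) set \<Rightarrow> ('x \<Rightarrow> 'k) \<Rightarrow> nat \<Rightarrow> bool" where
  "surj_at L x t \<longleftrightarrow> (\<forall>f\<in>R (Suc t). \<exists>g\<in>R t. f - x * g \<in> J L (Suc t))"

lemma gen_reindex:
  assumes "gen L t S c" shows "\<exists>c'. gen L t {..<card S} c'"
proof -
  obtain e where e: "bij_betw e {..<card S} S"
    using assms ex_bij_betw_nat_finite[of S] unfolding gen_def by (auto simp: atLeast0LessThan)
  have "gen L t {..<card S} (c \<circ> e)"
    unfolding gen_def
  proof (intro conjI ballI)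
    fix i assume "i \<in> {..<card S}"
    then show "(c \<circ> e) i \<in> R t" using assms e unfolding gen_def by (auto simp: bij_betw_apply)
  next
    fix f assume "f \<in> R t"
    then obtain a where a: "f - (\<Sum>i\<in>S. scf (a i) (c i)) \<in> J L t" using assms unfolding gen_def by blast
    have "(\<Sum>i\<in>S. scf (a i) (c i)) = (\<Sum>i<card S. scf ((a \<circ> e) i) ((c \<circ> e) i))"
      using sum.reindex_bij_betw[OF e, of "\<lambda>i. scf (a i) (c i)"] by simp
    then show "\<exists>a. f - (\<Sum>i<card S. scf (a i) ((c \<circ> e) i)) \<in> J L t" using a by metis
  qed simp
  then show ?thesis by blast
qed

lemma gen_exists: "\<exists>S (c :: nat \<Rightarrow> _). gen L t S c"
proof -
  obtain F where F: "finite F" "F \<subseteq> R t" "R t \<subseteq> fs.span F" using R_finite_span by blast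
  have "gen L t F (\<lambda>f. f)"
    unfolding gen_def
  proof (intro conjI ballI)
    fix f assume "f \<in> R t"
    then obtain u where "f = (\<Sum>v\<in>F. scf (u v) v)" using F(3) fs.span_finite[OF F(1)] by blast
    then show "\<exists>a. f - (\<Sum>v\<in>F. scf (a v) v) \<in> J L t"
      using fs.subspace_0[OF subspace_J] by (intro exI[of _ u]) simp
  qed (use F in auto)
  then show ?thesis using gen_reindex by blast
qed

lemma gen_step:
  assumes "gen L t S c" "surj_at L x t" "x \<in> R 1"
  shows "gen L (Suc t) S (\<lambda>i. x * c i)"
  unfolding gen_def
proof (intro conjI ballI)
  show "finite S" using assms(1) by (simp add: gen_def)
  fix i assume "i \<in> S"
  then show "x * c i \<in> R (Suc t)" using assms(1) R1_mult[OF assms(3)] unfolding gen_def by blast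
next
  fix f assume "f \<in> R (Suc t)"
  then obtain g where g: "g \<in> R t" "f - x * g \<in> J L (Suc t)" using assms(2) unfolding surj_at_def by blast
  obtain a where "g - (\<Sum>i\<in>S. scf (a i) (c i)) \<in> J L t" using assms(1) g(1) unfolding gen_def by blast
  from R1_mult_J[OF assms(3) this]
  have "(f - x * g) + x * (g - (\<Sum>i\<in>S. scf (a i) (c i))) \<in> J L (Suc t)"
    by (intro fs.subspace_add[OF subspace_J g(2)])
  also have "(f - x * g) + x * (g - (\<Sum>i\<in>S. scf (a i) (c i))) = f - (\<Sum>i\<in>S. scf (a i) (x * c i))"
    by (simp add: right_diff_distrib sum_distrib_left scf_mult)
  finally show "\<exists>a. f - (\<Sum>i\<in>S. scf (a i) (x * c i)) \<in> J L (Suc t)" by blast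
qed

lemma gen_drop:
  assumes g: "gen L t S c" and z: "(\<Sum>i\<in>S. scf (z i) (c i)) \<in> J L t" "z i0 \<noteq> 0" "i0 \<in> S"
  shows "gen L t (S - {i0}) c"
  unfolding gen_def
proof (intro conjI ballI)
  have fin: "finite S" using g by (simp add: gen_def)
  then show "finite (S - {i0})" by simp
  fix f assume "f \<in> R t"
  then obtain a where a: "f - (\<Sum>i\<in>S. scf (a i) (c i)) \<in> J L t" using g unfolding gen_def by blast
  \<comment> \<open>Adding this multiple of the relation cancels the coefficient at
    \<open>i0\<close>.\<close>
  define b where "b = a i0 / z i0"
  have "(f - (\<Sum>i\<in>S. scf (a i) (c i))) + scf b (\<Sum>i\<in>S. scf (z i) (c i)) \<in> J L t"
    by (intro fs.subspace_add[OF subspace_J a] fs.subspace_scale[OF subspace_J z(1)])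
  also have "(f - (\<Sum>i\<in>S. scf (a i) (c i))) + scf b (\<Sum>i\<in>S. scf (z i) (c i))
     = f - (\<Sum>i\<in>S. scf (a i - b * z i) (c i))"
    by (simp add: fun_eq_iff sum_distrib_left left_diff_distrib sum_subtractf sum_fun_apply mult.assoc)
  also have "(\<Sum>i\<in>S. scf (a i - b * z i) (c i)) = (\<Sum>i\<in>S - {i0}. scf (a i - b * z i) (c i))"
    using fin z(2,3) by (subst sum.remove[of _ i0]) (auto simp: b_def fun_eq_iff sum_fun_apply)
  finally show "\<exists>a. f - (\<Sum>i\<in>S - {i0}. scf (a i) (c i)) \<in> J L t"
    by (rule exI[of _ "\<lambda>i. a i - b * z i"])
qed (use g in \<open>auto simp: gen_def\<close>)

text \<open>In high degree the ideal of \<open>insert x L\<close> is everything, so every element is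
  a multiple of \<open>x\<close> up to the ideal of \<open>L\<close>.\<close>

lemma surj_at_eventually:
  assumes "L \<subseteq> R 1" "x \<in> R 1" "\<not> good (insert x L)"
  shows "\<exists>T. \<forall>t\<ge>T. surj_at L x t"
proof -
  obtain T where T: "J (insert x L) T = R T" using assms(3) unfolding good_def by blast
  have "surj_at L x t" if "t \<ge> T" for t
    unfolding surj_at_def
  proof
    fix f assume "f \<in> R (Suc t)"
    then have "f \<in> J (insert x L) (Suc t)"
      using J_eq_R_mono[OF _ T, of "Suc t"] assms that by auto
    moreover have "J (insert x L) (Suc t) \<subseteq> {f. \<exists>g\<in>R t. f - x * g \<in> J L (Suc t)}"
      unfolding J.simps(2)[of "insert x L"]
    proof (intro fs.span_minimal subspace_mod subspace_J subspace_R subsetI CollectI)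
      fix a assume "a \<in> {l * f |l f. l \<in> insert x L \<and> f \<in> R t}"
      then obtain l g where a: "a = l * g" "l = x \<or> l \<in> L" "g \<in> R t" by auto
      show "\<exists>g\<in>R t. a - x * g \<in> J L (Suc t)"
      proof (cases "l = x")
        case True
        then show ?thesis using a fs.subspace_0[OF subspace_J] by (intro bexI[of _ g]) (auto simp del: J.simps)
      next
        case False
        then show ?thesis using a J_SucI fs.subspace_0[OF subspace_R]
          by (intro bexI[of _ 0]) (auto simp del: J.simps)
      qed
    qed
    ultimately show "\<exists>g\<in>R t. f - x * g \<in> J L (Suc t)" by blast
  qed
  then show ?thesis by blast
qed


lemma R1_subset_J:
  assumes "\<And>q. q \<in> I \<Longrightarrow> X q \<in> L" shows "R 1 \<subseteq> J L 1"
proof -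
  have "{X q * f | q f. q \<in> I \<and> f \<in> R 0} \<subseteq> J L (Suc 0)"
    using assms J_SucI[where t=0] by (auto simp del: J.simps R.simps)
  from fs.span_minimal[OF this subspace_J] show ?thesis by (simp only: One_nat_def R.simps(2))
qed

text \<open>
  By maximality, multiplication by any \<open>x \<notin> L\<close> is onto on \<open>R/J\<close> in high degrees. Once the number \<open>h\<close>
  of generators has become minimal, \<open>y/x\<close> acts as an \<open>h \<times> h\<close> matrix, and an eigenvalue \<open>\<mu>\<close> of it gives
  \<open>y - \<mu> x \<in> L\<close>, since otherwise multiplication by \<open>y - \<mu> x\<close> would allow a generator to be dropped.
\<close>

lemma eigenvalue_mod:
  assumes L: "fs.subspace L" "L \<subseteq> R 1" "good L"
    and max: "\<And>x. x \<in> R 1 \<Longrightarrow> x \<notin> L \<Longrightarrow> \<not> good (insert x L)"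
  shows "\<exists>x\<in>R 1. x \<notin> L \<and> (\<forall>y\<in>R 1. \<exists>\<mu>. y - scf \<mu> x \<in> L)"
proof -
  have "\<not> R 1 \<subseteq> L"
  proof
    assume "R 1 \<subseteq> L"
    then have "R 1 \<subseteq> J L 1" using X_in_R1 by (intro R1_subset_J) blast
    then show False using J_subset_R[OF L(2), of 1] L(3) unfolding good_def by blast
  qed
  then obtain x where x: "x \<in> R 1" "x \<notin> L" by blast
  obtain T where T: "\<And>t. t \<ge> T \<Longrightarrow> surj_at L x t" using surj_at_eventually[OF L(2) x(1) max[OF x]] by blast
  \<comment> \<open>\<open>P k\<close> says that \<open>k\<close> elements span the quotient in some
    degree from \<open>T\<close> on, where multiplication by \<open>x\<close> is already onto. The
    least such \<open>k\<close> is the number \<open>h\<close>.\<close>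
  define P where "P k \<longleftrightarrow> (\<exists>t\<ge>T. \<exists>c::nat \<Rightarrow> _. gen L t {..<k} c)" for k :: nat
  have PI: "P (card S)" if "gen L t S c" "t \<ge> T" for t and S :: "nat set" and c
    using gen_reindex[OF that(1)] that(2) unfolding P_def by blast
  obtain S and c :: "nat \<Rightarrow> 'x \<Rightarrow> 'k" where "gen L T S c" using gen_exists by blast
  then have "\<exists>k. P k" using PI by blast
  define h where "h = (LEAST k. P k)"
  have "P h" and hmin: "\<And>k. P k \<Longrightarrow> h \<le> k"
    using LeastI_ex[OF \<open>\<exists>k. P k\<close>] Least_le unfolding h_def by auto
  then obtain t0 c where t0: "t0 \<ge> T" and c: "gen L t0 {..<h} c" unfolding P_def by blast
  have cR: "c i \<in> R t0" if "i < h" for i using c that unfolding gen_def by blast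
  \<comment> \<open>Powers of \<open>x\<close> carry a spanning family of the minimal size
    \<open>h\<close> to every later degree.\<close>
  have ck: "gen L (t0 + k) {..<h} (\<lambda>i. x ^ k * c i)" for k
  proof (induction k)
    case 0
    then show ?case using c by simp
  next
    case (Suc k)
    have "surj_at L x (t0 + k)" using T t0 by simp
    from gen_step[OF Suc this x(1)] show ?case by (simp only: power_Suc mult.assoc add_Suc_right)
  qed
  have h0: "h > 0"
  proof (rule ccontr)
    assume "\<not> h > 0"
    then have "R t0 \<subseteq> J L t0" using c unfolding gen_def by auto
    then show False using J_subset_R[OF L(2), of t0] L(3) unfolding good_def by blast
  qed
  have "\<exists>\<mu>. y - scf \<mu> x \<in> L" if y: "y \<in> R 1" for y
  proof -
    have "\<exists>a. y * c i - (\<Sum>j<h. scf (a j) (x * c j)) \<in> J L (Suc t0)" if "i < h" for i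
      using R1_mult[OF y cR[OF that]] gen_step[OF c T[OF t0] x(1)] unfolding gen_def by blast
    \<comment> \<open>This is the matrix of \<open>y / x\<close>: modulo the ideal, \<open>y\<close>
      times a generator is a combination of the \<open>x * c j\<close>.\<close>
    then obtain m where m: "\<And>i. i < h \<Longrightarrow> y * c i - (\<Sum>j<h. scf (m i j) (x * c j)) \<in> J L (Suc t0)"
      by metis
    obtain z \<mu> where z: "\<exists>i<h. z i \<noteq> 0" "\<And>j. j < h \<Longrightarrow> (\<Sum>i<h. z i * m i j) = \<mu> * z j"
      using eigenvector_exists[OF h0, of m] by blast
    define w where "w = y - scf \<mu> x"
    have wR: "w \<in> R 1" unfolding w_def
      by (intro fs.subspace_diff[OF subspace_R] fs.subspace_scale[OF subspace_R] y x(1))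
    \<comment> \<open>The eigenvector turns the matrix relation into one for \<open>w\<close> alone:
      \<open>w\<close> annihilates the combination of generators with coefficients \<open>z\<close>
      modulo the ideal.\<close>
    have rel: "(\<Sum>i<h. scf (z i) (w * c i)) \<in> J L (Suc t0)"
    proof -
      have "(\<Sum>i<h. scf (z i) (y * c i - (\<Sum>j<h. scf (m i j) (x * c j)))) \<in> J L (Suc t0)"
        by (intro fs.subspace_sum[OF subspace_J] fs.subspace_scale[OF subspace_J] m) auto
      also have "(\<Sum>i<h. scf (z i) (y * c i - (\<Sum>j<h. scf (m i j) (x * c j)))) = (\<Sum>i<h. scf (z i) (w * c i))"
      proof
        fix p
        have "(\<Sum>i<h. z i * (\<Sum>j<h. m i j * (x p * c j p))) = (\<Sum>j<h. (\<Sum>i<h. z i * m i j) * (x p * c j p))"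
          by (simp add: sum_distrib_left sum_distrib_right mult.assoc, subst sum.swap, simp)
        also have "\<dots> = (\<Sum>j<h. \<mu> * z j * (x p * c j p))" using z(2) by simp
        finally show "(\<Sum>i<h. scf (z i) (y * c i - (\<Sum>j<h. scf (m i j) (x * c j)))) p = (\<Sum>i<h. scf (z i) (w * c i)) p"
          by (simp add: sum_fun_apply w_def algebra_simps sum_subtractf)
      qed
      finally show ?thesis .
    qed
    have "w \<in> L"
    proof (rule ccontr)
      assume "w \<notin> L"
      then obtain T' where T': "\<And>t. t \<ge> T' \<Longrightarrow> surj_at L w t"
        using surj_at_eventually[OF L(2) wR max[OF wR]] by blast
      \<comment> \<open>If \<open>w\<close> is onto in high degree, then \<open>w\<close> times the
        spanning family in degree \<open>t0 + T'\<close> spans again with \<open>h\<close> members.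
        The annihilation relation, multiplied by \<open>x ^ T'\<close>, is a relation between these,
        so \<open>h - 1\<close> of them suffice.\<close>
      have g: "gen L (Suc (t0 + T')) {..<h} (\<lambda>i. w * (x ^ T' * c i))"
        by (rule gen_step[OF ck T' wR]) simp
      have "x ^ k * (\<Sum>i<h. scf (z i) (w * c i)) \<in> J L (Suc (t0 + k))" for k
      proof (induction k)
        case (Suc k)
        from R1_mult_J[OF x(1) this] show ?case by (simp only: power_Suc mult.assoc add_Suc_right)
      qed (use rel in \<open>simp only: power_0 mult_1_left add_0_right\<close>)
      from this[of T'] have "(\<Sum>i<h. scf (z i) (w * (x ^ T' * c i))) \<in> J L (Suc (t0 + T'))"
        by (simp add: sum_distrib_left scf_mult mult.left_commute del: J.simps)
      moreover obtain i0 where "i0 < h" "z i0 \<noteq> 0" using z(1) by blast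
      ultimately have "gen L (Suc (t0 + T')) ({..<h} - {i0}) (\<lambda>i. w * (x ^ T' * c i))"
        by (intro gen_drop[OF g]) auto
      from PI[OF this] have "P (card ({..<h} - {i0}))" using t0 by simp
      then have "h \<le> card ({..<h} - {i0})" by (rule hmin)
      then show False using \<open>i0 < h\<close> h0 by simp
    qed
    then show ?thesis unfolding w_def by blast
  qed
  then show ?thesis using x by blast
qed

text \<open>\<open>R 1\<close> is spanned by a finite set, so independent sets in it have bounded
  cardinality; an independent set with good span of largest cardinality spans a maximal good
  space.\<close>

lemma maximal_good:
  assumes "L0 \<subseteq> R 1" "good L0"
  shows "\<exists>L. fs.subspace L \<and> L0 \<subseteq> L \<and> L \<subseteq> R 1 \<and> good L \<and> (\<forall>x\<in>R 1. x \<notin> L \<longrightarrow> \<not> good (insert x L))"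
proof -
  obtain F where F: "finite F" "F \<subseteq> R 1" "R 1 \<subseteq> fs.span F" using R_finite_span by blast
  define P where "P B \<longleftrightarrow> B \<subseteq> R 1 \<and> fs.independent B \<and> L0 \<subseteq> fs.span B \<and> good (fs.span B)" for B
  have spanR: "B \<subseteq> R 1 \<Longrightarrow> fs.span B \<subseteq> R 1" for B by (rule fs.span_minimal[OF _ subspace_R])
  have bound: "finite B \<and> card B \<le> card F" if "P B" for B
    using that F fs.independent_span_bound[OF F(1), of B] unfolding P_def by blast
  \<comment> \<open>\<open>L0\<close> need not be independent; a maximal independent subset has the
    same span and hence the same ideal.\<close>
  obtain B0 where B0: "B0 \<subseteq> L0" "fs.independent B0" "L0 \<subseteq> fs.span B0"
    using fs.maximal_independent_subset[of L0] by metis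
  have "J (fs.span B0) t \<subseteq> J L0 t" for t
    using J_mono[OF B0(1)] J_span by blast
  then have "good (fs.span B0)"
    using assms(2) J_mono[OF B0(3)] J_subset_R[OF spanR, of B0] B0(1) assms(1)
    unfolding good_def by (metis subset_antisym subset_trans)
  then have "P B0" unfolding P_def using B0 assms(1) by auto
  then obtain B where B: "P B" and Bmax: "\<And>B'. P B' \<Longrightarrow> card B' \<le> card B"
    using ex_has_greatest_nat[of P B0 card "Suc (card F)"] bound by (metis le_imp_less_Suc)
  have "\<not> good (insert x (fs.span B))" if x: "x \<in> R 1" "x \<notin> fs.span B" for x
  proof
    assume g: "good (insert x (fs.span B))"
    have ss: "fs.span (insert x B) \<subseteq> fs.span (insert x (fs.span B))"
      by (rule fs.span_mono) (use fs.span_superset in blast)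
    have "J (fs.span (insert x B)) t \<subseteq> J (insert x (fs.span B)) t" for t
      using J_mono[OF ss] J_span by blast
    moreover have "J (insert x (fs.span B)) t \<subseteq> R t" for t
      by (rule J_subset_R) (use x(1) spanR B in \<open>auto simp: P_def\<close>)
    ultimately have "good (fs.span (insert x B))"
      using g unfolding good_def by (metis subset_antisym)
    moreover have "fs.independent (insert x B)"
      using B x(2) unfolding P_def by (intro fs.independent_insertI) auto
    moreover have "L0 \<subseteq> fs.span (insert x B)"
      using B fs.span_mono[of B "insert x B"] unfolding P_def by blast
    ultimately have "P (insert x B)" using B x(1) unfolding P_def by blast
    then have "card (insert x B) \<le> card B" by (rule Bmax)
    moreover have "x \<notin> B" using x(2) fs.span_base by blast
    ultimately show False using bound[OF B] by simp
  qed
  then show ?thesis using B spanR[of B] fs.subspace_span[of B] unfolding P_def by blast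
qed

text \<open>
  For \<open>L\<close> maximal, \<open>R 1 = L \<oplus> k x\<close>, and the \<open>x\<close>-coefficients of the coordinates are the point sought:
  it satisfies the cubic relations between the coordinates because \<open>x ^ 3 \<notin> J L 3\<close>.
\<close>

lemma section_point:
  assumes "L0 \<subseteq> R 1" "good L0"
  shows "\<exists>p. (\<exists>q\<in>I. p q \<noteq> 0) \<and> (\<forall>b. (\<Sum>q\<in>I. scf (b q) (X q)) \<in> L0 \<longrightarrow> (\<Sum>q\<in>I. b q * p q) = 0) \<and>
    (\<forall>A a u v w. finite (A::nat set) \<and> u ` A \<subseteq> I \<and> v ` A \<subseteq> I \<and> w ` A \<subseteq> I \<and>
        (\<Sum>j\<in>A. scf (a j) (X (u j) * (X (v j) * X (w j)))) = 0 \<longrightarrow>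
        (\<Sum>j\<in>A. a j * (p (u j) * (p (v j) * p (w j)))) = 0)"
proof -
  obtain L where L: "fs.subspace L" "L0 \<subseteq> L" "L \<subseteq> R 1" "good L"
    and max: "\<And>x. x \<in> R 1 \<Longrightarrow> x \<notin> L \<Longrightarrow> \<not> good (insert x L)"
    using maximal_good[OF assms] by blast
  obtain x where x: "x \<in> R 1" "x \<notin> L" "\<And>y. y \<in> R 1 \<Longrightarrow> \<exists>\<mu>. y - scf \<mu> x \<in> L"
    using eigenvalue_mod[OF L(1,3,4) max] by blast
  have "\<exists>p. \<forall>q\<in>I. X q - scf (p q) x \<in> L" using x(3)[OF X_in_R1] by metis
  then obtain p where p: "\<And>q. q \<in> I \<Longrightarrow> X q - scf (p q) x \<in> L" by blast
  have lin: "(\<Sum>q\<in>I. scf (b q) (X q)) - scf (\<Sum>q\<in>I. b q * p q) x \<in> L" for b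
  proof -
    have "(\<Sum>q\<in>I. scf (b q) (X q - scf (p q) x)) \<in> L"
      by (intro fs.subspace_sum[OF L(1)] fs.subspace_scale[OF L(1)] p)
    also have "(\<Sum>q\<in>I. scf (b q) (X q - scf (p q) x)) = (\<Sum>q\<in>I. scf (b q) (X q)) - scf (\<Sum>q\<in>I. b q * p q) x"
      by (simp add: fun_eq_iff sum_fun_apply algebra_simps sum_subtractf sum_distrib_left)
    finally show ?thesis .
  qed
  have xt: "x ^ t \<in> R t" for t
  proof (induction t)
    case (Suc t)
    show ?case using R1_mult[OF x(1) Suc] by (simp only: power_Suc)
  qed (use one_in_R0 in \<open>simp only: power_0\<close>)
  \<comment> \<open>Congruences multiply: modulo the ideal, a product of \<open>t\<close>
    coordinates is the product of their \<open>p\<close>-values times \<open>x ^ t\<close>. This is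
    what makes \<open>p\<close> respect polynomial relations.\<close>
  have step: "X q * f - scf (p q * a) (x ^ Suc t) \<in> J L (Suc t)"
    if "q \<in> I" "f - scf a (x ^ t) \<in> J L t" for q f a t
  proof -
    have "X q * (f - scf a (x ^ t)) \<in> J L (Suc t)" by (rule R1_mult_J[OF X_in_R1[OF that(1)] that(2)])
    moreover have "(X q - scf (p q) x) * scf a (x ^ t) \<in> J L (Suc t)"
      by (intro J_SucI p that(1) fs.subspace_scale[OF subspace_R] xt)
    ultimately have "X q * (f - scf a (x ^ t)) + (X q - scf (p q) x) * scf a (x ^ t) \<in> J L (Suc t)"
      by (rule fs.subspace_add[OF subspace_J])
    also have "X q * (f - scf a (x ^ t)) + (X q - scf (p q) x) * scf a (x ^ t) = X q * f - scf (p q * a) (x ^ Suc t)"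
      by (simp add: fun_eq_iff algebra_simps)
    finally show ?thesis .
  qed
  have Rt: "\<exists>a. f - scf a (x ^ t) \<in> J L t" if "f \<in> R t" for f t
    using that
  proof (induction t arbitrary: f)
    case 0
    then obtain k where "f = scf k 1" by (auto simp: fs.span_singleton)
    then have "f - scf k (x ^ 0) = 0" by (simp add: fun_eq_iff)
    then show ?case by (intro exI[of _ k]) (simp only: J.simps singleton_iff)
  next
    case (Suc t)
    have ss: "fs.subspace {f. \<exists>a. f - scf a (x ^ Suc t) \<in> J L (Suc t)}"
      unfolding fs.subspace_def
    proof (intro conjI ballI allI, goal_cases)
      case 1
      then show ?case using fs.subspace_0[OF subspace_J[of L "Suc t"]] by (auto intro!: exI[of _ 0] simp: scf_def zero_fun_def simp del: J.simps)
    next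
      case (2 f g)
      then obtain a b where ab: "f - scf a (x ^ Suc t) \<in> J L (Suc t)" "g - scf b (x ^ Suc t) \<in> J L (Suc t)" by blast
      have "(f + g) - scf (a + b) (x ^ Suc t) = (f - scf a (x ^ Suc t)) + (g - scf b (x ^ Suc t))"
        by (simp add: fun_eq_iff algebra_simps)
      then show ?case using fs.subspace_add[OF subspace_J ab] by (intro CollectI exI[of _ "a + b"]) (simp only:)
    next
      case (3 k f)
      then obtain a where a: "f - scf a (x ^ Suc t) \<in> J L (Suc t)" by blast
      have "scf k f - scf (k * a) (x ^ Suc t) = scf k (f - scf a (x ^ Suc t))"
        by (simp add: fun_eq_iff algebra_simps)
      then show ?case using fs.subspace_scale[OF subspace_J a] by (intro CollectI exI[of _ "k * a"]) (simp only:)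
    qed
    have "{X q * f |q f. q \<in> I \<and> f \<in> R t} \<subseteq> {f. \<exists>a. f - scf a (x ^ Suc t) \<in> J L (Suc t)}"
      using Suc.IH step by blast
    from fs.span_minimal[OF this ss] show ?case using Suc.prems unfolding R.simps(2) by blast
  qed
  \<comment> \<open>By \<open>Rt\<close> each graded piece is spanned by \<open>x ^ t\<close> modulo
    the ideal; \<open>x ^ t\<close> in the ideal would therefore fill the piece, against
    \<open>good L\<close>.\<close>
  have xJ: "x ^ t \<notin> J L t" for t
  proof
    assume xt: "x ^ t \<in> J L t"
    have "R t \<subseteq> J L t"
    proof
      fix f assume "f \<in> R t"
      then obtain a where "f - scf a (x ^ t) \<in> J L t" using Rt by blast
      from fs.subspace_add[OF subspace_J this fs.subspace_scale[OF subspace_J xt], of a] show "f \<in> J L t" by simp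
    qed
    then show False using J_subset_R[OF L(3), of t] L(4) unfolding good_def by blast
  qed
  have c1: "\<exists>q\<in>I. p q \<noteq> 0"
  proof (rule ccontr)
    assume p0: "\<not> ?thesis"
    have "X q \<in> L" if "q \<in> I" for q proof -
      have "X q - scf (p q) x = X q" using p0 that by (simp add: fun_eq_iff)
      then show ?thesis using p[OF that] by (simp only:)
    qed
    then have "R 1 \<subseteq> J L 1" by (intro R1_subset_J)
    then show False using J_subset_R[OF L(3), of 1] L(4) unfolding good_def by blast
  qed
  have c2: "(\<Sum>q\<in>I. b q * p q) = 0" if "(\<Sum>q\<in>I. scf (b q) (X q)) \<in> L0" for b
  proof (rule ccontr)
    assume nz: "(\<Sum>q\<in>I. b q * p q) \<noteq> 0"
    have "(\<Sum>q\<in>I. scf (b q) (X q)) \<in> L" using that L(2) by blast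
    from fs.subspace_diff[OF L(1) this lin[of b]]
    have "scf (\<Sum>q\<in>I. b q * p q) x \<in> L" by simp
    from fs.subspace_scale[OF L(1) this, of "1 / (\<Sum>q\<in>I. b q * p q)"]
    have "x \<in> L" using nz by (simp add: scf_def)
    then show False using x(2) by simp
  qed
  have c3: "(\<Sum>j\<in>A. a j * (p (u j) * (p (v j) * p (w j)))) = 0"
    if A: "finite (A::nat set)" "u ` A \<subseteq> I" "v ` A \<subseteq> I" "w ` A \<subseteq> I"
      "(\<Sum>j\<in>A. scf (a j) (X (u j) * (X (v j) * X (w j)))) = 0" for A a u v w
  proof (rule ccontr)
    let ?s = "\<Sum>j\<in>A. a j * (p (u j) * (p (v j) * p (w j)))"
    assume nz: "?s \<noteq> 0"
    have tri: "X q1 * (X q2 * X q3) - scf (p q1 * (p q2 * p q3)) (x ^ 3) \<in> J L 3"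
      if q: "q1 \<in> I" "q2 \<in> I" "q3 \<in> I" for q1 q2 q3
    proof -
      have "1 - scf 1 (x ^ 0) \<in> J L 0" by (simp add: scf_def fun_eq_iff)
      from step[OF q(1) step[OF q(2) step[OF q(3) this]]] show ?thesis
        by (simp only: mult_1_right numeral_3_eq_3)
    qed
    have "(\<Sum>j\<in>A. scf (a j) (X (u j) * (X (v j) * X (w j)) - scf (p (u j) * (p (v j) * p (w j))) (x ^ 3))) \<in> J L 3"
      using A by (intro fs.subspace_sum[OF subspace_J] fs.subspace_scale[OF subspace_J] tri) auto
    also have "(\<Sum>j\<in>A. scf (a j) (X (u j) * (X (v j) * X (w j)) - scf (p (u j) * (p (v j) * p (w j))) (x ^ 3)))
       = (\<Sum>j\<in>A. scf (a j) (X (u j) * (X (v j) * X (w j)))) - scf ?s (x ^ 3)"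
      by (simp add: fun_eq_iff sum_fun_apply right_diff_distrib sum_subtractf sum_distrib_right mult.assoc)
    finally have "- scf ?s (x ^ 3) \<in> J L 3" unfolding A(5) by (simp only: diff_0)
    from fs.subspace_scale[OF subspace_J this, of "- 1 / ?s"] have "scf (-1 / ?s) (- scf ?s (x ^ 3)) \<in> J L 3" .
    also have "scf (-1 / ?s) (- scf ?s (x ^ 3)) = x ^ 3" using nz by (simp add: fun_eq_iff)
    finally show False using xJ by blast
  qed
  show ?thesis
  proof (intro exI[of _ p] conjI allI impI)
    show "\<exists>q\<in>I. p q \<noteq> 0" by (rule c1)
    show "(\<Sum>q\<in>I. b q * p q) = 0" if "(\<Sum>q\<in>I. scf (b q) (X q)) \<in> L0" for b using that by (rule c2)
  qed (rule c3, blast+)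
qed


text \<open>From degree \<open>T\<close> on, every element is a combination of monomials of degree
  \<open>s\<close> in the \<open>l i\<close> with coefficients from a spanning set of
  \<open>R T\<close>, so counting these monomials bounds the dimension.\<close>

lemma growth_bound:
  assumes l: "\<And>i. i < Suc M \<Longrightarrow> l i \<in> R 1" and ng: "\<not> good (l ` {..<Suc M})"
  shows "\<exists>G T. \<forall>s. \<exists>F. finite F \<and> card F \<le> G * (s + 1) ^ M \<and> R (T + s) \<subseteq> fs.span F"
proof -
  let ?L = "l ` {..<Suc M}"
  have LR: "?L \<subseteq> R 1" using l by blast
  obtain T where T: "J ?L T = R T" using ng unfolding good_def by blast
  obtain F0 where F0: "finite F0" "F0 \<subseteq> R T" "R T \<subseteq> fs.span F0" using R_finite_span by blast
  define A where "A s = {\<alpha> \<in> {..<Suc M} \<rightarrow>\<^sub>E {..s}. sum \<alpha> {..<Suc M} = s}" for s :: nat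
  define F where "F s = (\<lambda>(\<alpha>,f). (\<Prod>i<Suc M. l i ^ \<alpha> i) * f) ` (A s \<times> F0)" for s
  have finA: "finite (A s)" for s
    unfolding A_def by (rule finite_subset[OF _ finite_PiE[of "{..<Suc M}" "\<lambda>_. {..s}"]]) auto
  have cA: "card (A s) \<le> (s + 1) ^ M" for s
  proof -
    \<comment> \<open>The last exponent is determined by the others because the total degree is
      fixed; this lowers the exponent of the bound from \<open>M + 1\<close> to
      \<open>M\<close>.\<close>
    have "inj_on (\<lambda>\<alpha>. restrict \<alpha> {..<M}) (A s)"
    proof (rule inj_onI)
      fix \<alpha> \<beta> assume ab: "\<alpha> \<in> A s" "\<beta> \<in> A s" "restrict \<alpha> {..<M} = restrict \<beta> {..<M}"
      have eq: "\<alpha> i = \<beta> i" if "i < M" for i using fun_cong[OF ab(3), of i] that by simp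
      have "sum \<alpha> {..<M} = sum \<beta> {..<M}" using eq by simp
      then have "\<alpha> M = \<beta> M" using ab(1,2) unfolding A_def by simp
      then show "\<alpha> = \<beta>"
      proof (intro ext)
        fix i
        have "\<alpha> i = \<beta> i" if "\<not> i < Suc M"
        proof -
          have "\<alpha> \<in> {..<Suc M} \<rightarrow>\<^sub>E {..s}" "\<beta> \<in> {..<Suc M} \<rightarrow>\<^sub>E {..s}" using ab(1,2) unfolding A_def by blast+
          then have "\<alpha> i = undefined" "\<beta> i = undefined" using that by (simp_all only: PiE_iff extensional_def mem_Collect_eq lessThan_iff simp_thms)
          then show ?thesis by simp
        qed
        then show "\<alpha> i = \<beta> i" using eq \<open>\<alpha> M = \<beta> M\<close> less_Suc_eq by blast
      qed
    qed
    moreover have "(\<lambda>\<alpha>. restrict \<alpha> {..<M}) ` A s \<subseteq> {..<M} \<rightarrow>\<^sub>E {..s}"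
      unfolding A_def by (auto simp: PiE_def Pi_def)
    ultimately have "card (A s) \<le> card ({..<M} \<rightarrow>\<^sub>E {..s})"
      by (rule card_inj_on_le) (auto intro: finite_PiE)
    then show ?thesis by (simp add: card_PiE)
  qed
  have "card (F s) \<le> card F0 * (s + 1) ^ M" for s
  proof -
    have "card (F s) \<le> card (A s \<times> F0)" unfolding F_def using finA F0(1) by (intro card_image_le) auto
    also have "\<dots> = card F0 * card (A s)" by (simp add: card_cartesian_product)
    finally show ?thesis using cA[of s] by (meson le_trans mult_le_mono2)
  qed
  moreover have "finite (F s)" for s unfolding F_def using finA F0(1) by auto
  moreover have "R (T + s) \<subseteq> fs.span (F s)" for s
  proof (induction s)
    case 0
    have "F0 \<subseteq> F 0"
    proof
      fix f assume "f \<in> F0"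
      moreover have "(\<lambda>i\<in>{..<Suc M}. 0) \<in> A 0" unfolding A_def by auto
      moreover have "f = (\<Prod>i<Suc M. l i ^ (\<lambda>i\<in>{..<Suc M}. 0) i) * f"
        by (simp only: restrict_apply' power_0 prod.neutral_const mult_1_left cong: prod.cong)
      ultimately show "f \<in> F 0" unfolding F_def
        by (intro image_eqI[of _ _ "(\<lambda>i\<in>{..<Suc M}. 0, f)"]) (simp_all only: prod.case mem_Times_iff fst_conv snd_conv)
    qed
    from subset_trans[OF F0(3) fs.span_mono[OF this]] show ?case by (simp only: add_0_right)
  next
    case (Suc s)
    have "R (T + Suc s) = J ?L (Suc (T + s))"
      using J_eq_R_mono[OF LR T, of "Suc (T + s)"] by (simp only: add_Suc_right le_add1 le_SucI)
    moreover have "{g * f | g f. g \<in> ?L \<and> f \<in> R (T + s)} \<subseteq> fs.span (F (Suc s))"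
    proof
      fix a assume "a \<in> {g * f | g f. g \<in> ?L \<and> f \<in> R (T + s)}"
      then obtain i f where a: "a = l i * f" "i < Suc M" "f \<in> fs.span (F s)" using Suc.IH by blast
      show "a \<in> fs.span (F (Suc s))" unfolding a(1)
      proof (rule mult_span_in[OF fs.subspace_span _ a(3)])
        fix g assume "g \<in> F s"
        then obtain \<alpha> f where g: "g = (\<Prod>j<Suc M. l j ^ \<alpha> j) * f" "\<alpha> \<in> A s" "f \<in> F0" unfolding F_def by auto
        let ?\<alpha> = "\<alpha>(i := Suc (\<alpha> i))"
        have "?\<alpha> \<in> A (Suc s)"
        proof -
          have "sum ?\<alpha> {..<Suc M} = Suc (sum \<alpha> {..<Suc M})"
            using a(2) by (simp add: sum.remove[of "{..<Suc M}" i] del: sum.lessThan_Suc)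
          then show ?thesis using g(2) a(2) unfolding A_def
            by (auto simp: PiE_def Pi_def extensional_def le_SucI simp del: sum.lessThan_Suc)
        qed
        moreover have "l i * g = (\<Prod>j<Suc M. l j ^ ?\<alpha> j) * f"
        proof -
          have "(\<Prod>j<Suc M. l j ^ ?\<alpha> j) = l i ^ Suc (\<alpha> i) * (\<Prod>j\<in>{..<Suc M} - {i}. l j ^ \<alpha> j)"
            using a(2) by (simp only: prod.remove[of "{..<Suc M}" i] finite_lessThan lessThan_iff fun_upd_same) (intro arg_cong2[of _ _ _ _ "(*)"] refl prod.cong, auto)
          moreover have "(\<Prod>j<Suc M. l j ^ \<alpha> j) = l i ^ \<alpha> i * (\<Prod>j\<in>{..<Suc M} - {i}. l j ^ \<alpha> j)"
            using a(2) by (simp only: prod.remove[of "{..<Suc M}" i] finite_lessThan lessThan_iff)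
          ultimately show ?thesis unfolding g(1) by (simp only: power_Suc mult.assoc)
        qed
        ultimately have "l i * g \<in> F (Suc s)" unfolding F_def using g(3)
          by (intro image_eqI[of _ _ "(?\<alpha>, f)"]) (simp_all only: prod.case mem_Times_iff fst_conv snd_conv)
        then show "l i * g \<in> fs.span (F (Suc s))" by (rule fs.span_base)
      qed
    qed
    from fs.span_minimal[OF this fs.subspace_span] have "J ?L (Suc (T + s)) \<subseteq> fs.span (F (Suc s))"
      by (simp only: J.simps)
    ultimately show ?case by (simp only:)
  qed
  ultimately show ?thesis by blast
qed

text \<open>
  If \<open>M + 1\<close> linear forms generated everything in high degrees, the dimension of \<open>R t\<close> would grow like
  \<open>t ^ M\<close>, whereas the monomials in \<open>M + 1\<close> independent functions make it grow like \<open>t ^ (M + 1)\<close>.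
\<close>

lemma good_of_independent_monomials:
  assumes l: "\<And>i. i < Suc M \<Longrightarrow> l i \<in> R 1" and D: "finite D" "card D = Suc M"
    and f: "\<And>m t \<beta>. \<beta> \<in> D \<rightarrow>\<^sub>E {..m} \<Longrightarrow> f \<beta> \<in> R (t + Suc M * m)"
    and ind: "\<And>m. inj_on f (D \<rightarrow>\<^sub>E {..m}) \<and> fs.independent (f ` (D \<rightarrow>\<^sub>E {..m}))"
  shows "good (l ` {..<Suc M})"
proof (rule ccontr)
  assume "\<not> ?thesis"
  from growth_bound[OF l this] obtain G T where
    GT: "\<And>s. \<exists>F. finite F \<and> card F \<le> G * (s + 1) ^ M \<and> R (T + s) \<subseteq> fs.span F" by metis
  \<comment> \<open>Chosen so that the two counts would give
    \<open>(m + 1) ^ Suc M \<le> m * (m + 1) ^ M\<close>.\<close>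
  define m where "m = G * Suc M ^ M"
  obtain F where F: "finite F" "card F \<le> G * (Suc M * m + 1) ^ M" "R (T + Suc M * m) \<subseteq> fs.span F"
    using GT by blast
  have "f ` (D \<rightarrow>\<^sub>E {..m}) \<subseteq> fs.span F" using f F(3) by blast
  then have "card (f ` (D \<rightarrow>\<^sub>E {..m})) \<le> card F"
    using fs.independent_span_bound[OF F(1)] ind by blast
  moreover have "card (f ` (D \<rightarrow>\<^sub>E {..m})) = (m + 1) ^ Suc M"
    using ind D by (simp add: card_image card_PiE)
  ultimately have "(m + 1) ^ Suc M \<le> G * (Suc M * m + 1) ^ M" using F(2) by simp
  also have "\<dots> \<le> G * (Suc M * (m + 1)) ^ M" by (intro mult_le_mono2 power_mono) auto
  also have "\<dots> = m * (m + 1) ^ M" unfolding m_def power_mult_distrib by simp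
  finally show False by simp
qed

end

subsection \<open>Matrices of rank at most two\<close>

lemma power_sum_zero_imp_coeffs_zero:
  fixes y :: "nat \<Rightarrow> 'k::field"
  assumes "inj y" "\<And>n. (\<Sum>e\<le>m. b e * y n ^ e) = 0" "e \<le> m"
  shows "b e = 0"
proof -
  define p where "p = (\<Sum>e\<le>m. monom (b e) e)"
  have "poly p (y n) = 0" for n using assms(2)[of n] by (simp add: p_def poly_sum poly_monom)
  then have "range y \<subseteq> {x. poly p x = 0}" by auto
  moreover have "infinite (range y)" using assms(1) by (simp add: finite_image_iff)
  ultimately have "p = 0" using poly_roots_finite[of p] finite_subset by blast
  then have "coeff p e = 0" by simp
  then show ?thesis using assms(3) by (simp add: p_def coeff_sum coeff_monom)
qed

text \<open>One variable at a time: with the other grid indices fixed, the sum is a polynomial in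
  \<open>y q n\<close> with infinitely many zeros, and its coefficients are the same kind of sum
  over the remaining exponents.\<close>

lemma grid_monomials_zero_imp_coeffs_zero:
  fixes y :: "'q \<Rightarrow> nat \<Rightarrow> 'k::field"
  assumes "finite D" "\<And>q. q \<in> D \<Longrightarrow> inj (y q)"
    "\<And>\<rho>. (\<Sum>\<beta>\<in>D \<rightarrow>\<^sub>E {..m}. c \<beta> * (\<Prod>q\<in>D. y q (\<rho> q) ^ \<beta> q)) = 0" "\<beta> \<in> D \<rightarrow>\<^sub>E {..m}"
  shows "c \<beta> = 0"
  using assms
proof (induction D arbitrary: c \<beta> rule: finite_induct)
  case empty
  then show ?case by simp
next
  case (insert q D)
  have bij: "bij_betw (\<lambda>(e,g). g(q := e)) ({..m} \<times> (D \<rightarrow>\<^sub>E {..m})) (insert q D \<rightarrow>\<^sub>E {..m})"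
    unfolding bij_betw_def
  proof
    show "inj_on (\<lambda>(e, g). g(q := e)) ({..m} \<times> (D \<rightarrow>\<^sub>E {..m}))"
    proof (rule inj_onI, clarify)
      fix e g e' g' assume g: "g \<in> D \<rightarrow>\<^sub>E {..m}" "g' \<in> D \<rightarrow>\<^sub>E {..m}" "g(q := e) = g'(q := (e'::nat))"
      have "e = e'" using fun_cong[OF g(3), of q] by simp
      moreover have "g = g'"
      proof
        fix x show "g x = g' x" using fun_cong[OF g(3), of x] g(1,2) insert.hyps(2)
          by (cases "x = q") (auto simp: PiE_def extensional_def)
      qed
      ultimately show "e = e' \<and> g = g'" by simp
    qed
    show "(\<lambda>(e, g). g(q := e)) ` ({..m} \<times> (D \<rightarrow>\<^sub>E {..m})) = insert q D \<rightarrow>\<^sub>E {..m}"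
      by (simp add: PiE_insert_eq)
  qed
  have key: "(\<Sum>g\<in>D \<rightarrow>\<^sub>E {..m}. c (g(q := e)) * (\<Prod>r\<in>D. y r (\<rho> r) ^ g r)) = 0" if "e \<le> m" for e \<rho>
  proof (rule power_sum_zero_imp_coeffs_zero[OF insert.prems(1)[of q] _ that])
    fix n
    have "0 = (\<Sum>\<beta>\<in>insert q D \<rightarrow>\<^sub>E {..m}. c \<beta> * (\<Prod>r\<in>insert q D. y r ((\<rho>(q := n)) r) ^ \<beta> r))"
      using insert.prems(2)[of "\<rho>(q := n)"] by simp
    also have "\<dots> = (\<Sum>(e,g)\<in>{..m} \<times> (D \<rightarrow>\<^sub>E {..m}). c (g(q := e)) * (\<Prod>r\<in>insert q D. y r ((\<rho>(q := n)) r) ^ (g(q := e)) r))"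
      by (subst sum.reindex_bij_betw[OF bij, symmetric]) (simp add: case_prod_unfold)
    also have "\<dots> = (\<Sum>(e,g)\<in>{..m} \<times> (D \<rightarrow>\<^sub>E {..m}). c (g(q := e)) * (\<Prod>r\<in>D. y r (\<rho> r) ^ g r) * y q n ^ e)"
    proof (rule sum.cong[OF refl], clarify)
      fix e g
      have "(\<Prod>r\<in>D. y r ((\<rho>(q := n)) r) ^ (g(q := e)) r) = (\<Prod>r\<in>D. y r (\<rho> r) ^ g r)"
        using insert.hyps(2) by (intro prod.cong) auto
      then show "c (g(q := e)) * (\<Prod>r\<in>insert q D. y r ((\<rho>(q := n)) r) ^ (g(q := e)) r) =
        c (g(q := e)) * (\<Prod>r\<in>D. y r (\<rho> r) ^ g r) * y q n ^ e"
        using insert.hyps by simp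
    qed
    also have "\<dots> = (\<Sum>e\<le>m. (\<Sum>g\<in>D \<rightarrow>\<^sub>E {..m}. c (g(q := e)) * (\<Prod>r\<in>D. y r (\<rho> r) ^ g r)) * y q n ^ e)"
      by (simp add: sum.cartesian_product[symmetric] sum_distrib_right)
    finally show "(\<Sum>e\<le>m. (\<Sum>g\<in>D \<rightarrow>\<^sub>E {..m}. c (g(q := e)) * (\<Prod>r\<in>D. y r (\<rho> r) ^ g r)) * y q n ^ e) = 0" by simp
  qed simp
  have "\<beta> \<in> (\<lambda>(e,g). g(q := e)) ` ({..m} \<times> (D \<rightarrow>\<^sub>E {..m}))"
    using insert.prems(3) bij unfolding bij_betw_def by simp
  then obtain e g where b: "\<beta> = g(q := e)" "e \<le> m" "g \<in> D \<rightarrow>\<^sub>E {..m}" by auto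
  have "c (g(q := e)) = 0"
    by (rule insert.IH[of "\<lambda>g. c (g(q := e))", OF _ key[OF b(2)] b(3)]) (use insert.prems(1) in auto)
  then show ?case unfolding b(1) .
qed

text \<open>The 3 x 3 determinant with rows \<open>i, j, k\<close> and columns
  \<open>u, v, w\<close>. The products are nested to the right to match the cubic relations in
  \<open>section_point\<close>.\<close>

definition minor3 :: "(nat \<times> nat \<Rightarrow> 'k::comm_ring_1) \<Rightarrow> nat \<Rightarrow> nat \<Rightarrow> nat \<Rightarrow> nat \<Rightarrow> nat \<Rightarrow> nat \<Rightarrow> 'k" where
  "minor3 p i j k u v w =
     p (i,u) * (p (j,v) * p (k,w)) + p (i,v) * (p (j,w) * p (k,u)) + p (i,w) * (p (j,u) * p (k,v))
   - p (i,u) * (p (j,w) * p (k,v)) - p (i,v) * (p (j,u) * p (k,w)) - p (i,w) * (p (j,v) * p (k,u))"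

lemma minor3_rank_two:
  fixes f g f' g' :: "nat \<Rightarrow> 'k::comm_ring_1"
  shows "minor3 (\<lambda>(i,k). f i * g k + f' i * g' k) i j k u v w = 0"
  unfolding minor3_def prod.case by (simp add: algebra_simps)

text \<open>
  A generic matrix of rank \<open>2\<close> is determined by its first two rows and columns. Here these entries run
  through a grid; the entry \<open>(1,1)\<close> is even and the entries \<open>(0,1)\<close> and \<open>(1,0)\<close> are odd, so that the
  leading minor \<open>\<Delta>\<close> never vanishes.
\<close>

lemma exists_rank_two_point:
  fixes b :: "nat \<Rightarrow> nat \<times> nat \<Rightarrow> 'k::{alg_closed_field, field_char_0}"
  assumes a: "a \<ge> 2" "d \<ge> 2" and N: "N < 2 * a + 2 * d - 4"
  shows "\<exists>p. (\<exists>q\<in>{..<a} \<times> {..<d}. p q \<noteq> 0) \<and> (\<forall>l<N. (\<Sum>q\<in>{..<a} \<times> {..<d}. b l q * p q) = 0) \<and>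
     (\<forall>i<a. \<forall>j<a. \<forall>k<a. \<forall>u<d. \<forall>v<d. \<forall>w<d. minor3 p i j k u v w = 0)"
proof -
  define I where "I = {..<a} \<times> {..<d}"
  define y :: "nat \<times> nat \<Rightarrow> nat \<Rightarrow> 'k" where
    "y q n = (if q = (0,0) then 1 else if q = (1,1) then of_nat (2 * n) else of_nat (2 * n + 1))" for q n
  define \<Delta> where "\<Delta> \<rho> = y (1,1) (\<rho> (1,1)) - y (0,1) (\<rho> (0,1)) * y (1,0) (\<rho> (1,0))" for \<rho> :: "nat \<times> nat \<Rightarrow> nat"
  define r where "r \<rho> i k = y (i,k) (\<rho> (i,k))" for \<rho> :: "nat \<times> nat \<Rightarrow> nat" and i k
  \<comment> \<open>\<open>P0\<close> and \<open>P1\<close> are the coefficients of row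
    \<open>i\<close> in terms of rows 0 and 1, found by Cramer's rule from the first two columns.
    All other entries of the matrix \<open>X\<close> of rank two are then forced.\<close>
  define P0 where "P0 \<rho> i = (if i = 0 then 1 else if i = 1 then 0 else (r \<rho> i 0 * r \<rho> 1 1 - r \<rho> i 1 * r \<rho> 1 0) / \<Delta> \<rho>)" for \<rho> :: "nat \<times> nat \<Rightarrow> nat" and i :: nat
  define P1 where "P1 \<rho> i = (if i = 0 then 0 else if i = 1 then 1 else (r \<rho> i 1 - r \<rho> i 0 * r \<rho> 0 1) / \<Delta> \<rho>)" for \<rho> :: "nat \<times> nat \<Rightarrow> nat" and i :: nat
  define X where "X q \<rho> = P0 \<rho> (fst q) * r \<rho> 0 (snd q) + P1 \<rho> (fst q) * r \<rho> 1 (snd q)" for q :: "nat \<times> nat" and \<rho> :: "nat \<times> nat \<Rightarrow> nat"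
  have \<Delta>: "\<Delta> \<rho> \<noteq> 0" for \<rho>
  proof
    assume "\<Delta> \<rho> = 0"
    then have "(of_nat (2 * \<rho> (1,1)) :: 'k) = of_nat ((2 * \<rho> (0,1) + 1) * (2 * \<rho> (1,0) + 1))"
      unfolding \<Delta>_def y_def by (simp add: algebra_simps)
    then have "2 * \<rho> (1,1) = (2 * \<rho> (0,1) + 1) * (2 * \<rho> (1,0) + 1)" unfolding of_nat_eq_iff .
    moreover have "odd ((2 * \<rho> (0,1) + 1) * (2 * \<rho> (1,0) + 1))" by simp
    ultimately show False by (metis dvd_triv_left)
  qed
  have r00: "r \<rho> 0 0 = 1" for \<rho> by (simp add: r_def y_def)
  have \<Delta>r: "\<Delta> \<rho> = r \<rho> 1 1 - r \<rho> 0 1 * r \<rho> 1 0" for \<rho> unfolding \<Delta>_def r_def by simp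
  have Xr: "X (i,k) \<rho> = r \<rho> i k" if "i < 2 \<or> k < 2" for i k \<rho>
  proof (cases "i < 2")
    case True
    then have "i = 0 \<or> i = 1" by auto
    then show ?thesis by (auto simp: X_def P0_def P1_def)
  next
    case False
    then have k: "k = 0 \<or> k = 1" using that by auto
    have "X (i,k) \<rho> * \<Delta> \<rho> = (r \<rho> i 0 * r \<rho> 1 1 - r \<rho> i 1 * r \<rho> 1 0) * r \<rho> 0 k + (r \<rho> i 1 - r \<rho> i 0 * r \<rho> 0 1) * r \<rho> 1 k"
      using False \<Delta>[of \<rho>] unfolding X_def P0_def P1_def by (simp add: field_simps)
    also have "\<dots> = r \<rho> i k * \<Delta> \<rho>"
      using k r00[of \<rho>] unfolding \<Delta>r by (auto simp: algebra_simps)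
    finally show ?thesis using \<Delta>[of \<rho>] by simp
  qed
  interpret coord_functions I X by unfold_locales (simp add: I_def)
  \<comment> \<open>The free entries; \<open>(0,0)\<close> is left out, being normalised to 1. Their
    number \<open>2 * a + 2 * d - 5\<close> is the dimension of the projective variety of matrices
    of rank at most two.\<close>
  define D where "D = {q \<in> I. fst q < 2 \<or> snd q < 2} - {(0,0)}"
  have finD: "finite D" unfolding D_def I_def by auto
  have cD: "card D = 2 * a + 2 * d - 5"
  proof -
    have e: "{q \<in> I. fst q < 2 \<or> snd q < 2} = {..<2} \<times> {..<d} \<union> {2..<a} \<times> {..<2}"
      unfolding I_def using a by (auto simp: not_less)
    have "card ({..<2} \<times> {..<d} \<union> {2..<a} \<times> {..<2::nat}) = 2 * d + (a - 2) * 2"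
      by (subst card_Un_disjoint) (auto simp: card_cartesian_product)
    moreover have "(0,0) \<in> {..<2} \<times> {..<d} \<union> {2..<a} \<times> {..<2}" using a by auto
    ultimately show ?thesis unfolding D_def e using a by (subst card_Diff_singleton) auto
  qed
  define M where "M = 2 * a + 2 * d - 6"
  have cD': "card D = Suc M" unfolding cD M_def using a by simp
  define f where "f \<beta> = (\<lambda>\<rho>. \<Prod>q\<in>D. X q \<rho> ^ \<beta> q)" for \<beta> :: "nat \<times> nat \<Rightarrow> nat"
  have injy: "inj (y q)" if "q \<noteq> (0,0)" for q
    using that by (auto simp: y_def inj_on_def)
  have fy: "f \<beta> \<rho> = (\<Prod>q\<in>D. y q (\<rho> q) ^ \<beta> q)" for \<beta> \<rho>
    unfolding f_def
  proof (rule prod.cong[OF refl])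
    fix q assume "q \<in> D"
    then show "X q \<rho> ^ \<beta> q = y q (\<rho> q) ^ \<beta> q" using Xr[of "fst q" "snd q" \<rho>] unfolding D_def r_def by auto
  qed
  have zero: "c \<beta> = 0" if "\<And>\<rho>. (\<Sum>\<beta>\<in>D \<rightarrow>\<^sub>E {..m}. c \<beta> * f \<beta> \<rho>) = 0" "\<beta> \<in> D \<rightarrow>\<^sub>E {..m}" for c m \<beta>
    by (rule grid_monomials_zero_imp_coeffs_zero[OF finD _ that(1)[unfolded fy] that(2)])
      (rule injy, auto simp: D_def)
  have finE: "finite (D \<rightarrow>\<^sub>E {..m})" for m :: nat using finD by (intro finite_PiE) auto
  have injf: "inj_on f (D \<rightarrow>\<^sub>E {..m})" for m
  proof (rule inj_onI, rule ccontr)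
    fix \<beta> \<gamma> assume bg: "\<beta> \<in> D \<rightarrow>\<^sub>E {..m}" "\<gamma> \<in> D \<rightarrow>\<^sub>E {..m}" "f \<beta> = f \<gamma>" "\<beta> \<noteq> \<gamma>"
    have "(\<Sum>\<alpha>\<in>D \<rightarrow>\<^sub>E {..m}. ((if \<alpha> = \<beta> then 1 else 0) - (if \<alpha> = \<gamma> then 1 else 0)) * f \<alpha> \<rho>) = 0" for \<rho>
      using bg finE[of m] by (simp add: left_diff_distrib sum_subtractf if_distrib[of "\<lambda>x. x * _"] cong: if_cong)
    from zero[OF this bg(1)] bg(4) show False by simp
  qed
  have indf: "fs.independent (f ` (D \<rightarrow>\<^sub>E {..m}))" for m
  proof (rule ccontr)
    assume "\<not> ?thesis"
    then obtain u where u: "\<exists>v\<in>f ` (D \<rightarrow>\<^sub>E {..m}). u v \<noteq> 0" "(\<Sum>v\<in>f ` (D \<rightarrow>\<^sub>E {..m}). scf (u v) v) = 0"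
      using fs.dependent_finite[of "f ` (D \<rightarrow>\<^sub>E {..m})"] finE by blast
    have "(\<Sum>\<beta>\<in>D \<rightarrow>\<^sub>E {..m}. u (f \<beta>) * f \<beta> \<rho>) = 0" for \<rho>
    proof -
      have "(\<Sum>\<beta>\<in>D \<rightarrow>\<^sub>E {..m}. scf (u (f \<beta>)) (f \<beta>)) = 0"
        using u(2) injf[of m] by (simp add: sum.reindex)
      from fun_cong[OF this, of \<rho>] show ?thesis by (simp add: sum_fun_apply)
    qed
    from zero[OF this] u(1) show False by blast
  qed
  \<comment> \<open>The coordinate \<open>X (0,0)\<close> is the constant function 1, so the graded
    pieces, taken as sets of functions, increase. Monomials of smaller degree may thus be counted in
    a later piece.\<close>
  have R_mono: "t \<le> t' \<Longrightarrow> R t \<subseteq> R t'" for t t'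
  proof (induction t' rule: dec_induct)
    case (step t')
    have X00: "X (0,0) * g = g" for g using Xr[of 0 0] r00 by (auto simp: fun_eq_iff)
    show ?case
    proof
      fix g assume "g \<in> R t"
      then have "g \<in> R t'" using step.IH by blast
      from R_SucI[OF _ this, of "(0,0)"] show "g \<in> R (Suc t')" using a unfolding I_def X00 by auto
    qed
  qed simp
  have Xpow: "X q ^ e * g \<in> R (t + e)" if "q \<in> I" "g \<in> R t" for q e g t
  proof (induction e)
    case (Suc e)
    from R_SucI[OF that(1) Suc] show ?case by (simp only: power_Suc mult.assoc add_Suc_right)
  qed (use that in \<open>simp only: power_0 mult_1_left add_0_right\<close>)
  have prodR: "(\<Prod>q\<in>D'. X q ^ \<beta> q) \<in> R (\<Sum>q\<in>D'. \<beta> q)" if "finite D'" "D' \<subseteq> I" for D' \<beta>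
    using that
  proof (induction D' rule: finite_induct)
    case empty
    then show ?case using one_in_R0 by (simp only: prod.empty sum.empty)
  next
    case (insert q D')
    then have "X q ^ \<beta> q * (\<Prod>q\<in>D'. X q ^ \<beta> q) \<in> R (sum \<beta> D' + \<beta> q)" by (intro Xpow) auto
    then show ?case unfolding prod.insert[OF insert.hyps] sum.insert[OF insert.hyps] add.commute[of "\<beta> q"] .
  qed
  have fR: "f \<beta> \<in> R (t + Suc M * m)" if "\<beta> \<in> D \<rightarrow>\<^sub>E {..m}" for \<beta> m t
  proof -
    have pow: "(X q ^ e) \<rho> = X q \<rho> ^ e" for q e \<rho>
      by (induction e) (simp_all only: power_0 power_Suc one_fun_apply times_fun_apply)
    have "(\<Prod>q\<in>D'. X q ^ \<beta> q) \<rho> = (\<Prod>q\<in>D'. X q \<rho> ^ \<beta> q)" for D' \<rho>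
      by (induction D' rule: infinite_finite_induct) (simp_all only: prod.infinite prod.empty prod.insert one_fun_apply times_fun_apply pow simp_thms)
    then have "f \<beta> = (\<Prod>q\<in>D. X q ^ \<beta> q)" unfolding f_def by (intro ext) simp
    moreover have "(\<Prod>q\<in>D. X q ^ \<beta> q) \<in> R (\<Sum>q\<in>D. \<beta> q)" by (rule prodR[OF finD]) (auto simp: D_def)
    moreover have "(\<Sum>q\<in>D. \<beta> q) \<le> t + Suc M * m"
    proof -
      have "(\<Sum>q\<in>D. \<beta> q) \<le> card D * m" using that by (intro sum_bounded_above[of D \<beta> m, simplified]) auto
      then show ?thesis unfolding cD' by simp
    qed
    ultimately show ?thesis using R_mono by auto
  qed
  \<comment> \<open>There may be fewer than \<open>Suc M\<close> forms; the list is filled up with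
    zeros.\<close>
  define l where "l i = (if i < N then (\<Sum>q\<in>I. scf (b i q) (X q)) else 0)" for i
  have lR: "l i \<in> R 1" for i
  proof (cases "i < N")
    case True
    then show ?thesis unfolding l_def if_P[OF True]
      by (intro fs.subspace_sum[OF subspace_R] fs.subspace_scale[OF subspace_R] X_in_R1)
  next
    case False
    show ?thesis unfolding l_def if_not_P[OF False] by (rule fs.subspace_0[OF subspace_R])
  qed
  have gl: "good (l ` {..<Suc M})"
    by (rule good_of_independent_monomials[OF lR finD cD' fR]) (use injf indf in auto)
  have LR: "l ` {..<Suc M} \<subseteq> R 1" using lR by blast
  obtain p where pp: "(\<exists>q\<in>I. p q \<noteq> 0) \<and> (\<forall>b. (\<Sum>q\<in>I. scf (b q) (X q)) \<in> l ` {..<Suc M} \<longrightarrow> (\<Sum>q\<in>I. b q * p q) = 0) \<and>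
    (\<forall>A a u v w. finite (A::nat set) \<and> u ` A \<subseteq> I \<and> v ` A \<subseteq> I \<and> w ` A \<subseteq> I \<and>
        (\<Sum>j\<in>A. scf (a j) (X (u j) * (X (v j) * X (w j)))) = 0 \<longrightarrow>
        (\<Sum>j\<in>A. a j * (p (u j) * (p (v j) * p (w j)))) = 0)"
    using section_point[OF LR gl] by (elim exE)
  note p = conjunct1[OF pp] conjunct1[OF conjunct2[OF pp], rule_format]
    conjunct2[OF conjunct2[OF pp], rule_format]
  have "(\<Sum>q\<in>I. b i q * p q) = 0" if "i < N" for i
    by (rule p(2)) (use that N in \<open>auto simp: l_def M_def intro!: image_eqI[of _ _ i]\<close>)
  moreover have "minor3 p i j k u v w = 0" if "i < a" "j < a" "k < a" "u < d" "v < d" "w < d" for i j k u v w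
  proof -
    \<comment> \<open>The six terms of the Leibniz expansion, listed as a relation between cubic
      monomials in the coordinates, so that \<open>section_point\<close> carries it over to
      \<open>p\<close>.\<close>
    define c :: "nat \<Rightarrow> 'k" where "c n = [1,1,1,-1,-1,-1] ! n" for n
    define f1 where "f1 n = [(i,u),(i,v),(i,w),(i,u),(i,v),(i,w)] ! n" for n
    define f2 where "f2 n = [(j,v),(j,w),(j,u),(j,w),(j,u),(j,v)] ! n" for n
    define f3 where "f3 n = [(k,w),(k,u),(k,v),(k,v),(k,w),(k,u)] ! n" for n
    have six: "{..<6::nat} = {0,1,2,3,4,5}" by auto
    have exp: "(\<Sum>n<6. c n * (g (f1 n) * (g (f2 n) * g (f3 n)))) = minor3 g i j k u v w" for g :: "nat \<times> nat \<Rightarrow> 'k"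
      unfolding six c_def f1_def f2_def f3_def minor3_def by (simp add: numeral_2_eq_2 numeral_3_eq_3 eval_nat_numeral)
    have "(\<Sum>n<6. scf (c n) (X (f1 n) * (X (f2 n) * X (f3 n)))) = 0"
    proof
      fix \<rho>
      have "(\<Sum>n<6. c n * (X (f1 n) \<rho> * (X (f2 n) \<rho> * X (f3 n) \<rho>))) = minor3 (\<lambda>q. X q \<rho>) i j k u v w"
        using exp[of "\<lambda>q. X q \<rho>"] .
      also have "\<dots> = minor3 (\<lambda>(i,k). P0 \<rho> i * r \<rho> 0 k + P1 \<rho> i * r \<rho> 1 k) i j k u v w"
        unfolding minor3_def X_def by simp
      also have "\<dots> = 0" by (rule minor3_rank_two)
      finally show "(\<Sum>n<6. scf (c n) (X (f1 n) * (X (f2 n) * X (f3 n)))) \<rho> = 0 \<rho>" by (simp add: sum_fun_apply)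
    qed
    moreover have "f1 ` {..<6} \<subseteq> I" "f2 ` {..<6} \<subseteq> I" "f3 ` {..<6} \<subseteq> I"
      unfolding six f1_def f2_def f3_def I_def using that by (auto simp: eval_nat_numeral)
    ultimately have "(\<Sum>n<6. c n * (p (f1 n) * (p (f2 n) * p (f3 n)))) = 0" by (intro p(3)) auto
    then show ?thesis unfolding exp .
  qed
  ultimately show ?thesis using p(1) unfolding I_def by blast
qed

text \<open>If some 2 x 2 minor is nonzero, its two columns serve as \<open>u\<close> and
  \<open>w\<close>, and the vanishing 3 x 3 minors express all other columns through them. In rank
  one, \<open>w\<close> is a unit vector with \<open>h = 0\<close>: the line condition speaks only
  of independent pairs, so \<open>u\<close> and \<open>w\<close> have to be independent in this case
  too.\<close>

lemma rank_le_two_decomposition: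
  fixes p :: "nat \<times> nat \<Rightarrow> 'k::field"
  assumes a: "a \<ge> 2" and nz: "i0 < a" "k0 < d" "p (i0,k0) \<noteq> 0"
    and min: "\<And>i j k u v w. i < a \<Longrightarrow> j < a \<Longrightarrow> k < a \<Longrightarrow> u < d \<Longrightarrow> v < d \<Longrightarrow> w < d \<Longrightarrow> minor3 p i j k u v w = 0"
  shows "\<exists>u w g h. (\<forall>i<a. \<forall>k<d. p (i,k) = u i * g k + w i * h k) \<and>
    (\<forall>s t. (\<forall>i<a. s * u i + t * w i = 0) \<longrightarrow> s = 0 \<and> t = 0)"
proof (cases "\<exists>i j k l. i < a \<and> j < a \<and> k < d \<and> l < d \<and> p (i,k) * p (j,l) - p (i,l) * p (j,k) \<noteq> 0")
  case True
  then obtain i j k l where ij: "i < a" "j < a" "k < d" "l < d" and D: "p (i,k) * p (j,l) - p (i,l) * p (j,k) \<noteq> 0" by blast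
  define D where "D = p (i,k) * p (j,l) - p (i,l) * p (j,k)"
  have D0: "D \<noteq> 0" using D D_def by simp
  show ?thesis
  proof (intro exI conjI allI impI)
    fix m n assume "m < a" "n < d"
    \<comment> \<open>Expansion of the minor along its row \<open>m\<close>.\<close>
    have "p (m,n) * D - (p (m,k) * (p (i,n) * p (j,l) - p (i,l) * p (j,n)) + p (m,l) * (p (i,k) * p (j,n) - p (i,n) * p (j,k)))
       = minor3 p i j m k l n"
      unfolding minor3_def D_def by (simp add: algebra_simps)
    also have "\<dots> = 0" using min[OF ij(1,2) \<open>m < a\<close> ij(3,4) \<open>n < d\<close>] .
    finally have "p (m,n) * D = p (m,k) * (p (i,n) * p (j,l) - p (i,l) * p (j,n)) + p (m,l) * (p (i,k) * p (j,n) - p (i,n) * p (j,k))"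
      by simp
    then show "p (m,n) = (\<lambda>m. p (m,k)) m * (\<lambda>n. (p (i,n) * p (j,l) - p (i,l) * p (j,n)) / D) n
        + (\<lambda>m. p (m,l)) m * (\<lambda>n. (p (i,k) * p (j,n) - p (i,n) * p (j,k)) / D) n"
      using D0 by (simp add: add_divide_distrib[symmetric] eq_divide_eq)
  next
    fix s t assume st: "\<forall>m<a. s * (\<lambda>m. p (m,k)) m + t * (\<lambda>m. p (m,l)) m = 0"
    have e: "s * p (i,k) + t * p (i,l) = 0" "s * p (j,k) + t * p (j,l) = 0" using st ij by auto
    have "s * D = (s * p (i,k) + t * p (i,l)) * p (j,l) - (s * p (j,k) + t * p (j,l)) * p (i,l)"
      "t * D = (s * p (j,k) + t * p (j,l)) * p (i,k) - (s * p (i,k) + t * p (i,l)) * p (j,k)"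
      unfolding D_def by (simp_all add: algebra_simps)
    then have "s * D = 0" "t * D = 0" unfolding e by simp_all
    then show "s = 0" "t = 0" using D0 by auto
  qed
next
  case False
  then have m2: "p (i,k) * p (j,l) = p (i,l) * p (j,k)" if "i < a" "j < a" "k < d" "l < d" for i j k l using that by auto
  \<comment> \<open>Any index other than \<open>i0\<close>: column \<open>k0\<close> does not vanish
    at \<open>i0\<close>, so it is independent of the unit vector at \<open>i1\<close>.\<close>
  define i1 where "i1 = (if i0 = 0 then 1 else 0::nat)"
  have i1: "i1 < a" "i1 \<noteq> i0" using a by (auto simp: i1_def)
  show ?thesis
  proof (intro exI conjI allI impI)
    fix i k assume "i < a" "k < d"
    then show "p (i,k) = (\<lambda>i. p (i,k0)) i * (\<lambda>k. p (i0,k) / p (i0,k0)) k + (\<lambda>i. if i = i1 then 1 else 0) i * (\<lambda>k. 0) k"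
      using m2[of i i0 k k0] nz by (simp add: field_simps)
  next
    fix s t assume st: "\<forall>i<a. s * (\<lambda>i. p (i,k0)) i + t * (\<lambda>i. if i = i1 then 1 else 0) i = 0"
    from st[rule_format, OF nz(1)] have "s = 0" using i1 nz by simp
    then show "s = 0" "t = 0" using st[rule_format, OF i1(1)] by auto
  qed
qed

section \<open>The condition on lines and the lower bound\<close>

definition ev :: "nat \<Rightarrow> (nat \<Rightarrow> nat \<Rightarrow> nat \<Rightarrow> 'k::field) \<Rightarrow> 'k vect \<Rightarrow> nat \<Rightarrow> nat \<Rightarrow> 'k" where
  "ev n \<Phi> v k l = (\<Sum>i<Suc n. \<Phi> k l i * v i)"

definition indep2 :: "nat \<Rightarrow> 'k::field vect \<Rightarrow> 'k vect \<Rightarrow> bool" where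
  "indep2 n u w \<longleftrightarrow> (\<forall>s t. (\<forall>i<Suc n. s * u i + t * w i = 0) \<longrightarrow> s = 0 \<and> t = 0)"

definition line_indep :: "nat \<Rightarrow> nat \<Rightarrow> nat \<Rightarrow> (nat \<Rightarrow> nat \<Rightarrow> nat \<Rightarrow> 'k::field) \<Rightarrow> bool" where
  "line_indep n c N \<Phi> \<longleftrightarrow> (\<forall>u w. indep2 n u w \<longrightarrow>
     (\<forall>g h. (\<forall>l<N. (\<Sum>k<c. g k * ev n \<Phi> u k l + h k * ev n \<Phi> w k l) = 0) \<longrightarrow> (\<forall>k<c. g k = 0 \<and> h k = 0)))"

lemma line_indep_lower_bound:
  fixes \<Phi> :: "nat \<Rightarrow> nat \<Rightarrow> nat \<Rightarrow> 'k::{alg_closed_field, field_char_0}"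
  assumes "n \<ge> 1" "c \<ge> 2" "line_indep n c N \<Phi>"
  shows "2 * c + 2 * (n - 1) \<le> N"
proof (rule ccontr)
  assume "\<not> ?thesis"
  then have N: "N < 2 * Suc n + 2 * c - 4" using assms(1) by simp
  have n2: "2 \<le> Suc n" using assms(1) by simp
  \<comment> \<open>Column \<open>l\<close> is read as a linear form on \<open>(n + 1) x c\<close>
    matrices, with coefficient \<open>\<Phi> k l i\<close> at the entry
    \<open>(i, k)\<close>.\<close>
  obtain p where pp: "(\<exists>q\<in>{..<Suc n} \<times> {..<c}. p q \<noteq> 0) \<and> (\<forall>l<N. (\<Sum>q\<in>{..<Suc n} \<times> {..<c}. (case q of (i,k) \<Rightarrow> \<Phi> k l i) * p q) = 0) \<and>
     (\<forall>i<Suc n. \<forall>j<Suc n. \<forall>k<Suc n. \<forall>u<c. \<forall>v<c. \<forall>w<c. minor3 p i j k u v w = 0)"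
    using exists_rank_two_point[OF n2 assms(2) N, of "\<lambda>l (i,k). \<Phi> k l i"] by (elim exE)
  then have p: "\<exists>q\<in>{..<Suc n} \<times> {..<c}. p q \<noteq> 0"
    "\<And>l. l < N \<Longrightarrow> (\<Sum>q\<in>{..<Suc n} \<times> {..<c}. (case q of (i,k) \<Rightarrow> \<Phi> k l i) * p q) = 0"
    "\<And>i j k u v w. i < Suc n \<Longrightarrow> j < Suc n \<Longrightarrow> k < Suc n \<Longrightarrow> u < c \<Longrightarrow> v < c \<Longrightarrow> w < c \<Longrightarrow> minor3 p i j k u v w = 0"
    by (simp_all only:)
  from p(1) obtain i0 k0 where nz: "i0 < Suc n" "k0 < c" "p (i0,k0) \<noteq> 0" by auto
  obtain u w g h where uwgh: "(\<forall>i<Suc n. \<forall>k<c. p (i,k) = u i * g k + w i * h k) \<and>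
    (\<forall>s t. (\<forall>i<Suc n. s * u i + t * w i = 0) \<longrightarrow> s = 0 \<and> t = 0)"
  proof -
    have "\<exists>u w g h. (\<forall>i<Suc n. \<forall>k<c. p (i,k) = u i * g k + w i * h k) \<and>
      (\<forall>s t. (\<forall>i<Suc n. s * u i + t * w i = 0) \<longrightarrow> s = 0 \<and> t = 0)"
      by (rule rank_le_two_decomposition[of "Suc n" i0 k0 c p, OF n2 nz]) (rule p(3))
    then show thesis using that by (elim exE)
  qed
  then have uw: "indep2 n u w" unfolding indep2_def by (rule conjunct2)
  have d: "p (i,k) = u i * g k + w i * h k" if "i < Suc n" "k < c" for i k
    using uwgh that by blast
  have "(\<Sum>k<c. g k * ev n \<Phi> u k l + h k * ev n \<Phi> w k l) = 0" if "l < N" for l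
  proof -
    have "(\<Sum>k<c. g k * ev n \<Phi> u k l + h k * ev n \<Phi> w k l) = (\<Sum>k<c. \<Sum>i<Suc n. \<Phi> k l i * p (i,k))"
      unfolding ev_def sum_distrib_left sum.distrib[symmetric] by (intro sum.cong refl) (simp add: d algebra_simps)
    also have "\<dots> = (\<Sum>i<Suc n. \<Sum>k<c. \<Phi> k l i * p (i,k))" by (rule sum.swap)
    also have "\<dots> = (\<Sum>q\<in>{..<Suc n} \<times> {..<c}. (case q of (i,k) \<Rightarrow> \<Phi> k l i) * p q)"
      unfolding sum.cartesian_product by (rule sum.cong) auto
    finally show ?thesis using p(2)[OF that] by simp
  qed
  then have "g k0 = 0 \<and> h k0 = 0" using assms(3) uw nz(2) unfolding line_indep_def by blast
  then show False using d[OF nz(1,2)] nz(3) by simp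
qed

subsection \<open>Linear forms attaining the bound\<close>

text \<open>The leading coefficients of the two products differ only by the factors
  \<open>degree W\<close> and \<open>degree U\<close>, which characteristic 0 tells apart.\<close>

lemma wronskian_zero_imp_same_degree:
  fixes U W :: "'k::field_char_0 poly"
  assumes "U * pderiv W = pderiv U * W" "U \<noteq> 0" "W \<noteq> 0"
  shows "degree U = degree W"
proof (cases "pderiv U = 0 \<or> pderiv W = 0")
  case True
  then have "pderiv U = 0 \<and> pderiv W = 0" using assms by auto
  then show ?thesis by (simp add: pderiv_eq_0_iff)
next
  case False
  have lc: "lead_coeff (pderiv p) = of_nat (degree p) * lead_coeff p" for p :: "'k poly"
    by (cases "degree p") (simp_all add: degree_pderiv coeff_pderiv coeff_eq_0)
  have "lead_coeff (U * pderiv W) = lead_coeff (pderiv U * W)" using assms(1) by simp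
  then have "(of_nat (degree W) :: 'k) = of_nat (degree U)"
    using assms(2,3) by (simp add: lead_coeff_mult lc)
  then show ?thesis by simp
qed

text \<open>Subtracting from \<open>W\<close> the multiple of \<open>U\<close> that removes its
  coefficient at \<open>degree U\<close> keeps the Wronskian zero. If nonzero, the difference would
  have degree \<open>degree U\<close> but no coefficient there.\<close>

lemma wronskian_zero_imp_dependent:
  fixes U W :: "'k::field_char_0 poly"
  assumes "U * pderiv W = pderiv U * W"
  shows "\<exists>s t. (s \<noteq> 0 \<or> t \<noteq> 0) \<and> Polynomial.smult s U + Polynomial.smult t W = 0"
proof (cases "U = 0")
  case True
  then show ?thesis by (intro exI[of _ 1] exI[of _ 0]) simp
next
  case U: False
  define V where "V = W - Polynomial.smult (coeff W (degree U) / lead_coeff U) U"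
  have "V = 0"
  proof (rule ccontr)
    assume V: "V \<noteq> 0"
    have "U * pderiv V = pderiv U * V"
      using assms unfolding V_def by (simp add: pderiv_diff pderiv_smult algebra_simps)
    then have "degree U = degree V" by (rule wronskian_zero_imp_same_degree[OF _ U V])
    moreover have "coeff V (degree U) = 0" using U unfolding V_def by simp
    ultimately show False using V by simp
  qed
  then show ?thesis unfolding V_def
    by (intro exI[of _ "- (coeff W (degree U) / lead_coeff U)"] exI[of _ 1]) simp
qed

lemma sum_lessThan_add: "(\<Sum>l<a + b. f l) = (\<Sum>l<a. f l) + (\<Sum>l<b. f (a + l) :: 'k::comm_monoid_add)" for a b :: nat
  by (induction b) (simp_all add: add.assoc)

lemma sum_shifted_delta:
  "(\<Sum>l<M. h l * (if a = l + 1 then b else 0)) = (if 0 < a \<and> a \<le> M then h (a - 1) * b else (0 :: 'k::field))" for a M :: nat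
proof (cases a)
  case (Suc a')
  then have "(\<Sum>l<M. h l * (if a = l + 1 then b else 0)) = (\<Sum>l<M. if a' = l then h l * b else 0)"
    by (intro sum.cong) auto
  then show ?thesis using Suc by (simp add: sum.delta')
qed simp

lemma coeff_mult_sum_monom:
  "coeff ((\<Sum>i<a. monom (x i) i) * (\<Sum>k<b. monom (y k) k)) s
    = (\<Sum>k<b. \<Sum>i<a. if i + k = s then x i * y k else (0::'k::field))" for a b :: nat
  by (simp add: sum_product mult_monom coeff_sum coeff_monom, subst sum.swap, simp)

text \<open>The equations are the coefficients of \<open>P u * Q g + P w * Q h = 0\<close> and of
  the same relation with \<open>x\<close> times the derivatives of \<open>P u\<close> and
  \<open>P w\<close>. As a linear system for \<open>Q g\<close> and \<open>Q h\<close> it has the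
  Wronskian as determinant.\<close>

lemma convolution_zero_imp_zero:
  fixes u w g h :: "nat \<Rightarrow> 'k::field_char_0"
  assumes uw: "indep2 n u w"
    and e1: "\<And>s. s < n + c \<Longrightarrow> (\<Sum>k<c. \<Sum>i<Suc n. if i + k = s then u i * g k + w i * h k else 0) = 0"
    and e2: "\<And>s. s < n + c \<Longrightarrow> (\<Sum>k<c. \<Sum>i<Suc n. if i + k = s then of_nat i * (u i * g k + w i * h k) else 0) = 0"
    and k: "k < c"
  shows "g k = 0 \<and> h k = 0"
proof -
  define P where "P x = (\<Sum>i<Suc n. monom (x i) i)" for x :: "nat \<Rightarrow> 'k"
  define Q where "Q x = (\<Sum>k<c. monom (x k) k)" for x :: "nat \<Rightarrow> 'k"
  have cP: "coeff (P x) i = (if i < Suc n then x i else 0)" for x i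
    unfolding P_def coeff_sum by (simp add: coeff_monom sum.delta' del: sum.lessThan_Suc)
  have cQ: "coeff (Q x) i = (if i < c then x i else 0)" for x i
    unfolding Q_def coeff_sum by (simp add: coeff_monom sum.delta')
  \<comment> \<open>Weighting coefficient \<open>i\<close> by \<open>i\<close> is the operator
    \<open>x d/dx\<close>; \<open>pCons 0\<close> is multiplication by \<open>x\<close>.\<close>
  have dP: "pCons 0 (pderiv (P x)) = P (\<lambda>i. of_nat i * x i)" for x
    by (rule poly_eqI) (simp add: coeff_pCons coeff_pderiv cP split: nat.split)
  have ext: "(\<Sum>k<c. \<Sum>i<Suc n. if i + k = s then f i k else 0) = (0::'k)" if "\<not> s < n + c" for s f
    using that by (intro sum.neutral ballI) auto
  have z: "P u * Q g + P w * Q h = 0"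
  proof (rule poly_eqI)
    fix s
    have "coeff (P u * Q g + P w * Q h) s = (\<Sum>k<c. \<Sum>i<Suc n. if i + k = s then u i * g k + w i * h k else 0)"
      unfolding coeff_add P_def Q_def coeff_mult_sum_monom sum.distrib[symmetric] by (intro sum.cong refl) auto
    then show "coeff (P u * Q g + P w * Q h) s = coeff 0 s" using e1[of s] ext[of s] by (cases "s < n + c") auto
  qed
  have z': "pCons 0 (pderiv (P u)) * Q g + pCons 0 (pderiv (P w)) * Q h = 0"
  proof (rule poly_eqI)
    fix s
    have "coeff (P (\<lambda>i. of_nat i * u i) * Q g + P (\<lambda>i. of_nat i * w i) * Q h) s
       = (\<Sum>k<c. \<Sum>i<Suc n. if i + k = s then of_nat i * (u i * g k + w i * h k) else 0)"
      unfolding coeff_add P_def Q_def coeff_mult_sum_monom sum.distrib[symmetric]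
      by (intro sum.cong refl) (auto simp: algebra_simps)
    then show "coeff (pCons 0 (pderiv (P u)) * Q g + pCons 0 (pderiv (P w)) * Q h) s = coeff 0 s"
      unfolding dP using e2[of s] ext[of s] by (cases "s < n + c") auto
  qed
  then have z'': "pderiv (P u) * Q g + pderiv (P w) * Q h = 0" by simp
  have nz: "P u * pderiv (P w) - pderiv (P u) * P w \<noteq> 0"
  proof
    assume "P u * pderiv (P w) - pderiv (P u) * P w = 0"
    then obtain s t where st: "s \<noteq> 0 \<or> t \<noteq> 0" "Polynomial.smult s (P u) + Polynomial.smult t (P w) = 0"
      using wronskian_zero_imp_dependent[of "P u" "P w"] by auto
    have "s * u i + t * w i = 0" if "i < Suc n" for i
      using arg_cong[OF st(2), of "\<lambda>p. coeff p i"] that by (simp add: cP)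
    then show False using uw st(1) unfolding indep2_def by blast
  qed
  have "(P u * pderiv (P w) - pderiv (P u) * P w) * Q g =
      (P u * Q g + P w * Q h) * pderiv (P w) - (pderiv (P u) * Q g + pderiv (P w) * Q h) * P w"
    by (simp add: algebra_simps)
  then have "(P u * pderiv (P w) - pderiv (P u) * P w) * Q g = 0" unfolding z z'' by simp
  then have g: "Q g = 0" using nz by auto
  have "(P u * pderiv (P w) - pderiv (P u) * P w) * Q h =
      (pderiv (P u) * Q g + pderiv (P w) * Q h) * P u - (P u * Q g + P w * Q h) * pderiv (P u)"
    by (simp add: algebra_simps)
  then have "(P u * pderiv (P w) - pderiv (P u) * P w) * Q h = 0" unfolding z z'' by simp
  then have h: "Q h = 0" using nz by auto
  show ?thesis using cQ[of g k] cQ[of h k] g h k by simp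
qed

text \<open>
  The entry \<open>(i, k)\<close> of a matrix has the index \<open>q = i * c + k\<close>. The first \<open>n + c\<close> rows of \<open>B\<close> are the
  coefficients of \<open>u g + w h\<close>, the others those of its analogue for \<open>x u'\<close> and \<open>x w'\<close>; the lowest and the
  highest of the latter are left out, being \<open>0\<close> and a multiple of a former row.
\<close>

lemma exists_line_indep:
  assumes "n \<ge> 1" "c \<ge> 2" "2 * c + 2 * (n - 1) \<le> N" "N \<le> Suc n * c"
  shows "\<exists>\<Phi> :: nat \<Rightarrow> nat \<Rightarrow> nat \<Rightarrow> 'k::field_char_0. line_indep n c N \<Phi> \<and>
    (\<forall>x. (\<forall>k<c. \<forall>i<Suc n. (\<Sum>l<N. \<Phi> k l i * x l) = 0) \<longrightarrow> (\<forall>l<N. x l = 0))"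
proof -
  define m where "m = Suc n * c"
  define N0 where "N0 = (n + c) + (n + c - 2)"
  define B :: "nat \<Rightarrow> nat \<Rightarrow> 'k" where "B l q = (if l < n + c
     then (if q div c + q mod c = l then 1 else 0)
     else (if q div c + q mod c = l - (n + c) + 1 then of_nat (q div c) else 0))" for l q
  have code: "i * c + k < m" "(i * c + k) div c = i" "(i * c + k) mod c = k" if "i < Suc n" "k < c" for i k
  proof -
    have "i * c + k < Suc i * c" using that by simp
    also have "\<dots> \<le> Suc n * c" using that by (intro mult_le_mono1) simp
    finally show "i * c + k < m" unfolding m_def .
  qed (use that in auto)
  have "indep_rows N0 m B"
    unfolding indep_rows_def
  proof (intro allI impI)
    fix g l assume g: "\<forall>q<m. (\<Sum>l<N0. g l * B l q) = 0" and l: "l < N0"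
    \<comment> \<open>At the entry \<open>(i, k)\<close> only the two rows for
      \<open>s = i + k\<close> are nonzero, with values 1 and \<open>i\<close>, so a relation reads
      \<open>g s + i * g' s = 0\<close> with \<open>g'\<close> the coefficients of the second
      family.\<close>
    have eq: "g (i + k) + (if 0 < i + k \<and> i + k \<le> n + c - 2 then g (n + c + (i + k - 1)) * of_nat i else 0) = 0"
      if ik: "i < Suc n" "k < c" for i k
    proof -
      have "0 = (\<Sum>l<N0. g l * B l (i * c + k))" using g code(1)[OF ik] by simp
      also have "\<dots> = (\<Sum>l<n + c. g l * B l (i * c + k)) + (\<Sum>l<n + c - 2. g (n + c + l) * B (n + c + l) (i * c + k))"
        unfolding N0_def by (rule sum_lessThan_add)
      also have "(\<Sum>l<n + c. g l * B l (i * c + k)) = (\<Sum>l<n + c. if i + k = l then g l else 0)"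
        by (intro sum.cong refl) (use ik in \<open>simp add: B_def\<close>)
      also have "\<dots> = g (i + k)" using ik by (simp add: sum.delta')
      also have "(\<Sum>l<n + c - 2. g (n + c + l) * B (n + c + l) (i * c + k))
         = (\<Sum>l<n + c - 2. g (n + c + l) * (if i + k = l + 1 then of_nat i else 0))"
        by (intro sum.cong refl) (use ik in \<open>simp add: B_def\<close>)
      also have "\<dots> = (if 0 < i + k \<and> i + k \<le> n + c - 2 then g (n + c + (i + k - 1)) * of_nat i else 0)"
        by (rule sum_shifted_delta)
      finally show ?thesis by simp
    qed
    have both: "g s = 0 \<and> g (n + c + (s - 1)) = 0" if s: "0 < s" "s \<le> n + c - 2" for s
    proof -
      \<comment> \<open>The least row index on the antidiagonal \<open>s\<close>, truncated at 0.
        The antidiagonal also contains row \<open>Suc i\<close>, and the difference of the two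
        equations isolates the coefficient of the second family.\<close>
      define i where "i = s + 1 - c"
      define k where "k = s - i"
      have ik: "i < n" "k < c" "0 < k" "i + k = s" using s assms(1,2) unfolding i_def k_def by auto
      have 1: "g s + g (n + c + (s - 1)) * of_nat i = 0" using eq[of i k] ik s by simp
      have ik': "Suc i + (k - 1) = s" using ik by simp
      have 2: "g s + g (n + c + (s - 1)) * of_nat (Suc i) = 0" using eq[of "Suc i" "k - 1", unfolded ik'] ik s by simp
      have "g (n + c + (s - 1)) = (g s + g (n + c + (s - 1)) * of_nat (Suc i)) - (g s + g (n + c + (s - 1)) * of_nat i)"
        by (simp add: algebra_simps)
      also have "\<dots> = 0" using 1 2 by simp
      finally show ?thesis using 1 by simp
    qed
    show "g l = 0"
    proof (cases "l < n + c")
      case True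
      then consider "l = 0" | "0 < l" "l \<le> n + c - 2" | "l = n + (c - 1)" using assms(2) by linarith
      then show ?thesis
      proof cases
        case 1
        then show ?thesis using eq[of 0 0] assms(2) by simp
      next
        case 3
        have e: "\<not> n + (c - 1) \<le> n + c - 2" using assms(2) by linarith
        from eq[of n "c - 1"] assms(2) have "g (n + (c - 1)) = 0" by (simp only: e simp_thms if_False add_0_right lessI diff_less)
        then show ?thesis using 3 by simp
      qed (use both in blast)
    next
      case False
      then have "l = n + c + ((l - (n + c) + 1) - 1)" "l - (n + c) + 1 \<le> n + c - 2" using l unfolding N0_def by auto
      then show ?thesis using both[of "l - (n + c) + 1"] by (metis zero_less_Suc Suc_eq_plus1)
    qed
  qed
  moreover have "N0 + (N - N0) \<le> m" "N0 + (N - N0) = N" using assms unfolding N0_def m_def by auto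
  ultimately obtain G where G: "indep_rows N m G" "\<And>l. l < N0 \<Longrightarrow> G l = B l"
    using indep_rows_extend_many[of N0 m B "N - N0"] by auto
  have N0N: "N0 \<le> N" using assms unfolding N0_def by auto
  \<comment> \<open>The first \<open>N0\<close> rows already give the condition on lines, and
    further rows only add equations to its premise. Independence of all \<open>N\<close> rows says
    that no constant vector is annihilated by every \<open>A v\<close>.\<close>
  define \<Phi> where "\<Phi> k l i = G l (i * c + k)" for k l i
  have "line_indep n c N \<Phi>"
    unfolding line_indep_def
  proof (intro allI impI)
    fix u w g h k assume uw: "indep2 n u w"
      and z: "\<forall>l<N. (\<Sum>k<c. g k * ev n \<Phi> u k l + h k * ev n \<Phi> w k l) = 0" and k: "k < c"
    define t where "t i k = u i * g k + w i * h k" for i k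
    have z': "(\<Sum>k<c. \<Sum>i<Suc n. B l (i * c + k) * t i k) = 0" if "l < N0" for l
    proof -
      have "(\<Sum>k<c. \<Sum>i<Suc n. B l (i * c + k) * t i k) = (\<Sum>k<c. g k * ev n \<Phi> u k l + h k * ev n \<Phi> w k l)"
        unfolding ev_def sum_distrib_left sum.distrib[symmetric] \<Phi>_def G(2)[OF that]
        by (intro sum.cong refl) (simp add: t_def algebra_simps)
      then show ?thesis using z that N0N by simp
    qed
    have e1: "(\<Sum>k<c. \<Sum>i<Suc n. if i + k = s then t i k else 0) = 0" if "s < n + c" for s
    proof -
      have "s < N0" using that assms(1,2) unfolding N0_def by simp
      have "(\<Sum>k<c. \<Sum>i<Suc n. if i + k = s then t i k else 0) = (\<Sum>k<c. \<Sum>i<Suc n. B s (i * c + k) * t i k)"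
        by (intro sum.cong refl) (use that code in \<open>auto simp: B_def\<close>)
      then show ?thesis using z'[OF \<open>s < N0\<close>] by simp
    qed
    have e2: "(\<Sum>k<c. \<Sum>i<Suc n. if i + k = s then of_nat i * t i k else 0) = 0" if s: "s < n + c" for s
    proof -
      consider "s = 0" | "0 < s" "s \<le> n + c - 2" | "s = n + (c - 1)" using s assms(2) by linarith
      then show ?thesis
      proof cases
        case 1
        then show ?thesis by (intro sum.neutral ballI) auto
      next
        case 2
        then have "n + c + (s - 1) < N0" unfolding N0_def by auto
        have "(\<Sum>k<c. \<Sum>i<Suc n. if i + k = s then of_nat i * t i k else 0) = (\<Sum>k<c. \<Sum>i<Suc n. B (n + c + (s - 1)) (i * c + k) * t i k)"
          by (intro sum.cong refl) (use 2 code in \<open>auto simp: B_def\<close>)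
        then show ?thesis using z'[OF \<open>n + c + (s - 1) < N0\<close>] by simp
      next
        case 3
        have "(\<Sum>k<c. \<Sum>i<Suc n. if i + k = s then of_nat i * t i k else 0) = (\<Sum>k<c. \<Sum>i<Suc n. of_nat n * (if i + k = s then t i k else 0))"
          by (intro sum.cong refl) (use 3 in auto)
        then show ?thesis using e1[OF s] by (simp only: sum_distrib_left[symmetric] mult_zero_right)
      qed
    qed
    show "g k = 0 \<and> h k = 0"
      by (rule convolution_zero_imp_zero[OF uw e1[unfolded t_def] e2[unfolded t_def] k])
  qed
  moreover have "x l = 0" if x: "\<forall>k<c. \<forall>i<Suc n. (\<Sum>l<N. \<Phi> k l i * x l) = 0" and l: "l < N" for x l
  proof (rule indep_rowsD[OF G(1) _ l])
    fix q assume q: "q < m"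
    have c0: "c > 0" using assms(2) by simp
    have "q div c < Suc n" using q unfolding m_def by (rule less_mult_imp_div_less)
    then have "(\<Sum>l<N. \<Phi> (q mod c) l (q div c) * x l) = 0" using x c0 by simp
    then show "(\<Sum>l<N. x l * G l q) = 0" unfolding \<Phi>_def by (simp add: mult.commute)
  qed
  ultimately show ?thesis by blast
qed

subsection \<open>Forms and regular functions\<close>

lemma form_homogeneous: "form n d f \<Longrightarrow> f (\<lambda>i. t * v i) = t ^ d * f v"
  by (induction rule: form.induct) (simp_all add: algebra_simps power_add)

lemma form_scale: "form n d f \<Longrightarrow> form n d (\<lambda>v. a * f v)"
  using form.mult[OF form.const[of n a], of d f] by simp

lemma form_power_var: "i \<le> n \<Longrightarrow> form n d (\<lambda>v. v i ^ d)"
proof (induction d)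
  case 0
  then show ?case using form.const[of n 1] by simp
next
  case (Suc d)
  then show ?case using form.mult[OF form.var[of i n] Suc.IH] Suc.prems by simp
qed

lemma form_zero: "form n d (\<lambda>_. 0)"
  using form_scale[OF form_power_var[of 0 n d], of 0] by simp

lemma form_sum: "(\<And>i. i \<in> A \<Longrightarrow> form n d (f i)) \<Longrightarrow> form n d (\<lambda>v. \<Sum>i\<in>A. f i v)"
  by (induction A rule: infinite_finite_induct) (auto intro: form_zero form.add)

lemma form_prod: "finite A \<Longrightarrow> (\<And>i. i \<in> A \<Longrightarrow> form n d (f i)) \<Longrightarrow> form n (card A * d) (\<lambda>v. \<Prod>i\<in>A. f i v)"
proof (induction A rule: finite_induct)
  case empty
  then show ?case using form.const[of n 1] by simp
next
  case (insert i A)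
  then show ?case using form.mult[of n d "f i" "card A * d"] by simp
qed

lemma form_linear: "form n 1 (\<lambda>v. \<Sum>i<Suc n. a i * v i)"
  by (intro form_sum form_scale form.var) auto

lemma form_on_line_poly: "form n d f \<Longrightarrow> \<exists>p. \<forall>t. f (\<lambda>i. u i + t * w i) = poly p t"
proof (induction rule: form.induct)
  case (const a)
  then show ?case by (intro exI[of _ "[:a:]"]) simp
next
  case (var i)
  then show ?case by (intro exI[of _ "[:u i, w i:]"]) simp
next
  case (add d f g)
  then obtain p q where "\<forall>t. f (\<lambda>i. u i + t * w i) = poly p t" "\<forall>t. g (\<lambda>i. u i + t * w i) = poly q t" by blast
  then show ?case by (intro exI[of _ "p + q"]) simp
next
  case (mult d f e g)
  then obtain p q where "\<forall>t. f (\<lambda>i. u i + t * w i) = poly p t" "\<forall>t. g (\<lambda>i. u i + t * w i) = poly q t" by blast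
  then show ?case by (intro exI[of _ "p * q"]) simp
qed

lemma mem_point_of: "v \<in> point_of v"
  unfolding point_of_def by (intro CollectI exI[of _ 1]) simp

lemma point_of_scale: "t \<noteq> 0 \<Longrightarrow> point_of (\<lambda>i. t * v i) = point_of v"
proof -
  assume t: "t \<noteq> 0"
  have "(\<lambda>i. s * v i) = (\<lambda>i. (s / t) * (t * v i))" for s using t by auto
  moreover have "(\<lambda>i. s * (t * v i)) = (\<lambda>i. (s * t) * v i)" for s by (simp add: mult.assoc)
  ultimately show ?thesis unfolding point_of_def using t
    by (intro equalityI subsetI; elim CollectE exE conjE; intro CollectI)
      (metis no_zero_divisors, metis divide_eq_0_iff)
qed

lemma proj_spaceE:
  assumes "p \<in> proj_space n" "v \<in> p"
  shows "p = point_of v" "v \<in> coord_space (Suc n)" "v \<noteq> (\<lambda>_. 0)"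
proof -
  obtain v0 where v0: "p = point_of v0" "v0 \<in> coord_space (Suc n)" "v0 \<noteq> (\<lambda>_. 0)"
    using assms(1) unfolding proj_space_def by auto
  obtain t where t: "v = (\<lambda>i. t * v0 i)" "t \<noteq> 0" using assms(2) unfolding v0(1) point_of_def by auto
  show "p = point_of v" unfolding v0(1) t(1) by (simp add: point_of_scale[OF t(2)])
  show "v \<in> coord_space (Suc n)" using v0(2) unfolding t(1) coord_space_def by auto
  show "v \<noteq> (\<lambda>_. 0)" using v0(3) t by (auto simp: fun_eq_iff)
qed

lemma point_of_in_proj_space: "v \<in> coord_space (Suc n) \<Longrightarrow> v \<noteq> (\<lambda>_. 0) \<Longrightarrow> point_of v \<in> proj_space n"
  unfolding proj_space_def by blast

lemma proj_space_nonempty: "p \<in> proj_space n \<Longrightarrow> \<exists>v. v \<in> p"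
  unfolding proj_space_def using mem_point_of by blast

lemma same_point: "p \<in> proj_space n \<Longrightarrow> v \<in> p \<Longrightarrow> w \<in> p \<Longrightarrow> \<exists>t. t \<noteq> 0 \<and> w = (\<lambda>i. t * v i)"
  using proj_spaceE(1)[of p n v] unfolding point_of_def by auto

lemma scale_in_point: "p \<in> proj_space n \<Longrightarrow> v \<in> p \<Longrightarrow> t \<noteq> 0 \<Longrightarrow> (\<lambda>i. t * v i) \<in> p"
  using proj_spaceE(1)[of p n v] unfolding point_of_def by auto

lemma form_nonzero_on_point:
  "form n d f \<Longrightarrow> p \<in> proj_space n \<Longrightarrow> v \<in> p \<Longrightarrow> f v \<noteq> 0 \<Longrightarrow> w \<in> p \<Longrightarrow> f w \<noteq> 0"
  using same_point[of p n v w] form_homogeneous[of n d f _ v] by auto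

lemma proj_space_coord_nonzero: "p \<in> proj_space n \<Longrightarrow> v \<in> p \<Longrightarrow> \<exists>i<Suc n. v i \<noteq> 0"
proof (rule ccontr)
  assume p: "p \<in> proj_space n" "v \<in> p" and "\<not> (\<exists>i<Suc n. v i \<noteq> 0)"
  then have "v i = 0" for i using proj_spaceE(2)[OF p] unfolding coord_space_def by (cases "i < Suc n") auto
  then show False using proj_spaceE(3)[OF p] by auto
qed

lemma zopen_subset: "zopen n X U \<Longrightarrow> U \<subseteq> X"
  unfolding zopen_def by auto

lemma zopen_basic: "form n d h \<Longrightarrow> zopen n X {p\<in>X. \<exists>v\<in>p. h v \<noteq> 0}"
  unfolding zopen_def by (intro exI[of _ "{h}"]) auto

text \<open>The witnesses of regularity at one point under a single name, so that they can be
  obtained once and used piece by piece.\<close>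

definition tr_rep ::
  "nat \<Rightarrow> 'k::field point set \<Rightarrow> int \<Rightarrow> 'k point set \<Rightarrow> ('k point \<Rightarrow> 'k vect \<Rightarrow> 'k) \<Rightarrow> 'k point
    \<Rightarrow> 'k point set \<Rightarrow> ('k vect \<Rightarrow> 'k) \<Rightarrow> ('k vect \<Rightarrow> 'k) \<Rightarrow> nat \<Rightarrow> nat \<Rightarrow> bool" where
  "tr_rep n X d U s p V g h a b \<longleftrightarrow> zopen n X V \<and> p \<in> V \<and> V \<subseteq> U \<and>
     form n a g \<and> form n b h \<and> int a - int b = d \<and> (\<forall>q\<in>V. \<forall>v\<in>q. h v \<noteq> 0 \<and> s q v = g v / h v)"

lemma tr_repD:
  assumes "tr_rep n X d U s p V g h a b"
  shows "zopen n X V" "p \<in> V" "V \<subseteq> U" "form n a g" "form n b h" "int a - int b = d"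
    "q \<in> V \<Longrightarrow> v \<in> q \<Longrightarrow> h v \<noteq> 0" "q \<in> V \<Longrightarrow> v \<in> q \<Longrightarrow> s q v = g v / h v"
  using assms unfolding tr_rep_def by blast+

text \<open>Serves both for the whole space and for its lines, so that regular sections on either
  obey the same rules.\<close>

locale proj_subset =
  fixes n :: nat and X :: "'k::field point set"
  assumes sub: "X \<subseteq> proj_space n"
begin

lemma zopen_whole: "zopen n X X"
proof -
  have "X = {p\<in>X. \<exists>v\<in>p. (\<lambda>_. 1) v \<noteq> (0::'k)}" using sub proj_space_nonempty by fastforce
  then show ?thesis using zopen_basic[OF form.const[of n 1], of X] by simp
qed

lemma zopen_Int:
  assumes "zopen n X U" "zopen n X V" shows "zopen n X (U \<inter> V)"
proof -
  obtain F G where F: "\<forall>f\<in>F. \<exists>d. form n d f" "U = {p\<in>X. \<exists>f\<in>F. \<exists>v\<in>p. f v \<noteq> 0}"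
    and G: "\<forall>f\<in>G. \<exists>d. form n d f" "V = {p\<in>X. \<exists>f\<in>G. \<exists>v\<in>p. f v \<noteq> 0}"
    using assms unfolding zopen_def by auto
  let ?H = "{\<lambda>v. f v * g v | f g. f \<in> F \<and> g \<in> G}"
  have "U \<inter> V = {p\<in>X. \<exists>f\<in>?H. \<exists>v\<in>p. f v \<noteq> 0}"
  proof (intro equalityI subsetI)
    fix p assume p: "p \<in> U \<inter> V"
    then obtain f g v w where fg: "f \<in> F" "g \<in> G" "v \<in> p" "f v \<noteq> 0" "w \<in> p" "g w \<noteq> 0" and pX: "p \<in> X"
      unfolding F G by auto
    then have "g v \<noteq> 0" using form_nonzero_on_point[of n _ g p w v] G(1) sub by blast
    then show "p \<in> {p\<in>X. \<exists>f\<in>?H. \<exists>v\<in>p. f v \<noteq> 0}" using fg pX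
      by (intro CollectI conjI bexI[of _ "\<lambda>v. f v * g v"] bexI[of _ v]) auto
  qed (auto simp: F G, force+)
  moreover have "\<forall>f\<in>?H. \<exists>d. form n d f" using F(1) G(1) form.mult by blast
  ultimately show ?thesis unfolding zopen_def by blast
qed

lemma zopen_Inter_finite:
  "finite A \<Longrightarrow> (\<And>i. i \<in> A \<Longrightarrow> zopen n X (V i)) \<Longrightarrow> zopen n X (X \<inter> (\<Inter>i\<in>A. V i))"
proof (induction A rule: finite_induct)
  case empty
  then show ?case using zopen_whole by simp
next
  case (insert i A)
  have "zopen n X (V i \<inter> (X \<inter> (\<Inter>i\<in>A. V i)))" by (rule zopen_Int) (use insert in auto)
  moreover have "V i \<inter> (X \<inter> (\<Inter>i\<in>A. V i)) = X \<inter> (\<Inter>i\<in>insert i A. V i)" by auto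
  ultimately show ?case by (simp only:)
qed

lemma zopen_nbhd_form:
  assumes "zopen n X U" "p \<in> U"
  shows "\<exists>d f. form n d f \<and> (\<forall>v\<in>p. f v \<noteq> 0) \<and> {q\<in>X. \<exists>v\<in>q. f v \<noteq> 0} \<subseteq> U"
proof -
  obtain F where F: "\<forall>f\<in>F. \<exists>d. form n d f" "U = {p\<in>X. \<exists>f\<in>F. \<exists>v\<in>p. f v \<noteq> 0}"
    using assms(1) unfolding zopen_def by auto
  then obtain f v d where f: "f \<in> F" "v \<in> p" "f v \<noteq> 0" "p \<in> X" "form n d f" using assms(2) by auto
  then have "\<forall>w\<in>p. f w \<noteq> 0" using form_nonzero_on_point sub by blast
  moreover have "{q\<in>X. \<exists>v\<in>q. f v \<noteq> 0} \<subseteq> U" using F f by auto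
  ultimately show ?thesis using f by blast
qed

lemma trI:
  assumes "\<And>p. p \<in> U \<Longrightarrow> \<exists>V g h a b. zopen n X V \<and> p \<in> V \<and> V \<subseteq> U \<and>
        form n a g \<and> form n b h \<and> int a - int b = d \<and> (\<forall>q\<in>V. \<forall>v\<in>q. h v \<noteq> 0 \<and> s q v = g v / h v)"
  shows "twisted_regular n X d U s"
  using assms unfolding twisted_regular_def by (intro ballI)

lemma trE:
  assumes "twisted_regular n X d U s" "p \<in> U"
  obtains V g h a b where "tr_rep n X d U s p V g h a b"
proof -
  have "\<exists>V g h a b. tr_rep n X d U s p V g h a b"
    using assms unfolding twisted_regular_def tr_rep_def by (rule bspec)
  then show thesis using that by (elim exE)
qed

lemma tr_local:
  assumes "\<And>p. p \<in> U \<Longrightarrow> \<exists>V. zopen n X V \<and> p \<in> V \<and> V \<subseteq> U \<and> twisted_regular n X d V s"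
  shows "twisted_regular n X d U s"
proof (rule trI)
  fix p assume "p \<in> U"
  then obtain V where V: "p \<in> V" "V \<subseteq> U" "twisted_regular n X d V s" using assms by blast
  obtain W g h a b where Wrep: "tr_rep n X d V s p W g h a b" by (rule trE[OF V(3) V(1)])
  note W = tr_repD[OF Wrep]
  show "\<exists>V g h a b. zopen n X V \<and> p \<in> V \<and> V \<subseteq> U \<and>
        form n a g \<and> form n b h \<and> int a - int b = d \<and> (\<forall>q\<in>V. \<forall>v\<in>q. h v \<noteq> 0 \<and> s q v = g v / h v)"
    using V(2) W by (intro exI[of _ W] exI[of _ g] exI[of _ h] exI[of _ a] exI[of _ b]) auto
qed

lemma tr_subset:
  assumes "twisted_regular n X d U s" "zopen n X V" "V \<subseteq> U" shows "twisted_regular n X d V s"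
proof (rule trI)
  fix p assume p: "p \<in> V"
  then have pU: "p \<in> U" using assms(3) by blast
  obtain W g h a b where Wrep: "tr_rep n X d U s p W g h a b" by (rule trE[OF assms(1) pU])
  note W = tr_repD[OF Wrep]
  show "\<exists>V' g h a b. zopen n X V' \<and> p \<in> V' \<and> V' \<subseteq> V \<and>
        form n a g \<and> form n b h \<and> int a - int b = d \<and> (\<forall>q\<in>V'. \<forall>v\<in>q. h v \<noteq> 0 \<and> s q v = g v / h v)"
    using p W zopen_Int[OF W(1) assms(2)]
    by (intro exI[of _ "W \<inter> V"] exI[of _ g] exI[of _ h] exI[of _ a] exI[of _ b]) auto
qed

lemma tr_cong:
  assumes "twisted_regular n X d U s" "\<And>p v. p \<in> U \<Longrightarrow> v \<in> p \<Longrightarrow> s p v = s' p v"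
  shows "twisted_regular n X d U s'"
proof (rule trI)
  fix p assume p: "p \<in> U"
  obtain W g h a b where Wrep: "tr_rep n X d U s p W g h a b" by (rule trE[OF assms(1) p])
  note W = tr_repD[OF Wrep]
  have "s' q v = g v / h v" if "q \<in> W" "v \<in> q" for q v using that W(3,8) assms(2)[of q v] by auto
  then show "\<exists>V g h a b. zopen n X V \<and> p \<in> V \<and> V \<subseteq> U \<and>
        form n a g \<and> form n b h \<and> int a - int b = d \<and> (\<forall>q\<in>V. \<forall>v\<in>q. h v \<noteq> 0 \<and> s' q v = g v / h v)"
    using W by (intro exI[of _ "W"] exI[of _ g] exI[of _ h] exI[of _ a] exI[of _ b]) auto
qed

lemma tr_quotient:
  assumes "form n a g" "form n b h" "int a - int b = d" "zopen n X U" "\<And>q v. q \<in> U \<Longrightarrow> v \<in> q \<Longrightarrow> h v \<noteq> 0"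
  shows "twisted_regular n X d U (\<lambda>p v. g v / h v)"
  by (rule trI) (use assms in \<open>intro exI[of _ U] exI[of _ g] exI[of _ h] exI[of _ a] exI[of _ b], auto\<close>)

lemma tr_form: "form n d f \<Longrightarrow> zopen n X U \<Longrightarrow> twisted_regular n X (int d) U (\<lambda>p v. f v)"
  using tr_quotient[OF _ form.const[of n 1], of d f "int d" U] by simp

lemma tr_const: "zopen n X U \<Longrightarrow> twisted_regular n X 0 U (\<lambda>p v. a)"
  using tr_form[OF form.const, of U a] by simp

text \<open>For negative \<open>d\<close> the zero section still needs a denominator of degree
  \<open>- d\<close> that is nonzero near the point; a power of a coordinate not vanishing there
  does it.\<close>

lemma tr_zero: assumes "zopen n X U" shows "twisted_regular n X d U (\<lambda>p v. 0)"
proof (rule trI)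
  fix p assume p: "p \<in> U"
  then have pX: "p \<in> X" using zopen_subset[OF assms] by blast
  obtain v where v: "v \<in> p" using proj_space_nonempty pX sub by blast
  then obtain i where i: "i < Suc n" "v i \<noteq> 0" using proj_space_coord_nonzero[of p n v] pX sub by blast
  let ?W = "{q\<in>X. \<exists>w\<in>q. (\<lambda>v. v i) w \<noteq> 0}"
  have nz: "w i \<noteq> 0" if "q \<in> ?W" "w \<in> q" for q w
    using form_nonzero_on_point[OF form.var[of i n], of q _ w] that i sub by auto
  have z: "zopen n X (U \<inter> ?W)" by (intro zopen_Int assms zopen_basic[OF form.var]) (use i in simp)
  have pW: "p \<in> U \<inter> ?W" using p pX v i by auto
  have f: "form n (nat (- d)) (\<lambda>v. v i ^ nat (- d))" using i by (intro form_power_var) simp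
  show "\<exists>V g h a b. zopen n X V \<and> p \<in> V \<and> V \<subseteq> U \<and>
        form n a g \<and> form n b h \<and> int a - int b = d \<and> (\<forall>q\<in>V. \<forall>v\<in>q. h v \<noteq> 0 \<and> 0 = g v / h v)"
  proof (rule exI[of _ "U \<inter> ?W"], rule exI[of _ "\<lambda>_. 0"], rule exI[of _ "\<lambda>v. v i ^ nat (- d)"],
      rule exI[of _ "nat d"], rule exI[of _ "nat (- d)"], intro conjI ballI)
    fix q w assume "q \<in> U \<inter> ?W" "w \<in> q"
    then show "w i ^ nat (- d) \<noteq> 0" "0 = 0 / w i ^ nat (- d)" using nz[of q w] by simp_all
  qed (use z pW f form_zero in auto)
qed

lemma tr_mult:
  assumes "twisted_regular n X d U s" "twisted_regular n X e U t"
  shows "twisted_regular n X (d + e) U (\<lambda>p v. s p v * t p v)"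
proof (rule trI)
  fix p assume p: "p \<in> U"
  obtain W g h a b where Wrep: "tr_rep n X d U s p W g h a b" by (rule trE[OF assms(1) p])
  note W = tr_repD[OF Wrep]
  obtain W' g' h' a' b' where W'rep: "tr_rep n X e U t p W' g' h' a' b'" by (rule trE[OF assms(2) p])
  note W' = tr_repD[OF W'rep]
  show "\<exists>V g h a b. zopen n X V \<and> p \<in> V \<and> V \<subseteq> U \<and>
        form n a g \<and> form n b h \<and> int a - int b = d + e \<and> (\<forall>q\<in>V. \<forall>v\<in>q. h v \<noteq> 0 \<and> s q v * t q v = g v / h v)"
    using W W' zopen_Int[OF W(1) W'(1)] form.mult[OF W(4) W'(4)] form.mult[OF W(5) W'(5)]
    by (intro exI[of _ "W \<inter> W'"] exI[of _ "\<lambda>v. g v * g' v"] exI[of _ "\<lambda>v. h v * h' v"] exI[of _ "a + a'"] exI[of _ "b + b'"]) auto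
qed

lemma tr_add:
  assumes "twisted_regular n X d U s" "twisted_regular n X d U t"
  shows "twisted_regular n X d U (\<lambda>p v. s p v + t p v)"
proof (rule trI)
  fix p assume p: "p \<in> U"
  obtain W g h a b where Wrep: "tr_rep n X d U s p W g h a b" by (rule trE[OF assms(1) p])
  note W = tr_repD[OF Wrep]
  obtain W' g' h' a' b' where W'rep: "tr_rep n X d U t p W' g' h' a' b'" by (rule trE[OF assms(2) p])
  note W' = tr_repD[OF W'rep]
  have deg: "a' + b = a + b'" using W(6) W'(6) by linarith
  have "form n (a + b') (\<lambda>v. g v * h' v + g' v * h v)"
    using form.add[OF form.mult[OF W(4) W'(5)] form.mult[OF W'(4) W(5), unfolded deg]] .
  then show "\<exists>V g h a b. zopen n X V \<and> p \<in> V \<and> V \<subseteq> U \<and>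
        form n a g \<and> form n b h \<and> int a - int b = d \<and> (\<forall>q\<in>V. \<forall>v\<in>q. h v \<noteq> 0 \<and> s q v + t q v = g v / h v)"
    using W W' zopen_Int[OF W(1) W'(1)] form.mult[OF W(5) W'(5)]
    by (intro exI[of _ "W \<inter> W'"] exI[of _ "\<lambda>v. g v * h' v + g' v * h v"] exI[of _ "\<lambda>v. h v * h' v"] exI[of _ "a + b'"] exI[of _ "b + b'"])
      (auto simp: add_frac_eq)
qed

lemma tr_scale:
  assumes "twisted_regular n X d U s" "zopen n X U" shows "twisted_regular n X d U (\<lambda>p v. a * s p v)"
  using tr_mult[OF tr_const[OF assms(2)] assms(1), of a] by simp

lemma tr_sum:
  assumes "zopen n X U" "\<And>i. i \<in> A \<Longrightarrow> twisted_regular n X d U (s i)"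
  shows "twisted_regular n X d U (\<lambda>p v. \<Sum>i\<in>A. s i p v)"
  using assms(2)
proof (induction A rule: infinite_finite_induct)
  case (insert i A)
  then show ?case using tr_add[of d U "s i" "\<lambda>p v. \<Sum>i\<in>A. s i p v"] by simp
qed (use tr_zero[OF assms(1)] in simp_all)

lemma tr_prod0:
  assumes "zopen n X U" "\<And>i. i \<in> A \<Longrightarrow> twisted_regular n X 0 U (s i)"
  shows "twisted_regular n X 0 U (\<lambda>p v. \<Prod>i\<in>A. s i p v)"
  using assms(2)
proof (induction A rule: infinite_finite_induct)
  case (insert i A)
  then show ?case using tr_mult[of 0 U "s i" 0 "\<lambda>p v. \<Prod>i\<in>A. s i p v"] by simp
qed (use tr_const[OF assms(1)] in simp_all)

lemma tr_divide_form:
  assumes "twisted_regular n X d U s" "form n e h" "zopen n X U" "\<And>q v. q \<in> U \<Longrightarrow> v \<in> q \<Longrightarrow> h v \<noteq> 0"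
  shows "twisted_regular n X (d - int e) U (\<lambda>p v. s p v / h v)"
  using tr_mult[OF assms(1) tr_quotient[OF form.const[of n 1] assms(2) _ assms(3,4), of "- int e"]] by simp

lemma tr_inverse:
  assumes "twisted_regular n X d U s" "\<And>q v. q \<in> U \<Longrightarrow> v \<in> q \<Longrightarrow> s q v \<noteq> 0"
  shows "twisted_regular n X (- d) U (\<lambda>p v. 1 / s p v)"
proof (rule trI)
  fix p assume p: "p \<in> U"
  obtain W g h a b where Wrep: "tr_rep n X d U s p W g h a b" by (rule trE[OF assms(1) p])
  note W = tr_repD[OF Wrep]
  have "g v \<noteq> 0" if "q \<in> W" "v \<in> q" for q v using assms(2)[of q v] W(3,8) that by auto
  then show "\<exists>V g h a b. zopen n X V \<and> p \<in> V \<and> V \<subseteq> U \<and>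
        form n a g \<and> form n b h \<and> int a - int b = - d \<and> (\<forall>q\<in>V. \<forall>v\<in>q. h v \<noteq> 0 \<and> 1 / s q v = g v / h v)"
    using W by (intro exI[of _ W] exI[of _ h] exI[of _ g] exI[of _ b] exI[of _ a]) auto
qed

lemma tr_nonzero_nbhd:
  assumes "twisted_regular n X d U s" "p \<in> U" "v \<in> p" "s p v \<noteq> 0"
  shows "\<exists>V. zopen n X V \<and> p \<in> V \<and> V \<subseteq> U \<and> (\<forall>q\<in>V. \<forall>w\<in>q. s q w \<noteq> 0)"
proof -
  obtain W g h a b where Wrep: "tr_rep n X d U s p W g h a b" by (rule trE[OF assms(1) assms(2)])
  note W = tr_repD[OF Wrep]
  let ?V = "W \<inter> {q\<in>X. \<exists>v\<in>q. g v \<noteq> 0}"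
  have "zopen n X ?V" by (rule zopen_Int[OF W(1) zopen_basic[OF W(4)]])
  moreover have "p \<in> ?V" using W(2,8) assms(3,4) zopen_subset[OF W(1)] by auto
  moreover have "s q w \<noteq> 0" if "q \<in> ?V" "w \<in> q" for q w
  proof -
    have "g w \<noteq> 0" using that form_nonzero_on_point[OF W(4), of q _ w] sub by blast
    then show ?thesis using W(7,8) that by auto
  qed
  ultimately show ?thesis using W(3) by blast
qed

text \<open>Numerator and denominator are forms whose degrees differ by \<open>d\<close>. For
  \<open>d = 0\<close> this is what allows values at a chosen representative to be compared with
  those at any other.\<close>

lemma tr_homogeneous:
  assumes "twisted_regular n X d U s" "p \<in> U" "v \<in> p" "t \<noteq> 0" "p \<in> X"
  shows "s p (\<lambda>i. t * v i) = t powi d * s p v"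
proof -
  obtain W g h a b where Wrep: "tr_rep n X d U s p W g h a b" by (rule trE[OF assms(1) assms(2)])
  note W = tr_repD[OF Wrep]
  have "(\<lambda>i. t * v i) \<in> p" using scale_in_point assms sub by blast
  then have "s p (\<lambda>i. t * v i) = (t ^ a * g v) / (t ^ b * h v)"
    using W(8)[OF W(2)] form_homogeneous[OF W(4)] form_homogeneous[OF W(5)] by simp
  also have "\<dots> = t powi d * (g v / h v)"
    using assms(4) W(6)[symmetric] by (simp add: power_int_diff)
  finally show ?thesis using W(8)[OF W(2) assms(3)] by simp
qed

end

lemma zopen_restrict:
  assumes "zopen n X U" "L \<subseteq> X" shows "zopen n L (U \<inter> L)"
proof -
  obtain F where F: "\<forall>f\<in>F. \<exists>d. form n d f" "U = {p\<in>X. \<exists>f\<in>F. \<exists>v\<in>p. f v \<noteq> 0}"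
    using assms(1) unfolding zopen_def by auto
  then show ?thesis unfolding zopen_def using assms(2) by (intro exI[of _ F]) auto
qed

lemma tr_restrict:
  assumes "twisted_regular n X d U s" "X \<subseteq> proj_space n" "L \<subseteq> X" "zopen n L W" "W \<subseteq> U"
  shows "twisted_regular n L d W s"
proof -
  interpret Y: proj_subset n X by unfold_locales (rule assms)
  interpret L: proj_subset n L by unfold_locales (use assms in blast)
  show ?thesis
  proof (rule L.trI)
    fix p assume p: "p \<in> W"
    then have pU: "p \<in> U" using assms by blast
    obtain V g h a b where Wrep: "tr_rep n X d U s p V g h a b" by (rule Y.trE[OF assms(1) pU])
    note W = tr_repD[OF Wrep]
    have "zopen n L (V \<inter> L \<inter> W)" by (rule L.zopen_Int[OF zopen_restrict[OF W(1) assms(3)] assms(4)])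
    moreover have "p \<in> V \<inter> L \<inter> W" using p W(2) zopen_subset[OF assms(4)] by auto
    ultimately show "\<exists>V g h a b. zopen n L V \<and> p \<in> V \<and> V \<subseteq> W \<and>
        form n a g \<and> form n b h \<and> int a - int b = d \<and> (\<forall>q\<in>V. \<forall>v\<in>q. h v \<noteq> 0 \<and> s q v = g v / h v)"
      using W by (intro exI[of _ "V \<inter> L \<inter> W"] exI[of _ g] exI[of _ h] exI[of _ a] exI[of _ b]) auto
  qed
qed


subsection \<open>Sections over a line\<close>

lemma poly_ext_char_0: "(\<And>x. poly p x = poly q x) \<Longrightarrow> p = q" for p q :: "'k::field_char_0 poly"
  by (rule poly_eq_poly_eq_iff[THEN iffD1]) (rule ext)

text \<open>The hypothesis is the gluing of the two standard charts of the projective line for O(d).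
  Clearing denominators gives \<open>t ^ degree Q * P = t ^ d * reflect_poly Q\<close>, and degrees
  are compared.\<close>

lemma scaling_imp_degree_le:
  fixes P Q :: "'k::field_char_0 poly"
  assumes "\<And>t. t \<noteq> 0 \<Longrightarrow> poly P t = t ^ d * poly Q (1 / t)"
  shows "degree P \<le> d"
proof (cases "P = 0")
  case False
  \<comment> \<open>The additional factor \<open>t\<close> makes both sides agree at 0, where the
    hypothesis says nothing.\<close>
  have "monom 1 (degree Q) * P * [:0,1:] = monom 1 d * reflect_poly Q * [:0,1:]"
  proof (rule poly_ext_char_0)
    fix t :: 'k
    show "poly (monom 1 (degree Q) * P * [:0,1:]) t = poly (monom 1 d * reflect_poly Q * [:0,1:]) t"
    proof (cases "t = 0")
      case False
      then show ?thesis using assms[OF False] by (simp add: poly_monom poly_reflect_poly_nz inverse_eq_divide)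
    qed simp
  qed
  then have "monom 1 (degree Q) * P = monom 1 d * reflect_poly Q" by simp
  then have eq: "degree (monom 1 (degree Q) * P) = degree (monom 1 d * reflect_poly Q)" by simp
  have "Q \<noteq> 0" using \<open>monom 1 (degree Q) * P = monom 1 d * reflect_poly Q\<close> False by auto
  then have "degree Q + degree P = d + degree (reflect_poly Q)"
    using eq False by (simp add: degree_mult_eq degree_monom_eq)
  then show ?thesis using degree_reflect_poly_le[of Q] by linarith
qed simp

text \<open>Among the polynomials \<open>h\<close> for which \<open>\<sigma> * h\<close> is a
  polynomial, one of least degree is constant: at a root \<open>a\<close> of it, a local denominator
  not vanishing at \<open>a\<close> shows that the factor \<open>x - a\<close> can be
  cancelled.\<close>

lemma locally_rational_imp_poly:
  fixes \<sigma> :: "'k::{alg_closed_field, field_char_0} \<Rightarrow> 'k"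
  assumes "\<And>x. \<exists>f g h. poly f x \<noteq> 0 \<and> (\<forall>y. poly f y \<noteq> 0 \<longrightarrow> poly h y \<noteq> 0 \<and> \<sigma> y = poly g y / poly h y)"
  shows "\<exists>p. \<forall>x. \<sigma> x = poly p x"
proof -
  define Q where "Q h \<longleftrightarrow> h \<noteq> 0 \<and> (\<exists>g. \<forall>y. \<sigma> y * poly h y = poly g y)" for h
  have loc: "\<exists>h. poly h x \<noteq> 0 \<and> (\<exists>g. \<forall>y. \<sigma> y * poly h y = poly g y)" for x
  proof -
    obtain f g h where f: "poly f x \<noteq> 0" "\<And>y. poly f y \<noteq> 0 \<Longrightarrow> poly h y \<noteq> 0 \<and> \<sigma> y = poly g y / poly h y"
      using assms by blast
    have "\<sigma> y * poly (f * h) y = poly (f * g) y" for y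
      using f(2)[of y] by (cases "poly f y = 0") (simp_all add: field_simps)
    then show ?thesis using f by (intro exI[of _ "f * h"] conjI exI[of _ "f * g"]) auto
  qed
  have "\<exists>h. Q h"
  proof -
    obtain h where "poly h 0 \<noteq> 0 \<and> (\<exists>g. \<forall>y. \<sigma> y * poly h y = poly g y)" using loc[of 0] by (elim exE)
    then show ?thesis unfolding Q_def by (intro exI[of _ h]) auto
  qed
  then obtain h where h: "Q h" "\<And>h'. Q h' \<Longrightarrow> degree h \<le> degree h'"
    using ex_has_least_nat[of Q _ degree] by metis
  then obtain g where g: "\<And>y. \<sigma> y * poly h y = poly g y" and h0: "h \<noteq> 0" unfolding Q_def by blast
  have "degree h = 0"
  proof (rule ccontr)
    assume "degree h \<noteq> 0"
    then obtain a where a: "poly h a = 0" using alg_closed_imp_poly_has_root[of h] by auto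
    then have "poly g a = 0" using g[of a] by simp
    then obtain g1 where g1: "g = [:- a, 1:] * g1" using poly_eq_0_iff_dvd by blast
    obtain h1 where h1: "h = [:- a, 1:] * h1" using a poly_eq_0_iff_dvd by blast
    have off: "\<sigma> y * poly h1 y = poly g1 y" if "y \<noteq> a" for y
    proof -
      have "(y - a) * (\<sigma> y * poly h1 y) = (y - a) * poly g1 y"
        using g[of y] unfolding g1 h1 by (simp add: algebra_simps)
      then show ?thesis using that by simp
    qed
    obtain h2 g2 where h2: "poly h2 a \<noteq> 0" "\<And>y. \<sigma> y * poly h2 y = poly g2 y" using loc[of a] by blast
    \<comment> \<open>Off \<open>a\<close> both quotients are \<open>\<sigma>\<close>. The extra
      factor covers the point \<open>a\<close> and is cancelled afterwards.\<close>
    have "g1 * h2 * [:- a, 1:] = g2 * h1 * [:- a, 1:]"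
    proof (rule poly_ext_char_0)
      fix y
      have "poly g1 y * poly h2 y = poly g2 y * poly h1 y" if "y \<noteq> a"
        unfolding off[OF that, symmetric] h2(2)[symmetric] by simp
      then show "poly (g1 * h2 * [:- a, 1:]) y = poly (g2 * h1 * [:- a, 1:]) y" by (cases "y = a") simp_all
    qed
    then have "g1 * h2 = g2 * h1" by (metis mult_right_cancel one_neq_zero pCons_eq_0_iff)
    then have "poly g1 a * poly h2 a = \<sigma> a * poly h2 a * poly h1 a"
      unfolding h2(2) by (metis poly_mult)
    then have "\<sigma> a * poly h1 a = poly g1 a" using h2(1) by simp
    then have "Q h1" unfolding Q_def using off h0 h1 by (metis mult_zero_right)
    then have "degree h \<le> degree h1" by (rule h(2))
    moreover have "degree h = Suc (degree h1)" using h0 unfolding h1 by (subst degree_mult_eq) auto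
    ultimately show False by simp
  qed
  then obtain k where k: "h = [:k:]" using degree_eq_zeroE by blast
  then have "k \<noteq> 0" using h0 by auto
  have "\<sigma> x = poly (Polynomial.smult (1 / k) g) x" for x
    using g[of x] \<open>k \<noteq> 0\<close> unfolding k by (simp add: field_simps)
  then show ?thesis by blast
qed

lemma span_two_in_coord_space:
  "u \<in> coord_space m \<Longrightarrow> w \<in> coord_space m \<Longrightarrow> (\<lambda>i. a * u i + b * w i) \<in> coord_space m"
  unfolding coord_space_def by simp

text \<open>The set \<open>L\<close> is a parameter of its own, so that exchanging \<open>u\<close>
  and \<open>w\<close> gives the second chart of the same line.\<close>

locale proj_line =
  fixes n :: nat and u w :: "'k::{alg_closed_field, field_char_0} vect" and L :: "'k point set"
  assumes u: "u \<in> coord_space (Suc n)" and w: "w \<in> coord_space (Suc n)"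
    and ind: "\<And>a b. (\<forall>i. a * u i + b * w i = 0) \<Longrightarrow> a = 0 \<and> b = 0"
    and L: "L = {point_of (\<lambda>i. a * u i + b * w i) | a b. a \<noteq> 0 \<or> b \<noteq> 0}"
begin

lemma nonzero_comb: "a \<noteq> 0 \<or> b \<noteq> 0 \<Longrightarrow> (\<lambda>i. a * u i + b * w i) \<noteq> (\<lambda>_. 0)"
  using ind by (metis (full_types))

lemma L_sub: "L \<subseteq> proj_space n"
  unfolding L using point_of_in_proj_space[OF span_two_in_coord_space[OF u w] nonzero_comb] by blast

sublocale proj_subset n L by unfold_locales (rule L_sub)

lemma comb_in_L: "a \<noteq> 0 \<or> b \<noteq> 0 \<Longrightarrow> point_of (\<lambda>i. a * u i + b * w i) \<in> L"
  unfolding L by blast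

lemma in_L_comb: assumes "p \<in> L" "v \<in> p" shows "\<exists>a b. (a \<noteq> 0 \<or> b \<noteq> 0) \<and> v = (\<lambda>i. a * u i + b * w i)"
proof -
  obtain a b where ab: "p = point_of (\<lambda>i. a * u i + b * w i)" "a \<noteq> 0 \<or> b \<noteq> 0" using assms(1) unfolding L by blast
  then obtain t where "v = (\<lambda>i. t * (a * u i + b * w i))" "t \<noteq> 0" using assms(2) unfolding point_of_def by blast
  then show ?thesis using ab(2) by (intro exI[of _ "t * a"] exI[of _ "t * b"]) (auto simp: algebra_simps)
qed

lemma section_poly:
  assumes "twisted_regular n L d L s"
  shows "\<exists>p. \<forall>t. s (point_of (\<lambda>i. u i + t * w i)) (\<lambda>i. u i + t * w i) = poly p t"
proof (rule locally_rational_imp_poly)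
  fix x
  let ?v = "\<lambda>t i. u i + t * w i"
  have inL: "point_of (?v t) \<in> L" for t using comb_in_L[of 1 t] by simp
  obtain V g h a b where r: "tr_rep n L d L s (point_of (?v x)) V g h a b" by (rule trE[OF assms inL])
  note V = tr_repD[OF r]
  obtain e f where f: "form n e f" "\<forall>v\<in>point_of (?v x). f v \<noteq> 0" "{q\<in>L. \<exists>v\<in>q. f v \<noteq> 0} \<subseteq> V"
    using zopen_nbhd_form[OF V(1,2)] by blast
  obtain F where F: "\<And>t. f (?v t) = poly F t" using form_on_line_poly[OF f(1)] by blast
  obtain G where G: "\<And>t. g (?v t) = poly G t" using form_on_line_poly[OF V(4)] by blast
  obtain H where H: "\<And>t. h (?v t) = poly H t" using form_on_line_poly[OF V(5)] by blast
  have "poly F x \<noteq> 0" using f(2) mem_point_of unfolding F[symmetric] by blast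
  moreover have "poly H y \<noteq> 0 \<and> s (point_of (?v y)) (?v y) = poly G y / poly H y" if "poly F y \<noteq> 0" for y
  proof -
    have "point_of (?v y) \<in> V" using f(3) inL mem_point_of that unfolding F[symmetric] by blast
    then show ?thesis using V(7,8) mem_point_of unfolding H[symmetric] G[symmetric] by blast
  qed
  ultimately show "\<exists>f g h. poly f x \<noteq> 0 \<and>
     (\<forall>y. poly f y \<noteq> 0 \<longrightarrow> poly h y \<noteq> 0 \<and> s (point_of (?v y)) (?v y) = poly g y / poly h y)" by blast
qed

end

lemma proj_line_swap: "proj_line n u w L \<Longrightarrow> proj_line n w u L"
proof -
  assume a: "proj_line n u w L"
  interpret proj_line n u w L by (rule a)
  show ?thesis
  proof
    show "L = {point_of (\<lambda>i. a * w i + b * u i) | a b. a \<noteq> 0 \<or> b \<noteq> 0}"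
    proof -
      have "point_of (\<lambda>i. a * u i + b * w i) = point_of (\<lambda>i. b * w i + a * u i)" for a b by (simp add: add.commute)
      then show ?thesis unfolding L by blast
    qed
    fix a b assume "\<forall>i. a * w i + b * u i = 0"
    then show "a = 0 \<and> b = 0" using ind[of b a] by (simp add: add.commute)
  qed (rule w u)+
qed

context proj_line
begin

text \<open>The charts \<open>u + t w\<close> and \<open>w + t u\<close> describe the section by
  polynomials \<open>P\<close> and \<open>Q\<close>, and homogeneity glues them by
  \<open>P(t) = t ^ d * Q(1 / t)\<close>, which bounds both degrees.\<close>

lemma section_degree_le:
  assumes s: "twisted_regular n L (int d) L s"
  shows "\<exists>P Q. degree P \<le> d \<and> (\<forall>t. s (point_of (\<lambda>i. u i + t * w i)) (\<lambda>i. u i + t * w i) = poly P t) \<and>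
    (\<forall>t. s (point_of (\<lambda>i. w i + t * u i)) (\<lambda>i. w i + t * u i) = poly Q t) \<and>
    (\<forall>t. t \<noteq> 0 \<longrightarrow> poly P t = t ^ d * poly Q (1 / t)) \<and> degree Q \<le> d"
proof -
  obtain P where P: "\<And>t. s (point_of (\<lambda>i. u i + t * w i)) (\<lambda>i. u i + t * w i) = poly P t"
    using section_poly[OF s] by blast
  interpret sw: proj_line n w u L by (rule proj_line_swap) unfold_locales
  obtain Q where Q: "\<And>t. s (point_of (\<lambda>i. w i + t * u i)) (\<lambda>i. w i + t * u i) = poly Q t"
    using sw.section_poly[OF s] by blast
  have PQ: "poly P t = t ^ d * poly Q (1 / t)" if t: "t \<noteq> 0" for t
  proof -
    have e: "(\<lambda>i. u i + t * w i) = (\<lambda>i. t * (\<lambda>i. w i + (1 / t) * u i) i)" using t by (auto simp: algebra_simps)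
    have inL: "point_of (\<lambda>i. w i + (1 / t) * u i) \<in> L" using sw.comb_in_L[of 1 "1 / t"] by simp
    have "poly P t = s (point_of (\<lambda>i. w i + (1 / t) * u i)) (\<lambda>i. t * (\<lambda>i. w i + (1 / t) * u i) i)"
      unfolding P[symmetric] e point_of_scale[OF t] ..
    also have "\<dots> = t powi (int d) * poly Q (1 / t)"
      unfolding Q[symmetric] by (rule tr_homogeneous[OF s inL mem_point_of t inL])
    finally show ?thesis by simp
  qed
  have QP: "poly Q t = t ^ d * poly P (1 / t)" if t: "t \<noteq> 0" for t
    using PQ[of "1 / t"] t by (simp add: field_simps)
  show ?thesis using scaling_imp_degree_le[OF PQ] P Q PQ scaling_imp_degree_le[OF QP] by blast
qed

lemma section_deg1_linear:
  assumes s: "twisted_regular n L 1 L s" and ab: "a \<noteq> 0 \<or> b \<noteq> 0"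
  shows "s (point_of (\<lambda>i. a * u i + b * w i)) (\<lambda>i. a * u i + b * w i) = a * s (point_of u) u + b * s (point_of w) w"
proof -
  have s': "twisted_regular n L (int 1) L s" using s by simp
  obtain P Q where PQ: "degree P \<le> 1 \<and> (\<forall>t. s (point_of (\<lambda>i. u i + t * w i)) (\<lambda>i. u i + t * w i) = poly P t) \<and>
    (\<forall>t. s (point_of (\<lambda>i. w i + t * u i)) (\<lambda>i. w i + t * u i) = poly Q t) \<and>
    (\<forall>t. t \<noteq> 0 \<longrightarrow> poly P t = t ^ 1 * poly Q (1 / t)) \<and> degree Q \<le> 1"
    using section_degree_le[OF s'] by (elim exE)
  have P: "degree P \<le> 1" "\<And>t. s (point_of (\<lambda>i. u i + t * w i)) (\<lambda>i. u i + t * w i) = poly P t"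
    "\<And>t. s (point_of (\<lambda>i. w i + t * u i)) (\<lambda>i. w i + t * u i) = poly Q t"
    "\<And>t. t \<noteq> 0 \<Longrightarrow> poly P t = t ^ 1 * poly Q (1 / t)" "degree Q \<le> 1"
    using PQ by blast+
  have deg1: "\<exists>a b. p = [:a, b:]" if "degree p \<le> 1" for p :: "'k poly"
    using that by (intro exI[of _ "coeff p 0"] exI[of _ "coeff p 1"] poly_eqI)
      (auto simp: coeff_pCons coeff_eq_0 split: nat.split)
  obtain p0 p1 where p: "P = [:p0, p1:]" using deg1[OF P(1)] by blast
  obtain q0 q1 where q: "Q = [:q0, q1:]" using deg1[OF P(5)] by blast
  \<comment> \<open>The gluing identity at \<open>t = 1\<close> and \<open>t = -1\<close> determines
    the coefficients, as 2 is invertible.\<close>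
  have "p0 + p1 = q0 + q1" "p0 - p1 = q1 - q0" using P(4)[of 1] P(4)[of "-1"] unfolding p q by simp_all
  then have "(p0 + p1) + (p0 - p1) = (q0 + q1) + (q1 - q0)" "(p0 + p1) - (p0 - p1) = (q0 + q1) - (q1 - q0)" by (simp_all only:)
  then have "2 * p0 = 2 * q1" "2 * p1 = 2 * q0" by (simp_all add: algebra_simps)
  then have pq: "p0 = q1" "p1 = q0" by simp_all
  have su: "s (point_of u) u = p0" using P(2)[of 0] p by simp
  have sw: "s (point_of w) w = p1" using P(3)[of 0] q pq by simp
  have hom: "s (point_of (\<lambda>i. t * v i)) (\<lambda>i. t * v i) = t * s (point_of v) v" if "point_of v \<in> L" "t \<noteq> 0" for t v
    unfolding point_of_scale[OF that(2)] using tr_homogeneous[OF s that(1) mem_point_of that(2) that(1)] by simp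
  show ?thesis
  proof (cases "a = 0")
    case True
    then show ?thesis using hom[of w b] comb_in_L[of 0 1] ab sw by simp
  next
    case False
    have e: "(\<lambda>i. a * u i + b * w i) = (\<lambda>i. a * (\<lambda>i. u i + (b / a) * w i) i)" using False by (auto simp: algebra_simps)
    show ?thesis unfolding e using hom[of "\<lambda>i. u i + (b / a) * w i" a] comb_in_L[of 1 "b / a"] False P(2)[of "b / a"]
      unfolding p su sw by (simp add: algebra_simps)
  qed
qed

lemma section_deg0_const:
  assumes s: "twisted_regular n L 0 L s"
  shows "s (point_of u) u = s (point_of w) w"
proof -
  have s': "twisted_regular n L (int 0) L s" using s by simp
  obtain P Q where PQ: "degree P \<le> 0 \<and> (\<forall>t. s (point_of (\<lambda>i. u i + t * w i)) (\<lambda>i. u i + t * w i) = poly P t) \<and>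
    (\<forall>t. s (point_of (\<lambda>i. w i + t * u i)) (\<lambda>i. w i + t * u i) = poly Q t) \<and>
    (\<forall>t. t \<noteq> 0 \<longrightarrow> poly P t = t ^ 0 * poly Q (1 / t)) \<and> degree Q \<le> 0"
    using section_degree_le[OF s'] by (elim exE)
  have P: "degree P \<le> 0" "\<And>t. s (point_of (\<lambda>i. u i + t * w i)) (\<lambda>i. u i + t * w i) = poly P t"
    "\<And>t. s (point_of (\<lambda>i. w i + t * u i)) (\<lambda>i. w i + t * u i) = poly Q t"
    "\<And>t. t \<noteq> 0 \<Longrightarrow> poly P t = t ^ 0 * poly Q (1 / t)" "degree Q \<le> 0"
    using PQ by blast+
  obtain p where p: "P = [:p:]" using P(1) degree_eq_zeroE by blast
  obtain q where q: "Q = [:q:]" using P(5) degree_eq_zeroE by blast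
  have "p = q" using P(4)[of 1] unfolding p q by simp
  then show ?thesis using P(2)[of 0] P(3)[of 0] unfolding p q by simp
qed

end

section \<open>Linearity on fibres\<close>

definition lin_on :: "('a \<Rightarrow> 'k::field) set \<Rightarrow> (('a \<Rightarrow> 'k) \<Rightarrow> 'b \<Rightarrow> 'k) \<Rightarrow> bool" where
  "lin_on S h \<longleftrightarrow> (\<forall>u\<in>S. \<forall>w\<in>S. \<forall>a b. h (\<lambda>x. a * u x + b * w x) = (\<lambda>y. a * h u y + b * h w y))"

definition lin_closed :: "('a \<Rightarrow> 'k::field) set \<Rightarrow> bool" where
  "lin_closed S \<longleftrightarrow> S \<noteq> {} \<and> (\<forall>u\<in>S. \<forall>w\<in>S. \<forall>a b. (\<lambda>x. a * u x + b * w x) \<in> S)"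

lemma lin_closed_zero: "lin_closed S \<Longrightarrow> (\<lambda>_. 0) \<in> S"
proof -
  assume S: "lin_closed S"
  then obtain u where u: "u \<in> S" unfolding lin_closed_def by blast
  then have "(\<lambda>x. 0 * u x + 0 * u x) \<in> S" using S unfolding lin_closed_def by blast
  then show ?thesis by simp
qed

lemma lin_closed_comb: "lin_closed S \<Longrightarrow> u \<in> S \<Longrightarrow> w \<in> S \<Longrightarrow> (\<lambda>x. a * u x + b * w x) \<in> S"
  unfolding lin_closed_def by blast

lemma lin_closed_sum:
  fixes m :: nat
  assumes S: "lin_closed S" and u: "\<And>i. i < m \<Longrightarrow> u i \<in> S"
  shows "(\<lambda>x. \<Sum>i<m. a i * u i x) \<in> S"
  using u
proof (induction m)
  case 0
  then show ?case using lin_closed_zero[OF S] by simp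
next
  case (Suc m)
  then have "(\<lambda>x. 1 * (\<Sum>i<m. a i * u i x) + a m * u m x) \<in> S"
    by (intro lin_closed_comb[OF S, of "\<lambda>x. \<Sum>i<m. a i * u i x"]) auto
  then show ?case by simp
qed

lemma lin_onD: "lin_on S h \<Longrightarrow> u \<in> S \<Longrightarrow> w \<in> S \<Longrightarrow> h (\<lambda>x. a * u x + b * w x) = (\<lambda>y. a * h u y + b * h w y)"
  unfolding lin_on_def by blast

lemma lin_on_scale: "lin_on S h \<Longrightarrow> u \<in> S \<Longrightarrow> h (\<lambda>x. a * u x) = (\<lambda>y. a * h u y)"
  using lin_onD[of S h u u a 0] by simp

lemma lin_on_sum:
  fixes m :: nat
  assumes S: "lin_closed S" and h: "lin_on S h" and u: "\<And>i. i < m \<Longrightarrow> u i \<in> S"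
  shows "h (\<lambda>x. \<Sum>i<m. a i * u i x) = (\<lambda>y. \<Sum>i<m. a i * h (u i) y)"
  using u
proof (induction m)
  case 0
  obtain u where "u \<in> S" using S unfolding lin_closed_def by blast
  then show ?case using lin_on_scale[OF h, of u 0] by simp
next
  case (Suc m)
  have "h (\<lambda>x. 1 * (\<lambda>x. \<Sum>i<m. a i * u i x) x + a m * u m x) = (\<lambda>y. 1 * h (\<lambda>x. \<Sum>i<m. a i * u i x) y + a m * h (u m) y)"
    by (rule lin_onD[OF h lin_closed_sum[OF S]]) (use Suc.prems in auto)
  then show ?case using Suc by simp
qed

lemma hom_lin_on: "bundle_hom n X E F \<phi> \<Longrightarrow> p \<in> X \<Longrightarrow> lin_on (fibre E p) (\<phi> p)"
  unfolding bundle_hom_def lin_on_def by blast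

lemma hom_fibre: "bundle_hom n X E F \<phi> \<Longrightarrow> p \<in> X \<Longrightarrow> u \<in> fibre E p \<Longrightarrow> \<phi> p u \<in> fibre F p"
  unfolding bundle_hom_def by blast

lemma hom_sections: "bundle_hom n X E F \<phi> \<Longrightarrow> zopen n X U \<Longrightarrow> s \<in> sections E U \<Longrightarrow> (\<lambda>p. \<phi> p (s p)) \<in> sections F U"
  unfolding bundle_hom_def by blast

lemma lin_closed_twist: "lin_closed (fibre (twist_bundle n X d) p)"
  unfolding lin_closed_def twist_bundle_def
  by (auto simp: algebra_simps intro!: exI[of _ "\<lambda>_. 0"])

lemma lin_closed_direct_sum:
  assumes "\<And>i. i < m \<Longrightarrow> lin_closed (fibre (F i) p)" shows "lin_closed (fibre (direct_sum m F) p)"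
proof -
  have "(\<lambda>_. 0) \<in> fibre (direct_sum m F) p" unfolding direct_sum_def by (simp add: lin_closed_zero[OF assms])
  moreover have "(\<lambda>x. a * u x + b * w x) \<in> fibre (direct_sum m F) p"
    if "u \<in> fibre (direct_sum m F) p" "w \<in> fibre (direct_sum m F) p" for u w a b
    using that lin_closed_comb[OF assms] unfolding direct_sum_def by simp
  ultimately show ?thesis unfolding lin_closed_def by blast
qed

subsection \<open>Global sections of twists\<close>

lemma proj_subset_whole: "proj_subset n (proj_space n)"
  by unfold_locales simp

lemma independent_imp_proj_line:
  fixes u w :: "'k::{alg_closed_field, field_char_0} vect"
  assumes "u \<in> coord_space (Suc n)" "w \<in> coord_space (Suc n)"
    "\<forall>a b. (\<forall>i. a * u i + b * w i = 0) \<longrightarrow> a = 0 \<and> b = 0"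
  shows "proj_line n u w {point_of (\<lambda>i. a * u i + b * w i) | a b. a \<noteq> 0 \<or> b \<noteq> 0}"
  by (rule proj_line.intro) (rule assms, rule assms, use assms(3) in blast, rule refl)

lemma tr_on_line:
  assumes "proj_line n u w L" "twisted_regular n (proj_space n) d (proj_space n) s"
  shows "twisted_regular n L d L s"
proof -
  interpret proj_line n u w L by (rule assms)
  show ?thesis by (rule tr_restrict[OF assms(2) order_refl L_sub zopen_whole L_sub])
qed

lemma dependent_vectors_cases:
  fixes u w :: "'k::field vect"
  assumes "\<not> (\<forall>a b. (\<forall>i. a * u i + b * w i = 0) \<longrightarrow> a = 0 \<and> b = 0)"
  shows "(\<exists>t. w = (\<lambda>i. t * u i)) \<or> (\<exists>t. u = (\<lambda>i. t * w i))"
proof -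
  obtain a b where ab: "\<And>i. a * u i + b * w i = 0" "a \<noteq> 0 \<or> b \<noteq> 0" using assms by blast
  show ?thesis
  proof (cases "b = 0")
    case True
    then have "u i = 0 * w i" for i using ab(1)[of i] ab(2) by simp
    then show ?thesis by blast
  next
    case False
    have "w i = (- a / b) * u i" for i
    proof -
      have "b * w i = - (a * u i)" using ab(1)[of i] by (simp add: eq_neg_iff_add_eq_0 add.commute)
      then show ?thesis using False by (simp add: field_simps)
    qed
    then show ?thesis by blast
  qed
qed

text \<open>Two independent vectors span a line, on which the section is linear; for dependent ones
  homogeneity suffices. So the section is a linear function on the coordinate space, determined by
  its values on unit vectors.\<close>

lemma global_section_deg1:
  fixes s :: "'k::{alg_closed_field, field_char_0} point \<Rightarrow> 'k vect \<Rightarrow> 'k"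
  assumes s: "twisted_regular n (proj_space n) 1 (proj_space n) s"
  shows "\<exists>a. \<forall>p\<in>proj_space n. \<forall>v\<in>p. s p v = (\<Sum>i<Suc n. a i * v i)"
proof -
  interpret proj_subset n "proj_space n :: 'k point set" by (rule proj_subset_whole)
  \<comment> \<open>Zero is not a representative of a point; the value 0 there makes linearity hold
    without exceptions.\<close>
  define \<sigma> where "\<sigma> v = (if v = (\<lambda>_. 0) then 0 else s (point_of v) v)" for v :: "'k vect"
  have scale: "\<sigma> (\<lambda>i. t * v i) = t * \<sigma> v" if v: "v \<in> coord_space (Suc n)" for t v
  proof (cases "t = 0 \<or> v = (\<lambda>_. 0)")
    case True
    then show ?thesis unfolding \<sigma>_def by auto
  next
    case False
    then have t: "t \<noteq> 0" and v0: "v \<noteq> (\<lambda>_. 0)" by auto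
    then have "(\<lambda>i. t * v i) \<noteq> (\<lambda>_. 0)" by (auto simp: fun_eq_iff)
    then show ?thesis unfolding \<sigma>_def point_of_scale[OF t]
      using tr_homogeneous[OF s point_of_in_proj_space[OF v v0] mem_point_of t point_of_in_proj_space[OF v v0]] v0 by simp
  qed
  have lin: "\<sigma> (\<lambda>i. a * u i + b * w i) = a * \<sigma> u + b * \<sigma> w"
    if u: "u \<in> coord_space (Suc n)" and w: "w \<in> coord_space (Suc n)" for u w a b
  proof (cases "\<forall>a b. (\<forall>i. a * u i + b * w i = 0) \<longrightarrow> a = 0 \<and> b = 0")
    case True
    let ?L = "{point_of (\<lambda>i. a * u i + b * w i) | a b. a \<noteq> 0 \<or> b \<noteq> 0}"
    have pl: "proj_line n u w ?L" by (rule independent_imp_proj_line[OF u w True])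
    interpret l: proj_line n u w ?L by (rule pl)
    have u0: "u \<noteq> (\<lambda>_. 0)" "w \<noteq> (\<lambda>_. 0)" using l.nonzero_comb[of 1 0] l.nonzero_comb[of 0 1] by auto
    show ?thesis
    proof (cases "a \<noteq> 0 \<or> b \<noteq> 0")
      case True
      then show ?thesis
        using l.section_deg1_linear[OF tr_on_line[OF pl s] True] l.nonzero_comb[OF True] u0 unfolding \<sigma>_def by simp
    next
      case False
      then show ?thesis unfolding \<sigma>_def by simp
    qed
  next
    case False
    from dependent_vectors_cases[OF this] show ?thesis
    proof
      assume "\<exists>t. w = (\<lambda>i. t * u i)"
      then obtain t where t: "w = (\<lambda>i. t * u i)" by blast
      have "(\<lambda>i. a * u i + b * w i) = (\<lambda>i. (a + b * t) * u i)" unfolding t by (auto simp: algebra_simps)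
      then have "\<sigma> (\<lambda>i. a * u i + b * w i) = (a + b * t) * \<sigma> u" by (simp only: scale[OF u])
      moreover have "\<sigma> w = t * \<sigma> u" unfolding t by (rule scale[OF u])
      ultimately show ?thesis by (simp add: algebra_simps)
    next
      assume "\<exists>t. u = (\<lambda>i. t * w i)"
      then obtain t where t: "u = (\<lambda>i. t * w i)" by blast
      have "(\<lambda>i. a * u i + b * w i) = (\<lambda>i. (a * t + b) * w i)" unfolding t by (auto simp: algebra_simps)
      then have "\<sigma> (\<lambda>i. a * u i + b * w i) = (a * t + b) * \<sigma> w" by (simp only: scale[OF w])
      moreover have "\<sigma> u = t * \<sigma> w" unfolding t by (rule scale[OF w])
      ultimately show ?thesis by (simp add: algebra_simps)
    qed
  qed
  define e where "e j = (\<lambda>i. if i = j then 1 else 0 :: 'k)" for j :: nat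
  have exp: "\<sigma> (\<lambda>i. if i < m then v i else 0) = (\<Sum>i<m. \<sigma> (e i) * v i)" if "m \<le> Suc n" for m v
    using that
  proof (induction m)
    case 0
    then show ?case by (simp add: \<sigma>_def)
  next
    case (Suc m)
    have "(\<lambda>i. if i < Suc m then v i else 0) = (\<lambda>i. 1 * (\<lambda>i. if i < m then v i else 0) i + v m * e m i)"
      by (auto simp: e_def fun_eq_iff less_Suc_eq)
    then have "\<sigma> (\<lambda>i. if i < Suc m then v i else 0) = 1 * \<sigma> (\<lambda>i. if i < m then v i else 0) + v m * \<sigma> (e m)"
      using Suc.prems by (simp only:) (rule lin, auto simp: coord_space_def e_def)
    then show ?case using Suc by simp
  qed
  show ?thesis
  proof (intro exI[of _ "\<lambda>i. \<sigma> (e i)"] ballI)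
    fix p :: "'k point" and v assume pv: "p \<in> proj_space n" "v \<in> p"
    note P = proj_spaceE[OF pv]
    have "v = (\<lambda>i. if i < Suc n then v i else 0)" using P(2) unfolding coord_space_def by (auto simp: fun_eq_iff not_less)
    then have "\<sigma> v = (\<Sum>i<Suc n. \<sigma> (e i) * v i)" using exp[of "Suc n" v] by simp
    then show "s p v = (\<Sum>i<Suc n. \<sigma> (e i) * v i)" unfolding \<sigma>_def using P by simp
  qed
qed

text \<open>Any two points lie on a line, and on a line a section of degree 0 is constant.\<close>

lemma global_section_deg0:
  fixes s :: "'k::{alg_closed_field, field_char_0} point \<Rightarrow> 'k vect \<Rightarrow> 'k"
  assumes s: "twisted_regular n (proj_space n) 0 (proj_space n) s"
  shows "\<exists>a. \<forall>p\<in>proj_space n. \<forall>v\<in>p. s p v = a"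
proof -
  interpret proj_subset n "proj_space n :: 'k point set" by (rule proj_subset_whole)
  have eq: "s p v = s q w" if pv: "p \<in> proj_space n" "v \<in> p" and qw: "q \<in> proj_space n" "w \<in> q" for p q v w
  proof (cases "\<forall>a b. (\<forall>i. a * v i + b * w i = 0) \<longrightarrow> a = 0 \<and> b = 0")
    case True
    let ?L = "{point_of (\<lambda>i. a * v i + b * w i) | a b. a \<noteq> 0 \<or> b \<noteq> 0}"
    note P = proj_spaceE[OF pv] and Q = proj_spaceE[OF qw]
    have pl: "proj_line n v w ?L" by (rule independent_imp_proj_line[OF P(2) Q(2) True])
    show ?thesis using proj_line.section_deg0_const[OF pl tr_on_line[OF pl s]] P(1) Q(1) by simp
  next
    case False
    note P = proj_spaceE[OF pv] and Q = proj_spaceE[OF qw]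
    have h: "s q w = s p v" if pv: "p \<in> proj_space n" "v \<in> p" and qw: "q \<in> proj_space n" "w \<in> q" and t: "w = (\<lambda>i. t * v i)" for p q v w t
    proof -
      have "t \<noteq> 0" using proj_spaceE(3)[OF qw] t by auto
      then have "q = p" using proj_spaceE(1)[OF pv] proj_spaceE(1)[OF qw] unfolding t by (simp add: point_of_scale)
      then show ?thesis using tr_homogeneous[OF s pv \<open>t \<noteq> 0\<close> pv(1)] unfolding t by simp
    qed
    from dependent_vectors_cases[OF False] show ?thesis
    proof
      assume "\<exists>t. w = (\<lambda>i. t * v i)"
      then obtain t where "w = (\<lambda>i. t * v i)" by (elim exE)
      from h[OF pv qw this] show ?thesis by simp
    next
      assume "\<exists>t. v = (\<lambda>i. t * w i)"
      then obtain t where "v = (\<lambda>i. t * w i)" by (elim exE)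
      from h[OF qw pv this] show ?thesis by simp
    qed
  qed
  show ?thesis
  proof (cases "\<exists>p v. p \<in> proj_space n \<and> v \<in> (p :: 'k point)")
    case True
    then obtain p v where "p \<in> proj_space n" "v \<in> (p :: 'k point)" by blast
    then show ?thesis by (intro exI[of _ "s p v"] ballI) (rule eq)
  qed blast
qed

subsection \<open>Vector bundles\<close>

locale vbundle_on =
  fixes n r :: nat and E :: "('k::{alg_closed_field, field_char_0}, 'a) vbundle"
  assumes vb: "vector_bundle n (proj_space n) r E"
begin

sublocale proj_subset n "proj_space n :: 'k point set" by (rule proj_subset_whole)

lemma sections_restrict: "zopen n (proj_space n) U \<Longrightarrow> zopen n (proj_space n) V \<Longrightarrow> V \<subseteq> U \<Longrightarrow> s \<in> sections E U \<Longrightarrow> s \<in> sections E V"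
  using vb unfolding vector_bundle_def by blast

lemma sections_glue:
  "zopen n (proj_space n) U \<Longrightarrow> (\<And>p. p \<in> U \<Longrightarrow> \<exists>V. zopen n (proj_space n) V \<and> p \<in> V \<and> V \<subseteq> U \<and> s \<in> sections E V) \<Longrightarrow> s \<in> sections E U"
  using vb unfolding vector_bundle_def by blast

lemma frame_at:
  assumes "p \<in> proj_space n"
  obtains U e where "zopen n (proj_space n) U \<and> p \<in> U \<and> local_frame n (proj_space n) E r U e"
proof -
  have "\<forall>p\<in>proj_space n. \<exists>U e. zopen n (proj_space n) U \<and> p \<in> U \<and> local_frame n (proj_space n) E r U e"
    using vb unfolding vector_bundle_def by (elim conjE)
  from bspec[OF this assms] show thesis using that by (elim exE)
qed

lemma frame_fibre: "local_frame n (proj_space n) E r U e \<Longrightarrow> q \<in> U \<Longrightarrow> fibre E q = {(\<lambda>x. \<Sum>i<r. a i * e i q x) | a. True}"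
  unfolding local_frame_def by blast

lemma frame_indep: "local_frame n (proj_space n) E r U e \<Longrightarrow> q \<in> U \<Longrightarrow> (\<And>x. (\<Sum>i<r. a i * e i q x) = 0) \<Longrightarrow> i < r \<Longrightarrow> a i = 0"
  unfolding local_frame_def by blast

lemma frame_sections: "local_frame n (proj_space n) E r U e \<Longrightarrow> zopen n (proj_space n) W \<Longrightarrow> W \<subseteq> U \<Longrightarrow>
   s \<in> sections E W \<longleftrightarrow> (\<exists>f. (\<forall>i<r. regular_fun n (proj_space n) W (f i)) \<and> (\<forall>q\<in>W. s q = (\<lambda>x. \<Sum>i<r. f i q * e i q x)))"
  unfolding local_frame_def by blast

lemma lin_closed_fibre: assumes "p \<in> proj_space n" shows "lin_closed (fibre E p)"
proof -
  obtain U e where U: "zopen n (proj_space n) U \<and> p \<in> U \<and> local_frame n (proj_space n) E r U e" by (rule frame_at[OF assms])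
  then have f: "fibre E p = {(\<lambda>x. \<Sum>i<r. a i * e i p x) | a. True}" using frame_fibre by blast
  have comb: "(\<lambda>x. s * (\<Sum>i<r. a i * e i p x) + t * (\<Sum>i<r. b i * e i p x)) = (\<lambda>x. \<Sum>i<r. (s * a i + t * b i) * e i p x)" for a b s t
    by (simp add: sum_distrib_left sum.distrib algebra_simps)
  have "(\<lambda>x. s * u x + t * w x) \<in> fibre E p" if "u \<in> fibre E p" "w \<in> fibre E p" for u w s t
  proof -
    have uw: "u \<in> fibre E p" "w \<in> fibre E p" using that by simp_all
    obtain a b where "u = (\<lambda>x. \<Sum>i<r. a i * e i p x)" "w = (\<lambda>x. \<Sum>i<r. b i * e i p x)"
      using uw unfolding f by auto
    then have "(\<lambda>x. s * u x + t * w x) = (\<lambda>x. \<Sum>i<r. (s * a i + t * b i) * e i p x)" using comb by simp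
    then show ?thesis unfolding f by (intro CollectI exI[of _ "\<lambda>i. s * a i + t * b i"] conjI TrueI)
  qed
  moreover have "fibre E p \<noteq> {}" unfolding f by blast
  ultimately show ?thesis unfolding lin_closed_def by blast
qed

lemma section_in_fibre:
  assumes "zopen n (proj_space n) U" "s \<in> sections E U" "p \<in> U" shows "s p \<in> fibre E p"
proof -
  have pP: "p \<in> proj_space n" using zopen_subset[OF assms(1)] assms(3) by blast
  obtain U0 e where U0: "zopen n (proj_space n) U0 \<and> p \<in> U0 \<and> local_frame n (proj_space n) E r U0 e" by (rule frame_at[OF pP])
  have z: "zopen n (proj_space n) (U \<inter> U0)" using zopen_Int assms(1) U0 by blast
  have "s \<in> sections E (U \<inter> U0)" by (rule sections_restrict[OF assms(1) z _ assms(2)]) blast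
  then obtain f where "\<forall>q\<in>U \<inter> U0. s q = (\<lambda>x. \<Sum>i<r. f i q * e i q x)" using frame_sections[of U0 e, OF _ z] U0 by blast
  then have sp: "s p = (\<lambda>x. \<Sum>i<r. f i p * e i p x)" using U0 assms(3) by simp
  have "fibre E p = {(\<lambda>x. \<Sum>i<r. a i * e i p x) | a. True}" using U0 by (intro frame_fibre) auto
  then show ?thesis unfolding sp by (simp only:) (intro CollectI exI[of _ "\<lambda>i. f i p"] conjI refl TrueI)
qed

text \<open>That sections form a sheaf of modules over the regular functions is not part of the
  structure; it follows from gluing once everything is written in a local frame.\<close>

lemma sections_local_comb:
  assumes "zopen n (proj_space n) U"
    and "\<And>p. p \<in> U \<Longrightarrow> \<exists>V (m::nat) e f. zopen n (proj_space n) V \<and> p \<in> V \<and> V \<subseteq> U \<and> (\<forall>j<m. e j \<in> sections E V) \<and>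
       (\<forall>j<m. regular_fun n (proj_space n) V (f j)) \<and> (\<forall>q\<in>V. s q = (\<lambda>x. \<Sum>j<m. f j q * e j q x))"
  shows "s \<in> sections E U"
proof (rule sections_glue[OF assms(1)])
  fix p assume p: "p \<in> U"
  then have pP: "p \<in> proj_space n" using zopen_subset[OF assms(1)] by blast
  obtain V m e f where V: "zopen n (proj_space n) V \<and> p \<in> V \<and> V \<subseteq> U \<and> (\<forall>j<m. e j \<in> sections E V) \<and>
       (\<forall>j<m. regular_fun n (proj_space n) V (f j)) \<and> (\<forall>q\<in>V. s q = (\<lambda>x. \<Sum>j<(m::nat). f j q * e j q x))"
    using assms(2)[OF p] by (elim exE)
  obtain U0 b where U0: "zopen n (proj_space n) U0 \<and> p \<in> U0 \<and> local_frame n (proj_space n) E r U0 b" by (rule frame_at[OF pP])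
  let ?W = "V \<inter> U0"
  have z: "zopen n (proj_space n) ?W" using zopen_Int V U0 by blast
  have "\<exists>g. (\<forall>i<r. regular_fun n (proj_space n) ?W (g i)) \<and> (\<forall>q\<in>?W. e j q = (\<lambda>x. \<Sum>i<r. g i q * b i q x))" if "j < m" for j
  proof -
    have "e j \<in> sections E ?W" using V that by (intro sections_restrict[OF _ z, of V]) auto
    then show ?thesis using frame_sections[of U0 b, OF _ z] U0 by blast
  qed
  then have "\<forall>j. \<exists>g. j < m \<longrightarrow> (\<forall>i<r. regular_fun n (proj_space n) ?W (g i)) \<and> (\<forall>q\<in>?W. e j q = (\<lambda>x. \<Sum>i<r. g i q * b i q x))"
    by blast
  from choice[OF this] obtain g where gg: "\<forall>j. j < m \<longrightarrow> (\<forall>i<r. regular_fun n (proj_space n) ?W (g j i)) \<and> (\<forall>q\<in>?W. e j q = (\<lambda>x. \<Sum>i<r. g j i q * b i q x))"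
    by (elim exE)
  then have g: "\<And>j i. j < m \<Longrightarrow> i < r \<Longrightarrow> regular_fun n (proj_space n) ?W (g j i)"
    "\<And>j q. j < m \<Longrightarrow> q \<in> ?W \<Longrightarrow> e j q = (\<lambda>x. \<Sum>i<r. g j i q * b i q x)" by (simp_all only: simp_thms)
  have "s \<in> sections E ?W"
  proof (subst frame_sections[of U0 b, OF _ z])
    show "\<exists>h. (\<forall>i<r. regular_fun n (proj_space n) ?W (h i)) \<and> (\<forall>q\<in>?W. s q = (\<lambda>x. \<Sum>i<r. h i q * b i q x))"
    proof (intro exI[of _ "\<lambda>i q. \<Sum>j<m. f j q * g j i q"] conjI allI impI ballI)
      fix i assume i: "i < r"
      have "twisted_regular n (proj_space n) 0 ?W (\<lambda>p v. f j p * g j i p)" if "j < m" for j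
      proof -
        have "twisted_regular n (proj_space n) 0 ?W (\<lambda>p v. f j p)"
          using V that unfolding regular_fun_def by (intro tr_subset[OF _ z, of _ V]) auto
        from tr_mult[OF this g(1)[OF that i, unfolded regular_fun_def]] show ?thesis by simp
      qed
      then show "regular_fun n (proj_space n) ?W (\<lambda>q. \<Sum>j<m. f j q * g j i q)"
        unfolding regular_fun_def by (intro tr_sum[OF z]) auto
    next
      fix q assume q: "q \<in> ?W"
      have "s q = (\<lambda>x. \<Sum>j<m. f j q * (\<Sum>i<r. g j i q * b i q x))" using V q g(2) by simp
      also have "\<dots> = (\<lambda>x. \<Sum>i<r. (\<Sum>j<m. f j q * g j i q) * b i q x)"
        by (simp add: sum_distrib_left sum_distrib_right mult.assoc) (subst sum.swap, simp)
      finally show "s q = (\<lambda>x. \<Sum>i<r. (\<Sum>j<m. f j q * g j i q) * b i q x)" .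
    qed
  qed (use U0 in auto)
  then show "\<exists>V. zopen n (proj_space n) V \<and> p \<in> V \<and> V \<subseteq> U \<and> s \<in> sections E V"
    using z p V U0 by (intro exI[of _ ?W]) auto
qed

lemma sections_comb2:
  assumes U: "zopen n (proj_space n) U" and s: "s \<in> sections E U" "t \<in> sections E U"
    and fg: "regular_fun n (proj_space n) U f" "regular_fun n (proj_space n) U g"
    and w: "\<And>q. q \<in> U \<Longrightarrow> w q = (\<lambda>x. f q * s q x + g q * t q x)"
  shows "w \<in> sections E U"
proof (rule sections_local_comb[OF U])
  fix p assume p: "p \<in> U"
  let ?e = "\<lambda>j::nat. if j = 0 then s else t" and ?f = "\<lambda>j::nat. if j = 0 then f else g"
  have "w q = (\<lambda>x. \<Sum>j<2. ?f j q * ?e j q x)" if "q \<in> U" for q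
    using w[OF that] by (simp add: numeral_2_eq_2)
  then show "\<exists>V (m::nat) e f. zopen n (proj_space n) V \<and> p \<in> V \<and> V \<subseteq> U \<and> (\<forall>j<m. e j \<in> sections E V) \<and>
       (\<forall>j<m. regular_fun n (proj_space n) V (f j)) \<and> (\<forall>q\<in>V. w q = (\<lambda>x. \<Sum>j<m. f j q * e j q x))"
    using U p s fg by (intro exI[of _ U] exI[of _ "2::nat"] exI[of _ ?e] exI[of _ ?f]) auto
qed

text \<open>Constant coefficients in a local frame. This is how statements about sections, exactness
  above all, are brought down to fibres.\<close>

lemma fibre_extends_to_section:
  assumes "p \<in> proj_space n" "y \<in> fibre E p"
  shows "\<exists>U s. zopen n (proj_space n) U \<and> p \<in> U \<and> s \<in> sections E U \<and> s p = y"
proof -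
  obtain U e where U: "zopen n (proj_space n) U \<and> p \<in> U \<and> local_frame n (proj_space n) E r U e" by (rule frame_at[OF assms(1)])
  then have "fibre E p = {(\<lambda>x. \<Sum>i<r. a i * e i p x) | a. True}" by (intro frame_fibre) auto
  then obtain a where a: "y = (\<lambda>x. \<Sum>i<r. a i * e i p x)" using assms(2) by auto
  have "(\<lambda>q x. \<Sum>i<r. a i * e i q x) \<in> sections E U"
  proof (subst frame_sections[of U e U])
    show "\<exists>f. (\<forall>i<r. regular_fun n (proj_space n) U (f i)) \<and>
        (\<forall>q\<in>U. (\<lambda>x. \<Sum>i<r. a i * e i q x) = (\<lambda>x. \<Sum>i<r. f i q * e i q x))"
      using U tr_const unfolding regular_fun_def by (intro exI[of _ "\<lambda>i q. a i"]) auto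
  qed (use U in auto)
  then show ?thesis using U a by (intro exI[of _ U] exI[of _ "\<lambda>q x. \<Sum>i<r. a i * e i q x"]) auto
qed

end

text \<open>The fibre of the trivial bundle of rank \<open>N\<close> at \<open>p\<close> consists of
  functions on pairs that are constant along \<open>p\<close>; \<open>emb N p\<close> identifies it
  with the constant vectors of length \<open>N\<close>.\<close>

definition emb :: "nat \<Rightarrow> 'k::field point \<Rightarrow> (nat \<Rightarrow> 'k) \<Rightarrow> nat \<times> 'k vect \<Rightarrow> 'k" where
  "emb N p x = (\<lambda>(l,v). if l < N \<and> v \<in> p then x l else 0)"

definition rep :: "'k::field point \<Rightarrow> 'k vect" where
  "rep p = (SOME v. v \<in> p)"

definition unit_vect :: "nat \<Rightarrow> nat \<Rightarrow> 'k::field" where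
  "unit_vect l = (\<lambda>m. if m = l then 1 else 0)"

lemma rep_in: "p \<in> proj_space n \<Longrightarrow> rep p \<in> p"
  unfolding rep_def using proj_space_nonempty by (rule someI_ex)

lemma emb_expand:
  fixes p :: "'k::field point"
  shows "emb N p x = (\<lambda>y. \<Sum>l<N. x l * emb N p (unit_vect l) y)"
proof
  fix y :: "nat \<times> 'k vect"
  obtain m v where y: "y = (m, v)" by (cases y)
  have "(\<Sum>l<N. x l * emb N p (unit_vect l) y) = (\<Sum>l<N. if m = l then (if m < N \<and> v \<in> p then x m else 0) else 0)"
    by (intro sum.cong refl) (auto simp: y emb_def unit_vect_def)
  then show "emb N p x y = (\<Sum>l<N. x l * emb N p (unit_vect l) y)" by (simp add: y emb_def sum.delta')
qed

lemma emb_cong: "(\<And>l. l < N \<Longrightarrow> x l = y l) \<Longrightarrow> emb N p x = emb N p y"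
  unfolding emb_def by (auto simp: fun_eq_iff)

lemma emb_apply: "l < N \<Longrightarrow> v \<in> p \<Longrightarrow> emb N p x (l, v) = x l"
  unfolding emb_def by simp

lemma emb_in_fibre:
  assumes "p \<in> proj_space n"
  shows "emb N p x \<in> fibre (power_bundle N (twist_bundle n X 0)) p"
  unfolding direct_sum_def twist_bundle_def emb_def using scale_in_point[OF assms] by simp

lemma power_trivial_fibre_emb:
  assumes p: "p \<in> proj_space n" and u: "u \<in> fibre (power_bundle N (twist_bundle n X 0)) p" and v: "v \<in> p"
  shows "u = emb N p (\<lambda>l. u (l,v))"
proof (rule ext, clarify)
  fix l w
  show "u (l, w) = emb N p (\<lambda>l. u (l, v)) (l, w)"
  proof (cases "l < N \<and> w \<in> p")
    case True
    then obtain t where t: "t \<noteq> 0" "w = (\<lambda>i. t * v i)" using same_point[OF p v] by blast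
    have "u (l, \<lambda>i. t * v i) = t powi 0 * u (l, v)"
      using u True v t(1) unfolding direct_sum_def twist_bundle_def by simp
    then show ?thesis using True t by (simp add: emb_def)
  next
    case False
    then have "u (l, w) = 0" using u unfolding direct_sum_def twist_bundle_def by (cases "l < N") auto
    then show ?thesis using False by (auto simp: emb_def)
  qed
qed

context proj_subset
begin

lemma emb_section:
  assumes "\<And>l. l < N \<Longrightarrow> twisted_regular n X 0 U (\<lambda>p v. x p l)"
  shows "(\<lambda>p. emb N p (x p)) \<in> sections (power_bundle N (twist_bundle n X 0)) U"
  unfolding direct_sum_def twist_bundle_def
  by (auto simp: emb_def intro: tr_cong[OF assms])

lemma power_trivial_section:
  assumes "t \<in> sections (power_bundle N (twist_bundle n X d)) U" "l < N"
  shows "twisted_regular n X d U (\<lambda>p v. t p (l, v))"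
  using assms unfolding direct_sum_def twist_bundle_def by auto

lemma power_section_fibre:
  assumes "t \<in> sections (power_bundle N (twist_bundle n X d)) U" "zopen n X U" "p \<in> U"
  shows "t p \<in> fibre (power_bundle N (twist_bundle n X d)) p"
proof -
  have pX: "p \<in> X" using zopen_subset[OF assms(2)] assms(3) by blast
  have "t p (l, \<lambda>i. a * v i) = a powi d * t p (l, v)" if "l < N" "v \<in> p" "a \<noteq> 0" for l v a
    using tr_homogeneous[OF power_trivial_section[OF assms(1) that(1)] assms(3) that(2,3) pX] .
  then show ?thesis using assms(1,3) unfolding direct_sum_def twist_bundle_def by auto
qed

end

lemma lin_closed_power_twist: "lin_closed (fibre (power_bundle N (twist_bundle n X d)) p)"
  by (intro lin_closed_direct_sum lin_closed_twist)

subsection \<open>The matrix of a Steiner bundle\<close>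

locale steiner_sequence = vbundle_on n r E
  for n r :: nat and E :: "('k::{alg_closed_field, field_char_0}, 'a) vbundle" +
  fixes c :: nat and \<iota> :: "'k point \<Rightarrow> ('a \<Rightarrow> 'k) \<Rightarrow> (nat \<times> 'k vect \<Rightarrow> 'k)"
    and \<pi> :: "'k point \<Rightarrow> (nat \<times> 'k vect \<Rightarrow> 'k) \<Rightarrow> (nat \<times> 'k vect \<Rightarrow> 'k)"
  assumes exact: "short_exact n (proj_space n) E
        (power_bundle (r + c) (twist_bundle n (proj_space n) 0))
        (power_bundle c (twist_bundle n (proj_space n) 1)) \<iota> \<pi>"
begin

abbreviation "N \<equiv> r + c"
abbreviation "FF \<equiv> power_bundle N (twist_bundle n (proj_space n :: 'k point set) 0)"
abbreviation "GG \<equiv> power_bundle c (twist_bundle n (proj_space n :: 'k point set) 1)"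

lemma hom_iota: "bundle_hom n (proj_space n) E FF \<iota>"
  using exact unfolding short_exact_def by (elim conjE)

lemma hom_pi: "bundle_hom n (proj_space n) FF GG \<pi>"
  using exact unfolding short_exact_def by (elim conjE)

lemma exact_middle: "zopen n (proj_space n) U \<Longrightarrow> t \<in> sections FF U \<Longrightarrow>
   (\<forall>p\<in>U. \<pi> p (t p) = (\<lambda>_. 0)) \<longleftrightarrow> (\<exists>s\<in>sections E U. \<forall>p\<in>U. \<iota> p (s p) = t p)"
  using exact unfolding short_exact_def by blast

lemma exact_right: "zopen n (proj_space n) U \<Longrightarrow> w \<in> sections GG U \<Longrightarrow> p \<in> U \<Longrightarrow>
   \<exists>V t. zopen n (proj_space n) V \<and> p \<in> V \<and> V \<subseteq> U \<and> t \<in> sections FF V \<and> (\<forall>q\<in>V. \<pi> q (t q) = w q)"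
  using exact unfolding short_exact_def by blast

text \<open>The image of the constant section \<open>unit_vect l\<close> consists of
  \<open>c\<close> global sections of O(1), hence of linear forms; linearity of \<open>\<pi>\<close>
  on fibres does the rest.\<close>

lemma pi_linear_forms: "\<exists>\<Phi>. \<forall>p\<in>proj_space n. \<forall>v\<in>p. \<forall>x. \<forall>k<c. \<pi> p (emb N p x) (k, v) = (\<Sum>l<N. ev n \<Phi> v k l * x l)"
proof -
  have "\<exists>a. \<forall>p\<in>proj_space n. \<forall>v\<in>p. \<pi> p (emb N p (unit_vect l)) (k, v) = (\<Sum>i<Suc n. a i * v i)" if "k < c" for k l
  proof (rule global_section_deg1)
    have "(\<lambda>p. emb N p (unit_vect l)) \<in> sections FF (proj_space n)"
      by (rule emb_section) (rule tr_const[OF zopen_whole])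
    from hom_sections[OF hom_pi zopen_whole this]
    show "twisted_regular n (proj_space n) 1 (proj_space n) (\<lambda>p v. \<pi> p (emb N p (unit_vect l)) (k, v))"
      using power_trivial_section that by blast
  qed
  then have "\<forall>k l. \<exists>a. k < c \<longrightarrow> (\<forall>p\<in>proj_space n. \<forall>v\<in>p. \<pi> p (emb N p (unit_vect l)) (k, v) = (\<Sum>i<Suc n. a i * v i))"
    by blast
  then obtain \<Phi> where \<Phi>: "\<forall>k l. k < c \<longrightarrow> (\<forall>p\<in>proj_space n. \<forall>v\<in>p. \<pi> p (emb N p (unit_vect l)) (k, v) = (\<Sum>i<Suc n. \<Phi> k l i * v i))"
    by (simp only: choice_iff) (elim exE)
  show ?thesis
  proof (intro exI[of _ \<Phi>] ballI allI impI)
    fix p :: "'k point" and v x k assume p: "p \<in> proj_space n" and v: "v \<in> p" and k: "k < c"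
    have "\<pi> p (emb N p x) = \<pi> p (\<lambda>y. \<Sum>l<N. x l * emb N p (unit_vect l) y)" by (subst emb_expand) rule
    also have "\<dots> = (\<lambda>y. \<Sum>l<N. x l * \<pi> p (emb N p (unit_vect l)) y)"
      by (rule lin_on_sum[OF lin_closed_power_twist hom_lin_on[OF hom_pi p]]) (rule emb_in_fibre[OF p])
    finally show "\<pi> p (emb N p x) (k, v) = (\<Sum>l<N. ev n \<Phi> v k l * x l)"
      using \<Phi> p v k by (simp add: ev_def mult.commute)
  qed
qed

definition Phi :: "nat \<Rightarrow> nat \<Rightarrow> nat \<Rightarrow> 'k" where
  "Phi = (SOME \<Phi>. \<forall>p\<in>proj_space n. \<forall>v\<in>p. \<forall>x. \<forall>k<c. \<pi> p (emb N p x) (k, v) = (\<Sum>l<N. ev n \<Phi> v k l * x l))"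

lemma pi_emb: "p \<in> proj_space n \<Longrightarrow> v \<in> p \<Longrightarrow> k < c \<Longrightarrow> \<pi> p (emb N p x) (k, v) = (\<Sum>l<N. ev n Phi v k l * x l)"
  using someI_ex[OF pi_linear_forms] unfolding Phi_def[symmetric] by blast

lemma pi_emb_eq_zero_iff:
  assumes p: "p \<in> proj_space n" "v \<in> p"
  shows "\<pi> p (emb N p x) = (\<lambda>_. 0) \<longleftrightarrow> (\<forall>k<c. (\<Sum>l<N. ev n Phi v k l * x l) = 0)"
proof
  assume "\<pi> p (emb N p x) = (\<lambda>_. 0)"
  then show "\<forall>k<c. (\<Sum>l<N. ev n Phi v k l * x l) = 0" using pi_emb[OF p, of _ x] by (metis (full_types))
next
  assume z: "\<forall>k<c. (\<Sum>l<N. ev n Phi v k l * x l) = 0"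
  have f: "\<pi> p (emb N p x) \<in> fibre GG p" by (rule hom_fibre[OF hom_pi p(1) emb_in_fibre[OF p(1)]])
  show "\<pi> p (emb N p x) = (\<lambda>_. 0)"
  proof (rule ext, clarify)
    fix k w
    show "\<pi> p (emb N p x) (k, w) = 0"
    proof (cases "k < c \<and> w \<in> p")
      case True
      then obtain t where t: "w = (\<lambda>i. t * v i)" using same_point[OF p] by blast
      have "ev n Phi w k l = t * ev n Phi v k l" for l unfolding t ev_def by (simp add: sum_distrib_left algebra_simps)
      then have "\<pi> p (emb N p x) (k, w) = t * (\<Sum>l<N. ev n Phi v k l * x l)"
        using True pi_emb[OF p(1), of w k x] by (simp add: sum_distrib_left mult.assoc)
      then show ?thesis using z True by simp
    next
      case False
      then show ?thesis using f unfolding direct_sum_def twist_bundle_def by (cases "k < c") auto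
    qed
  qed
qed

text \<open>Exactness concerns sections, so the vector \<open>y\<close> is first extended to a
  section near \<open>p\<close>.\<close>

lemma pi_iota: assumes "p \<in> proj_space n" "y \<in> fibre E p" shows "\<pi> p (\<iota> p y) = (\<lambda>_. 0)"
proof -
  obtain U s where U: "zopen n (proj_space n) U" "p \<in> U" "s \<in> sections E U" "s p = y"
    using fibre_extends_to_section[OF assms] by blast
  have "(\<lambda>p. \<iota> p (s p)) \<in> sections FF U" by (rule hom_sections[OF hom_iota U(1,3)])
  then have "\<forall>q\<in>U. \<pi> q (\<iota> q (s q)) = (\<lambda>_. 0)" using exact_middle[OF U(1)] U(3) by blast
  then show ?thesis using U(2,4) by blast
qed

text \<open>The section of O(1) given by the coordinate \<open>i0\<close>, placed at position
  \<open>k\<close>, lifts locally through \<open>\<pi>\<close>. The coefficient vectors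
  \<open>T q k\<close> of these lifts form a right inverse of \<open>A v\<close> up to the factor
  \<open>v i0\<close>, with regular entries.\<close>

lemma local_lifts:
  assumes p: "p \<in> proj_space n"
  shows "\<exists>V T i0. zopen n (proj_space n) V \<and> p \<in> V \<and> i0 < Suc n \<and> (\<forall>q\<in>V. \<forall>v\<in>q. v i0 \<noteq> 0) \<and>
    (\<forall>k<c. \<forall>l<N. twisted_regular n (proj_space n) 0 V (\<lambda>q v. T q k l)) \<and>
    (\<forall>q\<in>V. \<forall>v\<in>q. \<forall>j<c. \<forall>k<c. (\<Sum>l<N. ev n Phi v j l * T q k l) = (if j = k then v i0 else 0))"
proof -
  obtain i0 where i0: "i0 < Suc n" "rep p i0 \<noteq> 0" using proj_space_coord_nonzero[OF p rep_in[OF p]] by blast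
  have "\<exists>V t. zopen n (proj_space n) V \<and> p \<in> V \<and> t \<in> sections FF V \<and>
     (\<forall>q\<in>V. \<pi> q (t q) = (\<lambda>(j,v). if v \<in> q \<and> j = k \<and> j < c then v i0 else 0))" for k
  proof -
    have "(\<lambda>q (j,v). if v \<in> q \<and> j = k \<and> j < c then v i0 else 0) \<in> sections GG (proj_space n)"
    proof -
      have "twisted_regular n (proj_space n) 1 (proj_space n) (\<lambda>(q :: 'k point) v. if v \<in> q \<and> j = k then v i0 else 0)" for j
      proof (cases "j = k")
        case True
        have "twisted_regular n (proj_space n) 1 (proj_space n) (\<lambda>(q :: 'k point) v. v i0)"
          using tr_form[OF form.var[of i0 n] zopen_whole] i0 by simp
        then show ?thesis by (rule tr_cong) (use True in auto)
      next
        case False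
        show ?thesis by (rule tr_cong[OF tr_zero[OF zopen_whole]]) (use False in auto)
      qed
      then show ?thesis unfolding direct_sum_def twist_bundle_def by auto
    qed
    from exact_right[OF zopen_whole this p] show ?thesis by blast
  qed
  then have "\<forall>k. \<exists>V. \<exists>t. zopen n (proj_space n) V \<and> p \<in> V \<and> t \<in> sections FF V \<and>
     (\<forall>q\<in>V. \<pi> q (t q) = (\<lambda>(j,v). if v \<in> q \<and> j = k \<and> j < c then v i0 else 0))" by (intro allI)
  from choice[OF this] obtain V where "\<forall>k. \<exists>t. zopen n (proj_space n) (V k) \<and> p \<in> V k \<and> t \<in> sections FF (V k) \<and>
     (\<forall>q\<in>V k. \<pi> q (t q) = (\<lambda>(j,v). if v \<in> q \<and> j = k \<and> j < c then v i0 else 0))" by (elim exE)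
  from choice[OF this] obtain t where Vt: "\<forall>k. zopen n (proj_space n) (V k) \<and> p \<in> V k \<and> t k \<in> sections FF (V k) \<and>
     (\<forall>q\<in>V k. \<pi> q (t k q) = (\<lambda>(j,v). if v \<in> q \<and> j = k \<and> j < c then v i0 else 0))" by (elim exE)
  define W where "W = {q\<in>proj_space n. \<exists>v\<in>q. v i0 \<noteq> 0} \<inter> (proj_space n \<inter> (\<Inter>k<c. V k))"
  have zW: "zopen n (proj_space n) W" unfolding W_def
    by (intro zopen_Int zopen_basic[OF form.var] zopen_Inter_finite) (use Vt i0 in auto)
  have pW: "p \<in> W" unfolding W_def using p i0(2) rep_in[OF p] Vt by blast
  have nz: "v i0 \<noteq> 0" if "q \<in> W" "v \<in> q" for q v
    using form_nonzero_on_point[OF form.var[of i0 n], of q _ v] i0 that unfolding W_def by auto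
  have WV: "W \<subseteq> V k" if "k < c" for k unfolding W_def using that by blast
  have WP: "W \<subseteq> proj_space n" unfolding W_def by blast
  have tk: "t k q = emb N q (\<lambda>l. t k q (l, v))" if "k < c" "q \<in> W" "v \<in> q" for k q v
  proof (rule power_trivial_fibre_emb)
    show "q \<in> proj_space n" using that WP by blast
    show "t k q \<in> fibre FF q" by (rule power_section_fibre[of _ _ _ "V k"]) (use Vt WV that in blast)+
  qed (rule that)
  define T where "T q k l = t k q (l, rep q)" for q k l
  have T: "t k q = emb N q (T q k)" if "k < c" "q \<in> W" for k q
    unfolding T_def by (rule tk) (use that WP rep_in in blast)+
  have "twisted_regular n (proj_space n) 0 W (\<lambda>q v. T q k l)" if "k < c" "l < N" for k l
  proof (rule tr_cong)
    show "twisted_regular n (proj_space n) 0 W (\<lambda>q v. t k q (l, v))"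
      by (rule tr_subset[OF power_trivial_section zW WV[OF that(1)]]) (use Vt that in blast)+
    show "t k q (l, v) = T q k l" if "q \<in> W" "v \<in> q" for q v
      using T[OF \<open>k < c\<close> that(1)] emb_apply[OF \<open>l < N\<close> that(2), of "T q k"] by simp
  qed
  moreover have "(\<Sum>l<N. ev n Phi v j l * T q k l) = (if j = k then v i0 else 0)" if "q \<in> W" "v \<in> q" "j < c" "k < c" for q v j k
  proof -
    have qP: "q \<in> proj_space n" using that WP by blast
    have "(\<Sum>l<N. ev n Phi v j l * T q k l) = \<pi> q (emb N q (T q k)) (j, v)" using pi_emb[OF qP that(2,3)] by simp
    also have "\<dots> = \<pi> q (t k q) (j, v)" using T[OF that(4,1)] by simp
    also have "\<dots> = (if j = k then v i0 else 0)" using Vt WV[OF that(4)] that by auto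
    finally show ?thesis .
  qed
  ultimately show ?thesis using zW pW i0(1) nz by blast
qed

text \<open>Surjectivity of the sheaf map, read off at one point from the local lifts.\<close>

lemma pointwise_indep:
  assumes "p \<in> proj_space n" "v \<in> p"
  shows "indep_rows c N (ev n Phi v)"
proof -
  obtain V T i0 where VT: "zopen n (proj_space n) V \<and> p \<in> V \<and> i0 < Suc n \<and> (\<forall>q\<in>V. \<forall>v\<in>q. v i0 \<noteq> 0) \<and>
    (\<forall>k<c. \<forall>l<N. twisted_regular n (proj_space n) 0 V (\<lambda>q v. T q k l)) \<and>
    (\<forall>q\<in>V. \<forall>v\<in>q. \<forall>j<c. \<forall>k<c. (\<Sum>l<N. ev n Phi v j l * T q k l) = (if j = k then v i0 else 0))"
    using local_lifts[OF assms(1)] by (elim exE)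
  then have v0: "v i0 \<noteq> 0" and T: "\<forall>j<c. \<forall>k<c. (\<Sum>l<N. ev n Phi v j l * T p k l) = (if j = k then v i0 else 0)"
    using assms(2) by blast+
  show ?thesis
  proof (rule right_inverse_imp_indep_rows)
    fix j k assume jk: "j < c" "k < c"
    have "(\<Sum>l<N. ev n Phi v j l * (T p k l / v i0)) = (\<Sum>l<N. ev n Phi v j l * T p k l) / v i0"
      by (simp add: sum_divide_distrib)
    then show "(\<Sum>l<N. ev n Phi v j l * (T p k l / v i0)) = (if j = k then 1 else 0)" using T jk v0 by simp
  qed
qed

text \<open>Exactness at a single fibre. The constant section \<open>x\<close> lies in the kernel
  only at \<open>p\<close>; corrected by local lifts it becomes a section of the kernel that still
  takes the value \<open>x\<close> at \<open>p\<close>.\<close>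

lemma kernel_in_image:
  assumes p: "p \<in> proj_space n" "v0 \<in> p" and x: "\<And>k. k < c \<Longrightarrow> (\<Sum>l<N. ev n Phi v0 k l * x l) = 0"
  shows "\<exists>y\<in>fibre E p. \<iota> p y = emb N p x"
proof -
  obtain V T i0 where VT: "zopen n (proj_space n) V \<and> p \<in> V \<and> i0 < Suc n \<and> (\<forall>q\<in>V. \<forall>v\<in>q. v i0 \<noteq> 0) \<and>
    (\<forall>k<c. \<forall>l<N. twisted_regular n (proj_space n) 0 V (\<lambda>q v. T q k l)) \<and>
    (\<forall>q\<in>V. \<forall>v\<in>q. \<forall>j<c. \<forall>k<c. (\<Sum>l<N. ev n Phi v j l * T q k l) = (if j = k then v i0 else 0))"
    using local_lifts[OF p(1)] by (elim exE)
  then have zV: "zopen n (proj_space n) V" and pV: "p \<in> V" and i0: "i0 < Suc n" and nz: "\<And>q v. q \<in> V \<Longrightarrow> v \<in> q \<Longrightarrow> v i0 \<noteq> 0"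
    and Treg: "\<And>k l. k < c \<Longrightarrow> l < N \<Longrightarrow> twisted_regular n (proj_space n) 0 V (\<lambda>q v. T q k l)"
    and T: "\<And>q v j k. q \<in> V \<Longrightarrow> v \<in> q \<Longrightarrow> j < c \<Longrightarrow> k < c \<Longrightarrow> (\<Sum>l<N. ev n Phi v j l * T q k l) = (if j = k then v i0 else 0)"
    by blast+
  \<comment> \<open>The defect \<open>A v x\<close> divided by the coordinate \<open>i0\<close>: it
    is regular of degree 0, vanishes at \<open>p\<close>, and subtracting \<open>b\<close> times the
    lifts removes the defect nearby.\<close>
  define b where "b v k = (\<Sum>m<N. ev n Phi v k m * x m) / v i0" for v k
  define Z where "Z q v l = x l - (\<Sum>k<c. b v k * T q k l)" for q v l
  have breg: "twisted_regular n (proj_space n) 0 V (\<lambda>q v. b v k)" for k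
  proof -
    have "form n 1 (\<lambda>v. \<Sum>i<Suc n. (\<Sum>m<N. Phi k m i * x m) * v i)" by (rule form_linear)
    moreover have "(\<Sum>i<Suc n. (\<Sum>m<N. Phi k m i * x m) * v i) = (\<Sum>m<N. ev n Phi v k m * x m)" for v
      unfolding ev_def sum_distrib_right by (subst sum.swap) (simp add: mult.assoc mult.commute mult.left_commute)
    ultimately have "form n 1 (\<lambda>v. \<Sum>m<N. ev n Phi v k m * x m)" by simp
    then show ?thesis unfolding b_def by (rule tr_quotient[OF _ form.var[of i0 n]]) (use i0 zV nz in auto)
  qed
  have Zreg: "twisted_regular n (proj_space n) 0 V (\<lambda>q v. Z q v l)" if "l < N" for l
  proof -
    have "twisted_regular n (proj_space n) 0 V (\<lambda>q v. b v k * T q k l)" if "k < c" for k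
      using tr_mult[OF breg Treg[OF that \<open>l < N\<close>]] by simp
    then have "twisted_regular n (proj_space n) 0 V (\<lambda>q v. x l + (-1) * (\<Sum>k<c. b v k * T q k l))"
      by (intro tr_add tr_const tr_scale tr_sum zV) auto
    then show ?thesis unfolding Z_def by simp
  qed
  define s where "s q = emb N q (Z q (rep q))" for q
  have VP: "V \<subseteq> proj_space n" by (rule zopen_subset[OF zV])
  have sec: "s \<in> sections FF V"
    unfolding s_def
  proof (rule emb_section)
    fix l assume l: "l < N"
    show "twisted_regular n (proj_space n) 0 V (\<lambda>q v. Z q (rep q) l)"
    proof (rule tr_cong[OF Zreg[OF l]])
      fix q v assume q: "q \<in> V" "v \<in> q"
      then have qP: "q \<in> proj_space n" using VP by blast
      obtain t where t: "t \<noteq> 0" "rep q = (\<lambda>i. t * v i)" using same_point[OF qP q(2) rep_in[OF qP]] by blast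
      show "Z q v l = Z q (rep q) l" unfolding t(2) using tr_homogeneous[OF Zreg[OF l] q t(1) qP] by simp
    qed
  qed
  have ker: "\<pi> q (s q) = (\<lambda>_. 0)" if q: "q \<in> V" for q
  proof -
    have qP: "q \<in> proj_space n" using q VP by blast
    note rq = rep_in[OF qP]
    have "(\<Sum>l<N. ev n Phi (rep q) j l * Z q (rep q) l) = 0" if j: "j < c" for j
    proof -
      have "(\<Sum>l<N. ev n Phi (rep q) j l * Z q (rep q) l) =
         (\<Sum>l<N. ev n Phi (rep q) j l * x l) - (\<Sum>k<c. b (rep q) k * (\<Sum>l<N. ev n Phi (rep q) j l * T q k l))"
      proof -
        have "(\<Sum>l<N. ev n Phi (rep q) j l * (\<Sum>k<c. b (rep q) k * T q k l)) = (\<Sum>k<c. b (rep q) k * (\<Sum>l<N. ev n Phi (rep q) j l * T q k l))"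
          unfolding sum_distrib_left by (subst sum.swap) (simp add: mult.left_commute)
        then show ?thesis unfolding Z_def right_diff_distrib sum_subtractf by simp
      qed
      also have "(\<Sum>k<c. b (rep q) k * (\<Sum>l<N. ev n Phi (rep q) j l * T q k l)) = (\<Sum>k<c. if j = k then b (rep q) k * rep q i0 else 0)"
        by (intro sum.cong refl) (use T[OF q rq j] in auto)
      also have "\<dots> = (\<Sum>l<N. ev n Phi (rep q) j l * x l)" using j nz[OF q rq] by (simp add: sum.delta' b_def)
      finally show ?thesis by simp
    qed
    then show ?thesis unfolding s_def using pi_emb_eq_zero_iff[OF qP rq] by blast
  qed
  then obtain s' where s': "s' \<in> sections E V" "\<forall>q\<in>V. \<iota> q (s' q) = s q" using exact_middle[OF zV sec] by blast
  have "s p = emb N p x"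
    unfolding s_def
  proof (rule emb_cong)
    fix l
    obtain t where t: "rep p = (\<lambda>i. t * v0 i)" using same_point[OF p rep_in[OF p(1)]] by blast
    have "ev n Phi (rep p) k m = t * ev n Phi v0 k m" for k m unfolding t ev_def by (simp add: sum_distrib_left algebra_simps)
    then have "b (rep p) k = 0" if "k < c" for k
      using x[OF that] by (simp add: b_def mult.assoc sum_distrib_left[symmetric])
    then show "Z p (rep p) l = x l" unfolding Z_def by simp
  qed
  then show ?thesis using s' pV section_in_fibre[OF zV s'(1) pV] by (intro bexI[of _ "s' p"]) auto
qed

end

text \<open>Any unit vector minus its \<open>Y\<close>-part lies in the kernel of \<open>Q\<close>,
  so \<open>z\<close> is determined by its values on the columns of the right inverse
  \<open>Y\<close>; these values are the coefficients.\<close>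

lemma vanishing_on_kernel_imp_in_row_span:
  fixes Q :: "nat \<Rightarrow> nat \<Rightarrow> 'k::field"
  assumes Q: "indep_rows c N Q"
    and z: "\<And>x. (\<And>k. k < c \<Longrightarrow> (\<Sum>l<N. Q k l * x l) = 0) \<Longrightarrow> (\<Sum>l<N. z l * x l) = 0"
  shows "\<exists>h. \<forall>l<N. z l = (\<Sum>k<c. h k * Q k l)"
proof -
  obtain Y where Y: "\<And>k j. k < c \<Longrightarrow> j < c \<Longrightarrow> (\<Sum>l<N. Q k l * Y l j) = (if k = j then 1 else 0)"
    using indep_rows_right_inverse[OF Q] by blast
  show ?thesis
  proof (intro exI[of _ "\<lambda>k. \<Sum>l<N. z l * Y l k"] allI impI)
    fix m assume m: "m < N"
    define x where "x l = (if l = m then 1 else 0) - (\<Sum>k<c. Y l k * Q k m)" for l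
    have e: "(\<Sum>l<N. f l * x l) = f m - (\<Sum>k<c. (\<Sum>l<N. f l * Y l k) * Q k m)" for f
    proof -
      have "(\<Sum>l<N. f l * (\<Sum>k<c. Y l k * Q k m)) = (\<Sum>k<c. (\<Sum>l<N. f l * Y l k) * Q k m)"
        by (simp add: sum_distrib_left sum_distrib_right mult.assoc) (subst sum.swap, simp)
      then show ?thesis using m unfolding x_def right_diff_distrib sum_subtractf by (simp add: if_distrib cong: if_cong)
    qed
    have "(\<Sum>l<N. Q j l * x l) = 0" if j: "j < c" for j
    proof -
      have "(\<Sum>k<c. (\<Sum>l<N. Q j l * Y l k) * Q k m) = (\<Sum>k<c. if j = k then Q k m else 0)"
        by (intro sum.cong refl) (use Y j in auto)
      then show ?thesis unfolding e using j by (simp add: sum.delta')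
    qed
    from z[OF this] show "z m = (\<Sum>k<c. (\<Sum>l<N. z l * Y l k) * Q k m)" unfolding e by simp
  qed
qed

text \<open>If \<open>(g, h)\<close> annihilates the image of \<open>(P, Q)\<close>, the lifting property extends it to an infinite
  sequence of annihilating pairs; an eigenvector of the shift then violates the independence of the rows of \<open>P + \<mu> Q\<close>.\<close>

lemma pencil_indep:
  fixes P Q :: "nat \<Rightarrow> nat \<Rightarrow> 'k::alg_closed_field"
  assumes indP: "\<And>\<mu>. indep_rows c N (\<lambda>k l. P k l + \<mu> * Q k l)" and indQ: "indep_rows c N Q"
    and lift: "\<And>x. (\<And>k. k < c \<Longrightarrow> (\<Sum>l<N. Q k l * x l) = 0) \<Longrightarrow>
       \<exists>y. \<forall>k<c. (\<Sum>l<N. P k l * y l) = 0 \<and> (\<Sum>l<N. P k l * x l) + (\<Sum>l<N. Q k l * y l) = 0"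
    and gh: "\<And>l. l < N \<Longrightarrow> (\<Sum>k<c. g k * P k l + h k * Q k l) = 0" and k: "k < c"
  shows "g k = 0 \<and> h k = 0"
proof -
  have pair: "(\<Sum>k<c. g k * (\<Sum>l<N. A k l * x l)) = (\<Sum>l<N. (\<Sum>k<c. g k * A k l) * x l)" for g x :: "nat \<Rightarrow> 'k" and A
    by (simp add: sum_distrib_left sum_distrib_right mult.assoc) (subst sum.swap, simp)
  \<comment> \<open>For \<open>x\<close> in the kernel of \<open>Q\<close> with lift
    \<open>y\<close> one has \<open>h P x = - h Q y = g P y = 0\<close>. So \<open>h P\<close>
    vanishes on the kernel of \<open>Q\<close> and is a combination of the rows of \<open>Q\<close>:
    the pair \<open>(h, h')\<close> is the next relation.\<close>
  have next_ex: "\<exists>h'. \<forall>l<N. (\<Sum>k<c. h k * P k l + h' k * Q k l) = 0"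
    if gh: "\<forall>l<N. (\<Sum>k<c. g k * P k l + h k * Q k l) = 0" for g h
  proof -
    have "(\<Sum>l<N. (\<Sum>k<c. h k * P k l) * x l) = 0" if x: "\<And>k. k < c \<Longrightarrow> (\<Sum>l<N. Q k l * x l) = 0" for x
    proof -
      obtain y where y: "\<forall>k<c. (\<Sum>l<N. P k l * y l) = 0 \<and> (\<Sum>l<N. P k l * x l) + (\<Sum>l<N. Q k l * y l) = 0"
        using lift[OF x] by blast
      have "(\<Sum>l<N. (\<Sum>k<c. h k * P k l) * x l) = (\<Sum>k<c. h k * (\<Sum>l<N. P k l * x l))" by (rule pair[symmetric])
      also have "\<dots> = (\<Sum>k<c. - (h k * (\<Sum>l<N. Q k l * y l)))"
        by (intro sum.cong refl) (use y in \<open>auto simp: eq_neg_iff_add_eq_0 distrib_left[symmetric]\<close>)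
      also have "\<dots> = - (\<Sum>k<c. h k * (\<Sum>l<N. Q k l * y l)) - (\<Sum>k<c. g k * (\<Sum>l<N. P k l * y l))"
        using y by (simp add: sum_negf)
      also have "\<dots> = - (\<Sum>l<N. (\<Sum>k<c. g k * P k l + h k * Q k l) * y l)"
        unfolding pair by (simp add: sum.distrib distrib_right)
      also have "\<dots> = 0" using gh by simp
      finally show ?thesis .
    qed
    from vanishing_on_kernel_imp_in_row_span[OF indQ this]
    obtain f where f: "\<forall>l<N. (\<Sum>k<c. h k * P k l) = (\<Sum>k<c. f k * Q k l)" by blast
    have "\<forall>l<N. (\<Sum>k<c. h k * P k l + (- f k) * Q k l) = 0"
      using f by (simp add: sum.distrib sum_negf sum_subtractf)
    then show ?thesis by (intro exI[of _ "\<lambda>k. - f k"])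
  qed
  define R where "R g h \<longleftrightarrow> (\<forall>l<N. (\<Sum>k<c. g k * P k l + h k * Q k l) = 0)" for g h
  \<comment> \<open>Consecutive pairs overlap: the second member of one is the first member of the
    next.\<close>
  define v where "v = rec_nat (g, h) (\<lambda>_ (a,b). (b, SOME b'. R b b'))"
  have v: "v 0 = (g, h)" "v (Suc j) = (snd (v j), SOME b'. R (snd (v j)) b')" for j
    unfolding v_def by (simp_all add: case_prod_unfold)
  have Rv: "R (fst (v j)) (snd (v j))" for j
  proof (induction j)
    case 0
    then show ?case using gh unfolding v R_def by simp
  next
    case (Suc j)
    then have "\<exists>b'. R (snd (v j)) b'" using next_ex unfolding R_def by blast
    from someI_ex[OF this] show ?case unfolding v(2) by simp
  qed
  have g0: "\<forall>k<c. g k = 0"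
  proof (rule ccontr)
    assume "\<not> ?thesis"
    then have nz: "\<exists>i<c. fst (v 0) i \<noteq> 0" unfolding v(1) by simp
    \<comment> \<open>The successors are merely chosen, not given by a linear map, so the
      eigenvector is one of the shift on formal combinations. For it the relation becomes
      \<open>e P + \<mu> e Q = 0\<close>.\<close>
    obtain a M \<mu> where a: "(\<exists>i<c. (\<Sum>j<M. a j * fst (v j) i) \<noteq> 0) \<and>
      (\<forall>i<c. (\<Sum>j<M. a j * fst (v (Suc j)) i) = \<mu> * (\<Sum>j<M. a j * fst (v j) i))"
      by (rule shift_eigenvector[of c "\<lambda>j. fst (v j)", OF nz])
    define e where "e i = (\<Sum>j<M. a j * fst (v j) i)" for i
    have "(\<Sum>k<c. e k * (P k l + \<mu> * Q k l)) = 0" if l: "l < N" for l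
    proof -
      have "(\<Sum>k<c. e k * (P k l + \<mu> * Q k l)) = (\<Sum>k<c. (\<Sum>j<M. a j * fst (v j) k) * P k l + (\<Sum>j<M. a j * fst (v (Suc j)) k) * Q k l)"
        by (intro sum.cong refl) (use a in \<open>simp add: e_def algebra_simps\<close>)
      also have "\<dots> = (\<Sum>j<M. a j * (\<Sum>k<c. fst (v j) k * P k l + snd (v j) k * Q k l))"
        unfolding v(2) fst_conv sum_distrib_left sum_distrib_right sum.distrib[symmetric]
        by (subst sum.swap) (simp add: algebra_simps)
      also have "\<dots> = 0" using Rv l unfolding R_def by simp
      finally show ?thesis .
    qed
    then have "\<forall>k<c. e k = 0" using indep_rowsD[OF indP] by blast
    then show False using a unfolding e_def by blast
  qed
  then have "\<forall>l<N. (\<Sum>k<c. h k * Q k l) = 0" using gh by simp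
  then have "h k = 0" using indep_rowsD[OF indQ _ k] by blast
  then show ?thesis using g0 k by blast
qed

context steiner_sequence
begin

text \<open>Locally such a section combines sections of \<open>E\<close> with coefficients regular
  on \<open>L\<close>; linearity of \<open>\<iota>\<close> reduces the claim to restrictions of
  regular functions.\<close>

lemma restricted_section_regular:
  assumes L: "L \<subseteq> proj_space n" and s: "s \<in> sections (restrict_bundle n (proj_space n) L E) W"
    and W: "zopen n L W" and l: "l < N"
  shows "twisted_regular n L 0 W (\<lambda>p v. \<iota> p (s p) (l, v))"
proof -
  interpret L: proj_subset n L by unfold_locales (rule L)
  show ?thesis
  proof (rule L.tr_local)
    fix p assume p: "p \<in> W"
    have "\<forall>p\<in>W. \<exists>U V m e f.
          zopen n (proj_space n) U \<and> zopen n L V \<and> p \<in> V \<and> V \<subseteq> U \<and> V \<subseteq> W \<and>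
          (\<forall>j<m. e j \<in> sections E U) \<and> (\<forall>j<m. regular_fun n L V (f j)) \<and>
          (\<forall>q\<in>V. s q = (\<lambda>x. \<Sum>j<(m::nat). f j q * e j q x))"
      using s unfolding restrict_bundle_def by simp
    from bspec[OF this p] obtain U V m e f where r: "zopen n (proj_space n) U \<and> zopen n L V \<and> p \<in> V \<and> V \<subseteq> U \<and> V \<subseteq> W \<and>
          (\<forall>j<m. e j \<in> sections E U) \<and> (\<forall>j<m. regular_fun n L V (f j)) \<and>
          (\<forall>q\<in>V. s q = (\<lambda>x. \<Sum>j<(m::nat). f j q * e j q x))" by (elim exE)
    then have zU: "zopen n (proj_space n) U" and zV: "zopen n L V" and VU: "V \<subseteq> U" by blast+
    have "twisted_regular n L 0 V (\<lambda>q v. f j q * \<iota> q (e j q) (l, v))" if "j < m" for j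
    proof -
      have "(\<lambda>q. \<iota> q (e j q)) \<in> sections FF U" by (rule hom_sections[OF hom_iota zU]) (use r that in blast)
      from power_trivial_section[OF this l]
      have "twisted_regular n L 0 V (\<lambda>q v. \<iota> q (e j q) (l, v))"
        by (rule tr_restrict[OF _ order_refl L zV VU])
      moreover have "twisted_regular n L 0 V (\<lambda>q v. f j q)" using r that unfolding regular_fun_def by blast
      ultimately show ?thesis using L.tr_mult[of 0 V "\<lambda>q v. f j q" 0] by simp
    qed
    then have t: "twisted_regular n L 0 V (\<lambda>q v. \<Sum>j<m. f j q * \<iota> q (e j q) (l, v))" by (intro L.tr_sum[OF zV]) auto
    have "twisted_regular n L 0 V (\<lambda>q v. \<iota> q (s q) (l, v))"
    proof (rule L.tr_cong[OF t])
      fix q v assume q: "q \<in> V"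
      then have qP: "q \<in> proj_space n" using zopen_subset[OF zU] VU by blast
      have "s q = (\<lambda>x. \<Sum>j<m. f j q * e j q x)" using r q by blast
      then have "\<iota> q (s q) = (\<lambda>y. \<Sum>j<m. f j q * \<iota> q (e j q) y)"
        by (simp only:) (rule lin_on_sum[OF lin_closed_fibre[OF qP] hom_lin_on[OF hom_iota qP]],
          rule section_in_fibre[OF zU], use r q VU in blast, use q VU in blast)
      then show "(\<Sum>j<m. f j q * \<iota> q (e j q) (l, v)) = \<iota> q (s q) (l, v)" by simp
    qed
    then show "\<exists>V. zopen n L V \<and> p \<in> V \<and> V \<subseteq> W \<and> twisted_regular n L 0 V (\<lambda>q v. \<iota> q (s q) (l, v))"
      using r by blast
  qed
qed

text \<open>Twisted by O(1), the restriction is a sum of copies of O(1) and O, hence globally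
  generated. So the vector \<open>x\<close> over the point of \<open>w\<close> is the value of a
  global section, which is linear along the line, \<open>s y + t x\<close> at
  \<open>s u + t w\<close>. It lies in the kernel everywhere, and comparing coefficients gives the
  two equations.\<close>

lemma line_lift:
  assumes pl: "proj_line n u w L"
    and iso: "bundle_iso n L (restrict_bundle n (proj_space n) L E)
             (direct_sum 2 (\<lambda>i. power_bundle (a i) (twist_bundle n L (- int i))))"
    and x: "\<And>k. k < c \<Longrightarrow> (\<Sum>l<N. ev n Phi w k l * x l) = 0"
  shows "\<exists>y. \<forall>k<c. (\<Sum>l<N. ev n Phi u k l * y l) = 0 \<and> (\<Sum>l<N. ev n Phi u k l * x l) + (\<Sum>l<N. ev n Phi w k l * y l) = 0"
proof -
  interpret L: proj_line n u w L by (rule pl)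
  define S where "S = direct_sum 2 (\<lambda>i. power_bundle (a i) (twist_bundle n L (- int i)))"
  obtain \<phi> \<psi> where iso': "bundle_hom n L (restrict_bundle n (proj_space n) L E) S \<phi> \<and> bundle_hom n L S (restrict_bundle n (proj_space n) L E) \<psi> \<and>
     (\<forall>p\<in>L. (\<forall>u\<in>fibre (restrict_bundle n (proj_space n) L E) p. \<psi> p (\<phi> p u) = u) \<and> (\<forall>w\<in>fibre S p. \<phi> p (\<psi> p w) = w))"
    using iso unfolding bundle_iso_def S_def by (elim exE)
  have rf: "fibre (restrict_bundle n (proj_space n) L E) p = fibre E p" for p unfolding restrict_bundle_def by simp
  have hphi: "bundle_hom n L (restrict_bundle n (proj_space n) L E) S \<phi>" and hpsi: "bundle_hom n L S (restrict_bundle n (proj_space n) L E) \<psi>"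
    and inv: "\<And>p u. p \<in> L \<Longrightarrow> u \<in> fibre E p \<Longrightarrow> \<psi> p (\<phi> p u) = u"
    using iso' unfolding rf by blast+
  have LP: "p \<in> proj_space n" if "p \<in> L" for p using that L.L_sub by blast
  define p0 where "p0 = point_of w"
  have p0: "p0 \<in> L" "w \<in> p0" using L.comb_in_L[of 0 1] mem_point_of unfolding p0_def by auto
  obtain y0 where y0: "y0 \<in> fibre E p0" "\<iota> p0 y0 = emb N p0 x" using kernel_in_image[OF LP[OF p0(1)] p0(2), of x] x by blast
  define e0 where "e0 = \<phi> p0 y0"
  have e0: "e0 \<in> fibre S p0" unfolding e0_def by (rule hom_fibre[OF hphi p0(1)]) (simp add: rf y0)
  obtain i0 where i0: "i0 < Suc n" "w i0 \<noteq> 0" using proj_space_coord_nonzero[OF LP[OF p0(1)] p0(2)] by blast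
  \<comment> \<open>The global section of the twist by O(1), divided by the coordinate
    \<open>j\<close> to obtain a section of the sum itself over \<open>U j\<close>. Before division
    the O(1) components are multiples of the coordinate \<open>i0\<close>, and the O components are
    constants, both with value \<open>e0\<close> at \<open>w\<close>.\<close>
  define \<sigma> :: "nat \<Rightarrow> 'k point \<Rightarrow> nat \<times> nat \<times> 'k vect \<Rightarrow> 'k" where
    "\<sigma> j p = (\<lambda>(i,m,v). if v \<in> p then (if i = 0 \<and> m < a 0 then e0 (0,m,w) * (v i0 / w i0) / v j
        else if i = 1 \<and> m < a 1 then e0 (1,m,w) / v j else 0) else 0)" for j p
  define U where "U j = {p\<in>L. \<exists>v\<in>p. v j \<noteq> 0}" for j
  have zU: "zopen n L (U j)" if "j < Suc n" for j unfolding U_def by (rule zopen_basic[OF form.var]) (use that in simp)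
  have nz: "v j \<noteq> 0" if "j < Suc n" "p \<in> U j" "v \<in> p" for j p v
    using form_nonzero_on_point[OF form.var[of j n], of p _ v] that LP unfolding U_def by auto
  have "twisted_regular n L 0 (U j) (\<lambda>p v. \<sigma> j p (0,m,v))" if "j < Suc n" "m < a 0" for j m
  proof -
    have "twisted_regular n L 0 (U j) (\<lambda>p v. (e0 (0,m,w) / w i0 * v i0) / v j)"
      by (rule L.tr_quotient[OF form_scale[OF form.var[of i0 n]] form.var[of j n]]) (use i0 that zU nz in auto)
    then show ?thesis by (rule L.tr_cong) (use that in \<open>simp add: \<sigma>_def\<close>)
  qed
  moreover have "twisted_regular n L (- 1) (U j) (\<lambda>p v. \<sigma> j p (1,m,v))" if "j < Suc n" "m < a 1" for j m
  proof -
    have "twisted_regular n L (- 1) (U j) (\<lambda>p v. e0 (1,m,w) / v j)"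
      by (rule L.tr_quotient[OF form.const[of n "e0 (1,m,w)"] form.var[of j n]]) (use that zU nz in auto)
    then show ?thesis by (rule L.tr_cong) (use that in \<open>simp add: \<sigma>_def\<close>)
  qed
  ultimately have ssec: "\<sigma> j \<in> sections S (U j)" if "j < Suc n" for j
    unfolding S_def direct_sum_def twist_bundle_def using that
    by (auto simp: less_2_cases_iff) (auto simp: \<sigma>_def)
  have sfib: "\<sigma> j p \<in> fibre S p" if j: "j < Suc n" and p: "p \<in> U j" for j p
  proof -
    have pP: "p \<in> proj_space n" using p LP unfolding U_def by blast
    have "t powi - 1 = 1 / t" for t :: 'k by (simp add: power_int_minus divide_inverse)
    then show ?thesis unfolding S_def direct_sum_def twist_bundle_def using scale_in_point[OF pP]
      by (auto simp: less_2_cases_iff \<sigma>_def)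
  qed
  define \<kappa> where "\<kappa> p = \<iota> p \<circ> \<psi> p" for p
  have klin: "lin_on (fibre S p) (\<kappa> p)" if p: "p \<in> L" for p
    unfolding lin_on_def
  proof (intro ballI allI)
    fix u w a b assume "u \<in> fibre S p" "w \<in> fibre S p"
    then show "\<kappa> p (\<lambda>x. a * u x + b * w x) = (\<lambda>y. a * \<kappa> p u y + b * \<kappa> p w y)"
      unfolding \<kappa>_def comp_def
      using lin_onD[OF hom_lin_on[OF hpsi p]] lin_onD[OF hom_lin_on[OF hom_iota LP[OF p]]] hom_fibre[OF hpsi p] rf by simp
  qed
  have kker: "\<pi> p (\<kappa> p g) = (\<lambda>_. 0)" if "p \<in> L" "g \<in> fibre S p" for p g
    unfolding \<kappa>_def comp_def by (rule pi_iota[OF LP[OF that(1)]]) (use hom_fibre[OF hpsi that] rf in simp)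
  have kfib: "\<kappa> p g \<in> fibre FF p" if "p \<in> L" "g \<in> fibre S p" for p g
    unfolding \<kappa>_def comp_def by (rule hom_fibre[OF hom_iota LP[OF that(1)]]) (use hom_fibre[OF hpsi that] rf in simp)
  \<comment> \<open>Multiplying back by the coordinate gives the same vector for every admissible
    \<open>j\<close>, so the local pieces glue to the section \<open>H\<close> of degree 1.\<close>
  have indep: "v j * \<kappa> p (\<sigma> j p) y = v j' * \<kappa> p (\<sigma> j' p) y"
    if j: "j < Suc n" "p \<in> U j" and j': "j' < Suc n" "p \<in> U j'" and v: "v \<in> p" for j j' p v y
  proof -
    have pL: "p \<in> L" using j unfolding U_def by blast
    have "(\<lambda>y. v j * \<sigma> j p y) = (\<lambda>y. v j' * \<sigma> j' p y)"
    proof (rule ext, clarify)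
      fix i m z
      show "v j * \<sigma> j p (i,m,z) = v j' * \<sigma> j' p (i,m,z)"
      proof (cases "z \<in> p")
        case True
        then obtain t where "t \<noteq> 0" "z = (\<lambda>i. t * v i)" using same_point[OF LP[OF pL] v] by blast
        then have "v j / z j = v j' / z j'" using nz[OF j v] nz[OF j' v] by simp
        moreover have "v j * \<sigma> j p (i,m,z) = (v j / z j) * (if i = 0 \<and> m < a 0 then e0 (0,m,w) * (z i0 / w i0)
          else if i = 1 \<and> m < a 1 then e0 (1,m,w) else 0)" for j using True by (simp add: \<sigma>_def)
        ultimately show ?thesis by (simp only:)
      qed (simp add: \<sigma>_def)
    qed
    then show ?thesis using lin_on_scale[OF klin[OF pL] sfib[OF j], of "v j"] lin_on_scale[OF klin[OF pL] sfib[OF j'], of "v j'"]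
      by (metis (no_types, lifting))
  qed
  define J where "J p = (SOME j. j < Suc n \<and> p \<in> U j)" for p
  have J: "J p < Suc n" "p \<in> U (J p)" if pL: "p \<in> L" for p
  proof -
    obtain j where "j < Suc n" "rep p j \<noteq> 0" using proj_space_coord_nonzero[OF LP[OF pL] rep_in[OF LP[OF pL]]] by blast
    then have "\<exists>j. j < Suc n \<and> p \<in> U j" using pL rep_in[OF LP[OF pL]] unfolding U_def by blast
    from someI_ex[OF this] show "J p < Suc n" "p \<in> U (J p)" unfolding J_def by blast+
  qed
  define H where "H l p v = v (J p) * \<kappa> p (\<sigma> (J p) p) (l, v)" for l p v
  have Hj: "H l p v = v j * \<kappa> p (\<sigma> j p) (l, v)" if "j < Suc n" "p \<in> U j" "v \<in> p" for l p v j
    unfolding H_def by (rule indep) (use that J in \<open>auto simp: U_def\<close>)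
  have Hreg: "twisted_regular n L 1 L (H l)" if l: "l < N" for l
  proof (rule L.tr_local)
    fix p assume p: "p \<in> L"
    have j: "J p < Suc n" by (rule J[OF p])
    have "(\<lambda>p. \<psi> p (\<sigma> (J p0) p)) \<in> sections (restrict_bundle n (proj_space n) L E) (U (J p0))" if "J p0 < Suc n" for p0
      by (rule hom_sections[OF hpsi zU[OF that] ssec[OF that]])
    from restricted_section_regular[OF L.L_sub this[OF j] zU[OF j] l]
    have "twisted_regular n L 0 (U (J p)) (\<lambda>q v. \<kappa> q (\<sigma> (J p) q) (l, v))" unfolding \<kappa>_def comp_def .
    from L.tr_mult[OF L.tr_form[OF form.var[of "J p" n] zU[OF j]] this] j
    have "twisted_regular n L 1 (U (J p)) (\<lambda>q v. v (J p) * \<kappa> q (\<sigma> (J p) q) (l, v))" by simp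
    then have "twisted_regular n L 1 (U (J p)) (H l)" by (rule L.tr_cong) (use Hj[OF j] in auto)
    then show "\<exists>V. zopen n L V \<and> p \<in> V \<and> V \<subseteq> L \<and> twisted_regular n L 1 V (H l)"
      using zU[OF j] J(2)[OF p] by (intro exI[of _ "U (J p)"]) (auto simp: U_def)
  qed
  have Hker: "(\<Sum>l<N. ev n Phi v k l * H l p v) = 0" if "p \<in> L" "v \<in> p" "k < c" for p v k
  proof -
    let ?g = "\<kappa> p (\<sigma> (J p) p)"
    have "?g = emb N p (\<lambda>l. ?g (l, v))"
      by (rule power_trivial_fibre_emb[OF LP[OF that(1)] kfib that(2)]) (use that sfib J in auto)
    moreover have "\<pi> p ?g = (\<lambda>_. 0)" by (rule kker) (use that sfib J in auto)
    ultimately have "(\<Sum>l<N. ev n Phi v k l * ?g (l, v)) = 0"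
      using pi_emb_eq_zero_iff[OF LP[OF that(1)] that(2), of "\<lambda>l. ?g (l, v)"] that(3) by simp
    then have "v (J p) * (\<Sum>l<N. ev n Phi v k l * ?g (l, v)) = 0" by simp
    then show ?thesis unfolding H_def sum_distrib_left by (simp add: mult.left_commute)
  qed
  define y where "y l = H l (point_of u) u" for l
  have Hw: "H l p0 w = x l" if l: "l < N" for l
  proof -
    have j: "J p0 < Suc n" "p0 \<in> U (J p0)" using J[OF p0(1)] .
    have "(\<lambda>y. w (J p0) * \<sigma> (J p0) p0 y) = e0"
    proof (rule ext, clarify)
      fix i m z
      show "w (J p0) * \<sigma> (J p0) p0 (i,m,z) = e0 (i,m,z)"
      proof (cases "z \<in> p0 \<and> (i = 0 \<and> m < a 0 \<or> i = 1 \<and> m < a 1)")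
        case True
        then obtain t where t: "t \<noteq> 0" "z = (\<lambda>i. t * w i)" using same_point[OF LP[OF p0(1)] p0(2)] by blast
        have e00: "e0 (0,m,\<lambda>i. t * w i) = e0 (0,m,w)" if "m < a 0"
          using e0 that p0(2) t(1) unfolding S_def direct_sum_def twist_bundle_def by auto
        have e01: "e0 (1,m,\<lambda>i. t * w i) = e0 (1,m,w) / t" if "m < a 1"
          using e0 that p0(2) t(1) unfolding S_def direct_sum_def twist_bundle_def
          by (auto simp: less_2_cases_iff power_int_minus divide_inverse mult.commute)
        show ?thesis using True t nz[OF j p0(2)] i0 e00 e01 by (auto simp: \<sigma>_def)
      next
        case False
        then have "e0 (i,m,z) = 0" using e0 unfolding S_def direct_sum_def twist_bundle_def
          by (cases "i = 0"; cases "i = 1"; cases "m < a i") (auto simp: not_less)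
        then show ?thesis using False by (auto simp: \<sigma>_def)
      qed
    qed
    then have "(\<lambda>y. w (J p0) * \<kappa> p0 (\<sigma> (J p0) p0) y) = \<kappa> p0 e0"
      using lin_on_scale[OF klin[OF p0(1)] sfib[OF j], of "w (J p0)"] by simp
    also have "\<dots> = emb N p0 x" unfolding \<kappa>_def comp_def e0_def using inv[OF p0(1) y0(1)] y0(2) by simp
    finally show ?thesis using emb_apply[OF l p0(2), of x] unfolding H_def by (metis (full_types))
  qed
  have Hlin: "H l (point_of (\<lambda>i. s * u i + t * w i)) (\<lambda>i. s * u i + t * w i) = s * y l + t * x l" if "s \<noteq> 0 \<or> t \<noteq> 0" "l < N" for s t l
    using L.section_deg1_linear[OF Hreg[OF that(2)] that(1)] Hw[OF that(2)] unfolding y_def p0_def by simp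
  have evlin: "ev n Phi (\<lambda>i. s * u i + t * w i) k l = s * ev n Phi u k l + t * ev n Phi w k l" for s t k l
    unfolding ev_def sum_distrib_left sum.distrib[symmetric] by (intro sum.cong refl) (simp add: algebra_simps)
  \<comment> \<open>At \<open>(s, t) = (1, 0)\<close> this is the first equation; at
    \<open>(1, 1)\<close>, after removing the two pure terms, it is the second.\<close>
  have main: "(\<Sum>l<N. (s * ev n Phi u k l + t * ev n Phi w k l) * (s * y l + t * x l)) = 0" if "s \<noteq> 0 \<or> t \<noteq> 0" "k < c" for s t k
    using Hker[OF L.comb_in_L[OF that(1)] mem_point_of that(2)] Hlin[OF that(1)] by (simp add: evlin)
  show ?thesis
  proof (intro exI[of _ y] allI impI conjI)
    fix k assume k: "k < c"
    show 1: "(\<Sum>l<N. ev n Phi u k l * y l) = 0" using main[of 1 0 k] k by simp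
    have "0 = (\<Sum>l<N. (1 * ev n Phi u k l + 1 * ev n Phi w k l) * (1 * y l + 1 * x l))" using main[of 1 1 k] k by simp
    also have "\<dots> = (\<Sum>l<N. ev n Phi u k l * y l) + (\<Sum>l<N. ev n Phi u k l * x l) + (\<Sum>l<N. ev n Phi w k l * y l) + (\<Sum>l<N. ev n Phi w k l * x l)"
      by (simp add: sum.distrib[symmetric] algebra_simps)
    finally show "(\<Sum>l<N. ev n Phi u k l * x l) + (\<Sum>l<N. ev n Phi w k l * y l) = 0" using 1 x[OF k] by simp
  qed
qed

lemma one_type_uniform_imp_line_indep:
  assumes iso: "\<And>L. is_line n L \<Longrightarrow> bundle_iso n L (restrict_bundle n (proj_space n) L E)
             (direct_sum 2 (\<lambda>i. power_bundle (a i) (twist_bundle n L (- int i))))"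
  shows "line_indep n c N Phi"
  unfolding line_indep_def
proof (intro allI impI)
  fix u w g h k assume uw: "indep2 n u w" and gh: "\<forall>l<N. (\<Sum>k<c. g k * ev n Phi u k l + h k * ev n Phi w k l) = 0" and k: "k < c"
  \<comment> \<open>Truncation to the coordinate space: \<open>indep2\<close> and \<open>ev\<close>
    see only the coordinates up to \<open>n\<close>, but points need vectors that vanish
    beyond.\<close>
  define u' where "u' i = (if i < Suc n then u i else 0)" for i
  define w' where "w' i = (if i < Suc n then w i else 0)" for i
  have ev': "ev n Phi u' = ev n Phi u" "ev n Phi w' = ev n Phi w" unfolding ev_def u'_def w'_def by (auto simp: fun_eq_iff)
  have coord: "u' \<in> coord_space (Suc n)" "w' \<in> coord_space (Suc n)" unfolding coord_space_def u'_def w'_def by auto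
  have ind: "\<forall>a b. (\<forall>i. a * u' i + b * w' i = 0) \<longrightarrow> a = 0 \<and> b = 0"
  proof (intro allI impI)
    fix s t assume "\<forall>i. s * u' i + t * w' i = 0"
    then have "\<forall>i<Suc n. s * u i + t * w i = 0" unfolding u'_def w'_def by (metis (full_types))
    then show "s = 0 \<and> t = 0" using uw unfolding indep2_def by blast
  qed
  let ?L = "{point_of (\<lambda>i. a * u' i + b * w' i) | a b. a \<noteq> 0 \<or> b \<noteq> 0}"
  have pl: "proj_line n u' w' ?L" by (rule independent_imp_proj_line[OF coord ind])
  interpret L: proj_line n u' w' ?L by (rule pl)
  have "is_line n ?L" unfolding is_line_def using coord ind by blast
  note iL = iso[OF this]
  have evlin: "ev n Phi (\<lambda>i. s * u' i + t * w' i) k l = s * ev n Phi u' k l + t * ev n Phi w' k l" for s t k l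
    unfolding ev_def sum_distrib_left sum.distrib[symmetric] by (intro sum.cong refl) (simp add: algebra_simps)
  show "g k = 0 \<and> h k = 0"
  proof (rule pencil_indep[where P="ev n Phi u'" and Q="ev n Phi w'" and N=N, OF _ _ line_lift[OF pl iL] _ k])
    fix \<mu> :: 'k
    have "point_of (\<lambda>i. 1 * u' i + \<mu> * w' i) \<in> proj_space n" using L.comb_in_L[of 1 \<mu>] L.L_sub by auto
    from pointwise_indep[OF this mem_point_of]
    have "indep_rows c N (ev n Phi (\<lambda>i. 1 * u' i + \<mu> * w' i))" .
    moreover have "ev n Phi (\<lambda>i. 1 * u' i + \<mu> * w' i) = (\<lambda>k l. ev n Phi u' k l + \<mu> * ev n Phi w' k l)"
      using evlin[of 1 \<mu>] by (intro ext) simp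
    ultimately show "indep_rows c N (\<lambda>k l. ev n Phi u' k l + \<mu> * ev n Phi w' k l)" by (simp only:)
  next
    have "point_of (\<lambda>i. 0 * u' i + 1 * w' i) \<in> proj_space n" using L.comb_in_L[of 0 1] L.L_sub by auto
    from pointwise_indep[OF this mem_point_of] show "indep_rows c N (ev n Phi w')" by simp
  qed (use gh ev' in auto)
qed

end

subsection \<open>The upper bound\<close>

lemma sum_insert_index:
  assumes "i < Suc m"
  shows "(\<Sum>j<Suc m. h j) = h i + (\<Sum>j<m. h (insert_index i j) :: 'k::comm_monoid_add)"
proof -
  have "(\<Sum>j<Suc m. h j) = h i + (\<Sum>j\<in>{..<Suc m} - {i}. h j)" using assms by (intro sum.remove) auto
  also have "{..<Suc m} - {i} = insert_index i ` {..<m}"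
    using insert_index_image[of i m] assms by (simp add: atLeast0LessThan)
  also have "(\<Sum>j\<in>insert_index i ` {..<m}. h j) = (\<Sum>j<m. h (insert_index i j))"
    using insert_index_inj_on[of i "{..<m}"] by (simp add: sum.reindex)
  finally show ?thesis .
qed

lemma insert_index_lt: "j < m \<Longrightarrow> insert_index i j < Suc m"
  unfolding insert_index_def by auto

lemma insert_index_neq: "insert_index i j \<noteq> i"
  unfolding insert_index_def by auto

lemma (in vbundle_on) frame_element_section:
  assumes "local_frame n (proj_space n) E r U e" "zopen n (proj_space n) U" "m < r"
  shows "e m \<in> sections E U"
proof (subst frame_sections[OF assms(1,2) order_refl])
  have "e m q = (\<lambda>x. \<Sum>i<r. (if i = m then 1 else 0) * e i q x)" for q
    using assms(3) by (simp add: if_distrib[of "\<lambda>x. x * _"] cong: if_cong)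
  then show "\<exists>f. (\<forall>i<r. regular_fun n (proj_space n) U (f i)) \<and> (\<forall>q\<in>U. e m q = (\<lambda>x. \<Sum>i<r. f i q * e i q x))"
    using tr_const[OF assms(2)] unfolding regular_fun_def
    by (intro exI[of _ "\<lambda>i q. if i = m then 1 else 0"]) auto
qed

context proj_subset
begin

lemma regular_divide:
  assumes "regular_fun n X U f" "regular_fun n X U g" "\<And>q. q \<in> U \<Longrightarrow> g q \<noteq> 0"
  shows "regular_fun n X U (\<lambda>q. f q / g q)"
  using tr_mult[OF assms(1)[unfolded regular_fun_def] tr_inverse[OF assms(2)[unfolded regular_fun_def]]] assms(3)
  unfolding regular_fun_def by simp

lemma regular_uminus:
  assumes "regular_fun n X U f" "zopen n X U" shows "regular_fun n X U (\<lambda>q. - f q)"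
  using tr_scale[OF assms(1)[unfolded regular_fun_def] assms(2), of "-1"] unfolding regular_fun_def by simp

lemma regular_const: "zopen n X U \<Longrightarrow> regular_fun n X U (\<lambda>q. a)"
  unfolding regular_fun_def by (rule tr_const)

lemma regular_subset: "regular_fun n X U f \<Longrightarrow> zopen n X V \<Longrightarrow> V \<subseteq> U \<Longrightarrow> regular_fun n X V f"
  unfolding regular_fun_def by (rule tr_subset)

end

context steiner_sequence
begin

text \<open>The constant vector \<open>x\<close> is a global section \<open>s0\<close> of
  \<open>E\<close>, and the coordinate \<open>l0\<close> of \<open>\<iota>\<close> is a functional
  \<open>lam\<close> on \<open>E\<close> with \<open>lam s0 = 1\<close>. Hence \<open>E\<close> is
  the sum of the trivial bundle spanned by \<open>s0\<close> and the kernel of \<open>lam\<close>;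
  most of the work is a local frame of that kernel.\<close>

lemma kernel_vector_imp_trivial_summand:
  assumes x: "\<And>k i. k < c \<Longrightarrow> i < Suc n \<Longrightarrow> (\<Sum>l<N. Phi k l i * x l) = 0" and l0: "l0 < N" "x l0 = 1"
  shows "has_trivial_summand n E"
proof -
  have evx: "(\<Sum>l<N. ev n Phi v k l * x l) = 0" if "k < c" for v k
  proof -
    have "(\<Sum>l<N. ev n Phi v k l * x l) = (\<Sum>i<Suc n. v i * (\<Sum>l<N. Phi k l i * x l))"
      unfolding ev_def sum_distrib_left sum_distrib_right by (subst sum.swap) (simp add: algebra_simps)
    then show ?thesis using x that by simp
  qed
  have "(\<lambda>p. emb N p x) \<in> sections FF (proj_space n)" by (rule emb_section) (rule tr_const[OF zopen_whole])
  moreover have "\<pi> p (emb N p x) = (\<lambda>_. 0)" if "p \<in> proj_space n" for p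
    using pi_emb_eq_zero_iff[OF that rep_in[OF that]] evx by blast
  ultimately obtain s0 where s0: "s0 \<in> sections E (proj_space n)" "\<And>p. p \<in> proj_space n \<Longrightarrow> \<iota> p (s0 p) = emb N p x"
    using exact_middle[OF zopen_whole] by blast
  define lam where "lam p y = \<iota> p y (l0, rep p)" for p y
  have lam_s0: "lam p (s0 p) = 1" if "p \<in> proj_space n" for p
    unfolding lam_def s0(2)[OF that] using emb_apply[OF l0(1) rep_in[OF that], of x] l0(2) by simp
  have s0fib: "s0 p \<in> fibre E p" if "p \<in> proj_space n" for p by (rule section_in_fibre[OF zopen_whole s0(1) that])
  have lam_comb: "lam p (\<lambda>x. a * y x + b * z x) = a * lam p y + b * lam p z"
    if "p \<in> proj_space n" "y \<in> fibre E p" "z \<in> fibre E p" for p y z a b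
    unfolding lam_def using lin_onD[OF hom_lin_on[OF hom_iota that(1)] that(2,3)] by simp
  have lam_sum: "lam p (\<lambda>x. \<Sum>i<m. a i * y i x) = (\<Sum>i<m. a i * lam p (y i))"
    if "p \<in> proj_space n" "\<And>i. i < m \<Longrightarrow> y i \<in> fibre E p" for p m a and y :: "nat \<Rightarrow> 'a \<Rightarrow> 'k"
    unfolding lam_def using lin_on_sum[OF lin_closed_fibre[OF that(1)] hom_lin_on[OF hom_iota that(1)] that(2)] by simp
  have lam_reg: "regular_fun n (proj_space n) U (\<lambda>p. lam p (s p))" if zU: "zopen n (proj_space n) U" and s: "s \<in> sections E U" for U s
    unfolding regular_fun_def
  proof (rule tr_cong)
    have sec: "(\<lambda>p. \<iota> p (s p)) \<in> sections FF U" by (rule hom_sections[OF hom_iota zU s])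
    show t: "twisted_regular n (proj_space n) 0 U (\<lambda>p v. \<iota> p (s p) (l0, v))" by (rule power_trivial_section[OF sec l0(1)])
    fix p v assume p: "p \<in> U" "v \<in> p"
    then have pP: "p \<in> proj_space n" using zopen_subset[OF zU] by blast
    obtain u where u: "u \<noteq> 0" "rep p = (\<lambda>i. u * v i)" using same_point[OF pP p(2) rep_in[OF pP]] by blast
    show "\<iota> p (s p) (l0, v) = lam p (s p)" unfolding lam_def u(2) using tr_homogeneous[OF t p u(1) pP] by simp
  qed
  define F :: "('k, 'a) vbundle" where
    "F = \<lparr>fibre = (\<lambda>p. {y\<in>fibre E p. lam p y = 0}), sections = (\<lambda>U. {s\<in>sections E U. \<forall>p\<in>U. lam p (s p) = 0})\<rparr>"
  have Ff: "fibre F p = {y\<in>fibre E p. lam p y = 0}" and Fs: "sections F U = {s\<in>sections E U. \<forall>p\<in>U. lam p (s p) = 0}" for p U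
    unfolding F_def by simp_all
  have frameF: "\<exists>U e. zopen n (proj_space n) U \<and> p \<in> U \<and> local_frame n (proj_space n) F (r - 1) U e" if p: "p \<in> proj_space n" for p
  proof -
    obtain U e where U: "zopen n (proj_space n) U \<and> p \<in> U \<and> local_frame n (proj_space n) E r U e" by (rule frame_at[OF p])
    then have zU: "zopen n (proj_space n) U" and pU: "p \<in> U" and fr: "local_frame n (proj_space n) E r U e" by blast+
    have UP: "U \<subseteq> proj_space n" by (rule zopen_subset[OF zU])
    have esec: "e m \<in> sections E U" if "m < r" for m by (rule frame_element_section[OF fr zU that])
    have efib: "e m q \<in> fibre E q" if "m < r" "q \<in> U" for m q by (rule section_in_fibre[OF zU esec[OF that(1)] that(2)])
    define g where "g m q = lam q (e m q)" for m q
    have greg: "regular_fun n (proj_space n) U (g m)" if "m < r" for m unfolding g_def by (rule lam_reg[OF zU esec[OF that]])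
    have "\<exists>i<r. g i p \<noteq> 0"
    proof (rule ccontr)
      assume z: "\<not> ?thesis"
      obtain b where "s0 p = (\<lambda>x. \<Sum>i<r. b i * e i p x)" using s0fib[OF p] frame_fibre[OF fr pU] by auto
      then have "lam p (s0 p) = (\<Sum>i<r. b i * g i p)" using lam_sum[OF p, of r "\<lambda>i. e i p" b] efib pU unfolding g_def by simp
      then show False using lam_s0[OF p] z by simp
    qed
    then obtain i where i: "i < r" "g i p \<noteq> 0" by blast
    obtain r' where r': "r = Suc r'" using i(1) by (cases r) auto
    obtain V where V: "zopen n (proj_space n) V" "p \<in> V" "V \<subseteq> U" "\<forall>q\<in>V. \<forall>w\<in>q. g i q \<noteq> 0"
      using tr_nonzero_nbhd[OF greg[OF i(1), unfolded regular_fun_def] pU rep_in[OF p] i(2)] by blast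
    have VP: "V \<subseteq> proj_space n" by (rule zopen_subset[OF V(1)])
    have gi: "g i q \<noteq> 0" if "q \<in> V" for q using V(4) that rep_in VP by blast
    let ?s = "insert_index i"
    \<comment> \<open>Where \<open>lam (e i)\<close> is nonzero, subtracting multiples of
      \<open>e i\<close> puts the other members of the frame into the kernel of \<open>lam\<close>,
      and \<open>e i\<close> itself is dropped. The map \<open>?s\<close> enumerates the indices
      other than \<open>i\<close>.\<close>
    define e' where "e' j q = (\<lambda>x. 1 * e (?s j) q x + (- (g (?s j) q / g i q)) * e i q x)" for j q
    have sr: "?s j < r" if "j < r'" for j unfolding r' by (rule insert_index_lt[OF that])
    have e'sec: "e' j \<in> sections E V" if j: "j < r'" for j
    proof (rule sections_comb2[OF V(1)])
      show "e (?s j) \<in> sections E V" "e i \<in> sections E V"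
        by (rule sections_restrict[OF zU V(1,3)], rule esec, use sr[OF j] i in simp)+
      show "regular_fun n (proj_space n) V (\<lambda>q. 1)" by (rule regular_const[OF V(1)])
      show "regular_fun n (proj_space n) V (\<lambda>q. - (g (?s j) q / g i q))"
        by (intro regular_uminus regular_divide regular_subset[OF greg V(1,3)] sr[OF j] i(1) gi V(1))
      show "e' j q = (\<lambda>x. 1 * e (?s j) q x + (- (g (?s j) q / g i q)) * e i q x)" for q by (rule e'_def[THEN fun_cong, of j q, simplified] | simp add: e'_def)
    qed
    have e'fib: "e' j q \<in> fibre E q" if "j < r'" "q \<in> V" for j q by (rule section_in_fibre[OF V(1) e'sec[OF that(1)] that(2)])
    have e'lam: "lam q (e' j q) = 0" if j: "j < r'" and q: "q \<in> V" for j q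
    proof -
      have "q \<in> proj_space n" "q \<in> U" using q VP V(3) by blast+
      then have "lam q (e' j q) = 1 * g (?s j) q + (- (g (?s j) q / g i q)) * g i q"
        unfolding e'_def g_def by (intro lam_comb efib sr[OF j] i(1))
      then show ?thesis using gi[OF q] by simp
    qed
    have A: "(\<lambda>x. \<Sum>m<r. b m * e m q x) = (\<lambda>x. \<Sum>j<r'. b (?s j) * e' j q x)"
      if q: "q \<in> V" and z: "lam q (\<lambda>x. \<Sum>m<r. b m * e m q x) = 0" for b q
    proof -
      have "q \<in> proj_space n" "q \<in> U" using q VP V(3) by blast+
      then have "(\<Sum>m<r. b m * g m q) = 0" using z lam_sum[of q r "\<lambda>m. e m q" b] efib unfolding g_def by simp
      then have "b i * g i q + (\<Sum>j<r'. b (?s j) * g (?s j) q) = 0"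
        unfolding r' sum_insert_index[OF i(1)[unfolded r']] .
      then have bi: "b i = (\<Sum>j<r'. b (?s j) * (- (g (?s j) q / g i q)))"
        using gi[OF q] by (simp add: sum_negf sum_divide_distrib[symmetric] eq_neg_iff_add_eq_0 field_simps)
      show ?thesis
      proof
        fix x
        have "(\<Sum>m<r. b m * e m q x) = b i * e i q x + (\<Sum>j<r'. b (?s j) * e (?s j) q x)"
          unfolding r' by (rule sum_insert_index[OF i(1)[unfolded r']])
        also have "\<dots> = (\<Sum>j<r'. b (?s j) * e' j q x)"
          unfolding bi e'_def mult_1_left distrib_left sum.distrib sum_distrib_right by (simp only: mult.assoc add.commute)
        finally show "(\<Sum>m<r. b m * e m q x) = (\<Sum>j<r'. b (?s j) * e' j q x)" .
      qed
    qed
    have zl: "(\<lambda>x. \<Sum>j<r'. a j * e' j q x) \<in> fibre E q \<and> lam q (\<lambda>x. \<Sum>j<r'. a j * e' j q x) = 0" if q: "q \<in> V" for a q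
    proof -
      have qP: "q \<in> proj_space n" using q VP by blast
      show ?thesis using lin_closed_sum[OF lin_closed_fibre[OF qP], of r' "\<lambda>j. e' j q" a] lam_sum[OF qP, of r' "\<lambda>j. e' j q" a] e'fib e'lam q by simp
    qed
    have "local_frame n (proj_space n) F r' V e'"
      unfolding local_frame_def
    proof (intro conjI ballI allI impI)
      fix q assume q: "q \<in> V"
      then have qU: "q \<in> U" using V(3) by blast
      show "fibre F q = {(\<lambda>x. \<Sum>i<r'. a i * e' i q x) | a. True}"
      proof (intro equalityI subsetI)
        fix y assume "y \<in> fibre F q"
        then have y: "y \<in> fibre E q" "lam q y = 0" unfolding Ff by auto
        then obtain b where b: "y = (\<lambda>x. \<Sum>m<r. b m * e m q x)" using frame_fibre[OF fr qU] by auto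
        have "y = (\<lambda>x. \<Sum>j<r'. b (?s j) * e' j q x)" unfolding b by (rule A[OF q]) (use y(2) b in simp)
        then show "y \<in> {(\<lambda>x. \<Sum>i<r'. a i * e' i q x) | a. True}" by (intro CollectI exI[of _ "\<lambda>j. b (?s j)"] conjI TrueI)
      next
        fix y assume "y \<in> {(\<lambda>x. \<Sum>i<r'. a i * e' i q x) | a. True}"
        then obtain a where "y = (\<lambda>x. \<Sum>i<r'. a i * e' i q x)" by auto
        then show "y \<in> fibre F q" using zl[OF q, of a] unfolding Ff by simp
      qed
    next
      fix q a j assume q: "q \<in> V" and z: "\<forall>x. (\<Sum>i<r'. a i * e' i q x) = 0" and j: "j < r'"
      \<comment> \<open>The same combination written in the old frame; the coefficient at
        \<open>i\<close> collects the corrections.\<close>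
      define b where "b m = (if m = i then \<Sum>j<r'. a j * (- (g (?s j) q / g i q)) else a (delete_index i m))" for m
      have bs: "b (?s j) = a j" for j unfolding b_def by (simp add: insert_index_neq delete_insert_index)
      have "(\<Sum>m<r. b m * e m q x) = 0" for x
      proof -
        have "(\<Sum>m<r. b m * e m q x) = b i * e i q x + (\<Sum>j<r'. a j * e (?s j) q x)"
          unfolding r' sum_insert_index[OF i(1)[unfolded r']] bs ..
        also have "\<dots> = (\<Sum>j<r'. a j * e' j q x)"
          unfolding b_def e'_def if_P[OF refl] mult_1_left distrib_left sum.distrib sum_distrib_right by (simp only: mult.assoc add.commute)
        finally show ?thesis using z by simp
      qed
      from frame_indep[OF fr _ this sr[OF j]] q V(3) have "b (?s j) = 0" by blast
      then show "a j = 0" unfolding bs .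
    next
      fix W s assume "zopen n (proj_space n) W \<and> W \<subseteq> V"
      then have W: "zopen n (proj_space n) W" "W \<subseteq> V" by auto
      then have WU: "W \<subseteq> U" using V(3) by blast
      show "s \<in> sections F W \<longleftrightarrow> (\<exists>f. (\<forall>i<r'. regular_fun n (proj_space n) W (f i)) \<and> (\<forall>q\<in>W. s q = (\<lambda>x. \<Sum>i<r'. f i q * e' i q x)))"
      proof
        assume "s \<in> sections F W"
        then have s: "s \<in> sections E W" "\<forall>q\<in>W. lam q (s q) = 0" unfolding Fs by auto
        obtain f where f: "(\<forall>i<r. regular_fun n (proj_space n) W (f i)) \<and> (\<forall>q\<in>W. s q = (\<lambda>x. \<Sum>i<r. f i q * e i q x))"
          using s(1) unfolding frame_sections[OF fr W(1) WU] by (elim exE)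
        have "s q = (\<lambda>x. \<Sum>j<r'. f (?s j) q * e' j q x)" if q: "q \<in> W" for q
        proof -
          have sq: "s q = (\<lambda>x. \<Sum>i<r. f i q * e i q x)" using f q by blast
          show ?thesis unfolding sq by (rule A[of q "\<lambda>m. f m q"]) (use q W(2) s(2) sq in auto)
        qed
        then show "\<exists>f. (\<forall>i<r'. regular_fun n (proj_space n) W (f i)) \<and> (\<forall>q\<in>W. s q = (\<lambda>x. \<Sum>i<r'. f i q * e' i q x))"
          using f sr by (intro exI[of _ "\<lambda>j. f (?s j)"]) blast
      next
        assume "\<exists>f. (\<forall>i<r'. regular_fun n (proj_space n) W (f i)) \<and> (\<forall>q\<in>W. s q = (\<lambda>x. \<Sum>i<r'. f i q * e' i q x))"
        then obtain f where f: "(\<forall>i<r'. regular_fun n (proj_space n) W (f i)) \<and> (\<forall>q\<in>W. s q = (\<lambda>x. \<Sum>i<r'. f i q * e' i q x))" by (elim exE)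
        have "s \<in> sections E W"
        proof (rule sections_local_comb[OF W(1)])
          fix p assume "p \<in> W"
          moreover have "\<forall>j<r'. e' j \<in> sections E W" using sections_restrict[OF V(1) W e'sec] by blast
          ultimately show "\<exists>V (m::nat) e f. zopen n (proj_space n) V \<and> p \<in> V \<and> V \<subseteq> W \<and> (\<forall>j<m. e j \<in> sections E V) \<and>
             (\<forall>j<m. regular_fun n (proj_space n) V (f j)) \<and> (\<forall>q\<in>V. s q = (\<lambda>x. \<Sum>j<m. f j q * e j q x))"
            using f W(1) by (intro exI[of _ W] exI[of _ r'] exI[of _ e'] exI[of _ f]) blast
        qed
        moreover have "lam q (s q) = 0" if "q \<in> W" for q
        proof -
          have "s q = (\<lambda>x. \<Sum>i<r'. f i q * e' i q x)" using f that by blast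
          then show ?thesis using zl[of q "\<lambda>i. f i q"] that W(2) by auto
        qed
        ultimately show "s \<in> sections F W" unfolding Fs by blast
      qed
    qed
    then show ?thesis using V(1,2) r' by (intro exI[of _ V] exI[of _ e']) simp
  qed
  have vF: "vector_bundle n (proj_space n) (r - 1) F"
    unfolding vector_bundle_def
  proof (intro conjI allI impI ballI)
    fix U V s assume a: "zopen n (proj_space n) U \<and> zopen n (proj_space n) V \<and> V \<subseteq> U \<and> s \<in> sections F U"
    then show "s \<in> sections F V" unfolding Fs using sections_restrict[of U V s] by blast
  next
    fix U s assume a: "zopen n (proj_space n) U \<and> (\<forall>p\<in>U. \<exists>V. zopen n (proj_space n) V \<and> p \<in> V \<and> V \<subseteq> U \<and> s \<in> sections F V)"
    then have "s \<in> sections E U" unfolding Fs by (intro sections_glue) blast+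
    then show "s \<in> sections F U" using a unfolding Fs by blast
  qed (rule frameF)
  let ?T = "twist_bundle n (proj_space n :: 'k point set) 0"
  define \<phi> where "\<phi> p y = case_sum (\<lambda>v. if v \<in> p then lam p y else 0) (\<lambda>z. 1 * y z + (- lam p y) * s0 p z)" for p :: "'k point" and y
  define \<psi> where "\<psi> p g = (\<lambda>z. g (Inl (rep p)) * s0 p z + 1 * g (Inr z))" for p :: "'k point" and g :: "'k vect + 'a \<Rightarrow> 'k"
  have bf: "fibre (binary_sum ?T F) p = {g. (\<lambda>x. g (Inl x)) \<in> fibre ?T p \<and> (\<lambda>y. g (Inr y)) \<in> fibre F p}" for p
    unfolding binary_sum_def by simp
  have bs: "sections (binary_sum ?T F) U = {s. (\<lambda>p x. s p (Inl x)) \<in> sections ?T U \<and> (\<lambda>p y. s p (Inr y)) \<in> sections F U}" for U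
    unfolding binary_sum_def by simp
  have hphi: "bundle_hom n (proj_space n) E (binary_sum ?T F) \<phi>"
    unfolding bundle_hom_def
  proof (intro conjI ballI allI impI)
    fix p y assume p: "p \<in> proj_space n" and y: "y \<in> fibre E p"
    have "(\<lambda>v. if v \<in> p then lam p y else 0) \<in> fibre ?T p" unfolding twist_bundle_def using scale_in_point[OF p] by simp
    moreover have "(\<lambda>z. 1 * y z + (- lam p y) * s0 p z) \<in> fibre F p" unfolding Ff
      using lin_closed_comb[OF lin_closed_fibre[OF p] y s0fib[OF p], of 1 "- lam p y"] lam_comb[OF p y s0fib[OF p], of 1 "- lam p y"] lam_s0[OF p] by simp
    ultimately show "\<phi> p y \<in> fibre (binary_sum ?T F) p" unfolding bf \<phi>_def by simp
  next
    fix p u w a b assume "p \<in> proj_space n" "u \<in> fibre E p" "w \<in> fibre E p"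
    then have "lam p (\<lambda>x. a * u x + b * w x) = a * lam p u + b * lam p w" by (rule lam_comb)
    then show "\<phi> p (\<lambda>x. a * u x + b * w x) = (\<lambda>y. a * \<phi> p u y + b * \<phi> p w y)"
      unfolding \<phi>_def by (auto simp: fun_eq_iff algebra_simps split: sum.split)
  next
    fix U s assume a: "zopen n (proj_space n) U \<and> s \<in> sections E U"
    then have zU: "zopen n (proj_space n) U" and s: "s \<in> sections E U" by auto
    have UP: "U \<subseteq> proj_space n" by (rule zopen_subset[OF zU])
    note lr = lam_reg[OF zU s]
    have "(\<lambda>p v. if v \<in> p then lam p (s p) else 0) \<in> sections ?T U"
      unfolding twist_bundle_def using tr_cong[OF lr[unfolded regular_fun_def]] by simp
    moreover have "(\<lambda>p z. 1 * s p z + (- lam p (s p)) * s0 p z) \<in> sections E U"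
      by (rule sections_comb2[OF zU s sections_restrict[OF zopen_whole zU UP s0(1)] regular_const[OF zU, of 1] regular_uminus[OF lr zU]]) simp
    moreover have "lam p (\<lambda>z. 1 * s p z + (- lam p (s p)) * s0 p z) = 0" if "p \<in> U" for p
    proof -
      have p: "p \<in> proj_space n" using that UP by blast
      show ?thesis using lam_comb[OF p section_in_fibre[OF zU s that] s0fib[OF p], of 1 "- lam p (s p)"] lam_s0[OF p] by simp
    qed
    ultimately show "(\<lambda>p. \<phi> p (s p)) \<in> sections (binary_sum ?T F) U" unfolding bs Fs \<phi>_def by simp
  qed
  have hpsi: "bundle_hom n (proj_space n) (binary_sum ?T F) E \<psi>"
    unfolding bundle_hom_def
  proof (intro conjI ballI allI impI)
    fix p g assume p: "p \<in> proj_space n" and g: "g \<in> fibre (binary_sum ?T F) p"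
    then have "(\<lambda>y. g (Inr y)) \<in> fibre E p" unfolding bf Ff by blast
    from lin_closed_comb[OF lin_closed_fibre[OF p] s0fib[OF p] this] show "\<psi> p g \<in> fibre E p" unfolding \<psi>_def .
  next
    fix p u w a b
    show "\<psi> p (\<lambda>x. a * u x + b * w x) = (\<lambda>y. a * \<psi> p u y + b * \<psi> p w y)"
      unfolding \<psi>_def by (auto simp: fun_eq_iff algebra_simps)
  next
    fix U s assume a: "zopen n (proj_space n) U \<and> s \<in> sections (binary_sum ?T F) U"
    then have zU: "zopen n (proj_space n) U" and s: "(\<lambda>p x. s p (Inl x)) \<in> sections ?T U" "(\<lambda>p y. s p (Inr y)) \<in> sections E U"
      unfolding bs Fs by auto
    have UP: "U \<subseteq> proj_space n" by (rule zopen_subset[OF zU])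
    have t: "twisted_regular n (proj_space n) 0 U (\<lambda>p x. s p (Inl x))" using s(1) unfolding twist_bundle_def by simp
    have "regular_fun n (proj_space n) U (\<lambda>p. s p (Inl (rep p)))"
      unfolding regular_fun_def
    proof (rule tr_cong[OF t])
      fix p v assume p: "p \<in> U" "v \<in> p"
      then have pP: "p \<in> proj_space n" using UP by blast
      obtain u where u: "u \<noteq> 0" "rep p = (\<lambda>i. u * v i)" using same_point[OF pP p(2) rep_in[OF pP]] by blast
      show "s p (Inl v) = s p (Inl (rep p))" unfolding u(2) using tr_homogeneous[OF t p u(1) pP] by simp
    qed
    from sections_comb2[OF zU sections_restrict[OF zopen_whole zU UP s0(1)] s(2) this regular_const[OF zU, of 1]]
    show "(\<lambda>p. \<psi> p (s p)) \<in> sections E U" unfolding \<psi>_def by simp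
  qed
  have "\<psi> p (\<phi> p u) = u" if p: "p \<in> proj_space n" for p u
    using rep_in[OF p] unfolding \<psi>_def \<phi>_def by simp
  moreover have "\<phi> p (\<psi> p g) = g" if p: "p \<in> proj_space n" and g: "g \<in> fibre (binary_sum ?T F) p" for p g
  proof -
    have gr: "(\<lambda>y. g (Inr y)) \<in> fibre E p" "lam p (\<lambda>y. g (Inr y)) = 0" using g unfolding bf Ff by auto
    have gl: "(\<lambda>x. g (Inl x)) \<in> fibre ?T p" using g unfolding bf by blast
    have l: "lam p (\<psi> p g) = g (Inl (rep p))"
      unfolding \<psi>_def using lam_comb[OF p s0fib[OF p] gr(1), of "g (Inl (rep p))" 1] gr(2) lam_s0[OF p] by simp
    have gv: "g (Inl v) = g (Inl (rep p))" if vp: "v \<in> p" for v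
    proof -
      obtain u where u: "u \<noteq> 0" "rep p = (\<lambda>i. u * v i)" using same_point[OF p vp rep_in[OF p]] by blast
      show ?thesis unfolding u(2) using gl vp u(1) unfolding twist_bundle_def by simp
    qed
    have g0: "g (Inl v) = 0" if "v \<notin> p" for v using gl that unfolding twist_bundle_def by simp
    show ?thesis
    proof
      fix z show "\<phi> p (\<psi> p g) z = g z"
      proof (cases z)
        case (Inl v)
        then show ?thesis using l gv[of v] g0[of v] unfolding \<phi>_def by auto
      next
        case (Inr a)
        then show ?thesis using l unfolding \<phi>_def by (simp add: \<psi>_def)
      qed
    qed
  qed
  ultimately have "bundle_iso n (proj_space n) E (binary_sum ?T F)"
    unfolding bundle_iso_def using hphi hpsi by blast
  then show ?thesis unfolding has_trivial_summand_def using vF by blast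
qed

lemma no_trivial_summand_imp_rank_le:
  assumes "\<not> has_trivial_summand n E" shows "r \<le> c * n"
proof (rule ccontr)
  assume "\<not> r \<le> c * n"
  \<comment> \<open>A constant kernel vector has to satisfy one equation for each row
    \<open>k\<close> and each variable \<open>i\<close>, \<open>(n + 1) c\<close> in all.\<close>
  then have N: "Suc n * c < N" by (simp add: algebra_simps)
  obtain g where g: "\<exists>l<N. g l \<noteq> 0" "\<And>q. q < Suc n * c \<Longrightarrow> (\<Sum>l<N. g l * Phi (q mod c) l (q div c)) = 0"
    using more_unknowns_than_equations[OF N, of "\<lambda>l q. Phi (q mod c) l (q div c)"] by blast
  obtain l0 where l0: "l0 < N" "g l0 \<noteq> 0" using g(1) by blast
  have "has_trivial_summand n E"
  proof (rule kernel_vector_imp_trivial_summand[of "\<lambda>l. g l / g l0" l0])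
    fix k i assume ki: "k < c" "i < Suc n"
    have "i * c + k < Suc i * c" using ki by simp
    also have "\<dots> \<le> Suc n * c" using ki by (intro mult_le_mono1) simp
    finally have "(\<Sum>l<N. g l * Phi k l i) = 0" using g(2)[of "i * c + k"] ki by simp
    then have "(\<Sum>l<N. g l * Phi k l i) / g l0 = 0" by simp
    then show "(\<Sum>l<N. Phi k l i * (g l / g l0)) = 0" by (simp add: sum_divide_distrib mult.commute)
  qed (use l0 in auto)
  then show False using assms by blast
qed

end

theorem one_type_uniform_steiner_bounds:
  fixes E :: "('k::{alg_closed_field, field_char_0}, 'a) vbundle"
  assumes "n \<ge> 2" "c \<ge> 2" "k_type_uniform_steiner 1 n r c E" "\<not> has_trivial_summand n E"
  shows "c + 2 * (n - 1) \<le> r \<and> r \<le> c * n"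
proof -
  have st: "steiner_bundle n r c E" and a: "\<exists>a :: nat \<Rightarrow> nat. a 1 > 0 \<and> (\<forall>L. is_line n L \<longrightarrow>
           bundle_iso n L (restrict_bundle n (proj_space n) L E)
             (direct_sum (Suc 1) (\<lambda>i. power_bundle (a i) (twist_bundle n L (- int i)))))"
    using assms(3) unfolding k_type_uniform_steiner_def by blast+
  obtain \<iota> \<pi> where "short_exact n (proj_space n) E
        (power_bundle (r + c) (twist_bundle n (proj_space n) 0))
        (power_bundle c (twist_bundle n (proj_space n) 1)) \<iota> \<pi>" and vb: "vector_bundle n (proj_space n) r E"
    using st unfolding steiner_bundle_def by blast
  then interpret steiner_sequence n r E c \<iota> \<pi> by unfold_locales
  obtain a :: "nat \<Rightarrow> nat" where "\<And>L. is_line n L \<Longrightarrow> bundle_iso n L (restrict_bundle n (proj_space n) L E)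
             (direct_sum 2 (\<lambda>i. power_bundle (a i) (twist_bundle n L (- int i))))"
    using a by (auto simp: numeral_2_eq_2)
  then have "line_indep n c (r + c) Phi" by (rule one_type_uniform_imp_line_indep)
  then have "2 * c + 2 * (n - 1) \<le> r + c" using assms(1,2) by (intro line_indep_lower_bound) auto
  then show ?thesis using no_trivial_summand_imp_rank_le[OF assms(4)] by simp
qed

subsection \<open>The kernel bundle of a matrix of linear forms\<close>

lemma sum_product_assoc:
  fixes f :: "'a \<Rightarrow> 'k::comm_ring"
  shows "(\<Sum>j\<in>S. f j * (\<Sum>k\<in>T. g j k * y k)) = (\<Sum>k\<in>T. (\<Sum>j\<in>S. f j * g j k) * y k)"
  unfolding sum_distrib_left sum_distrib_right mult.assoc by (rule sum.swap)

text \<open>With the matrix given by a function of the indices, the expansion shows directly that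
  determinants of forms are forms and determinants of regular functions are regular.\<close>

lemma det_mat_Leibniz:
  "det (mat m m (\<lambda>(i,j). f i j)) = (\<Sum>p\<in>{p. p permutes {0..<m}}. signof p * (\<Prod>i=0..<m. f i (p i)))"
proof -
  have "(\<Prod>i=0..<m. mat m m (\<lambda>(i,j). f i j) $$ (i, p i)) = (\<Prod>i=0..<m. f i (p i))" if "p permutes {0..<m}" for p
    using permutes_in_image[OF that] by (intro prod.cong) auto
  then show ?thesis by (subst det_def'[of _ m]) auto
qed

lemma det_form:
  assumes "\<And>i j. i < m \<Longrightarrow> j < m \<Longrightarrow> form n 1 (\<lambda>v. M v i j)"
  shows "form n m (\<lambda>v. det (mat m m (\<lambda>(i,j). M v i j)))"
  unfolding det_mat_Leibniz
proof (intro form_sum form_scale)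
  fix p assume "p \<in> {p. p permutes {0..<m}}"
  then have p: "p permutes {0..<m}" by simp
  have "form n (card {0..<m} * 1) (\<lambda>v. \<Prod>i=0..<m. M v i (p i))"
  proof (rule form_prod)
    fix i assume "i \<in> {0..<m}"
    then show "form n 1 (\<lambda>v. M v i (p i))" using permutes_in_image[OF p, of i] by (intro assms) auto
  qed simp
  then show "form n m (\<lambda>v. \<Prod>i=0..<m. M v i (p i))" by simp
qed

lemma cofactor_form:
  assumes "\<And>i j. i < m \<Longrightarrow> j < m \<Longrightarrow> form n 1 (\<lambda>v. M v i j)" "a < m" "b < m"
  shows "form n (m - 1) (\<lambda>v. cofactor (mat m m (\<lambda>(i,j). M v i j)) a b)"
proof -
  have "mat_delete (mat m m (\<lambda>(i,j). M v i j)) a b =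
      mat (m - 1) (m - 1) (\<lambda>(i,j). M v (insert_index a i) (insert_index b j))" for v
    unfolding mat_delete_def by (rule eq_matI) (auto simp: insert_index_def)
  then show ?thesis unfolding cofactor_def
    by (simp only:) (intro form_scale det_form assms(1), use assms(2,3) in \<open>auto simp: insert_index_def\<close>)
qed

lemma form_ev: "form n 1 (\<lambda>v. ev n \<Phi> v k l)"
  unfolding ev_def by (rule form_linear)

lemma ev_scale: "ev n \<Phi> (\<lambda>i. t * v i) k l = t * ev n \<Phi> v k l"
  unfolding ev_def by (simp add: sum_distrib_left algebra_simps)

lemma ev_comb: "ev n \<Phi> (\<lambda>i. s * u i + t * w i) k l = s * ev n \<Phi> u k l + t * ev n \<Phi> w k l"
  unfolding ev_def sum_distrib_left sum.distrib[symmetric] by (intro sum.cong refl) (simp add: algebra_simps)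

lemma line_indepD:
  assumes "line_indep n c N \<Phi>" "indep2 n u w" "\<And>l. l < N \<Longrightarrow> (\<Sum>k<c. g k * ev n \<Phi> u k l + h k * ev n \<Phi> w k l) = 0" "k < c"
  shows "g k = 0 \<and> h k = 0"
proof -
  have "\<forall>g h. (\<forall>l<N. (\<Sum>k<c. g k * ev n \<Phi> u k l + h k * ev n \<Phi> w k l) = 0) \<longrightarrow> (\<forall>k<c. g k = 0 \<and> h k = 0)"
    using assms(1,2) unfolding line_indep_def by blast
  from spec[OF spec[OF this, of g], of h] assms(3,4) show ?thesis by blast
qed

text \<open>The hypothesis \<open>li\<close> makes the kernel a bundle and yields its splitting on
  lines; \<open>inj\<close> will exclude trivial summands.\<close>

locale kernel_bundle =
  fixes n c r :: nat and \<Phi> :: "nat \<Rightarrow> nat \<Rightarrow> nat \<Rightarrow> 'k::{alg_closed_field, field_char_0}"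
  assumes n1: "n \<ge> 1" and c1: "c \<ge> 1" and li: "line_indep n c (r + c) \<Phi>"
    and inj: "\<And>x. (\<And>k i. k < c \<Longrightarrow> i < Suc n \<Longrightarrow> (\<Sum>l<r + c. \<Phi> k l i * x l) = 0) \<Longrightarrow> \<forall>l<r + c. x l = 0"
begin

abbreviation "N \<equiv> r + c"
abbreviation "A \<equiv> ev n \<Phi>"

text \<open>The kernel is realised inside constant vectors extended by zero, so its index type is
  \<open>nat\<close> and its sections are vectors of regular functions.\<close>

definition K :: "('k, nat) vbundle" where
  "K = \<lparr>fibre = (\<lambda>p. {x. (\<forall>l\<ge>N. x l = 0) \<and> (\<forall>v\<in>p. \<forall>k<c. (\<Sum>l<N. A v k l * x l) = 0)}),
        sections = (\<lambda>U. {s. (\<forall>l<N. twisted_regular n (proj_space n) 0 U (\<lambda>p v. s p l)) \<and>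
           (\<forall>p\<in>U. (\<forall>l\<ge>N. s p l = 0) \<and> (\<forall>v\<in>p. \<forall>k<c. (\<Sum>l<N. A v k l * s p l) = 0))})\<rparr>"

lemma fibreK: "x \<in> fibre K p \<longleftrightarrow> (\<forall>l\<ge>N. x l = 0) \<and> (\<forall>v\<in>p. \<forall>k<c. (\<Sum>l<N. A v k l * x l) = 0)"
  unfolding K_def by simp

lemma sectionsK: "s \<in> sections K U \<longleftrightarrow> (\<forall>l<N. twisted_regular n (proj_space n) 0 U (\<lambda>p v. s p l)) \<and> (\<forall>p\<in>U. s p \<in> fibre K p)"
  unfolding K_def by simp

sublocale proj_subset n "proj_space n :: 'k point set" by (rule proj_subset_whole)

lemma fibreKI:
  assumes "p \<in> proj_space n" "v \<in> p" "\<And>l. l \<ge> N \<Longrightarrow> x l = 0" "\<And>k. k < c \<Longrightarrow> (\<Sum>l<N. A v k l * x l) = 0"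
  shows "x \<in> fibre K p"
  unfolding fibreK
proof (intro conjI ballI allI impI)
  fix w k assume w: "w \<in> p" and k: "k < c"
  obtain t where "w = (\<lambda>i. t * v i)" using same_point[OF assms(1,2) w] by blast
  then show "(\<Sum>l<N. A w k l * x l) = 0" using assms(4)[OF k] by (simp add: ev_scale mult.assoc sum_distrib_left[symmetric])
qed (use assms in simp)

lemma lin_closed_K: "lin_closed (fibre K p)"
proof -
  have "(\<lambda>l. a * x l + b * y l) \<in> fibre K p" if "x \<in> fibre K p" "y \<in> fibre K p" for x y a b
  proof -
    have "(\<Sum>l<N. A v k l * (a * x l + b * y l)) = a * (\<Sum>l<N. A v k l * x l) + b * (\<Sum>l<N. A v k l * y l)" for v k
      by (simp add: sum_distrib_left sum.distrib algebra_simps)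
    then show ?thesis using that unfolding fibreK by simp
  qed
  moreover have "(\<lambda>_. 0) \<in> fibre K p" unfolding fibreK by simp
  ultimately show ?thesis unfolding lin_closed_def by blast
qed

lemma exists_independent: assumes "p \<in> proj_space n" "v \<in> p" shows "\<exists>w. indep2 n v w"
proof -
  obtain i where i: "i < Suc n" "v i \<noteq> 0" using proj_space_coord_nonzero[OF assms] by blast
  define i' where "i' = (if i = 0 then 1 else 0::nat)"
  have i': "i' < Suc n" "i' \<noteq> i" using n1 unfolding i'_def by auto
  have "indep2 n v (\<lambda>m. if m = i' then 1 else 0)"
    unfolding indep2_def
  proof (intro allI impI)
    fix s t assume z: "\<forall>m<Suc n. s * v m + t * (if m = i' then 1 else 0) = 0"
    have "s = 0" using z[rule_format, OF i(1)] i' i(2) by simp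
    then show "s = 0 \<and> t = 0" using z[rule_format, OF i'(1)] by simp
  qed
  then show ?thesis by blast
qed

text \<open>The line condition with \<open>h = 0\<close>, for \<open>v\<close> and any vector
  independent of it.\<close>

lemma pointwise_indep: assumes "p \<in> proj_space n" "v \<in> p" shows "indep_rows c N (A v)"
  unfolding indep_rows_def
proof (intro allI impI)
  fix g k assume g: "\<forall>l<N. (\<Sum>k<c. g k * A v k l) = 0" and k: "k < c"
  obtain w where w: "indep2 n v w" using exists_independent[OF assms] by blast
  show "g k = 0" using line_indepD[OF li w _ k, of g "\<lambda>_. 0"] g by simp
qed

text \<open>Near \<open>p\<close>, the columns \<open>c, \<dots>, N - 1\<close> of \<open>Y\<close>, projected to the kernel along the columns
  \<open>0, \<dots>, c - 1\<close>, give a frame; \<open>a\<close> is the inverse of the block \<open>A v * Y\<close> (by Cramer's rule).\<close>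

lemma local_inverse:
  assumes p: "p \<in> proj_space n"
  shows "\<exists>U G Y a. zopen n (proj_space n) U \<and> p \<in> U \<and>
    (\<forall>i<N. \<forall>j<N. (\<Sum>l<N. G i l * Y l j) = (if i = j then 1 else (0::'k))) \<and>
    (\<forall>i<N. \<forall>j<N. (\<Sum>l<N. Y i l * G l j) = (if i = j then 1 else 0)) \<and>
    (\<forall>k<c. \<forall>j<c. twisted_regular n (proj_space n) (- 1) U (\<lambda>q v. a v k j)) \<and>
    (\<forall>q\<in>U. \<forall>v\<in>q. \<forall>i<c. \<forall>j<c. (\<Sum>k<c. (\<Sum>l<N. A v i l * Y l k) * a v k j) = (if i = j then 1 else 0)) \<and>
    (\<forall>q\<in>U. \<forall>v\<in>q. \<forall>i<c. \<forall>j<c. (\<Sum>k<c. a v i k * (\<Sum>l<N. A v k l * Y l j)) = (if i = j then 1 else 0))"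
proof -
  define v0 where "v0 = rep p"
  have v0: "v0 \<in> p" unfolding v0_def by (rule rep_in[OF p])
  obtain G Y where GYG: "(\<forall>k<c. G k = A v0 k) \<and>
    (\<forall>k<N. \<forall>j<N. (\<Sum>l<N. G k l * Y l j) = (if k = j then 1 else 0)) \<and>
    (\<forall>k<N. \<forall>j<N. (\<Sum>l<N. Y k l * G l j) = (if k = j then 1 else 0))"
    using indep_rows_completion[OF pointwise_indep[OF p v0]] by (elim exE)
  note G = GYG[THEN conjunct1, rule_format] and GY = GYG[THEN conjunct2, THEN conjunct1, rule_format]
    and YG = GYG[THEN conjunct2, THEN conjunct2, rule_format]
  \<comment> \<open>At \<open>v0\<close> this block is the identity, since the first
    \<open>c\<close> rows of \<open>G\<close> are those of \<open>A v0\<close>. So its determinant,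
    a form of degree \<open>c\<close>, is nonzero near \<open>p\<close>.\<close>
  define D where "D v = mat c c (\<lambda>(j,k). \<Sum>l<N. A v j l * Y l k)" for v
  have Dc: "D v \<in> carrier_mat c c" for v unfolding D_def by simp
  have Dform: "form n 1 (\<lambda>v. \<Sum>l<N. A v j l * Y l k)" for j k
  proof -
    have "form n 1 (\<lambda>v. \<Sum>l<N. Y l k * A v j l)" by (intro form_sum form_scale form_ev)
    then show ?thesis by (simp add: mult.commute)
  qed
  have dform: "form n c (\<lambda>v. det (D v))" unfolding D_def by (rule det_form) (rule Dform)
  have aform: "form n (c - 1) (\<lambda>v. adj_mat (D v) $$ (k,j))" if "k < c" "j < c" for k j
  proof -
    have "form n (c - 1) (\<lambda>v. cofactor (D v) j k)" unfolding D_def by (rule cofactor_form) (use Dform that in auto)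
    then show ?thesis using that unfolding adj_mat_def D_def by simp
  qed
  define a where "a v k j = adj_mat (D v) $$ (k,j) / det (D v)" for v k j
  define U where "U = {q\<in>proj_space n. \<exists>v\<in>q. det (D v) \<noteq> 0}"
  have zU: "zopen n (proj_space n) U" unfolding U_def by (rule zopen_basic[OF dform])
  have nz: "det (D v) \<noteq> 0" if "q \<in> U" "v \<in> q" for q v
    using form_nonzero_on_point[OF dform, of q _ v] that unfolding U_def by blast
  have "D v0 = 1\<^sub>m c"
  proof (rule eq_matI)
    fix i j assume "i < dim_row (1\<^sub>m c :: 'k mat)" "j < dim_col (1\<^sub>m c :: 'k mat)"
    then have ij: "i < c" "j < c" by auto
    then show "D v0 $$ (i, j) = 1\<^sub>m c $$ (i, j)" using GY[of i j] G[of i] unfolding D_def by simp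
  qed (simp_all add: D_def)
  then have pU: "p \<in> U" using p v0 unfolding U_def by (auto intro!: bexI[of _ v0])
  have inv1: "(\<Sum>k<c. (\<Sum>l<N. A v i l * Y l k) * a v k j) = (if i = j then 1 else 0)" if q: "q \<in> U" "v \<in> q" and ij: "i < c" "j < c" for q v i j
  proof -
    have "(D v * adj_mat (D v)) $$ (i,j) = (\<Sum>k<c. (\<Sum>l<N. A v i l * Y l k) * adj_mat (D v) $$ (k,j))"
      using ij adj_mat(1)[OF Dc[of v]] by (simp add: scalar_prod_def D_def atLeast0LessThan del: sum.op_ivl_Suc)
    then have "(\<Sum>k<c. (\<Sum>l<N. A v i l * Y l k) * adj_mat (D v) $$ (k,j)) = det (D v) * (if i = j then 1 else 0)"
      unfolding adj_mat(2)[OF Dc] using ij by simp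
    then show ?thesis using nz[OF q] unfolding a_def by (simp add: sum_divide_distrib[symmetric])
  qed
  have inv2: "(\<Sum>k<c. a v i k * (\<Sum>l<N. A v k l * Y l j)) = (if i = j then 1 else 0)" if q: "q \<in> U" "v \<in> q" and ij: "i < c" "j < c" for q v i j
  proof -
    have "(adj_mat (D v) * D v) $$ (i,j) = (\<Sum>k<c. adj_mat (D v) $$ (i,k) * (\<Sum>l<N. A v k l * Y l j))"
      using ij adj_mat(1)[OF Dc[of v]] by (simp add: scalar_prod_def D_def atLeast0LessThan del: sum.op_ivl_Suc)
    then have "(\<Sum>k<c. adj_mat (D v) $$ (i,k) * (\<Sum>l<N. A v k l * Y l j)) = det (D v) * (if i = j then 1 else 0)"
      unfolding adj_mat(3)[OF Dc] using ij by simp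
    then show ?thesis using nz[OF q] unfolding a_def by (simp add: sum_divide_distrib[symmetric])
  qed
  \<comment> \<open>Cofactors have degree \<open>c - 1\<close> and the determinant has degree
    \<open>c\<close>.\<close>
  have areg: "twisted_regular n (proj_space n) (- 1) U (\<lambda>q v. a v k j)" if "k < c" "j < c" for k j
    unfolding a_def by (rule tr_quotient[OF aform[OF that] dform _ zU nz]) (use c1 in auto)
  show ?thesis
    by (intro exI[of _ U] exI[of _ G] exI[of _ Y] exI[of _ a] conjI allI impI ballI zU pU GY YG areg inv1 inv2)
qed

text \<open>The coordinates with respect to the frame are given by functionals \<open>B\<close> that
  do not depend on the point. Coordinates of any section with regular entries are therefore regular,
  over open sets as well as over lines.\<close>

lemma local_basis:
  assumes p: "p \<in> proj_space n"
  shows "\<exists>U e B. zopen n (proj_space n) U \<and> p \<in> U \<and> (\<forall>i<r. e i \<in> sections K U) \<and>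
    (\<forall>q\<in>U. \<forall>x\<in>fibre K q. x = (\<lambda>m. \<Sum>i<r. (\<Sum>l<N. B i l * x l) * e i q m)) \<and>
    (\<forall>q\<in>U. \<forall>i<r. \<forall>j<r. (\<Sum>l<N. B i l * e j q l) = (if i = j then 1 else 0))"
proof -
  obtain U G Y a where UG: "zopen n (proj_space n) U \<and> p \<in> U \<and>
    (\<forall>i<N. \<forall>j<N. (\<Sum>l<N. G i l * Y l j) = (if i = j then 1 else (0::'k))) \<and>
    (\<forall>i<N. \<forall>j<N. (\<Sum>l<N. Y i l * G l j) = (if i = j then 1 else 0)) \<and>
    (\<forall>k<c. \<forall>j<c. twisted_regular n (proj_space n) (- 1) U (\<lambda>q v. a v k j)) \<and>
    (\<forall>q\<in>U. \<forall>v\<in>q. \<forall>i<c. \<forall>j<c. (\<Sum>k<c. (\<Sum>l<N. A v i l * Y l k) * a v k j) = (if i = j then 1 else 0)) \<and>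
    (\<forall>q\<in>U. \<forall>v\<in>q. \<forall>i<c. \<forall>j<c. (\<Sum>k<c. a v i k * (\<Sum>l<N. A v k l * Y l j)) = (if i = j then 1 else 0))"
    using local_inverse[OF p] by (elim exE)
  note zU = UG[THEN conjunct1] and pU = UG[THEN conjunct2, THEN conjunct1]
    and GY = UG[THEN conjunct2, THEN conjunct2, THEN conjunct1, rule_format]
    and YG = UG[THEN conjunct2, THEN conjunct2, THEN conjunct2, THEN conjunct1, rule_format]
    and areg = UG[THEN conjunct2, THEN conjunct2, THEN conjunct2, THEN conjunct2, THEN conjunct1, rule_format]
    and inv1 = UG[THEN conjunct2, THEN conjunct2, THEN conjunct2, THEN conjunct2, THEN conjunct2, THEN conjunct1, rule_format]
    and inv2 = UG[THEN conjunct2, THEN conjunct2, THEN conjunct2, THEN conjunct2, THEN conjunct2, THEN conjunct2, rule_format]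
  have UP: "U \<subseteq> proj_space n" by (rule zopen_subset[OF zU])
  \<comment> \<open>The inverse block applied to \<open>A v\<close> times column
    \<open>c + i\<close> of \<open>Y\<close>: the combination of the first \<open>c\<close> columns
    that has to be subtracted to reach the kernel. Its degree is \<open>-1 + 1 = 0\<close>.\<close>
  define \<beta> where "\<beta> v k i = (\<Sum>j<c. a v k j * (\<Sum>m<N. A v j m * Y m (c + i)))" for v k i
  have breg: "twisted_regular n (proj_space n) 0 U (\<lambda>q v. \<beta> v k i)" if k: "k < c" for k i
    unfolding \<beta>_def
  proof (rule tr_sum[OF zU])
    fix j assume "j \<in> {..<c}"
    then have j: "j < c" by simp
    have "form n 1 (\<lambda>v. \<Sum>m<N. Y m (c + i) * A v j m)" by (intro form_sum form_scale form_ev)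
    then have "form n 1 (\<lambda>v. \<Sum>m<N. A v j m * Y m (c + i))" by (simp add: mult.commute)
    from tr_mult[OF areg[OF k j] tr_form[OF this zU]]
    show "twisted_regular n (proj_space n) 0 U (\<lambda>q v. a v k j * (\<Sum>m<N. A v j m * Y m (c + i)))" by simp
  qed
  define e where "e i q l = (if l < N then Y l (c + i) - (\<Sum>k<c. Y l k * \<beta> (rep q) k i) else 0)" for i q l
  have esec: "e i \<in> sections K U" for i
    unfolding sectionsK
  proof (intro conjI allI impI ballI)
    fix l assume l: "l < N"
    have t: "twisted_regular n (proj_space n) 0 U (\<lambda>q v. Y l (c + i) + (-1) * (\<Sum>k<c. Y l k * \<beta> v k i))"
      by (intro tr_add tr_const tr_scale tr_sum zU breg) auto
    show "twisted_regular n (proj_space n) 0 U (\<lambda>q v. e i q l)"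
    proof (rule tr_cong[OF t])
      fix q v assume q: "q \<in> U" "v \<in> q"
      then have qP: "q \<in> proj_space n" using UP by blast
      obtain t where t: "t \<noteq> 0" "rep q = (\<lambda>i. t * v i)" using same_point[OF qP q(2) rep_in[OF qP]] by blast
      have "\<beta> (rep q) k i = \<beta> v k i" if "k < c" for k
        unfolding t(2) using tr_homogeneous[OF breg[OF that] q t(1) qP] by simp
      then show "Y l (c + i) + (-1) * (\<Sum>k<c. Y l k * \<beta> v k i) = e i q l" unfolding e_def using l by simp
    qed
  next
    fix q assume q: "q \<in> U"
    then have qP: "q \<in> proj_space n" using UP by blast
    let ?v = "rep q"
    show "e i q \<in> fibre K q"
    proof (rule fibreKI[OF qP rep_in[OF qP]])
      fix k assume k: "k < c"
      have "(\<Sum>l<N. A ?v k l * e i q l) = (\<Sum>l<N. A ?v k l * Y l (c + i)) - (\<Sum>l<N. A ?v k l * (\<Sum>k<c. Y l k * \<beta> ?v k i))"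
        by (simp add: e_def right_diff_distrib sum_subtractf)
      also have "(\<Sum>l<N. A ?v k l * (\<Sum>k<c. Y l k * \<beta> ?v k i)) = (\<Sum>k'<c. (\<Sum>l<N. A ?v k l * Y l k') * \<beta> ?v k' i)"
        by (simp add: sum_distrib_left sum_distrib_right mult.assoc) (subst sum.swap, simp)
      also have "\<dots> = (\<Sum>j<c. (\<Sum>k'<c. (\<Sum>l<N. A ?v k l * Y l k') * a ?v k' j) * (\<Sum>m<N. A ?v j m * Y m (c + i)))"
        unfolding \<beta>_def by (simp add: sum_distrib_left[of "\<Sum>l<N. _ l"] sum_distrib_right[of _ "{..<c}"] mult.assoc) (subst sum.swap, simp)
      also have "\<dots> = (\<Sum>j<c. if k = j then (\<Sum>m<N. A ?v j m * Y m (c + i)) else 0)"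
        by (intro sum.cong refl) (use inv1[OF q rep_in[OF qP] k] in auto)
      finally show "(\<Sum>l<N. A ?v k l * e i q l) = 0" using k by (simp add: sum.delta')
    qed (simp add: e_def)
  qed
  have dual: "(\<Sum>l<N. G (c + i) l * e j q l) = (if i = j then 1 else 0)" if ij: "i < r" "j < r" for i j q
  proof -
    have "(\<Sum>l<N. G (c + i) l * e j q l) = (\<Sum>l<N. G (c + i) l * Y l (c + j)) - (\<Sum>l<N. G (c + i) l * (\<Sum>k<c. Y l k * \<beta> (rep q) k j))"
      by (simp add: e_def right_diff_distrib sum_subtractf)
    also have "(\<Sum>l<N. G (c + i) l * (\<Sum>k<c. Y l k * \<beta> (rep q) k j)) = (\<Sum>k<c. (\<Sum>l<N. G (c + i) l * Y l k) * \<beta> (rep q) k j)"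
      by (simp add: sum_distrib_left sum_distrib_right mult.assoc) (subst sum.swap, simp)
    also have "\<dots> = 0" by (intro sum.neutral ballI) (use GY ij in auto)
    finally show ?thesis using GY[of "c + i" "c + j"] ij by simp
  qed
  have expand: "x = (\<lambda>m. \<Sum>i<r. (\<Sum>l<N. G (c + i) l * x l) * e i q m)" if q: "q \<in> U" and x: "x \<in> fibre K q" for q x
  proof
    fix m
    have qP: "q \<in> proj_space n" using UP q by blast
    let ?v = "rep q"
    show "x m = (\<Sum>i<r. (\<Sum>l<N. G (c + i) l * x l) * e i q m)"
    proof (cases "m < N")
      case False
      then show ?thesis using x unfolding fibreK e_def by simp
    next
      case m: True
      define y where "y l = (\<Sum>i<N. G l i * x i)" for l
      have xy: "x l = (\<Sum>k<c. Y l k * y k) + (\<Sum>i<r. Y l (c + i) * y (c + i))" if l: "l < N" for l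
      proof -
        have "(\<Sum>k<c + r. Y l k * y k) = (\<Sum>i<N. (\<Sum>k<N. Y l k * G k i) * x i)"
          unfolding y_def add.commute[of c r] by (simp add: sum_distrib_left sum_distrib_right mult.assoc) (subst sum.swap, simp)
        also have "\<dots> = (\<Sum>i<N. if l = i then x i else 0)" by (intro sum.cong refl) (use YG l in auto)
        also have "\<dots> = x l" using l by (simp add: sum.delta')
        finally show ?thesis unfolding sum_lessThan_add by simp
      qed
      \<comment> \<open>Here \<open>y\<close> holds the coordinates of \<open>x\<close> in the basis
        of columns of \<open>Y\<close>. The kernel condition determines the first \<open>c\<close>
        of them from the others.\<close>
      have yk: "y k = - (\<Sum>i<r. \<beta> ?v k i * y (c + i))" if k: "k < c" for k
      proof -
        have "0 = (\<Sum>j<c. a ?v k j * (\<Sum>l<N. A ?v j l * x l))"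
          using x rep_in[OF qP] unfolding fibreK by simp
        also have "\<dots> = (\<Sum>j<c. a ?v k j * ((\<Sum>k'<c. (\<Sum>l<N. A ?v j l * Y l k') * y k') + (\<Sum>i<r. (\<Sum>l<N. A ?v j l * Y l (c + i)) * y (c + i))))"
        proof (intro sum.cong refl arg_cong2[of _ _ _ _ "(*)"])
          fix j
          have "(\<Sum>l<N. A ?v j l * x l) = (\<Sum>l<N. A ?v j l * (\<Sum>k<c. Y l k * y k)) + (\<Sum>l<N. A ?v j l * (\<Sum>i<r. Y l (c + i) * y (c + i)))"
            unfolding sum.distrib[symmetric] distrib_left[symmetric] using xy by (intro sum.cong refl) simp
          also have "(\<Sum>l<N. A ?v j l * (\<Sum>k<c. Y l k * y k)) = (\<Sum>k'<c. (\<Sum>l<N. A ?v j l * Y l k') * y k')"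
            by (simp add: sum_distrib_left sum_distrib_right mult.assoc) (subst sum.swap, simp)
          also have "(\<Sum>l<N. A ?v j l * (\<Sum>i<r. Y l (c + i) * y (c + i))) = (\<Sum>i<r. (\<Sum>l<N. A ?v j l * Y l (c + i)) * y (c + i))"
            by (simp add: sum_distrib_left sum_distrib_right mult.assoc) (subst sum.swap, simp)
          finally show "(\<Sum>l<N. A ?v j l * x l) = (\<Sum>k'<c. (\<Sum>l<N. A ?v j l * Y l k') * y k') + (\<Sum>i<r. (\<Sum>l<N. A ?v j l * Y l (c + i)) * y (c + i))" .
        qed
        also have "\<dots> = (\<Sum>k'<c. (\<Sum>j<c. a ?v k j * (\<Sum>l<N. A ?v j l * Y l k')) * y k') + (\<Sum>i<r. \<beta> ?v k i * y (c + i))"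
        proof -
          have "(\<Sum>j<c. a ?v k j * (\<Sum>k'<c. (\<Sum>l<N. A ?v j l * Y l k') * y k')) = (\<Sum>k'<c. (\<Sum>j<c. a ?v k j * (\<Sum>l<N. A ?v j l * Y l k')) * y k')"
            by (rule sum_product_assoc)
          moreover have "(\<Sum>j<c. a ?v k j * (\<Sum>i<r. (\<Sum>l<N. A ?v j l * Y l (c + i)) * y (c + i))) = (\<Sum>i<r. \<beta> ?v k i * y (c + i))"
            unfolding \<beta>_def by (rule sum_product_assoc)
          ultimately show ?thesis by (simp add: distrib_left sum.distrib)
        qed
        also have "(\<Sum>k'<c. (\<Sum>j<c. a ?v k j * (\<Sum>l<N. A ?v j l * Y l k')) * y k') = (\<Sum>k'<c. if k = k' then y k' else 0)"
          by (intro sum.cong refl) (use inv2[OF q rep_in[OF qP] k] in auto)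
        also have "\<dots> = y k" using k by (simp add: sum.delta')
        finally show ?thesis by (simp add: eq_neg_iff_add_eq_0)
      qed
      have "(\<Sum>k<c. Y m k * y k) = - (\<Sum>i<r. y (c + i) * (\<Sum>k<c. Y m k * \<beta> ?v k i))"
      proof -
        have "(\<Sum>k<c. Y m k * y k) = - (\<Sum>k<c. \<Sum>i<r. Y m k * (\<beta> ?v k i * y (c + i)))"
          unfolding sum_negf[symmetric] by (intro sum.cong refl) (simp add: yk sum_distrib_left sum_negf)
        also have "(\<Sum>k<c. \<Sum>i<r. Y m k * (\<beta> ?v k i * y (c + i))) = (\<Sum>i<r. y (c + i) * (\<Sum>k<c. Y m k * \<beta> ?v k i))"
          unfolding sum_distrib_left by (subst sum.swap) (simp add: mult_ac)
        finally show ?thesis .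
      qed
      then have "x m = (\<Sum>i<r. y (c + i) * (Y m (c + i) - (\<Sum>k<c. Y m k * \<beta> ?v k i)))"
        unfolding xy[OF m] by (simp add: right_diff_distrib sum_subtractf mult.commute)
      then show ?thesis using m unfolding y_def e_def by simp
    qed
  qed
  show ?thesis
    by (intro exI[of _ U] exI[of _ e] exI[of _ "\<lambda>i. G (c + i)"] conjI allI impI ballI zU pU esec expand dual)
qed

end

context kernel_bundle
begin

lemma local_basisE:
  assumes p: "p \<in> proj_space n"
  obtains U e B where "zopen n (proj_space n) U \<and> p \<in> U \<and> (\<forall>i<r. e i \<in> sections K U) \<and>
    (\<forall>q\<in>U. \<forall>x\<in>fibre K q. x = (\<lambda>m. \<Sum>i<r. (\<Sum>l<N. B i l * x l) * e i q m)) \<and>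
    (\<forall>q\<in>U. \<forall>i<r. \<forall>j<r. (\<Sum>l<N. B i l * e j q l) = (if i = j then 1 else 0))"
  using local_basis[OF p] that by (elim exE)

lemma vector_bundle_K: "vector_bundle n (proj_space n) r K"
  unfolding vector_bundle_def
proof (intro conjI allI impI ballI)
  fix U V s assume a: "zopen n (proj_space n) U \<and> zopen n (proj_space n) V \<and> V \<subseteq> U \<and> s \<in> sections K U"
  show "s \<in> sections K V"
    unfolding sectionsK
  proof (intro conjI allI impI ballI)
    fix l assume "l < N"
    then have "twisted_regular n (proj_space n) 0 U (\<lambda>p v. s p l)" using a unfolding sectionsK by blast
    then show "twisted_regular n (proj_space n) 0 V (\<lambda>p v. s p l)" by (rule tr_subset) (use a in auto)
  qed (use a in \<open>auto simp: sectionsK\<close>)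
next
  fix U s assume a: "zopen n (proj_space n) U \<and> (\<forall>p\<in>U. \<exists>V. zopen n (proj_space n) V \<and> p \<in> V \<and> V \<subseteq> U \<and> s \<in> sections K V)"
  show "s \<in> sections K U"
    unfolding sectionsK
  proof (intro conjI allI impI ballI)
    fix l assume l: "l < N"
    show "twisted_regular n (proj_space n) 0 U (\<lambda>p v. s p l)"
    proof (rule tr_local)
      fix p assume "p \<in> U"
      then obtain V where "zopen n (proj_space n) V \<and> p \<in> V \<and> V \<subseteq> U \<and> s \<in> sections K V" using a by blast
      then show "\<exists>V. zopen n (proj_space n) V \<and> p \<in> V \<and> V \<subseteq> U \<and> twisted_regular n (proj_space n) 0 V (\<lambda>p v. s p l)"
        using l unfolding sectionsK by (intro exI[of _ V]) blast
    qed
  next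
    fix p assume "p \<in> U"
    then show "s p \<in> fibre K p" using a unfolding sectionsK by blast
  qed
next
  fix p :: "'k point" assume p: "p \<in> proj_space n"
  obtain U e B where UeB: "zopen n (proj_space n) U \<and> p \<in> U \<and> (\<forall>i<r. e i \<in> sections K U) \<and>
    (\<forall>q\<in>U. \<forall>x\<in>fibre K q. x = (\<lambda>m. \<Sum>i<r. (\<Sum>l<N. B i l * x l) * e i q m)) \<and>
    (\<forall>q\<in>U. \<forall>i<r. \<forall>j<r. (\<Sum>l<N. B i l * e j q l) = (if i = j then 1 else 0))" by (rule local_basisE[OF p])
  note zU = UeB[THEN conjunct1] and pU = UeB[THEN conjunct2, THEN conjunct1]
    and esec = UeB[THEN conjunct2, THEN conjunct2, THEN conjunct1, rule_format]
    and expand = UeB[THEN conjunct2, THEN conjunct2, THEN conjunct2, THEN conjunct1, rule_format]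
    and dual = UeB[THEN conjunct2, THEN conjunct2, THEN conjunct2, THEN conjunct2, rule_format]
  have efib: "e i q \<in> fibre K q" if "i < r" "q \<in> U" for i q using esec[OF that(1)] that(2) unfolding sectionsK by blast
  have "local_frame n (proj_space n) K r U e"
    unfolding local_frame_def
  proof (intro conjI ballI allI impI)
    fix q assume q: "q \<in> U"
    show "fibre K q = {(\<lambda>x. \<Sum>i<r. a i * e i q x) | a. True}"
    proof (intro equalityI subsetI)
      fix x assume "x \<in> fibre K q"
      from expand[OF q this] show "x \<in> {(\<lambda>x. \<Sum>i<r. a i * e i q x) | a. True}"
        by (intro CollectI exI[of _ "\<lambda>i. \<Sum>l<N. B i l * x l"] conjI TrueI)
    next
      fix x assume "x \<in> {(\<lambda>x. \<Sum>i<r. a i * e i q x) | a. True}"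
      then obtain a where "x = (\<lambda>x. \<Sum>i<r. a i * e i q x)" by auto
      then show "x \<in> fibre K q" using lin_closed_sum[OF lin_closed_K, of r "\<lambda>i. e i q" q a] efib q by simp
    qed
  next
    fix q a i assume q: "q \<in> U" and z: "\<forall>x. (\<Sum>i<r. a i * e i q x) = 0" and i: "i < r"
    have "0 = (\<Sum>l<N. B i l * (\<Sum>j<r. e j q l * a j))" using z by (simp add: mult.commute)
    also have "\<dots> = (\<Sum>j<r. (\<Sum>l<N. B i l * e j q l) * a j)" by (rule sum_product_assoc)
    also have "\<dots> = (\<Sum>j<r. if i = j then a j else 0)" by (intro sum.cong refl) (use dual[OF q i] in auto)
    finally show "a i = 0" using i by (simp add: sum.delta')
  next
    fix W s assume "zopen n (proj_space n) W \<and> W \<subseteq> U"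
    then have W: "zopen n (proj_space n) W" "W \<subseteq> U" by auto
    show "s \<in> sections K W \<longleftrightarrow> (\<exists>f. (\<forall>i<r. regular_fun n (proj_space n) W (f i)) \<and> (\<forall>q\<in>W. s q = (\<lambda>x. \<Sum>i<r. f i q * e i q x)))"
    proof
      assume s: "s \<in> sections K W"
      show "\<exists>f. (\<forall>i<r. regular_fun n (proj_space n) W (f i)) \<and> (\<forall>q\<in>W. s q = (\<lambda>x. \<Sum>i<r. f i q * e i q x))"
      proof (intro exI[of _ "\<lambda>i q. \<Sum>l<N. B i l * s q l"] conjI allI impI ballI)
        fix i
        show "regular_fun n (proj_space n) W (\<lambda>q. \<Sum>l<N. B i l * s q l)"
          unfolding regular_fun_def by (intro tr_sum tr_scale W(1)) (use s in \<open>auto simp: sectionsK\<close>)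
      next
        fix q assume q: "q \<in> W"
        show "s q = (\<lambda>x. \<Sum>i<r. (\<Sum>l<N. B i l * s q l) * e i q x)"
          by (rule expand) (use q W(2) s in \<open>auto simp: sectionsK\<close>)
      qed
    next
      assume "\<exists>f. (\<forall>i<r. regular_fun n (proj_space n) W (f i)) \<and> (\<forall>q\<in>W. s q = (\<lambda>x. \<Sum>i<r. f i q * e i q x))"
      then obtain f where f: "(\<forall>i<r. regular_fun n (proj_space n) W (f i)) \<and> (\<forall>q\<in>W. s q = (\<lambda>x. \<Sum>i<r. f i q * e i q x))" by (elim exE)
      show "s \<in> sections K W"
        unfolding sectionsK
      proof (intro conjI allI impI ballI)
        fix l assume l: "l < N"
        have "twisted_regular n (proj_space n) 0 W (\<lambda>q v. f i q * e i q l)" if "i < r" for i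
        proof -
          have "twisted_regular n (proj_space n) 0 W (\<lambda>q v. e i q l)"
            using esec[OF that] l by (intro tr_subset[OF _ W]) (auto simp: sectionsK)
          then show ?thesis using tr_mult[of 0 W "\<lambda>q v. f i q" 0] f that unfolding regular_fun_def by simp
        qed
        then have t: "twisted_regular n (proj_space n) 0 W (\<lambda>q v. \<Sum>i<r. f i q * e i q l)" by (intro tr_sum W(1)) auto
        show "twisted_regular n (proj_space n) 0 W (\<lambda>q v. s q l)" by (rule tr_cong[OF t]) (use f in simp)
      next
        fix q assume q: "q \<in> W"
        then have "s q = (\<lambda>x. \<Sum>i<r. f i q * e i q x)" using f by blast
        then show "s q \<in> fibre K q" using lin_closed_sum[OF lin_closed_K, of r "\<lambda>i. e i q" q "\<lambda>i. f i q"] efib q W(2) by auto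
      qed
    qed
  qed
  then show "\<exists>U e. zopen n (proj_space n) U \<and> p \<in> U \<and> local_frame n (proj_space n) K r U e" using zU pU by blast
qed

sublocale vb: vbundle_on n r K by unfold_locales (rule vector_bundle_K)

subsection \<open>The Steiner sequence\<close>

definition piK :: "'k point \<Rightarrow> (nat \<times> 'k vect \<Rightarrow> 'k) \<Rightarrow> nat \<times> 'k vect \<Rightarrow> 'k" where
  "piK p u = (\<lambda>(k,v). if k < c \<and> v \<in> p then \<Sum>l<N. A v k l * u (l, v) else 0)"

lemma local_right_inverse:
  assumes p: "p \<in> proj_space n"
  shows "\<exists>U \<rho>. zopen n (proj_space n) U \<and> p \<in> U \<and>
    (\<forall>l<N. \<forall>j<c. twisted_regular n (proj_space n) (- 1) U (\<lambda>q v. \<rho> v l j)) \<and>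
    (\<forall>q\<in>U. \<forall>v\<in>q. \<forall>i<c. \<forall>j<c. (\<Sum>l<N. A v i l * \<rho> v l j) = (if i = j then 1 else 0))"
proof -
  obtain U G Y a where UG: "zopen n (proj_space n) U \<and> p \<in> U \<and>
    (\<forall>i<N. \<forall>j<N. (\<Sum>l<N. G i l * Y l j) = (if i = j then 1 else (0::'k))) \<and>
    (\<forall>i<N. \<forall>j<N. (\<Sum>l<N. Y i l * G l j) = (if i = j then 1 else 0)) \<and>
    (\<forall>k<c. \<forall>j<c. twisted_regular n (proj_space n) (- 1) U (\<lambda>q v. a v k j)) \<and>
    (\<forall>q\<in>U. \<forall>v\<in>q. \<forall>i<c. \<forall>j<c. (\<Sum>k<c. (\<Sum>l<N. A v i l * Y l k) * a v k j) = (if i = j then 1 else 0)) \<and>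
    (\<forall>q\<in>U. \<forall>v\<in>q. \<forall>i<c. \<forall>j<c. (\<Sum>k<c. a v i k * (\<Sum>l<N. A v k l * Y l j)) = (if i = j then 1 else 0))"
    using local_inverse[OF p] by (elim exE)
  note zU = UG[THEN conjunct1] and pU = UG[THEN conjunct2, THEN conjunct1]
    and areg = UG[THEN conjunct2, THEN conjunct2, THEN conjunct2, THEN conjunct2, THEN conjunct1, rule_format]
    and inv1 = UG[THEN conjunct2, THEN conjunct2, THEN conjunct2, THEN conjunct2, THEN conjunct2, THEN conjunct1, rule_format]
  show ?thesis
  proof (intro exI[of _ U] exI[of _ "\<lambda>v l j. \<Sum>k<c. Y l k * a v k j"] conjI allI impI ballI zU pU)
    fix l j assume "j < c"
    then show "twisted_regular n (proj_space n) (- 1) U (\<lambda>q v. \<Sum>k<c. Y l k * a v k j)"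
      by (intro tr_sum tr_scale zU areg) auto
  next
    fix q v i j assume "q \<in> U" "v \<in> q" "i < c" "j < c"
    then show "(\<Sum>l<N. A v i l * (\<Sum>k<c. Y l k * a v k j)) = (if i = j then 1 else 0)"
      unfolding sum_product_assoc by (rule inv1)
  qed
qed

lemma steiner_K: "steiner_bundle n r c K"
proof -
  let ?F = "power_bundle N (twist_bundle n (proj_space n :: 'k point set) 0)"
  let ?G = "power_bundle c (twist_bundle n (proj_space n :: 'k point set) 1)"
  have piK_emb: "piK p (emb N p x) (k, v) = (\<Sum>l<N. A v k l * x l)" if "k < c" "v \<in> p" for p x k v
    using that unfolding piK_def by (simp add: emb_apply)
  have piK_out: "piK p u (k, v) = 0" if "\<not> (k < c \<and> v \<in> p)" for p u k v using that unfolding piK_def by auto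
  have hi: "bundle_hom n (proj_space n) K ?F (emb N)"
    unfolding bundle_hom_def
  proof (intro conjI ballI allI impI)
    fix U s assume "zopen n (proj_space n) U \<and> s \<in> sections K U"
    then show "(\<lambda>p. emb N p (s p)) \<in> sections ?F U" by (intro emb_section) (auto simp: sectionsK)
  qed (rule emb_in_fibre, assumption, auto simp: emb_def fun_eq_iff)
  have hp: "bundle_hom n (proj_space n) ?F ?G piK"
    unfolding bundle_hom_def
  proof (intro conjI ballI allI impI)
    fix p u assume p: "p \<in> proj_space n" and u: "u \<in> fibre ?F p"
    have uu: "u (l, \<lambda>i. t * v i) = u (l, v)" if "l < N" "v \<in> p" "t \<noteq> 0" for l v t
      using u that unfolding direct_sum_def twist_bundle_def by simp
    show "piK p u \<in> fibre ?G p"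
      unfolding direct_sum_def twist_bundle_def piK_def using scale_in_point[OF p]
      by (auto simp: uu ev_scale sum_distrib_left mult.assoc)
  next
    fix p u w a b
    show "piK p (\<lambda>x. a * u x + b * w x) = (\<lambda>y. a * piK p u y + b * piK p w y)"
      unfolding piK_def by (auto simp: fun_eq_iff sum_distrib_left sum.distrib[symmetric] algebra_simps)
  next
    fix U s assume a: "zopen n (proj_space n) U \<and> s \<in> sections ?F U"
    then have zU: "zopen n (proj_space n) U" by blast
    have "twisted_regular n (proj_space n) 1 U (\<lambda>p v. piK p (s p) (k, v))" if k: "k < c" for k
    proof -
      have "twisted_regular n (proj_space n) 1 U (\<lambda>p v. A v k l * s p (l, v))" if "l < N" for l
        using tr_mult[OF tr_form[OF form_ev zU] power_trivial_section[OF _ that]] a by fastforce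
      then have t: "twisted_regular n (proj_space n) 1 U (\<lambda>p v. \<Sum>l<N. A v k l * s p (l, v))" by (intro tr_sum zU) auto
      show ?thesis by (rule tr_cong[OF t]) (use k in \<open>simp add: piK_def\<close>)
    qed
    then show "(\<lambda>p. piK p (s p)) \<in> sections ?G U"
      unfolding direct_sum_def twist_bundle_def by (auto simp: piK_out)
  qed
  have ker_iff: "piK p (emb N p x) = (\<lambda>_. 0) \<longleftrightarrow> (\<forall>v\<in>p. \<forall>k<c. (\<Sum>l<N. A v k l * x l) = 0)" for p x
  proof
    assume z: "piK p (emb N p x) = (\<lambda>_. 0)"
    show "\<forall>v\<in>p. \<forall>k<c. (\<Sum>l<N. A v k l * x l) = 0"
      using z by (auto simp: piK_emb[symmetric])
  next
    assume "\<forall>v\<in>p. \<forall>k<c. (\<Sum>l<N. A v k l * x l) = 0"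
    then show "piK p (emb N p x) = (\<lambda>_. 0)" by (auto simp: fun_eq_iff piK_def emb_apply)
  qed
  have "short_exact n (proj_space n) K ?F ?G (emb N) piK"
    unfolding short_exact_def
  proof (intro conjI hi hp allI impI ballI)
    fix U s p assume a: "zopen n (proj_space n) U \<and> s \<in> sections K U \<and> (\<forall>p\<in>U. emb N p (s p) = (\<lambda>_. 0))" and p: "p \<in> U"
    then have pP: "p \<in> proj_space n" and fib: "s p \<in> fibre K p" and z: "emb N p (s p) = (\<lambda>_. 0)"
      using zopen_subset[of n "proj_space n" U] by (auto simp: sectionsK)
    show "s p = (\<lambda>_. 0)"
    proof
      fix l show "s p l = 0"
      proof (cases "l < N")
        case True
        then show ?thesis using emb_apply[OF True rep_in[OF pP], of "s p"] z by simp
      next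
        case False
        then show ?thesis using fib by (simp add: fibreK)
      qed
    qed
  next
    fix U t assume a: "zopen n (proj_space n) U \<and> t \<in> sections ?F U"
    then have zU: "zopen n (proj_space n) U" and t: "t \<in> sections ?F U" by auto
    have UP: "U \<subseteq> proj_space n" by (rule zopen_subset[OF zU])
    have temb: "t p = emb N p (\<lambda>l. t p (l, v))" if "p \<in> U" "v \<in> p" for p v
      by (rule power_trivial_fibre_emb[OF _ power_section_fibre[OF t zU that(1)] that(2)]) (use that UP in blast)
    show "(\<forall>p\<in>U. piK p (t p) = (\<lambda>_. 0)) \<longleftrightarrow> (\<exists>s\<in>sections K U. \<forall>p\<in>U. emb N p (s p) = t p)"
    proof
      assume z: "\<forall>p\<in>U. piK p (t p) = (\<lambda>_. 0)"
      define s where "s p l = (if l < N then t p (l, rep p) else 0)" for p l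
      have es: "emb N p (s p) = t p" if "p \<in> U" for p
      proof -
        have "emb N p (s p) = emb N p (\<lambda>l. t p (l, rep p))" unfolding s_def by (rule emb_cong) simp
        then show ?thesis using temb[OF that rep_in] that UP by auto
      qed
      have "s \<in> sections K U"
        unfolding sectionsK
      proof (intro conjI allI impI ballI)
        fix l assume l: "l < N"
        show "twisted_regular n (proj_space n) 0 U (\<lambda>p v. s p l)"
        proof (rule tr_cong[OF power_trivial_section[OF t l]])
          fix p v assume p: "p \<in> U" "v \<in> p"
          show "t p (l, v) = s p l" using es[OF p(1)] emb_apply[OF l p(2), of "s p"] by simp
        qed
      next
        fix p assume p: "p \<in> U"
        have "piK p (emb N p (s p)) = (\<lambda>_. 0)" using z es[OF p] p by simp
        then show "s p \<in> fibre K p" unfolding ker_iff fibreK by (simp add: s_def)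
      qed
      then show "\<exists>s\<in>sections K U. \<forall>p\<in>U. emb N p (s p) = t p" using es by blast
    next
      assume "\<exists>s\<in>sections K U. \<forall>p\<in>U. emb N p (s p) = t p"
      then obtain s where s: "s \<in> sections K U" "\<forall>p\<in>U. emb N p (s p) = t p" by blast
      have "piK p (emb N p (s p)) = (\<lambda>_. 0)" if "p \<in> U" for p
        unfolding ker_iff using s(1) that unfolding sectionsK fibreK by blast
      then show "\<forall>p\<in>U. piK p (t p) = (\<lambda>_. 0)" using s(2) by simp
    qed
  next
    fix U w p assume a: "zopen n (proj_space n) U \<and> w \<in> sections ?G U" and p: "p \<in> U"
    then have zU: "zopen n (proj_space n) U" and w: "w \<in> sections ?G U" by auto
    have UP: "U \<subseteq> proj_space n" by (rule zopen_subset[OF zU])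
    obtain U' \<rho> where U': "zopen n (proj_space n) U' \<and> p \<in> U' \<and>
      (\<forall>l<N. \<forall>j<c. twisted_regular n (proj_space n) (- 1) U' (\<lambda>q v. \<rho> v l j)) \<and>
      (\<forall>q\<in>U'. \<forall>v\<in>q. \<forall>i<c. \<forall>j<c. (\<Sum>l<N. A v i l * \<rho> v l j) = (if i = j then 1 else 0))"
      using local_right_inverse[OF subsetD[OF UP p]] by (elim exE)
    note rreg = U'[THEN conjunct2, THEN conjunct2, THEN conjunct1, rule_format]
      and rinv = U'[THEN conjunct2, THEN conjunct2, THEN conjunct2, rule_format]
    define V where "V = U \<inter> U'"
    have zV: "zopen n (proj_space n) V" unfolding V_def using zU U' by (intro zopen_Int) auto
    have VU: "V \<subseteq> U" "V \<subseteq> U'" "V \<subseteq> proj_space n" unfolding V_def using UP by auto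
    \<comment> \<open>The right inverse has degree -1 and \<open>w\<close> has degree 1, so this
      lift is a section of the trivial bundle.\<close>
    define T where "T q v l = (\<Sum>j<c. \<rho> v l j * w q (j, v))" for q v l
    have Treg: "twisted_regular n (proj_space n) 0 V (\<lambda>q v. T q v l)" if l: "l < N" for l
      unfolding T_def
    proof (rule tr_sum[OF zV])
      fix j assume "j \<in> {..<c}"
      then have j: "j < c" by simp
      show "twisted_regular n (proj_space n) 0 V (\<lambda>q v. \<rho> v l j * w q (j, v))"
        using tr_mult[OF tr_subset[OF rreg[OF l j] zV VU(2)] tr_subset[OF power_trivial_section[OF w j] zV VU(1)]] by simp
    qed
    have Trep: "T q (rep q) l = T q v l" if "q \<in> V" "v \<in> q" "l < N" for q v l
    proof -
      have qP: "q \<in> proj_space n" using that VU by blast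
      obtain t where t: "t \<noteq> 0" "rep q = (\<lambda>i. t * v i)" using same_point[OF qP \<open>v \<in> q\<close> rep_in[OF qP]] by blast
      show ?thesis unfolding t(2) using tr_homogeneous[OF Treg[OF that(3)] that(1,2) t(1) qP] by simp
    qed
    define t where "t q = emb N q (T q (rep q))" for q
    have tsec: "t \<in> sections ?F V" unfolding t_def
      by (rule emb_section, rule tr_cong[OF Treg]) (use Trep in auto)
    have "piK q (t q) = w q" if q: "q \<in> V" for q
    proof (rule ext, clarify)
      fix k v
      show "piK q (t q) (k, v) = w q (k, v)"
      proof (cases "k < c \<and> v \<in> q")
        case True
        then have "piK q (t q) (k, v) = (\<Sum>l<N. A v k l * T q (rep q) l)" unfolding t_def by (intro piK_emb) auto
        also have "\<dots> = (\<Sum>l<N. A v k l * T q v l)" by (intro sum.cong refl) (use Trep[OF q] True in auto)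
        also have "\<dots> = (\<Sum>j<c. (\<Sum>l<N. A v k l * \<rho> v l j) * w q (j, v))" unfolding T_def by (rule sum_product_assoc)
        also have "\<dots> = (\<Sum>j<c. if k = j then w q (j, v) else 0)"
          by (intro sum.cong refl) (use rinv[of q v k] q VU(2) True in auto)
        finally show ?thesis using True by (simp add: sum.delta')
      next
        case False
        then have "w q (k, v) = 0" using power_section_fibre[OF w zU, of q] q VU(1) unfolding direct_sum_def twist_bundle_def
          by (cases "k < c") auto
        then show ?thesis using piK_out[OF False] by simp
      qed
    qed
    then show "\<exists>V t. zopen n (proj_space n) V \<and> p \<in> V \<and> V \<subseteq> U \<and> t \<in> sections ?F V \<and> (\<forall>q\<in>V. piK q (t q) = w q)"
      using zV VU(1) tsec p U' unfolding V_def by blast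
  qed
  then show ?thesis unfolding steiner_bundle_def using vector_bundle_K by blast
qed

subsection \<open>Absence of trivial summands\<close>

text \<open>A trivial summand provides a nowhere vanishing global section. But a global section of
  \<open>K\<close> has constant entries, so it is a constant vector annihilated by every
  \<open>A v\<close>, and \<open>inj\<close> makes it zero.\<close>

lemma no_trivial_summand_K: "\<not> has_trivial_summand n K"
proof
  let ?T = "twist_bundle n (proj_space n :: 'k point set) 0"
  assume "has_trivial_summand n K"
  then obtain s and F :: "('k, nat) vbundle" where F: "vector_bundle n (proj_space n) s F"
    and iso: "bundle_iso n (proj_space n) K (binary_sum ?T F)" unfolding has_trivial_summand_def by blast
  interpret F: vbundle_on n s F by unfold_locales (rule F)
  obtain \<phi> \<psi> where pp: "bundle_hom n (proj_space n) K (binary_sum ?T F) \<phi> \<and> bundle_hom n (proj_space n) (binary_sum ?T F) K \<psi> \<and>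
      (\<forall>p\<in>proj_space n. (\<forall>u\<in>fibre K p. \<psi> p (\<phi> p u) = u) \<and> (\<forall>w\<in>fibre (binary_sum ?T F) p. \<phi> p (\<psi> p w) = w))"
    using iso unfolding bundle_iso_def by (elim exE)
  note hphi = pp[THEN conjunct1] and hpsi = pp[THEN conjunct2, THEN conjunct1]
  define g :: "'k point \<Rightarrow> 'k vect + nat \<Rightarrow> 'k"
    where "g p = case_sum (\<lambda>v. if v \<in> p then 1 else 0) (\<lambda>_. 0)" for p
  have zF: "(\<lambda>q x. 0) \<in> sections F (proj_space n)"
  proof (rule F.sections_local_comb[OF zopen_whole])
    fix p :: "'k point" assume "p \<in> proj_space n"
    then show "\<exists>V (m::nat) e f. zopen n (proj_space n) V \<and> p \<in> V \<and> V \<subseteq> proj_space n \<and> (\<forall>j<m. e j \<in> sections F V) \<and>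
       (\<forall>j<m. regular_fun n (proj_space n) V (f j)) \<and> (\<forall>q\<in>V. (\<lambda>x. 0) = (\<lambda>x. \<Sum>j<m. f j q * e j q x))"
      using zopen_whole by (intro exI[of _ "proj_space n"] exI[of _ "0::nat"]) simp
  qed
  have "(\<lambda>p v. if v \<in> p then 1 else 0) \<in> sections ?T (proj_space n)"
    unfolding twist_bundle_def using tr_cong[OF tr_const[OF zopen_whole, of 1]] by simp
  then have "g \<in> sections (binary_sum ?T F) (proj_space n)" unfolding binary_sum_def g_def using zF by simp
  from hom_sections[OF hpsi zopen_whole this] have sec: "(\<lambda>p. \<psi> p (g p)) \<in> sections K (proj_space n)" .
  have "\<exists>a. \<forall>p\<in>proj_space n. \<forall>v\<in>p. \<psi> p (g p) l = a" if "l < N" for l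
    by (rule global_section_deg0) (use sec that in \<open>simp add: sectionsK\<close>)
  then have "\<forall>l. \<exists>a. l < N \<longrightarrow> (\<forall>p\<in>proj_space n. \<forall>v\<in>p. \<psi> p (g p) l = a)" by blast
  from choice[OF this] obtain x where x0: "\<forall>l. l < N \<longrightarrow> (\<forall>p\<in>proj_space n. \<forall>v\<in>p. \<psi> p (g p) l = x l)" by (elim exE)
  have x: "\<psi> p (g p) l = x l" if "l < N" "p \<in> proj_space n" for l p
    using x0 that rep_in[OF that(2)] by blast
  have x_zero: "\<forall>l<N. x l = 0"
  proof (rule inj)
    fix k i assume k: "k < c" and i: "i < Suc n"
    \<comment> \<open>Evaluating \<open>A v\<close> at this unit vector picks out the coefficients
      \<open>\<Phi> k l i\<close>.\<close>
    define v where "v = (\<lambda>m. if m = i then 1 else (0::'k))"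
    have v: "v \<in> coord_space (Suc n)" "v \<noteq> (\<lambda>_. 0)" using i unfolding coord_space_def v_def by (auto simp: fun_eq_iff)
    have pP: "point_of v \<in> proj_space n" by (rule point_of_in_proj_space[OF v])
    have "(\<Sum>l<N. A v k l * \<psi> (point_of v) (g (point_of v)) l) = 0"
      using sec pP mem_point_of k unfolding sectionsK fibreK by blast
    then have "(\<Sum>l<N. A v k l * x l) = 0" using x[OF _ pP] by simp
    moreover have "A v k l = \<Phi> k l i" for l unfolding ev_def v_def using i by (simp add: if_distrib cong: if_cong)
    ultimately show "(\<Sum>l<N. \<Phi> k l i * x l) = 0" by simp
  qed
  define v where "v = (\<lambda>m::nat. if m = 0 then 1 else (0::'k))"
  have v: "v \<in> coord_space (Suc n)" "v \<noteq> (\<lambda>_. 0)" unfolding coord_space_def v_def by (auto simp: fun_eq_iff)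
  define p where "p = point_of v"
  have p: "p \<in> proj_space n" "v \<in> p" unfolding p_def by (rule point_of_in_proj_space[OF v], rule mem_point_of)
  have "\<psi> p (g p) \<in> fibre K p" using sec p(1) unfolding sectionsK by blast
  then have "\<psi> p (g p) l = 0" for l using x_zero x[OF _ p(1)] unfolding fibreK by (cases "l < N") auto
  then have "\<psi> p (g p) = (\<lambda>_. 0)" by (rule ext)
  moreover have "g p \<in> fibre (binary_sum ?T F) p"
  proof -
    have "(\<lambda>x. 0) \<in> fibre F p" using F.section_in_fibre[OF zopen_whole zF p(1)] .
    then show ?thesis unfolding binary_sum_def g_def twist_bundle_def using scale_in_point[OF p(1)] by simp
  qed
  ultimately have "\<phi> p (\<lambda>_. 0) = g p" using pp[THEN conjunct2, THEN conjunct2, rule_format, OF p(1), THEN conjunct2] by auto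
  moreover have "\<phi> p (\<lambda>_. 0) = (\<lambda>_. 0)"
    using lin_on_scale[OF hom_lin_on[OF hphi p(1)] lin_closed_zero[OF lin_closed_K], of 0] by simp
  ultimately have "g p = (\<lambda>_. 0)" by (simp only:)
  then have "g p (Inl v) = 0" by (simp only:)
  then show False using p(2) unfolding g_def by simp
qed

end

subsection \<open>Restriction to lines\<close>

lemma bundle_hom_comp:
  assumes f: "bundle_hom n X E F f" and g: "bundle_hom n X F G g"
  shows "bundle_hom n X E G (\<lambda>p u. g p (f p u))"
  unfolding bundle_hom_def
proof (intro conjI ballI allI impI)
  fix p u assume "p \<in> X" "u \<in> fibre E p"
  then show "g p (f p u) \<in> fibre G p" using hom_fibre[OF g] hom_fibre[OF f] by blast
next
  fix p u w a b assume a: "p \<in> X" "u \<in> fibre E p" "w \<in> fibre E p"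
  show "g p (f p (\<lambda>x. a * u x + b * w x)) = (\<lambda>y. a * g p (f p u) y + b * g p (f p w) y)"
    unfolding lin_onD[OF hom_lin_on[OF f a(1)] a(2,3)]
    by (rule lin_onD[OF hom_lin_on[OF g a(1)] hom_fibre[OF f a(1,2)] hom_fibre[OF f a(1,3)]])
next
  fix U s assume "zopen n X U \<and> s \<in> sections E U"
  then show "(\<lambda>p. g p (f p (s p))) \<in> sections G U" using hom_sections[OF g] hom_sections[OF f] by blast
qed

lemma bundle_iso_trans:
  assumes "bundle_iso n X E F" "bundle_iso n X F G" shows "bundle_iso n X E G"
proof -
  obtain \<phi> \<psi> where 1: "bundle_hom n X E F \<phi> \<and> bundle_hom n X F E \<psi> \<and>
        (\<forall>p\<in>X. (\<forall>u\<in>fibre E p. \<psi> p (\<phi> p u) = u) \<and> (\<forall>w\<in>fibre F p. \<phi> p (\<psi> p w) = w))"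
    using assms(1) unfolding bundle_iso_def by (elim exE)
  obtain \<phi>' \<psi>' where 2: "bundle_hom n X F G \<phi>' \<and> bundle_hom n X G F \<psi>' \<and>
        (\<forall>p\<in>X. (\<forall>u\<in>fibre F p. \<psi>' p (\<phi>' p u) = u) \<and> (\<forall>w\<in>fibre G p. \<phi>' p (\<psi>' p w) = w))"
    using assms(2) unfolding bundle_iso_def by (elim exE)
  show ?thesis
    unfolding bundle_iso_def
  proof (intro exI conjI ballI)
    show "bundle_hom n X E G (\<lambda>p u. \<phi>' p (\<phi> p u))" using 1 2 by (intro bundle_hom_comp[of n X E F _ G]) auto
    show "bundle_hom n X G E (\<lambda>p u. \<psi> p (\<psi>' p u))" using 1 2 by (intro bundle_hom_comp[of n X G F _ E]) auto
  next
    fix p u assume "p \<in> X" "u \<in> fibre E p"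
    then show "\<psi> p (\<psi>' p (\<phi>' p (\<phi> p u))) = u" using 1 2 hom_fibre[of n X E F \<phi> p u] by simp
  next
    fix p w assume "p \<in> X" "w \<in> fibre G p"
    then show "\<phi>' p (\<phi> p (\<psi> p (\<psi>' p w))) = w" using 1 2 hom_fibre[of n X G F \<psi>' p w] by simp
  qed
qed

lemma direct_sum_fibre: "g \<in> fibre (direct_sum m F) p \<longleftrightarrow> (\<forall>i<m. (\<lambda>x. g (i, x)) \<in> fibre (F i) p) \<and> (\<forall>i\<ge>m. \<forall>x. g (i, x) = 0)"
  unfolding direct_sum_def by simp

lemma direct_sum_sections: "s \<in> sections (direct_sum m F) U \<longleftrightarrow>
    (\<forall>i<m. (\<lambda>p x. s p (i, x)) \<in> sections (F i) U) \<and> (\<forall>p\<in>U. \<forall>i\<ge>m. \<forall>x. s p (i, x) = 0)"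
  unfolding direct_sum_def by simp

lemma twist_fibre: "g \<in> fibre (twist_bundle n X d) p \<longleftrightarrow>
    (\<forall>v\<in>p. \<forall>t. t \<noteq> 0 \<longrightarrow> g (\<lambda>i. t * v i) = t powi d * g v) \<and> (\<forall>v. v \<notin> p \<longrightarrow> g v = 0)"
  unfolding twist_bundle_def by simp

lemma twist_sections: "s \<in> sections (twist_bundle n X d) U \<longleftrightarrow>
    (\<forall>p\<in>U. \<forall>v. v \<notin> p \<longrightarrow> s p v = 0) \<and> twisted_regular n X d U s"
  unfolding twist_bundle_def by simp

text \<open>Both sides are \<open>\<O>(-1)\<^sup>c \<oplus> \<O>\<^sup>r\<^sup>-\<^sup>c\<close>, indexed differently.\<close>

lemma direct_sum_reindex_iso:
  assumes X: "X \<subseteq> proj_space n" and cr: "c \<le> r"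
  shows "bundle_iso n X (direct_sum r (\<lambda>i. twist_bundle n X (if i < c then - 1 else 0)))
     (direct_sum (Suc 1) (\<lambda>i. power_bundle (if i = 0 then r - c else c) (twist_bundle n X (- int i))))"
    (is "bundle_iso n X ?S ?T")
proof -
  interpret proj_subset n X by unfold_locales (rule X)
  define \<phi> where "\<phi> (p :: 'a point) g = (\<lambda>(i,j,v). if i = (0::nat) \<and> j < r - c then g (c + j, v) else if i = 1 \<and> j < c then g (j, v) else 0 :: 'a)"
    for p and g :: "nat \<times> 'a vect \<Rightarrow> 'a"
  define \<psi> where "\<psi> (p :: 'a point) h = (\<lambda>(m,v). if m < c then h (1, m, v) else if m < r then h (0, m - c, v) else 0 :: 'a)"
    for p and h :: "nat \<times> nat \<times> 'a vect \<Rightarrow> 'a"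
  have i1: "i = 1" if "\<not> i < c" "i < Suc 1" "i \<noteq> 0" for i :: nat using that by linarith
  have h1: "bundle_hom n X ?S ?T \<phi>"
    unfolding bundle_hom_def
  proof (intro conjI ballI allI impI)
    fix p g assume "p \<in> X" "g \<in> fibre ?S p"
    then have g: "\<And>i. i < r \<Longrightarrow> (\<lambda>x. g (i, x)) \<in> fibre (twist_bundle n X (if i < c then - 1 else 0)) p" unfolding direct_sum_fibre by blast
    show "\<phi> p g \<in> fibre ?T p"
      unfolding direct_sum_fibre
    proof (intro conjI allI impI)
      fix i j :: nat assume "i < Suc 1" and j: "j < (if i = 0 then r - c else c)"
      then consider "i = 0" | "i = 1" by linarith
      then show "(\<lambda>x. \<phi> p g (i, j, x)) \<in> fibre (twist_bundle n X (- int i)) p"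
        using g[of "c + j"] g[of j] j cr by cases (auto simp: \<phi>_def)
    qed (auto simp: \<phi>_def split: if_splits)
  next
    fix U s assume a: "zopen n X U \<and> s \<in> sections ?S U"
    then have g: "\<And>i. i < r \<Longrightarrow> (\<lambda>p x. s p (i, x)) \<in> sections (twist_bundle n X (if i < c then - 1 else 0)) U" unfolding direct_sum_sections by blast
    show "(\<lambda>p. \<phi> p (s p)) \<in> sections ?T U"
      unfolding direct_sum_sections
    proof (intro conjI allI impI ballI)
      fix i j :: nat assume "i < Suc 1" and j: "j < (if i = 0 then r - c else c)"
      then consider "i = 0" | "i = 1" by linarith
      then show "(\<lambda>p x. \<phi> p (s p) (i, j, x)) \<in> sections (twist_bundle n X (- int i)) U"
        using g[of "c + j"] g[of j] j cr by cases (auto simp: \<phi>_def)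
    qed (auto simp: \<phi>_def split: if_splits)
  qed (auto simp: \<phi>_def fun_eq_iff)
  have h2: "bundle_hom n X ?T ?S \<psi>"
    unfolding bundle_hom_def
  proof (intro conjI ballI allI impI)
    fix p h assume "p \<in> X" "h \<in> fibre ?T p"
    then have h: "(\<lambda>x. h (i, j, x)) \<in> fibre (twist_bundle n X (- int i)) p" if "i < Suc 1" "j < (if i = 0 then r - c else c)" for i j
      using that unfolding direct_sum_fibre by blast
    show "\<psi> p h \<in> fibre ?S p"
      unfolding direct_sum_fibre
    proof (intro conjI allI impI)
      fix m assume m: "m < r"
      show "(\<lambda>x. \<psi> p h (m, x)) \<in> fibre (twist_bundle n X (if m < c then - 1 else 0)) p"
        using h[of 1 m] h[of 0 "m - c"] m by (cases "m < c") (auto simp: \<psi>_def)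
    qed (use cr in \<open>auto simp: \<psi>_def\<close>)
  next
    fix U s assume a: "zopen n X U \<and> s \<in> sections ?T U"
    then have h: "(\<lambda>p x. s p (i, j, x)) \<in> sections (twist_bundle n X (- int i)) U" if "i < Suc 1" "j < (if i = 0 then r - c else c)" for i j
      using that unfolding direct_sum_sections by blast
    show "(\<lambda>p. \<psi> p (s p)) \<in> sections ?S U"
      unfolding direct_sum_sections
    proof (intro conjI allI impI ballI)
      fix m assume m: "m < r"
      show "(\<lambda>p x. \<psi> p (s p) (m, x)) \<in> sections (twist_bundle n X (if m < c then - 1 else 0)) U"
        using h[of 1 m] h[of 0 "m - c"] m by (cases "m < c") (auto simp: \<psi>_def)
    qed (use cr in \<open>auto simp: \<psi>_def\<close>)
  qed (auto simp: \<psi>_def fun_eq_iff)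
  show ?thesis
    unfolding bundle_iso_def
  proof (intro exI[of _ \<phi>] exI[of _ \<psi>] conjI h1 h2 ballI)
    fix p g assume "p \<in> X" "g \<in> fibre ?S p"
    then show "\<psi> p (\<phi> p g) = g" unfolding direct_sum_fibre by (auto simp: \<phi>_def \<psi>_def fun_eq_iff not_less)
  next
    fix p h assume "p \<in> X" "h \<in> fibre ?T p"
    then have z: "\<And>i x. i \<ge> Suc 1 \<Longrightarrow> h (i, x) = 0" "\<And>i j x. i < Suc 1 \<Longrightarrow> j \<ge> (if i = 0 then r - c else c) \<Longrightarrow> h (i, j, x) = 0"
      unfolding direct_sum_fibre by blast+
    show "\<phi> p (\<psi> p h) = h"
    proof (rule ext, clarify)
      fix i j v
      consider "i = 0" "j < r - c" | "i = 0" "\<not> j < r - c" | "i = 1" "j < c" | "i = 1" "\<not> j < c" | "i \<ge> Suc 1" "i \<noteq> 1" by linarith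
      then show "\<phi> p (\<psi> p h) (i, j, v) = h (i, j, v)"
        by cases (use z(1)[of i "(j,v)"] z(2)[of i j v] in \<open>auto simp: \<phi>_def \<psi>_def\<close>)
    qed
  qed
qed

context kernel_bundle
begin

text \<open>Turns the local description of restricted sections into one by entries. To recover
  combinations of sections of \<open>K\<close>, the constant functionals \<open>B\<close> of a local
  basis are applied: they yield coefficients regular on \<open>L\<close>.\<close>

lemma restricted_sections_K:
  assumes L: "L \<subseteq> proj_space n" and W: "zopen n L W"
  shows "s \<in> sections (restrict_bundle n (proj_space n) L K) W \<longleftrightarrow>
    (\<forall>l<N. twisted_regular n L 0 W (\<lambda>p v. s p l)) \<and> (\<forall>p\<in>W. s p \<in> fibre K p)"
proof -
  interpret L: proj_subset n L by unfold_locales (rule L)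
  have def: "s \<in> sections (restrict_bundle n (proj_space n) L K) W \<longleftrightarrow> (\<forall>p\<in>W. \<exists>U V m e f.
          zopen n (proj_space n) U \<and> zopen n L V \<and> p \<in> V \<and> V \<subseteq> U \<and> V \<subseteq> W \<and>
          (\<forall>j<m. e j \<in> sections K U) \<and> (\<forall>j<m. regular_fun n L V (f j)) \<and>
          (\<forall>q\<in>V. s q = (\<lambda>x. \<Sum>j<(m::nat). f j q * e j q x)))"
    unfolding restrict_bundle_def by simp
  have WL: "W \<subseteq> L" by (rule zopen_subset[OF W])
  show ?thesis
  proof
    assume s: "s \<in> sections (restrict_bundle n (proj_space n) L K) W"
    have loc: "\<exists>V. zopen n L V \<and> p \<in> V \<and> V \<subseteq> W \<and> (\<forall>l<N. twisted_regular n L 0 V (\<lambda>p v. s p l)) \<and> s p \<in> fibre K p" if p: "p \<in> W" for p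
    proof -
      obtain U V m e f where r: "zopen n (proj_space n) U \<and> zopen n L V \<and> p \<in> V \<and> V \<subseteq> U \<and> V \<subseteq> W \<and>
          (\<forall>j<m. e j \<in> sections K U) \<and> (\<forall>j<m. regular_fun n L V (f j)) \<and>
          (\<forall>q\<in>V. s q = (\<lambda>x. \<Sum>j<(m::nat). f j q * e j q x))" using bspec[OF s[unfolded def] p] by (elim exE)
      then have zV: "zopen n L V" and VU: "V \<subseteq> U" and e: "\<And>j. j < m \<Longrightarrow> e j \<in> sections K U" by blast+
      have "twisted_regular n L 0 V (\<lambda>p v. s p l)" if l: "l < N" for l
      proof -
        have "twisted_regular n L 0 V (\<lambda>q v. f j q * e j q l)" if j: "j < m" for j
        proof -
          have "twisted_regular n L 0 V (\<lambda>q v. e j q l)"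
            by (rule tr_restrict[OF _ order_refl L zV VU]) (use e[OF j] l in \<open>simp add: sectionsK\<close>)
          then show ?thesis using L.tr_mult[of 0 V "\<lambda>q v. f j q" 0] r j unfolding regular_fun_def by simp
        qed
        then have t: "twisted_regular n L 0 V (\<lambda>q v. \<Sum>j<m. f j q * e j q l)" by (intro L.tr_sum zV) auto
        show ?thesis by (rule L.tr_cong[OF t]) (use r in simp)
      qed
      moreover have "s p \<in> fibre K p"
      proof -
        have "s p = (\<lambda>x. \<Sum>j<m. f j p * e j p x)" using r by blast
        moreover have "e j p \<in> fibre K p" if "j < m" for j using e[OF that] r unfolding sectionsK by blast
        ultimately show ?thesis using lin_closed_sum[OF lin_closed_K, of m "\<lambda>j. e j p" p "\<lambda>j. f j p"] by simp
      qed
      ultimately show ?thesis using r by blast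
    qed
    show "(\<forall>l<N. twisted_regular n L 0 W (\<lambda>p v. s p l)) \<and> (\<forall>p\<in>W. s p \<in> fibre K p)"
    proof (intro conjI allI impI ballI)
      fix l assume "l < N"
      then show "twisted_regular n L 0 W (\<lambda>p v. s p l)" using loc by (intro L.tr_local) blast
    qed (use loc in blast)
  next
    assume s: "(\<forall>l<N. twisted_regular n L 0 W (\<lambda>p v. s p l)) \<and> (\<forall>p\<in>W. s p \<in> fibre K p)"
    show "s \<in> sections (restrict_bundle n (proj_space n) L K) W"
      unfolding def
    proof
      fix p assume p: "p \<in> W"
      then have pP: "p \<in> proj_space n" using WL L by blast
      obtain U e B where UeB: "zopen n (proj_space n) U \<and> p \<in> U \<and> (\<forall>i<r. e i \<in> sections K U) \<and>
        (\<forall>q\<in>U. \<forall>x\<in>fibre K q. x = (\<lambda>m. \<Sum>i<r. (\<Sum>l<N. B i l * x l) * e i q m)) \<and>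
        (\<forall>q\<in>U. \<forall>i<r. \<forall>j<r. (\<Sum>l<N. B i l * e j q l) = (if i = j then 1 else 0))" by (rule local_basisE[OF pP])
      note expand = UeB[THEN conjunct2, THEN conjunct2, THEN conjunct2, THEN conjunct1, rule_format]
      define V where "V = U \<inter> L \<inter> W"
      have zV: "zopen n L V" unfolding V_def using UeB L by (intro L.zopen_Int W zopen_restrict[of n "proj_space n"]) auto
      have "regular_fun n L V (\<lambda>q. \<Sum>l<N. B j l * s q l)" for j
        unfolding regular_fun_def
      proof (intro L.tr_sum L.tr_scale zV)
        fix l assume "l \<in> {..<N}"
        then have "twisted_regular n L 0 W (\<lambda>q v. s q l)" using s by simp
        then show "twisted_regular n L 0 V (\<lambda>q v. s q l)" by (rule L.tr_subset[OF _ zV]) (simp add: V_def)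
      qed
      moreover have "s q = (\<lambda>x. \<Sum>j<r. (\<Sum>l<N. B j l * s q l) * e j q x)" if "q \<in> V" for q
        by (rule expand) (use that s in \<open>auto simp: V_def\<close>)
      moreover have "p \<in> V" using p UeB WL unfolding V_def by blast
      ultimately show "\<exists>U V m e f. zopen n (proj_space n) U \<and> zopen n L V \<and> p \<in> V \<and> V \<subseteq> U \<and> V \<subseteq> W \<and>
          (\<forall>j<m. e j \<in> sections K U) \<and> (\<forall>j<m. regular_fun n L V (f j)) \<and>
          (\<forall>q\<in>V. s q = (\<lambda>x. \<Sum>j<(m::nat). f j q * e j q x))"
        using UeB zV by (intro exI[of _ U] exI[of _ V] exI[of _ r] exI[of _ e] exI[of _ "\<lambda>j q. \<Sum>l<N. B j l * s q l"]) (auto simp: V_def)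
    qed
  qed
qed

lemma line_rows_indep:
  assumes "indep2 n u w"
  shows "indep_rows (c + c) N (\<lambda>m. if m < c then A u m else A w (m - c))"
  unfolding indep_rows_def
proof (intro allI impI)
  fix g m assume g: "\<forall>l<N. (\<Sum>m<c + c. g m * (if m < c then A u m else A w (m - c)) l) = 0" and m: "m < c + c"
  have "(\<Sum>k<c. g k * A u k l + g (c + k) * A w k l) = 0" if "l < N" for l
    using g that unfolding sum_lessThan_add by (simp add: sum.distrib)
  note z = line_indepD[OF li assms this]
  show "g m = 0"
  proof (cases "m < c")
    case True
    then show ?thesis using z by simp
  next
    case False
    then have "m - c < c" "c + (m - c) = m" using m by auto
    then show ?thesis using z[of "m - c"] by simp
  qed
qed

lemma two_c_le: "2 * c \<le> N"
proof -
  \<comment> \<open>Any line will do; this one joins the first two coordinate points.\<close>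
  have "indep2 n (\<lambda>i. if i = 0 then 1 else 0 :: 'k) (\<lambda>i. if i = 1 then 1 else 0)"
    unfolding indep2_def
  proof (intro allI impI)
    fix s t :: 'k assume "\<forall>i<Suc n. s * (if i = 0 then 1 else 0) + t * (if i = 1 then 1 else 0) = 0"
    from this[rule_format, of 0] this[rule_format, of 1] show "s = 0 \<and> t = 0" using n1 by auto
  qed
  from indep_rows_le[OF line_rows_indep[OF this]] show ?thesis by simp
qed

text \<open>Complete the \<open>2c\<close> rows of \<open>A u\<close> and \<open>A w\<close> to
  coordinates \<open>gx\<close> on the constant vectors. At \<open>S u + T w\<close> the kernel is
  given by \<open>S gx_k + T gx_(c+k) = 0\<close>, so the pair \<open>(gx_k, gx_(c+k))\<close> is a
  multiple \<open>\<gamma>\<close> of \<open>(- T, S)\<close>, where \<open>\<gamma>\<close> has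
  degree -1. The remaining \<open>r - c\<close> coordinates are free and give the trivial
  part.\<close>

lemma line_splitting:
  assumes pl: "proj_line n u w L"
  shows "bundle_iso n L (restrict_bundle n (proj_space n) L K)
     (direct_sum r (\<lambda>i. twist_bundle n L (if i < c then - 1 else 0)))"
    (is "bundle_iso n L ?R ?S")
proof -
  interpret L: proj_line n u w L by (rule pl)
  have uw: "indep2 n u w"
    unfolding indep2_def
  proof (intro allI impI)
    fix s t assume z: "\<forall>i<Suc n. s * u i + t * w i = 0"
    have "s * u i + t * w i = 0" for i using z L.u L.w unfolding coord_space_def by (cases "i < Suc n") auto
    then show "s = 0 \<and> t = 0" using L.ind by blast
  qed
  obtain G Y where GYG: "(\<forall>m<c + c. G m = (if m < c then A u m else A w (m - c))) \<and>
    (\<forall>k<N. \<forall>j<N. (\<Sum>l<N. G k l * Y l j) = (if k = j then 1 else 0)) \<and>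
    (\<forall>k<N. \<forall>j<N. (\<Sum>l<N. Y k l * G l j) = (if k = j then 1 else 0))"
    using indep_rows_completion[OF line_rows_indep[OF uw]] by (elim exE)
  note G = GYG[THEN conjunct1, rule_format] and GY = GYG[THEN conjunct2, THEN conjunct1, rule_format]
    and YG = GYG[THEN conjunct2, THEN conjunct2, rule_format]
  have cN: "c + c \<le> N" and cr: "c \<le> r" using two_c_le by auto
  have Gu: "G k = A u k" and Gw: "G (c + k) = A w k" if "k < c" for k using G[of k] G[of "c + k"] that by auto
  have "indep_rows 2 (Suc n) (\<lambda>m. if m = 0 then u else w)"
    unfolding indep_rows_def
  proof (intro allI impI)
    fix g m assume g: "\<forall>l<Suc n. (\<Sum>k<(2::nat). g k * (if k = 0 then u else w) l) = 0" and m: "m < (2::nat)"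
    have "\<forall>i<Suc n. g 0 * u i + g 1 * w i = 0" using g by (simp add: numeral_2_eq_2)
    then have "g 0 = 0 \<and> g 1 = 0" using uw unfolding indep2_def by blast
    then show "g m = 0" using m by (auto simp: less_2_cases_iff)
  qed
  from indep_rows_right_inverse[OF this] obtain Z where Z: "\<forall>k<(2::nat). \<forall>j<(2::nat). (\<Sum>l<Suc n. (if k = 0 then u else w) l * Z l j) = (if k = j then 1 else (0::'k))"
    by (elim exE)
  \<comment> \<open>Linear forms on the ambient space that restrict to the two coordinates of the
    line; being forms, they can serve as denominators.\<close>
  define S where "S v = (\<Sum>i<Suc n. Z i 0 * v i)" for v
  define T where "T v = (\<Sum>i<Suc n. Z i 1 * v i)" for v
  have Sform: "form n 1 S" and Tform: "form n 1 T" unfolding S_def T_def by (rule form_linear)+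
  have lin: "S (\<lambda>i. a * u i + b * w i) = a" "T (\<lambda>i. a * u i + b * w i) = b" for a b
  proof -
    have Zu: "(\<Sum>i<Suc n. u i * Z i 0) = 1" "(\<Sum>i<Suc n. w i * Z i 0) = 0" "(\<Sum>i<Suc n. u i * Z i 1) = 0" "(\<Sum>i<Suc n. w i * Z i 1) = 1"
      using Z[rule_format, of 0 0] Z[rule_format, of 1 0] Z[rule_format, of 0 1] Z[rule_format, of 1 1] by simp_all
    have eq: "(\<Sum>i<Suc n. Z i j * (a * u i + b * w i)) = a * (\<Sum>i<Suc n. u i * Z i j) + b * (\<Sum>i<Suc n. w i * Z i j)" for j
      unfolding sum_distrib_left sum.distrib[symmetric] by (intro sum.cong refl) (simp add: algebra_simps)
    show "S (\<lambda>i. a * u i + b * w i) = a" "T (\<lambda>i. a * u i + b * w i) = b"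
      unfolding S_def T_def eq Zu by simp_all
  qed
  have Shom: "S (\<lambda>i. t * v i) = t * S v" and Thom: "T (\<lambda>i. t * v i) = t * T v" for t v
    unfolding S_def T_def by (simp_all add: sum_distrib_left algebra_simps)
  have vST: "v = (\<lambda>i. S v * u i + T v * w i)" "S v \<noteq> 0 \<or> T v \<noteq> 0" if pv: "p \<in> L" "v \<in> p" for p v
  proof -
    obtain a b where "a \<noteq> 0 \<or> b \<noteq> 0" "v = (\<lambda>i. a * u i + b * w i)" using L.in_L_comb[OF pv] by blast
    then show "v = (\<lambda>i. S v * u i + T v * w i)" "S v \<noteq> 0 \<or> T v \<noteq> 0" using lin by simp_all
  qed
  have Av: "A v k l = S v * A u k l + T v * A w k l" if "p \<in> L" "v \<in> p" for p v k l
    by (subst vST(1)[OF that]) (rule ev_comb)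
  have LP: "p \<in> proj_space n" if "p \<in> L" for p using that L.L_sub by blast
  have rf: "fibre ?R p = fibre K p" for p unfolding restrict_bundle_def by simp
  define gx where "gx x m = (\<Sum>l<N. G m l * x l)" for x m
  have gx_u: "gx x k = (\<Sum>l<N. A u k l * x l)" and gx_w: "gx x (c + k) = (\<Sum>l<N. A w k l * x l)" if "k < c" for x k
    unfolding gx_def using Gu[OF that] Gw[OF that] by simp_all
  have kerx: "S v * gx x k + T v * gx x (c + k) = 0" if "p \<in> L" "v \<in> p" "x \<in> fibre K p" "k < c" for p v x k
  proof -
    have "0 = (\<Sum>l<N. A v k l * x l)" using that unfolding fibreK by simp
    also have "\<dots> = S v * gx x k + T v * gx x (c + k)"
      unfolding gx_u[OF that(4)] gx_w[OF that(4)] Av[OF that(1,2)] by (simp add: sum_distrib_left sum.distrib algebra_simps)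
    finally show ?thesis by simp
  qed
  \<comment> \<open>Two expressions for one section of degree -1. They agree where both make sense
    because of \<open>kerx\<close>, and each gives regularity on its chart.\<close>
  define \<gamma> where "\<gamma> x k v = (if S v \<noteq> 0 then gx x (c + k) / S v else - gx x k / T v)" for x k v
  have gam: "S v * \<gamma> x k v = gx x (c + k)" "T v * \<gamma> x k v = - gx x k" if "p \<in> L" "v \<in> p" "x \<in> fibre K p" "k < c" for p v x k
  proof -
    note z = kerx[OF that]
    have nz: "S v \<noteq> 0 \<or> T v \<noteq> 0" using vST(2) that by blast
    show "S v * \<gamma> x k v = gx x (c + k)"
    proof (cases "S v = 0")
      case True
      then show ?thesis using z nz by simp
    qed (simp add: \<gamma>_def)
    show "T v * \<gamma> x k v = - gx x k"
    proof (cases "S v = 0")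
      case True
      then show ?thesis using nz by (simp add: \<gamma>_def)
    next
      case False
      then have "S v * (T v * \<gamma> x k v) = S v * (- gx x k)" using z by (simp add: \<gamma>_def eq_neg_iff_add_eq_0 add.commute)
      then show ?thesis unfolding mult_left_cancel[OF False] .
    qed
  qed
  have gamhom: "\<gamma> x k (\<lambda>i. t * v i) = \<gamma> x k v / t" if "t \<noteq> 0" for x k t v
    using that unfolding \<gamma>_def Shom Thom by simp
  define \<phi> where "\<phi> p x = (\<lambda>(i,v). if v \<in> p then (if i < c then \<gamma> x i v else if i < r then gx x (c + i) else 0) else 0)"
    for p :: "'k point" and x :: "nat \<Rightarrow> 'k"
  \<comment> \<open>The vector whose pair of coordinates \<open>(gx_j, gx_(c+j))\<close> is
    \<open>(- T, S)\<close>, all other coordinates being 0.\<close>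
  define \<beta> where "\<beta> j v l = S v * Y l (c + j) - T v * Y l j" for j v l
  define \<Psi> where "\<Psi> g v l = (if l < N then (\<Sum>j<c. g (j, v) * \<beta> j v l) + (\<Sum>i<r - c. g (c + i, v) * Y l (c + c + i)) else 0)"
    for g :: "nat \<times> 'k vect \<Rightarrow> 'k" and v l
  define \<psi> where "\<psi> p g = \<Psi> g (rep p)" for p g
  have Psi_indep: "\<Psi> g v = \<psi> p g" if p: "p \<in> L" "v \<in> p" and g: "g \<in> fibre ?S p" for p v g
  proof -
    obtain t where t: "t \<noteq> 0" "rep p = (\<lambda>i. t * v i)" using same_point[OF LP[OF p(1)] p(2) rep_in[OF LP[OF p(1)]]] by blast
    have g1: "g (j, \<lambda>i. t * v i) = g (j, v) / t" if "j < c" for j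
    proof -
      have "g (j, \<lambda>i. t * v i) = t powi (-1) * g (j, v)"
        using g that cr p(2) t(1) unfolding direct_sum_fibre twist_fibre by auto
      then show ?thesis by (simp add: power_int_minus divide_inverse mult.commute)
    qed
    have g0: "g (c + i, \<lambda>i. t * v i) = g (c + i, v)" if "i < r - c" for i
    proof -
      have "(\<lambda>x. g (c + i, x)) \<in> fibre (twist_bundle n L 0) p"
      proof -
        have "c + i < r" using that cr by simp
        then have "(\<lambda>x. g (c + i, x)) \<in> fibre (twist_bundle n L (if c + i < c then - 1 else 0)) p"
          using g unfolding direct_sum_fibre by blast
        then show ?thesis by simp
      qed
      then show ?thesis using p(2) t(1) unfolding twist_fibre by simp
    qed
    have "\<beta> j (\<lambda>i. t * v i) l = t * \<beta> j v l" for j l unfolding \<beta>_def Shom Thom by (simp add: algebra_simps)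
    then show ?thesis unfolding \<psi>_def t(2) \<Psi>_def using t(1) by (simp add: g1 g0 fun_eq_iff)
  qed
  have gxPsi: "gx (\<Psi> g v) m = (\<Sum>j<c. g (j, v) * (S v * (if m = c + j then 1 else 0) - T v * (if m = j then 1 else 0)))
      + (\<Sum>i<r - c. g (c + i, v) * (if m = c + c + i then 1 else 0))" if m: "m < N" for g v m
  proof -
    have "gx (\<Psi> g v) m = (\<Sum>l<N. G m l * (\<Sum>j<c. \<beta> j v l * g (j, v))) + (\<Sum>l<N. G m l * (\<Sum>i<r - c. Y l (c + c + i) * g (c + i, v)))"
      unfolding gx_def \<Psi>_def sum.distrib[symmetric] by (intro sum.cong refl) (simp add: distrib_left mult.commute)
    also have "(\<Sum>l<N. G m l * (\<Sum>j<c. \<beta> j v l * g (j, v))) = (\<Sum>j<c. (\<Sum>l<N. G m l * \<beta> j v l) * g (j, v))" by (rule sum_product_assoc)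
    also have "(\<Sum>l<N. G m l * (\<Sum>i<r - c. Y l (c + c + i) * g (c + i, v))) = (\<Sum>i<r - c. (\<Sum>l<N. G m l * Y l (c + c + i)) * g (c + i, v))" by (rule sum_product_assoc)
    also have "(\<Sum>j<c. (\<Sum>l<N. G m l * \<beta> j v l) * g (j, v)) = (\<Sum>j<c. g (j, v) * (S v * (if m = c + j then 1 else 0) - T v * (if m = j then 1 else 0)))"
    proof (intro sum.cong refl)
      fix j assume "j \<in> {..<c}"
      then have j: "c + j < N" "j < N" using cN by auto
      have "(\<Sum>l<N. G m l * \<beta> j v l) = S v * (\<Sum>l<N. G m l * Y l (c + j)) - T v * (\<Sum>l<N. G m l * Y l j)"
        unfolding \<beta>_def sum_distrib_left sum_subtractf[symmetric] by (intro sum.cong refl) (simp add: algebra_simps)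
      then show "(\<Sum>l<N. G m l * \<beta> j v l) * g (j, v) = g (j, v) * (S v * (if m = c + j then 1 else 0) - T v * (if m = j then 1 else 0))"
        using GY[OF m j(1)] GY[OF m j(2)] by simp
    qed
    also have "(\<Sum>i<r - c. (\<Sum>l<N. G m l * Y l (c + c + i)) * g (c + i, v)) = (\<Sum>i<r - c. g (c + i, v) * (if m = c + c + i then 1 else 0))"
    proof (intro sum.cong refl)
      fix i assume "i \<in> {..<r - c}"
      then have "c + c + i < N" using cN by auto
      then show "(\<Sum>l<N. G m l * Y l (c + c + i)) * g (c + i, v) = g (c + i, v) * (if m = c + c + i then 1 else 0)"
        using GY[OF m] by simp
    qed
    finally show ?thesis .
  qed
  have d1: "(\<Sum>j<(m::nat). f j * (if k = j then 1 else 0)) = (if k < m then f k else (0::'k))" for f m k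
    using sum.delta'[of "{..<m}" k f] by (simp add: if_distrib cong: if_cong)
  have gxPsi_u: "gx (\<Psi> g v) k = - T v * g (k, v)" and gxPsi_w: "gx (\<Psi> g v) (c + k) = S v * g (k, v)" if k: "k < c" for g v k
  proof -
    have "gx (\<Psi> g v) k = (\<Sum>j<c. (- T v * g (j, v)) * (if k = j then 1 else 0)) + (\<Sum>i<r - c. 0)"
      using k cN by (subst gxPsi) (auto intro!: arg_cong2[of _ _ _ _ "(+)"] sum.cong)
    then show "gx (\<Psi> g v) k = - T v * g (k, v)" using k by (simp only: d1) simp
    have "gx (\<Psi> g v) (c + k) = (\<Sum>j<c. (S v * g (j, v)) * (if k = j then 1 else 0)) + (\<Sum>i<r - c. 0)"
      using k cN by (subst gxPsi) (auto intro!: arg_cong2[of _ _ _ _ "(+)"] sum.cong)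
    then show "gx (\<Psi> g v) (c + k) = S v * g (k, v)" using k by (simp only: d1) simp
  qed
  have gxPsi_r: "gx (\<Psi> g v) (c + i) = g (i, v)" if i: "c \<le> i" "i < r" for g v i
  proof -
    have "gx (\<Psi> g v) (c + i) = (\<Sum>j<c. 0) + (\<Sum>i'<r - c. g (c + i', v) * (if i - c = i' then 1 else 0))"
      using i by (subst gxPsi) (auto intro!: arg_cong2[of _ _ _ _ "(+)"] sum.cong)
    also have "\<dots> = g (c + (i - c), v)" using i by (simp only: d1) (simp add: diff_less_mono)
    finally show ?thesis using i by simp
  qed
  have Psi_fibre: "\<Psi> g v \<in> fibre K p" if p: "p \<in> L" "v \<in> p" for p v g
  proof (rule fibreKI[OF LP[OF p(1)] p(2)])
    fix k assume k: "k < c"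
    have "(\<Sum>l<N. A v k l * \<Psi> g v l) = S v * gx (\<Psi> g v) k + T v * gx (\<Psi> g v) (c + k)"
      unfolding gx_u[OF k] gx_w[OF k] Av[OF p] by (simp add: sum_distrib_left sum.distrib algebra_simps)
    then show "(\<Sum>l<N. A v k l * \<Psi> g v l) = 0" unfolding gxPsi_u[OF k] gxPsi_w[OF k] by simp
  qed (simp add: \<Psi>_def)
  have gxlin: "gx (\<lambda>l. a * x l + b * y l) m = a * gx x m + b * gx y m" for a b x y m
    unfolding gx_def by (simp add: sum_distrib_left sum.distrib algebra_simps)
  have h1: "bundle_hom n L ?R ?S \<phi>"
    unfolding bundle_hom_def
  proof (intro conjI ballI allI impI)
    fix p x assume p: "p \<in> L" and x: "x \<in> fibre ?R p"
    show "\<phi> p x \<in> fibre ?S p"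
      unfolding direct_sum_fibre
    proof (intro conjI allI impI)
      fix i assume i: "i < r"
      show "(\<lambda>v. \<phi> p x (i, v)) \<in> fibre (twist_bundle n L (if i < c then - 1 else 0)) p"
        unfolding twist_fibre using scale_in_point[OF LP[OF p]] i
        by (auto simp: \<phi>_def gamhom power_int_minus divide_inverse)
    qed (use cr in \<open>auto simp: \<phi>_def\<close>)
  next
    fix p x y a b
    have "\<gamma> (\<lambda>l. a * x l + b * y l) k v = a * \<gamma> x k v + b * \<gamma> y k v" for k v
      unfolding \<gamma>_def gxlin by (simp add: add_divide_distrib diff_divide_distrib)
    then show "\<phi> p (\<lambda>l. a * x l + b * y l) = (\<lambda>z. a * \<phi> p x z + b * \<phi> p y z)"
      unfolding \<phi>_def by (auto simp: fun_eq_iff gxlin)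
  next
    fix U s assume a: "zopen n L U \<and> s \<in> sections ?R U"
    then have zU: "zopen n L U" and s: "\<And>l. l < N \<Longrightarrow> twisted_regular n L 0 U (\<lambda>p v. s p l)" and sf: "\<And>p. p \<in> U \<Longrightarrow> s p \<in> fibre K p"
      using restricted_sections_K[OF L.L_sub] by blast+
    have UL: "U \<subseteq> L" by (rule zopen_subset[OF zU])
    have gxr: "twisted_regular n L 0 U (\<lambda>p v. gx (s p) m)" for m
      unfolding gx_def by (intro L.tr_sum L.tr_scale zU s) auto
    have gr: "twisted_regular n L (- 1) U (\<lambda>p v. \<gamma> (s p) k v)" if k: "k < c" for k
    proof (rule L.tr_local)
      fix p assume p: "p \<in> U"
      then have pL: "p \<in> L" using UL by blast
      have loc: "\<exists>V. zopen n L V \<and> p \<in> V \<and> V \<subseteq> U \<and> twisted_regular n L (- 1) V (\<lambda>p v. \<gamma> (s p) k v)"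
        if H: "form n 1 H" and nz: "H (rep p) \<noteq> 0" and eq: "\<And>p v. p \<in> U \<Longrightarrow> v \<in> p \<Longrightarrow> H v \<noteq> 0 \<Longrightarrow> a * gx (s p) m / H v = \<gamma> (s p) k v" for H a m
      proof -
        let ?V = "U \<inter> {q\<in>L. \<exists>v\<in>q. H v \<noteq> 0}"
        have zV: "zopen n L ?V" by (rule L.zopen_Int[OF zU zopen_basic[OF H]])
        have Hnz: "H v \<noteq> 0" if "q \<in> ?V" "v \<in> q" for q v
          using form_nonzero_on_point[OF H, of q _ v] that LP by blast
        have t: "twisted_regular n L (- 1) ?V (\<lambda>p v. (a * gx (s p) m) / H v)"
          using L.tr_divide_form[OF L.tr_scale[OF L.tr_subset[OF gxr zV] zV] H zV Hnz] by auto
        have "twisted_regular n L (- 1) ?V (\<lambda>p v. \<gamma> (s p) k v)"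
        proof (rule L.tr_cong[OF t])
          fix q v assume q: "q \<in> ?V" "v \<in> q"
          show "a * gx (s q) m / H v = \<gamma> (s q) k v" by (rule eq[OF _ q(2) Hnz[OF q]]) (use q(1) in blast)
        qed
        moreover have "p \<in> ?V" using p pL nz rep_in[OF LP[OF pL]] by blast
        ultimately show ?thesis using zV by (intro exI[of _ ?V]) simp
      qed
      have "S (rep p) \<noteq> 0 \<or> T (rep p) \<noteq> 0" using vST(2)[OF pL rep_in[OF LP[OF pL]]] .
      then show "\<exists>V. zopen n L V \<and> p \<in> V \<and> V \<subseteq> U \<and> twisted_regular n L (- 1) V (\<lambda>p v. \<gamma> (s p) k v)"
      proof
        assume nz: "S (rep p) \<noteq> 0"
        show ?thesis by (rule loc[OF Sform nz, of 1 "c + k"]) (simp add: \<gamma>_def)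
      next
        assume nz: "T (rep p) \<noteq> 0"
        show ?thesis
        proof (rule loc[OF Tform nz, of "-1" k])
          fix q v assume q: "q \<in> U" "v \<in> q" "T v \<noteq> 0"
          then have "T v * \<gamma> (s q) k v = - gx (s q) k" using gam(2)[of q v "s q" k] UL sf k by blast
          then show "- 1 * gx (s q) k / T v = \<gamma> (s q) k v" using q(3) by (simp add: field_simps)
        qed
      qed
    qed
    show "(\<lambda>p. \<phi> p (s p)) \<in> sections ?S U"
      unfolding direct_sum_sections
    proof (intro conjI allI impI ballI)
      fix i assume i: "i < r"
      show "(\<lambda>p v. \<phi> p (s p) (i, v)) \<in> sections (twist_bundle n L (if i < c then - 1 else 0)) U"
        unfolding twist_sections
      proof (intro conjI ballI allI impI)
        show "twisted_regular n L (if i < c then - 1 else 0) U (\<lambda>p v. \<phi> p (s p) (i, v))"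
        proof (cases "i < c")
          case True
          show ?thesis using L.tr_cong[OF gr[OF True], of "\<lambda>p v. \<phi> p (s p) (i, v)"] True by (simp add: \<phi>_def)
        next
          case False
          show ?thesis using L.tr_cong[OF gxr[of "c + i"], of "\<lambda>p v. \<phi> p (s p) (i, v)"] False i by (simp add: \<phi>_def)
        qed
      qed (simp add: \<phi>_def)
    qed (use cr in \<open>auto simp: \<phi>_def\<close>)
  qed
  have h2: "bundle_hom n L ?S ?R \<psi>"
    unfolding bundle_hom_def
  proof (intro conjI ballI allI impI)
    fix p g assume p: "p \<in> L"
    show "\<psi> p g \<in> fibre ?R p" unfolding rf \<psi>_def by (rule Psi_fibre[OF p rep_in[OF LP[OF p]]])
  next
    fix p g h a b
    show "\<psi> p (\<lambda>x. a * g x + b * h x) = (\<lambda>l. a * \<psi> p g l + b * \<psi> p h l)"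
      unfolding \<psi>_def \<Psi>_def by (auto simp: fun_eq_iff sum_distrib_left sum.distrib algebra_simps)
  next
    fix U s assume a: "zopen n L U \<and> s \<in> sections ?S U"
    then have zU: "zopen n L U" and s: "s \<in> sections ?S U" by auto
    have UL: "U \<subseteq> L" by (rule zopen_subset[OF zU])
    have st: "twisted_regular n L (if i < c then - 1 else 0) U (\<lambda>p v. s p (i, v))" and so: "\<And>p v. p \<in> U \<Longrightarrow> v \<notin> p \<Longrightarrow> s p (i, v) = 0" if "i < r" for i
      using s that unfolding direct_sum_sections twist_sections by blast+
    have sfib: "s p \<in> fibre ?S p" if p: "p \<in> U" for p
      unfolding direct_sum_fibre twist_fibre
    proof (intro conjI allI impI ballI)
      fix i v t assume "i < r" "v \<in> p" "t \<noteq> (0::'k)"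
      then show "s p (i, \<lambda>i. t * v i) = t powi (if i < c then - 1 else 0) * s p (i, v)"
        using L.tr_homogeneous[OF st[OF \<open>i < r\<close>] p] p UL by blast
    qed (use s p so in \<open>auto simp: direct_sum_sections\<close>)
    show "(\<lambda>p. \<psi> p (s p)) \<in> sections ?R U"
      unfolding restricted_sections_K[OF L.L_sub zU]
    proof (intro conjI allI impI ballI)
      fix l assume l: "l < N"
      have "form n 1 (\<lambda>v. Y l (c + j) * S v + (- Y l j) * T v)" for j by (intro form.add form_scale Sform Tform)
      then have bf: "form n 1 (\<lambda>v. \<beta> j v l)" for j unfolding \<beta>_def by (simp add: mult.commute)
      have 1: "twisted_regular n L 0 U (\<lambda>p v. s p (j, v) * \<beta> j v l)" if j: "j < c" for j
        using L.tr_mult[OF st[of j] L.tr_form[OF bf zU, of j]] j cr by simp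
      have 2: "twisted_regular n L 0 U (\<lambda>p v. s p (c + i, v) * Y l (c + c + i))" if i: "i < r - c" for i
        using L.tr_mult[OF st[of "c + i"] L.tr_const[OF zU, of "Y l (c + c + i)"]] i by simp
      have t: "twisted_regular n L 0 U (\<lambda>p v. (\<Sum>j<c. s p (j, v) * \<beta> j v l) + (\<Sum>i<r - c. s p (c + i, v) * Y l (c + c + i)))"
        by (intro L.tr_add L.tr_sum zU 1 2) auto
      show "twisted_regular n L 0 U (\<lambda>p v. \<psi> p (s p) l)"
      proof (rule L.tr_cong[OF t])
        fix p v assume p: "p \<in> U" "v \<in> p"
        have "\<psi> p (s p) l = \<Psi> (s p) v l" using Psi_indep[OF _ p(2) sfib[OF p(1)]] p(1) UL by auto
        then show "(\<Sum>j<c. s p (j, v) * \<beta> j v l) + (\<Sum>i<r - c. s p (c + i, v) * Y l (c + c + i)) = \<psi> p (s p) l"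
          using l by (simp add: \<Psi>_def)
      qed
    next
      fix p assume "p \<in> U"
      then show "\<psi> p (s p) \<in> fibre K p" unfolding \<psi>_def using Psi_fibre rep_in LP UL by blast
    qed
  qed
  show ?thesis
    unfolding bundle_iso_def
  proof (intro exI[of _ \<phi>] exI[of _ \<psi>] conjI h1 h2 ballI)
    fix p x assume p: "p \<in> L" and "x \<in> fibre ?R p"
    then have x: "x \<in> fibre K p" unfolding rf by simp
    let ?v = "rep p"
    have v: "?v \<in> p" by (rule rep_in[OF LP[OF p]])
    show "\<psi> p (\<phi> p x) = x"
    proof
      fix l
      show "\<psi> p (\<phi> p x) l = x l"
      proof (cases "l < N")
        case False
        then show ?thesis using x unfolding fibreK \<psi>_def \<Psi>_def by simp
      next
        case l: True
        have split: "N = (c + c) + (r - c)" using cr by simp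
        have "x l = (\<Sum>i<N. if l = i then x i else 0)" using l by (simp add: sum.delta')
        also have "\<dots> = (\<Sum>i<N. (\<Sum>m<N. Y l m * G m i) * x i)" by (intro sum.cong refl) (use YG l in auto)
        also have "\<dots> = (\<Sum>m<N. Y l m * gx x m)" unfolding gx_def by (rule sum_product_assoc[symmetric])
        also have "\<dots> = (\<Sum>m<(c + c) + (r - c). Y l m * gx x m)"
          by (rule sum.cong[OF arg_cong[of _ _ lessThan, OF split] refl])
        also have "\<dots> = (\<Sum>j<c. Y l j * gx x j) + (\<Sum>j<c. Y l (c + j) * gx x (c + j)) + (\<Sum>i<r - c. Y l (c + c + i) * gx x (c + c + i))"
          unfolding sum_lessThan_add ..
        also have "(\<Sum>j<c. Y l j * gx x j) + (\<Sum>j<c. Y l (c + j) * gx x (c + j)) = (\<Sum>j<c. \<gamma> x j ?v * \<beta> j ?v l)"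
          unfolding sum.distrib[symmetric]
        proof (intro sum.cong refl)
          fix j assume "j \<in> {..<c}"
          then have j: "j < c" by simp
          have "\<gamma> x j ?v * \<beta> j ?v l = Y l (c + j) * (S ?v * \<gamma> x j ?v) - Y l j * (T ?v * \<gamma> x j ?v)"
            unfolding \<beta>_def by (simp add: algebra_simps)
          then show "Y l j * gx x j + Y l (c + j) * gx x (c + j) = \<gamma> x j ?v * \<beta> j ?v l"
            unfolding gam[OF p v x j] by simp
        qed
        also have "(\<Sum>j<c. \<gamma> x j ?v * \<beta> j ?v l) + (\<Sum>i<r - c. Y l (c + c + i) * gx x (c + c + i)) = \<psi> p (\<phi> p x) l"
          using l v by (auto simp: \<psi>_def \<Psi>_def \<phi>_def mult.commute add.assoc intro!: sum.cong)
        finally show ?thesis by simp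
      qed
    qed
  next
    fix p g assume p: "p \<in> L" and g: "g \<in> fibre ?S p"
    show "\<phi> p (\<psi> p g) = g"
    proof (rule ext, clarify)
      fix i v
      show "\<phi> p (\<psi> p g) (i, v) = g (i, v)"
      proof (cases "v \<in> p \<and> i < r")
        case False
        then have "g (i, v) = 0" using g unfolding direct_sum_fibre twist_fibre by (cases "i < r") auto
        then show ?thesis using False cr by (auto simp: \<phi>_def)
      next
        case True
        then have v: "v \<in> p" and i: "i < r" by auto
        have e: "\<psi> p g = \<Psi> g v" using Psi_indep[OF p v g] by simp
        show ?thesis
        proof (cases "i < c")
          case True
          have "\<gamma> (\<Psi> g v) i v = g (i, v)"
            using vST(2)[OF p v] unfolding \<gamma>_def gxPsi_u[OF True] gxPsi_w[OF True] by auto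
          then show ?thesis using True v unfolding e \<phi>_def by simp
        next
          case False
          then show ?thesis using v i gxPsi_r[of i g v] unfolding e \<phi>_def by simp
        qed
      qed
    qed
  qed
qed

lemma k_type_uniform_K: "k_type_uniform_steiner 1 n r c K"
proof -
  have cr: "c \<le> r" using two_c_le by simp
  have pl: "\<exists>u w. proj_line n u w L" if "is_line n L" for L :: "'k point set"
  proof -
    obtain u w where "u \<in> coord_space (Suc n)" "w \<in> coord_space (Suc n)" "\<forall>a b. (\<forall>i. a * u i + b * w i = 0) \<longrightarrow> a = 0 \<and> b = 0"
      "L = {point_of (\<lambda>i. a * u i + b * w i) | a b. a \<noteq> 0 \<or> b \<noteq> 0}" using \<open>is_line n L\<close> unfolding is_line_def by blast
    then show ?thesis using independent_imp_proj_line by blast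
  qed
  have iso: "bundle_iso n L (restrict_bundle n (proj_space n) L K) (direct_sum r (\<lambda>i. twist_bundle n L (if i < c then - 1 else 0)))"
    if "is_line n L" for L using pl[OF that] line_splitting by blast
  have iso': "bundle_iso n L (restrict_bundle n (proj_space n) L K)
     (direct_sum (Suc 1) (\<lambda>i. power_bundle (if i = 0 then r - c else c) (twist_bundle n L (- int i))))" if "is_line n L" for L
  proof (rule bundle_iso_trans[OF iso[OF that] direct_sum_reindex_iso[OF _ cr]])
    show "L \<subseteq> proj_space n" using pl[OF that] proj_line.L_sub by blast
  qed
  have "uniform_bundle n r K"
    unfolding uniform_bundle_def splitting_type_def
    by (intro conjI vector_bundle_K exI[of _ "\<lambda>i. if i < c then - 1 else 0"] allI impI iso) auto
  \<comment> \<open>The multiplicity of O(-1) is \<open>c\<close>, which is positive.\<close>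
  then show ?thesis unfolding k_type_uniform_steiner_def using steiner_K iso' c1
    by (intro conjI exI[of _ "\<lambda>i. if i = 0 then r - c else c"] allI impI) auto
qed

end

subsection \<open>The first Chern class\<close>

lemma det_row_linear:
  fixes f :: "nat \<Rightarrow> nat \<Rightarrow> 'k::field"
  assumes k: "k < m" and rows: "\<And>i j. i \<noteq> k \<Longrightarrow> F i j = G i j \<and> H i j = G i j" and row: "\<And>j. G k j = a * F k j + b * H k j"
  shows "det (mat m m (\<lambda>(i,j). G i j)) = a * det (mat m m (\<lambda>(i,j). F i j)) + b * det (mat m m (\<lambda>(i,j). H i j))"
proof -
  have "(\<Prod>i=0..<m. G i (p i)) = a * (\<Prod>i=0..<m. F i (p i)) + b * (\<Prod>i=0..<m. H i (p i))" for p
  proof -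
    have r: "(\<Prod>i=0..<m. X i (p i)) = X k (p k) * (\<Prod>i\<in>{0..<m} - {k}. X i (p i))" for X :: "nat \<Rightarrow> nat \<Rightarrow> 'a"
      using k by (intro prod.remove) auto
    have "(\<Prod>i\<in>{0..<m} - {k}. F i (p i)) = (\<Prod>i\<in>{0..<m} - {k}. G i (p i))"
      "(\<Prod>i\<in>{0..<m} - {k}. H i (p i)) = (\<Prod>i\<in>{0..<m} - {k}. G i (p i))" using rows by (intro prod.cong; simp)+
    then show ?thesis unfolding r[of F] r[of G] r[of H] row by (simp add: algebra_simps)
  qed
  then show ?thesis unfolding det_mat_Leibniz sum_distrib_left sum.distrib[symmetric]
    by (intro sum.cong refl) (simp add: algebra_simps)
qed

lemma (in proj_subset) regular_det:
  assumes zU: "zopen n X U" and f: "\<And>i j. i < m \<Longrightarrow> j < m \<Longrightarrow> twisted_regular n X 0 U (\<lambda>p v. f p i j)"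
  shows "twisted_regular n X 0 U (\<lambda>p v. det (mat m m (\<lambda>(i,j). f p i j)))"
  unfolding det_mat_Leibniz
proof (intro tr_sum tr_scale zU)
  fix p assume "p \<in> {p. p permutes {0..<m}}"
  then have p: "p permutes {0..<m}" by simp
  show "twisted_regular n X 0 U (\<lambda>q v. \<Prod>i=0..<m. f q i (p i))"
    by (rule tr_prod0[OF zU]) (use permutes_in_image[OF p] f in auto)
qed

context kernel_bundle
begin

definition Gmat :: "(nat \<Rightarrow> nat \<Rightarrow> 'k) \<Rightarrow> 'k vect \<Rightarrow> 'k mat" where
  "Gmat \<Lambda> v = mat N N (\<lambda>(m,l). if m < c then A v m l else \<Lambda> (m - c) l)"

definition lift :: "'k vect \<Rightarrow> nat \<Rightarrow> nat \<Rightarrow> 'k" where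
  "lift v = (SOME y. \<forall>j<c. \<forall>i<c. (\<Sum>l<N. A v j l * y i l) = (if j = i then 1 else 0))"

definition Mmat :: "'k vect \<Rightarrow> (nat \<Rightarrow> nat \<Rightarrow> 'k) \<Rightarrow> 'k mat" where
  "Mmat v u = mat N N (\<lambda>(i,l). if i < c then lift v i l else u (i - c) l)"

text \<open>The exact sequence identifies the top exterior power of \<open>K\<close>, times that of
  O(1)^c, with the trivial one. Concretely, vectors of the kernel are completed by lifts of the
  standard basis and the determinant is taken. Scaling \<open>v\<close> by \<open>t\<close> scales
  the lifts by \<open>1 / t\<close>, up to kernel vectors, whence the degree
  \<open>- c\<close>.\<close>

definition omega :: "'k point \<Rightarrow> (nat \<Rightarrow> nat \<Rightarrow> 'k) \<Rightarrow> 'k vect \<Rightarrow> 'k" where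
  "omega p u v = (if v \<in> p then det (Mmat v u) else 0)"

lemma lift: 
  assumes "p \<in> proj_space n" "v \<in> p" "j < c" "i < c"
  shows "(\<Sum>l<N. A v j l * lift v i l) = (if j = i then 1 else 0)"
proof -
  obtain Y where "\<forall>k<c. \<forall>j<c. (\<Sum>l<N. A v k l * Y l j) = (if k = j then 1 else (0::'k))"
    using indep_rows_right_inverse[OF pointwise_indep[OF assms(1,2)]] by (elim exE)
  then have "\<exists>y. \<forall>j<c. \<forall>i<c. (\<Sum>l<N. A v j l * y i l) = (if j = i then 1 else 0)"
    by (intro exI[of _ "\<lambda>i l. Y l i"])
  from someI_ex[OF this] show ?thesis using assms(3,4) unfolding lift_def by blast
qed

text \<open>This identity shows that \<open>omega\<close> does not depend on the chosen lifts and is a regular section.\<close>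

lemma omega_identity:
  assumes p: "p \<in> proj_space n" "v \<in> p" and u: "\<And>i. i < r \<Longrightarrow> u i \<in> fibre K p"
  shows "det (Gmat \<Lambda> v) * omega p u v = det (mat r r (\<lambda>(i,j). \<Sum>l<N. \<Lambda> i l * u j l))"
proof -
  let ?G = "Gmat \<Lambda> v" and ?M = "Mmat v u"
  let ?C = "mat r c (\<lambda>(i,j). \<Sum>l<N. \<Lambda> i l * lift v j l)"
  let ?D = "mat r r (\<lambda>(i,j). \<Sum>l<N. \<Lambda> i l * u j l)"
  have c: "?G \<in> carrier_mat N N" "?M \<in> carrier_mat N N" unfolding Gmat_def Mmat_def by auto
  \<comment> \<open>\<open>A v\<close> sends the lifts to the standard basis and the
    \<open>u j\<close> to 0, which gives the upper blocks.\<close>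
  have "?G * transpose_mat ?M = four_block_mat (1\<^sub>m c) (0\<^sub>m c r) ?C ?D"
  proof (rule eq_matI)
    fix i j assume "i < dim_row (four_block_mat (1\<^sub>m c) (0\<^sub>m c r) ?C ?D)" "j < dim_col (four_block_mat (1\<^sub>m c) (0\<^sub>m c r) ?C ?D)"
    then have ij: "i < c + r" "j < c + r" by auto
    have "(?G * transpose_mat ?M) $$ (i,j) = (\<Sum>l = 0..<N. (if i < c then A v i l else \<Lambda> (i - c) l) * (if j < c then lift v j l else u (j - c) l))"
      using ij unfolding Gmat_def Mmat_def by (simp add: scalar_prod_def)
    also have "\<dots> = (\<Sum>l<N. (if i < c then A v i l else \<Lambda> (i - c) l) * (if j < c then lift v j l else u (j - c) l))"
      by (simp only: atLeast0LessThan)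
    also have "\<dots> = four_block_mat (1\<^sub>m c) (0\<^sub>m c r) ?C ?D $$ (i,j)"
    proof (cases "i < c"; cases "j < c")
      assume "i < c" "j < c"
      then show ?thesis using lift[OF p, of i j] ij by simp
    next
      assume "i < c" "\<not> j < c"
      then show ?thesis using u[of "j - c"] p(2) ij unfolding fibreK by simp
    qed (use ij in simp_all)
    finally show "(?G * transpose_mat ?M) $$ (i,j) = four_block_mat (1\<^sub>m c) (0\<^sub>m c r) ?C ?D $$ (i,j)" .
  qed (simp_all add: Gmat_def Mmat_def)
  then have "det (?G * transpose_mat ?M) = det (four_block_mat (1\<^sub>m c) (0\<^sub>m c r) ?C ?D)" by simp
  also have "\<dots> = det (1\<^sub>m c) * det ?D" by (rule det_four_block_mat_upper_right_zero) auto
  also have "det (?G * transpose_mat ?M) = det ?G * det ?M"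
    using c det_transpose[OF c(2)] by (subst det_mult[of _ N]) auto
  finally show ?thesis using p(2) unfolding omega_def by simp
qed

text \<open>Only the first \<open>c\<close> rows depend on \<open>v\<close>, so each Leibniz term
  has \<open>c\<close> linear factors.\<close>

lemma Gmat_form: "form n c (\<lambda>v. det (Gmat \<Lambda> v))"
  unfolding Gmat_def det_mat_Leibniz
proof (intro form_sum form_scale)
  fix p :: "nat \<Rightarrow> nat"
  have "form n (card {0..<c} * 1) (\<lambda>v. \<Prod>i=0..<c. A v i (p i))" by (intro form_prod form_ev) auto
  then have "form n (c + 0) (\<lambda>v. (\<Prod>i=0..<c. A v i (p i)) * (\<Prod>i=c..<N. \<Lambda> (i - c) (p i)))"
    by (intro form.mult form.const) simp
  moreover have "(\<Prod>i=0..<N. if i < c then A v i (p i) else \<Lambda> (i - c) (p i)) = (\<Prod>i=0..<c. A v i (p i)) * (\<Prod>i=c..<N. \<Lambda> (i - c) (p i))" for v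
  proof -
    have "(\<Prod>i=0..<N. if i < c then A v i (p i) else \<Lambda> (i - c) (p i)) =
       (\<Prod>i=0..<c. if i < c then A v i (p i) else \<Lambda> (i - c) (p i)) * (\<Prod>i=c..<N. if i < c then A v i (p i) else \<Lambda> (i - c) (p i))"
      by (rule prod.atLeastLessThan_concat[symmetric]) auto
    then show ?thesis by simp
  qed
  ultimately show "form n c (\<lambda>v. \<Prod>i=0..<N. if i < c then A v i (p i) else \<Lambda> (i - c) (p i))" by simp
qed

text \<open>A completion of the rows of \<open>A v\<close> serves twice: the added rows
  \<open>\<Lambda>\<close> make \<open>Gmat\<close> invertible, and the dual columns are kernel
  vectors on which the right-hand determinant is 1.\<close>

lemma exists_completion:
  assumes p: "p \<in> proj_space n" "v \<in> p"
  shows "\<exists>\<Lambda> u. det (Gmat \<Lambda> v) \<noteq> 0 \<and> (\<forall>i<r. u i \<in> fibre K p) \<and> det (mat r r (\<lambda>(i,j). \<Sum>l<N. \<Lambda> i l * u j l)) \<noteq> 0"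
proof -
  obtain G Y where GYG: "(\<forall>k<c. G k = A v k) \<and>
    (\<forall>k<N. \<forall>j<N. (\<Sum>l<N. G k l * Y l j) = (if k = j then 1 else 0)) \<and>
    (\<forall>k<N. \<forall>j<N. (\<Sum>l<N. Y k l * G l j) = (if k = j then 1 else 0))"
    using indep_rows_completion[OF pointwise_indep[OF p]] by (elim exE)
  note G = GYG[THEN conjunct1, rule_format] and GY = GYG[THEN conjunct2, THEN conjunct1, rule_format]
  define \<Lambda> where "\<Lambda> i = G (c + i)" for i
  define u where "u i l = (if l < N then Y l (c + i) else 0)" for i l
  have Gm: "Gmat \<Lambda> v = mat N N (\<lambda>(m,l). G m l)"
    unfolding Gmat_def \<Lambda>_def using G by (intro eq_matI) auto
  have "mat N N (\<lambda>(m,l). G m l) * mat N N (\<lambda>(m,l). Y m l) = 1\<^sub>m N"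
  proof (rule eq_matI)
    fix i j assume "i < dim_row (1\<^sub>m N :: 'k mat)" "j < dim_col (1\<^sub>m N :: 'k mat)"
    then have ij: "i < N" "j < N" by auto
    then have "(mat N N (\<lambda>(m,l). G m l) * mat N N (\<lambda>(m,l). Y m l)) $$ (i,j) = (\<Sum>l = 0..<N. G i l * Y l j)"
      by (simp add: scalar_prod_def)
    then show "(mat N N (\<lambda>(m,l). G m l) * mat N N (\<lambda>(m,l). Y m l)) $$ (i,j) = 1\<^sub>m N $$ (i,j)"
      using GY[OF ij] ij by (simp only: atLeast0LessThan index_one_mat)
  qed auto
  then have "det (mat N N (\<lambda>(m,l). G m l)) * det (mat N N (\<lambda>(m,l). Y m l)) = 1"
    using det_mult[of "mat N N (\<lambda>(m,l). G m l)" N "mat N N (\<lambda>(m,l). Y m l)"] by simp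
  then have "det (Gmat \<Lambda> v) \<noteq> 0" unfolding Gm by auto
  moreover have "u i \<in> fibre K p" if i: "i < r" for i
  proof (rule fibreKI[OF p])
    fix k assume k: "k < c"
    have "(\<Sum>l<N. A v k l * u i l) = (\<Sum>l<N. G k l * Y l (c + i))" using G[OF k] by (intro sum.cong) (auto simp: u_def)
    then show "(\<Sum>l<N. A v k l * u i l) = 0" using GY[of k "c + i"] k i by simp
  qed (simp add: u_def)
  moreover have "mat r r (\<lambda>(i,j). \<Sum>l<N. \<Lambda> i l * u j l) = 1\<^sub>m r"
  proof (rule eq_matI)
    fix i j assume "i < dim_row (1\<^sub>m r :: 'k mat)" "j < dim_col (1\<^sub>m r :: 'k mat)"
    then have ij: "i < r" "j < r" by auto
    have "(\<Sum>l<N. \<Lambda> i l * u j l) = (\<Sum>l<N. G (c + i) l * Y l (c + j))" by (intro sum.cong) (auto simp: u_def \<Lambda>_def)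
    then show "mat r r (\<lambda>(i,j). \<Sum>l<N. \<Lambda> i l * u j l) $$ (i,j) = 1\<^sub>m r $$ (i,j)" using GY[of "c + i" "c + j"] ij by simp
  qed auto
  ultimately show ?thesis by (intro exI[of _ \<Lambda>] exI[of _ u]) simp
qed

lemma first_chern_class_K: "first_chern_class_is n r K (- int c)"
proof -
  \<comment> \<open>The right-hand side of \<open>omega_identity\<close> does not involve
    \<open>v\<close>, so the identities at \<open>v\<close> and at \<open>t v\<close> can be
    compared, and the form \<open>det (Gmat \<Lambda> v)\<close> contributes
    \<open>t ^ c\<close>.\<close>
  have hom: "omega p u (\<lambda>i. t * v i) = t powi (- int c) * omega p u v"
    if p: "p \<in> proj_space n" "v \<in> p" and t: "t \<noteq> 0" and u: "\<And>i. i < r \<Longrightarrow> u i \<in> fibre K p" for p u v t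
  proof -
    obtain \<Lambda> where L: "det (Gmat \<Lambda> v) \<noteq> 0" using exists_completion[OF p] by blast
    have "det (Gmat \<Lambda> (\<lambda>i. t * v i)) * omega p u (\<lambda>i. t * v i) = det (Gmat \<Lambda> v) * omega p u v"
      using omega_identity[OF p u] omega_identity[OF p(1) scale_in_point[OF p t] u] by simp
    then have "t ^ c * omega p u (\<lambda>i. t * v i) = omega p u v" using L unfolding form_homogeneous[OF Gmat_form] by simp
    then show ?thesis using t by (simp add: power_int_minus field_simps)
  qed
  show ?thesis
    unfolding first_chern_class_is_def
  proof (intro exI[of _ omega] conjI ballI allI impI)
    fix p u assume p: "p \<in> proj_space n" and u: "u \<in> {..<r} \<rightarrow>\<^sub>E fibre K p"
    have u': "u i \<in> fibre K p" if "i < r" for i using u that by auto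
    show "omega p u \<in> fibre (twist_bundle n (proj_space n) (- int c)) p"
      unfolding twist_fibre using hom[OF p _ _ u'] by (simp add: omega_def)
    {
      fix i x y a b assume i: "i < r"
      show "omega p (u(i := (\<lambda>z. a * x z + b * y z))) = (\<lambda>v. a * omega p (u(i := x)) v + b * omega p (u(i := y)) v)"
      proof
        fix v
        have "det (Mmat v (u(i := (\<lambda>z. a * x z + b * y z)))) = a * det (Mmat v (u(i := x))) + b * det (Mmat v (u(i := y)))"
          unfolding Mmat_def by (rule det_row_linear[of "c + i"]) (use i in auto)
        then show "omega p (u(i := (\<lambda>z. a * x z + b * y z))) v = a * omega p (u(i := x)) v + b * omega p (u(i := y)) v"
          unfolding omega_def by simp
      qed
    }
    {
      fix i j assume ij: "i < j \<and> j < r \<and> u i = u j"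
      show "omega p u = (\<lambda>_. 0)"
      proof
        fix v
        have "row (Mmat v u) (c + i) = row (Mmat v u) (c + j)" using ij unfolding Mmat_def by (intro eq_vecI) auto
        then have "det (Mmat v u) = 0"
          using ij by (intro det_identical_rows[of _ N "c + i" "c + j"]) (auto simp: Mmat_def)
        then show "omega p u v = 0" unfolding omega_def by simp
      qed
    }
  next
    fix p :: "'k point" assume p: "p \<in> proj_space n"
    obtain \<Lambda> u where Lu: "det (Gmat \<Lambda> (rep p)) \<noteq> 0" "\<forall>i<r. u i \<in> fibre K p" "det (mat r r (\<lambda>(i,j). \<Sum>l<N. \<Lambda> i l * u j l)) \<noteq> 0"
      using exists_completion[OF p rep_in[OF p]] by blast
    \<comment> \<open>The Chern class condition quantifies over extensional families.\<close>
    define u' where "u' = restrict u {..<r}"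
    have "det (mat r r (\<lambda>(i,j). \<Sum>l<N. \<Lambda> i l * u' j l)) = det (mat r r (\<lambda>(i,j). \<Sum>l<N. \<Lambda> i l * u j l))"
      by (intro arg_cong[of _ _ det] eq_matI) (auto simp: u'_def)
    then have "omega p u' (rep p) \<noteq> 0"
      using omega_identity[OF p rep_in[OF p], of u' \<Lambda>] Lu by (auto simp: u'_def)
    then show "\<exists>u\<in>{..<r} \<rightarrow>\<^sub>E fibre K p. omega p u \<noteq> (\<lambda>_. 0)"
      using Lu(2) by (intro bexI[of _ u']) (auto simp: u'_def)
  next
    fix U s assume a: "zopen n (proj_space n) U \<and> (\<forall>i<r. s i \<in> sections K U)"
    then have zU: "zopen n (proj_space n) U" and s: "\<And>i. i < r \<Longrightarrow> s i \<in> sections K U" by auto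
    have UP: "U \<subseteq> proj_space n" by (rule zopen_subset[OF zU])
    define u where "u p = (\<lambda>i\<in>{..<r}. s i p)" for p
    have uf: "u p i \<in> fibre K p" if "p \<in> U" "i < r" for p i using s[OF that(2)] that unfolding u_def sectionsK by simp
    have "twisted_regular n (proj_space n) (- int c) U (\<lambda>p v. omega p (u p) v)"
    proof (rule tr_local)
      fix p assume p: "p \<in> U"
      then have pP: "p \<in> proj_space n" using UP by blast
      \<comment> \<open>With \<open>\<Lambda>\<close> fixed, \<open>Gmat\<close> stays invertible
        near \<open>p\<close>, and the identity exhibits \<open>omega\<close> there as a regular
        function divided by a form of degree \<open>c\<close>.\<close>
      obtain \<Lambda> where L: "det (Gmat \<Lambda> (rep p)) \<noteq> 0" using exists_completion[OF pP rep_in[OF pP]] by blast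
      define V where "V = U \<inter> {q\<in>proj_space n. \<exists>v\<in>q. det (Gmat \<Lambda> v) \<noteq> 0}"
      have zV: "zopen n (proj_space n) V" unfolding V_def by (intro zopen_Int zU zopen_basic[OF Gmat_form])
      have nz: "det (Gmat \<Lambda> v) \<noteq> 0" if "q \<in> V" "v \<in> q" for q v
        using form_nonzero_on_point[OF Gmat_form, of q _ \<Lambda> v] that unfolding V_def by blast
      have "twisted_regular n (proj_space n) 0 V (\<lambda>q v. \<Sum>l<N. \<Lambda> i l * u q j l)" if "j < r" for i j
      proof (intro tr_sum tr_scale zV)
        fix l assume "l \<in> {..<N}"
        then have "twisted_regular n (proj_space n) 0 U (\<lambda>q v. s j q l)" using s[OF that] unfolding sectionsK by simp
        then have "twisted_regular n (proj_space n) 0 V (\<lambda>q v. s j q l)" by (rule tr_subset[OF _ zV]) (simp add: V_def)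
        then show "twisted_regular n (proj_space n) 0 V (\<lambda>q v. u q j l)" using that unfolding u_def by simp
      qed
      then have "twisted_regular n (proj_space n) 0 V (\<lambda>q v. det (mat r r (\<lambda>(i,j). \<Sum>l<N. \<Lambda> i l * u q j l)))"
        by (intro regular_det zV)
      from tr_divide_form[OF this Gmat_form zV nz]
      have t: "twisted_regular n (proj_space n) (- int c) V (\<lambda>q v. det (mat r r (\<lambda>(i,j). \<Sum>l<N. \<Lambda> i l * u q j l)) / det (Gmat \<Lambda> v))" by simp
      have "twisted_regular n (proj_space n) (- int c) V (\<lambda>p v. omega p (u p) v)"
      proof (rule tr_cong[OF t])
        fix q v assume q: "q \<in> V" "v \<in> q"
        have "det (Gmat \<Lambda> v) * omega q (u q) v = det (mat r r (\<lambda>(i,j). \<Sum>l<N. \<Lambda> i l * u q j l))"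
          by (rule omega_identity) (use q uf UP in \<open>auto simp: V_def\<close>)
        then show "det (mat r r (\<lambda>(i,j). \<Sum>l<N. \<Lambda> i l * u q j l)) / det (Gmat \<Lambda> v) = omega q (u q) v"
          using nz[OF q] by (simp add: field_simps)
      qed
      then show "\<exists>V. zopen n (proj_space n) V \<and> p \<in> V \<and> V \<subseteq> U \<and> twisted_regular n (proj_space n) (- int c) V (\<lambda>p v. omega p (u p) v)"
        using zV p pP L rep_in[OF pP] by (intro exI[of _ V]) (auto simp: V_def)
    qed
    then show "(\<lambda>p. omega p (\<lambda>i\<in>{..<r}. s i p)) \<in> sections (twist_bundle n (proj_space n) (- int c)) U"
      unfolding twist_sections u_def by (intro conjI ballI allI impI) (simp add: omega_def)
  qed
qed

end

lemma exists_one_type_uniform_steiner: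
  assumes "n \<ge> 2" "c \<ge> 2" "c + 2 * (n - 1) \<le> r" "r \<le> c * n"
  shows "\<exists>E :: ('k::{alg_closed_field, field_char_0}, nat) vbundle.
    k_type_uniform_steiner 1 n r c E \<and> \<not> has_trivial_summand n E \<and> first_chern_class_is n r E (- int c)"
proof -
  \<comment> \<open>The bounds on \<open>r\<close>, shifted by \<open>c\<close> to bounds on the
    number \<open>r + c\<close> of linear forms.\<close>
  have "1 \<le> n" "2 * c + 2 * (n - 1) \<le> r + c" "r + c \<le> Suc n * c" using assms by (auto simp: mult.commute)
  from exists_line_indep[OF this(1) assms(2) this(2,3), where ?'k='k]
  obtain \<Phi> :: "nat \<Rightarrow> nat \<Rightarrow> nat \<Rightarrow> 'k" where \<Phi>: "line_indep n c (r + c) \<Phi> \<and>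
    (\<forall>x. (\<forall>k<c. \<forall>i<Suc n. (\<Sum>l<r + c. \<Phi> k l i * x l) = 0) \<longrightarrow> (\<forall>l<r + c. x l = 0))" by (elim exE)
  interpret kernel_bundle n c r \<Phi>
  proof
    fix x assume "\<And>k i. k < c \<Longrightarrow> i < Suc n \<Longrightarrow> (\<Sum>l<r + c. \<Phi> k l i * x l) = 0"
    then show "\<forall>l<r + c. x l = 0" using \<Phi> by blast
  qed (use assms \<Phi> in auto)
  show ?thesis using k_type_uniform_K no_trivial_summand_K first_chern_class_K by blast
qed

theorem theorem13:
  fixes n c :: nat
  assumes "n \<ge> 2" and "c \<ge> 2"
  shows
    "(\<forall>r (E :: ('k::{alg_closed_field, field_char_0}, 'a) vbundle).
        k_type_uniform_steiner 1 n r c E \<and> \<not> has_trivial_summand n E \<longrightarrow>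
        c + 2 * (n - 1) \<le> r \<and> r \<le> c * n) \<and>
     (\<exists>E :: ('k, nat) vbundle.
        k_type_uniform_steiner 1 n (c + 2 * (n - 1)) c E \<and> \<not> has_trivial_summand n E) \<and>
     (\<exists>E :: ('k, nat) vbundle.
        k_type_uniform_steiner 1 n (c * n) c E \<and> \<not> has_trivial_summand n E) \<and>
     (\<forall>r. c + 2 * (n - 1) \<le> r \<and> r \<le> c * n \<longrightarrow>
        (\<exists>E :: ('k, nat) vbundle.
           k_type_uniform_steiner 1 n r c E \<and> \<not> has_trivial_summand n E \<and>
           first_chern_class_is n r E (- int c)))"
proof -
  \<comment> \<open>The interval is nonempty, its length being \<open>(c - 2) * (n - 1)\<close>; so
    both end points are attained.\<close>
  have le: "c + 2 * (n - 1) \<le> c * n"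
  proof -
    obtain n' where n: "n = Suc n'" using assms(1) by (cases n) auto
    have "2 * n' \<le> c * n'" using assms(2) by (intro mult_le_mono1)
    then show ?thesis unfolding n by simp
  qed
  have ex: "\<exists>E :: ('k, nat) vbundle. k_type_uniform_steiner 1 n r c E \<and> \<not> has_trivial_summand n E \<and>
      first_chern_class_is n r E (- int c)" if "c + 2 * (n - 1) \<le> r" "r \<le> c * n" for r
    using that by (rule exists_one_type_uniform_steiner[OF assms])
  show ?thesis
  proof (intro conjI allI impI)
    fix r and E :: "('k, 'a) vbundle"
    assume "k_type_uniform_steiner 1 n r c E \<and> \<not> has_trivial_summand n E"
    then have "c + 2 * (n - 1) \<le> r \<and> r \<le> c * n" by (intro one_type_uniform_steiner_bounds[OF assms]) auto
    then show "c + 2 * (n - 1) \<le> r" "r \<le> c * n" by auto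
  next
    show "\<exists>E :: ('k, nat) vbundle. k_type_uniform_steiner 1 n (c + 2 * (n - 1)) c E \<and> \<not> has_trivial_summand n E"
      using ex[OF order_refl le] by blast
    show "\<exists>E :: ('k, nat) vbundle. k_type_uniform_steiner 1 n (c * n) c E \<and> \<not> has_trivial_summand n E"
      using ex[OF le order_refl] by blast
  qed (use ex in blast)
qed

end
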